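(* Let $M_1,M_2,N_1,N_2$ be positive integers. For the $(M_1,M_2,N_1,N_2)$ MIMO interference channel with i.i.d. Rayleigh fading, the DoF region with Shannon feedback is outer-bounded by the region $\mathbf{D}^{\mathrm{S}}_{\mathrm{outer}}$, i.e., $$\mathbf{D}^{\mathrm{S}} \subseteq \mathbf{D}^{\mathrm{S}}_{\mathrm{outer}},$$ where $\mathbf{D}^{\mathrm{S}}_{\mathrm{outer}}$ is the set of all $(d_1,d_2)\in\mathbb{R}^2$ satisfying $$0\le d_i\le \min(M_i,N_i),\quad i=1,2;$$ $$\frac{d_1}{\min(N_1+N_2,M_1)}+\frac{d_2}{\min(N_2,M_1)}\le\frac{\min(N_2,M_1+M_2)}{\min(N_2,M_1)};$$ $$\frac{d_1}{\min(N_1,M_2)}+\frac{d_2}{\min(N_1+N_2,M_2)}\le\frac{\min(N_1,M_1+M_2)}{\min(N_1,M_2)};$$ $$d_1+d_2\le\min\big[M_1+M_2,\;N_1+N_2,\;\max(M_1,N_2),\;\max(M_2,N_1)\big].$$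
   Context: Channel. The $(M_1,M_2,N_1,N_2)$ MIMO interference channel (IC) has two transmitters T1, T2 and two receivers R1, R2 (with $M_1,M_2$ and $N_1,N_2$ antennas respectively). At each time $t=1,2,\dots$, $$Y_1(t)=H_{11}(t)X_1(t)+H_{12}(t)X_2(t)+W_1(t),\qquad Y_2(t)=H_{21}(t)X_1(t)+H_{22}(t)X_2(t)+W_2(t),$$ where $X_i(t)\in\mathbb{C}^{M_i}$ is the signal sent by transmitter $i$, $Y_i(t)\in\mathbb{C}^{N_i}$ is the signal received by receiver $i$, $H_{ij}(t)\in\mathbb{C}^{N_i\times M_j}$ is the channel matrix from transmitter $j$ to receiver $i$, and $W_i(t)\in\mathbb{C}^{N_i}$ is noise. All entries of all $H_{ij}(t)$ and all $W_i(t)$, over all $t$, are mutually independent and distributed as $\mathcal{CN}(0,1)$ (i.i.d. Rayleigh fading, additive white Gaussian noise). The power constraint is $\mathbb{E}\|X_i(t)\|^2\le P$ for all $i,t$. Both receivers know all channel matrices perfectly; the distribution of the channel matrices is known to all terminals. Notation. $\overline{H}(n)=\{H_{11}(t),H_{12}(t),H_{21}(t),H_{22}(t)\}_{t=1}^n$ and $\overline{Y}_i(n)=\{Y_i(t)\}_{t=1}^n$ for $n\ge1$; both are a fixed constant for $n=0$. Coding with Shannon feedback (both transmitters know all channel matrices and both channel outputs with a delay of one symbol time). The messages $\mathcal{M}_1,\mathcal{M}_2$ are independent of each other and of the channels and noises, and $\mathcal{M}_i$ (sent by transmitter $i$, intended for receiver $i$) is uniform over a set of cardinality $2^{nR_i(P)}$,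 $R_i(P)\ge0$. A coding scheme of blocklength $n$ consists of encoding functions $f^{(n)}_{i,t}$ with $X_i(t)=f^{(n)}_{i,t}\big(\mathcal{M}_i,\overline{H}(t-1),\overline{Y}_1(t-1),\overline{Y}_2(t-1)\big)$ satisfying the power constraint, and decoding functions $g_i^{(n)}$ with $\hat{\mathcal{M}}_i=g_i^{(n)}\big(\overline{Y}_i(n),\overline{H}(n)\big)$, $i=1,2$. A rate tuple $(R_1(P),R_2(P))$ is achievable if there is a sequence (over $n$) of coding schemes for which the probability that $\mathcal{M}_1\ne\hat{\mathcal{M}}_1$ or $\mathcal{M}_2\neq\hat{\mathcal{M}}_2$ tends to $0$ as $n\to\infty$. The capacity region $\mathcal{C}(P)$ is the set of all achievable rate tuples. DoF region with Shannon feedback: $$\mathbf{D}^{\mathrm{S}}=\Big\{(d_1,d_2)\in\mathbb{R}^2_+\;\Big|\;\forall (w_1,w_2)\in\mathbb{R}^2_+:\; w_1d_1+w_2d_2\le\limsup_{P\to\infty}\frac{1}{\log_2P}\sup_{(R_1(P),R_2(P))\in\mathcal{C}(P)}\{w_1R_1(P)+w_2R_2(P)\}\Big\},$$ where $\mathbb{R}_+^2$ is the set of pairs of non-negative real numbers. *)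

theory Defs
  imports "HOL-Probability.Probability"
begin

text \<open>
  The antenna numbers \<open>M\<^sub>1, M\<^sub>2, N\<^sub>1, N\<^sub>2\<close> are the cardinalities of four index types
  \<open>'m1, 'm2, 'n1, 'n2\<close> of class \<open>finite\<close>; they are arbitrary positive integers because types are
  nonempty. Constants whose type would otherwise not determine the index types take them as
  \<open>itself\<close> arguments.
\<close>

text \<open>
  \<open>CN(0,1)\<close> is circularly symmetric: real and imaginary part are independent with variance
  \<open>1/2\<close>. Note that the second argument of \<open>normal_density\<close> is the standard deviation.
\<close>

definition complex_normal :: "complex measure" where
  "complex_normal =
    (let N = density lborel (normal_density 0 (1 / sqrt 2))
     in distr (N \<Otimes>\<^sub>M N) borel (\<lambda>(x, y). Complex x y))"

definition noise_vector :: "(complex^'n::finite) measure" where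
  "noise_vector = distr (\<Pi>\<^sub>M i\<in>UNIV. complex_normal) borel (\<lambda>v. \<chi> i. v i)"

definition rayleigh_matrix :: "(complex^'m::finite^'n::finite) measure" where
  "rayleigh_matrix = distr (\<Pi>\<^sub>M p\<in>UNIV. complex_normal) borel (\<lambda>h. \<chi> i j. h (i, j))"

text \<open>The components are ordered \<open>(H\<^sub>1\<^sub>1, H\<^sub>1\<^sub>2, H\<^sub>2\<^sub>1, H\<^sub>2\<^sub>2)\<close>.\<close>

type_synonym ('m1, 'm2, 'n1, 'n2) channel =
  "(complex^'m1^'n1) \<times> (complex^'m2^'n1) \<times> (complex^'m1^'n2) \<times> (complex^'m2^'n2)"

definition channel_dist :: "('m1::finite, 'm2::finite, 'n1::finite, 'n2::finite) channel measure"
  where "channel_dist =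
    rayleigh_matrix \<Otimes>\<^sub>M (rayleigh_matrix \<Otimes>\<^sub>M (rayleigh_matrix \<Otimes>\<^sub>M rayleigh_matrix))"

definition noise_dist :: "((complex^'n1::finite) \<times> (complex^'n2::finite)) measure" where
  "noise_dist = noise_vector \<Otimes>\<^sub>M noise_vector"

type_synonym ('m1, 'm2, 'n1, 'n2) sample =
  "(nat \<times> nat) \<times> (nat \<Rightarrow> ('m1, 'm2, 'n1, 'n2) channel) \<times> (nat \<Rightarrow> (complex^'n1) \<times> (complex^'n2))"

definition sample_space ::
  "nat \<Rightarrow> nat \<Rightarrow> ('m1::finite, 'm2::finite, 'n1::finite, 'n2::finite) sample measure" where
  "sample_space K1 K2 =
    (uniform_count_measure {1..K1} \<Otimes>\<^sub>M uniform_count_measure {1..K2}) \<Otimes>\<^sub>M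
    ((\<Pi>\<^sub>M t\<in>{1..}. channel_dist) \<Otimes>\<^sub>M (\<Pi>\<^sub>M t\<in>{1..}. noise_dist))"

text \<open>
  Finite histories over times \<open>1, \<dots>, t\<close> are functions that are \<open>undefined\<close> outside \<open>{1..t}\<close>,
  that is, points of the product space over \<open>{1..t}\<close>; the empty history is the constant
  \<open>\<lambda>_. undefined\<close>.
\<close>

record ('m1, 'm2, 'n1, 'n2) ic_code =
  enc1 :: "nat \<Rightarrow> nat \<times> (nat \<Rightarrow> ('m1, 'm2, 'n1, 'n2) channel) \<times> (nat \<Rightarrow> complex^'n1) \<times> (nat \<Rightarrow> complex^'n2)
      \<Rightarrow> complex^'m1"
  enc2 :: "nat \<Rightarrow> nat \<times> (nat \<Rightarrow> ('m1, 'm2, 'n1, 'n2) channel) \<times> (nat \<Rightarrow> complex^'n1) \<times> (nat \<Rightarrow> complex^'n2)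
      \<Rightarrow> complex^'m2"
  dec1 :: "(nat \<Rightarrow> complex^'n1) \<times> (nat \<Rightarrow> ('m1, 'm2, 'n1, 'n2) channel) \<Rightarrow> nat"
  dec2 :: "(nat \<Rightarrow> complex^'n2) \<times> (nat \<Rightarrow> ('m1, 'm2, 'n1, 'n2) channel) \<Rightarrow> nat"

definition channels_upto ::
  "('m1::finite, 'm2::finite, 'n1::finite, 'n2::finite) sample \<Rightarrow> nat \<Rightarrow> nat \<Rightarrow> ('m1, 'm2, 'n1, 'n2) channel"
  where "channels_upto \<omega> t = (case \<omega> of (_, h, _) \<Rightarrow> restrict h {1..t})"

definition channel_output ::
  "('m1::finite, 'm2::finite, 'n1::finite, 'n2::finite) channel \<Rightarrow> complex^'m1 \<Rightarrow> complex^'m2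
    \<Rightarrow> (complex^'n1) \<times> (complex^'n2) \<Rightarrow> (complex^'n1) \<times> (complex^'n2)" where
  "channel_output H x1 x2 w = (case H of (H11, H12, H21, H22) \<Rightarrow> case w of (w1, w2) \<Rightarrow>
     (H11 *v x1 + H12 *v x2 + w1, H21 *v x1 + H22 *v x2 + w2))"

primrec outputs_upto ::
  "('m1::finite, 'm2::finite, 'n1::finite, 'n2::finite) ic_code \<Rightarrow> ('m1, 'm2, 'n1, 'n2) sample \<Rightarrow> nat
    \<Rightarrow> (nat \<Rightarrow> complex^'n1) \<times> (nat \<Rightarrow> complex^'n2)" where
  "outputs_upto c \<omega> 0 = (\<lambda>_. undefined, \<lambda>_. undefined)"
| "outputs_upto c \<omega> (Suc t) =
    (case \<omega> of ((m1, m2), h, w) \<Rightarrow> case outputs_upto c \<omega> t of (y1, y2) \<Rightarrow>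
     let x1 = enc1 c (Suc t) (m1, channels_upto \<omega> t, y1, y2);
         x2 = enc2 c (Suc t) (m2, channels_upto \<omega> t, y1, y2);
         (z1, z2) = channel_output (h (Suc t)) x1 x2 (w (Suc t))
     in (y1(Suc t := z1), y2(Suc t := z2)))"

definition input1 ::
  "('m1::finite, 'm2::finite, 'n1::finite, 'n2::finite) ic_code \<Rightarrow> nat \<Rightarrow> ('m1, 'm2, 'n1, 'n2) sample
    \<Rightarrow> complex^'m1" where
  "input1 c t \<omega> = (case outputs_upto c \<omega> (t - 1) of (y1, y2) \<Rightarrow>
     enc1 c t (fst (fst \<omega>), channels_upto \<omega> (t - 1), y1, y2))"

definition input2 ::
  "('m1::finite, 'm2::finite, 'n1::finite, 'n2::finite) ic_code \<Rightarrow> nat \<Rightarrow> ('m1, 'm2, 'n1, 'n2) sample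
    \<Rightarrow> complex^'m2" where
  "input2 c t \<omega> = (case outputs_upto c \<omega> (t - 1) of (y1, y2) \<Rightarrow>
     enc2 c t (snd (fst \<omega>), channels_upto \<omega> (t - 1), y1, y2))"

text \<open>
  Encoders and decoders are required to be measurable, so that inputs, outputs and decoded
  messages are random variables. The power constraint uses the nonnegative integral because the
  Bochner integral of a non-integrable function would be \<open>0\<close>.
\<close>

definition valid_code ::
  "real \<Rightarrow> nat \<Rightarrow> nat \<Rightarrow> nat \<Rightarrow> ('m1::finite, 'm2::finite, 'n1::finite, 'n2::finite) ic_code \<Rightarrow> bool" where
  "valid_code P n K1 K2 c \<longleftrightarrow>
    (\<forall>t\<in>{1..n}.
      enc1 c t \<in> borel_measurable (count_space {1..K1} \<Otimes>\<^sub>M ((\<Pi>\<^sub>M s\<in>{1..t-1}. borel) \<Otimes>\<^sub>M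
        ((\<Pi>\<^sub>M s\<in>{1..t-1}. borel) \<Otimes>\<^sub>M (\<Pi>\<^sub>M s\<in>{1..t-1}. borel)))) \<and>
      enc2 c t \<in> borel_measurable (count_space {1..K2} \<Otimes>\<^sub>M ((\<Pi>\<^sub>M s\<in>{1..t-1}. borel) \<Otimes>\<^sub>M
        ((\<Pi>\<^sub>M s\<in>{1..t-1}. borel) \<Otimes>\<^sub>M (\<Pi>\<^sub>M s\<in>{1..t-1}. borel)))) \<and>
      (\<integral>\<^sup>+\<omega>. ennreal ((norm (input1 c t \<omega>))\<^sup>2) \<partial>sample_space K1 K2) \<le> ennreal P \<and>
      (\<integral>\<^sup>+\<omega>. ennreal ((norm (input2 c t \<omega>))\<^sup>2) \<partial>sample_space K1 K2) \<le> ennreal P) \<and>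
    dec1 c \<in> measurable ((\<Pi>\<^sub>M s\<in>{1..n}. borel) \<Otimes>\<^sub>M (\<Pi>\<^sub>M s\<in>{1..n}. borel)) (count_space {1..K1}) \<and>
    dec2 c \<in> measurable ((\<Pi>\<^sub>M s\<in>{1..n}. borel) \<Otimes>\<^sub>M (\<Pi>\<^sub>M s\<in>{1..n}. borel)) (count_space {1..K2})"

definition error_prob ::
  "nat \<Rightarrow> nat \<Rightarrow> nat \<Rightarrow> ('m1::finite, 'm2::finite, 'n1::finite, 'n2::finite) ic_code \<Rightarrow> real" where
  "error_prob n K1 K2 c = measure (sample_space K1 K2)
     {\<omega> \<in> space (sample_space K1 K2).
        case outputs_upto c \<omega> n of (y1, y2) \<Rightarrow>
          dec1 c (y1, channels_upto \<omega> n) \<noteq> fst (fst \<omega>) \<or>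
          dec2 c (y2, channels_upto \<omega> n) \<noteq> snd (fst \<omega>)}"

text \<open>Since \<open>2\<^bsup>nR\<^esup>\<close> need not be an integer, it is rounded up.\<close>

definition num_messages :: "nat \<Rightarrow> real \<Rightarrow> nat" where
  "num_messages n R = nat \<lceil>2 powr (real n * R)\<rceil>"

definition capacity_region ::
  "'m1::finite itself \<Rightarrow> 'm2::finite itself \<Rightarrow> 'n1::finite itself \<Rightarrow> 'n2::finite itself \<Rightarrow> real
    \<Rightarrow> (real \<times> real) set" where
  "capacity_region _ _ _ _ P = {(R1, R2). R1 \<ge> 0 \<and> R2 \<ge> 0 \<and>
     (\<exists>c :: nat \<Rightarrow> ('m1, 'm2, 'n1, 'n2) ic_code.
       (\<forall>n\<ge>1. valid_code P n (num_messages n R1) (num_messages n R2) (c n)) \<and>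
       (\<lambda>n. error_prob n (num_messages n R1) (num_messages n R2) (c n)) \<longlonglongrightarrow> 0)}"

definition DoF_region ::
  "'m1::finite itself \<Rightarrow> 'm2::finite itself \<Rightarrow> 'n1::finite itself \<Rightarrow> 'n2::finite itself
    \<Rightarrow> (real \<times> real) set" where
  "DoF_region m1 m2 n1 n2 = {(d1, d2). d1 \<ge> 0 \<and> d2 \<ge> 0 \<and>
     (\<forall>w1\<ge>0. \<forall>w2\<ge>0. ereal (w1 * d1 + w2 * d2) \<le>
        Limsup at_top (\<lambda>P::real. ereal (1 / log 2 P) *
          (SUP (R1, R2)\<in>capacity_region m1 m2 n1 n2 P. ereal (w1 * R1 + w2 * R2))))}"

definition DoF_outer :: "nat \<Rightarrow> nat \<Rightarrow> nat \<Rightarrow> nat \<Rightarrow> (real \<times> real) set" where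
  "DoF_outer M1 M2 N1 N2 = {(d1, d2).
     0 \<le> d1 \<and> d1 \<le> real (min M1 N1) \<and>
     0 \<le> d2 \<and> d2 \<le> real (min M2 N2) \<and>
     d1 / real (min (N1 + N2) M1) + d2 / real (min N2 M1)
       \<le> real (min N2 (M1 + M2)) / real (min N2 M1) \<and>
     d1 / real (min N1 M2) + d2 / real (min (N1 + N2) M2)
       \<le> real (min N1 (M1 + M2)) / real (min N1 M2) \<and>
     d1 + d2 \<le> real (Min {M1 + M2, N1 + N2, max M1 N2, max M2 N1})}"

end

theory Submission
  imports Defs
begin

text \<open>
  A receiver that knows the channels and the other user's message sees, given the past, antennas
  that are independent copies of one another conditionally on the inputs. Hence the conditional
  entropy \<open>e k\<close> of \<open>k\<close> antennas at one time is increasing and concave in \<open>k\<close>. Once \<open>k\<close> reaches the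
  number \<open>M\<close> of antennas of the unknown transmitter, the signal part of a further antenna is a linear
  combination of \<open>M\<close> earlier ones, so \<open>e (k + 1) - e k\<close> is bounded independently of the power; this
  uses only that the logarithm of the determinant of a Gaussian matrix is integrable. Concavity then
  yields \<open>e N / min N M \<le> e L / min L M + O(1)\<close> for \<open>L \<le> N\<close>.

  Give receiver 1 the output of receiver 2 and message 2. By Fano's inequality the rate \<open>R\<^sub>1\<close> is at most
  the average of \<open>e (N\<^sub>1 + N\<^sub>2)\<close>, since feedback only makes the inputs depend on the past on which
  everything is conditioned. Receiver 2 alone satisfies \<open>R\<^sub>2 \<le> N\<^sub>2 log P + O(1) - e N\<^sub>2\<close>. The weights
  \<open>1 / min (N\<^sub>1 + N\<^sub>2) M\<^sub>1\<close> and \<open>1 / min N\<^sub>2 M\<^sub>1\<close> eliminate the entropies. This inequality,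
  \<open>d\<^sub>1 \<le> M\<^sub>1\<close> and the same two for exchanged users imply all others.

  Each output has density \<open>exp (-\<bar>y - \<mu>\<bar>\<^sup>2) \<le> 1\<close> with respect to \<open>1 / \<pi>\<close> times Lebesgue measure.
  Relative to this reference measure all entropies are nonnegative, and every expectation is a
  nonnegative integral.
\<close>

section \<open>Product measures\<close>

text \<open>With feedback, the outputs of the second receiver given its message are neither
  independent nor Markov, so their joint density has no usable factorisation. In Fano's inequality
  for that receiver it is therefore replaced by a product of one-step densities given the complete
  past of both receivers. This is legitimate because reweighting each step by predictive density
  over observed density maps the observed letters to the fixed product reference measure; the
  argument plays the role of "conditioning reduces entropy". Both Fano bounds then involve the same
  posterior of message 1 given message 2 and the past, hence the same sequence \<open>e\<close>, at
  two values of \<open>k\<close>.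

  The channel row of an antenna counts as part of its observation. Only then are antennas
  identically distributed given the inputs, which concavity requires.

  The log-determinant is controlled by the moment of order \<open>-1/2\<close> of the determinant,
  which can be integrated one diagonal entry at a time, at a factor \<open>5\<close> each. Gibbs'
  inequality against Gaussian test densities supplies all upper bounds on entropies that involve the
  power or extrapolation.\<close>

lemma nn_integral_PiM_insert:
  assumes "sigma_finite_measure M" "finite I" "i \<notin> I"
    and "F \<in> borel_measurable (PiM (insert i I) (\<lambda>_. M))"
  shows "(\<integral>\<^sup>+ z. F z \<partial>PiM (insert i I) (\<lambda>_. M)) = (\<integral>\<^sup>+ z. \<integral>\<^sup>+ x. F (z(i := x)) \<partial>M \<partial>PiM I (\<lambda>_. M))"
proof -
  interpret product_sigma_finite "\<lambda>_. M" using assms(1) by (simp add: product_sigma_finite_def)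
  show ?thesis by (rule product_nn_integral_insert[OF assms(2-4)])
qed

lemma sigma_finite_PiM_const:
  assumes "sigma_finite_measure M" "finite I"
  shows "sigma_finite_measure (PiM I (\<lambda>_. M))"
proof -
  interpret product_sigma_finite "\<lambda>_. M" using assms(1) by (simp add: product_sigma_finite_def)
  show ?thesis by (rule sigma_finite[OF assms(2)])
qed

lemma sigma_finite_pair:
  assumes "sigma_finite_measure M" "sigma_finite_measure N"
  shows "sigma_finite_measure (M \<Otimes>\<^sub>M N)"
proof -
  interpret pair_sigma_finite M N using assms by (simp add: pair_sigma_finite_def)
  show ?thesis by (rule sigma_finite_measure_axioms)
qed

lemma nn_integral_swap:
  assumes "sigma_finite_measure M" "sigma_finite_measure N"
    and "(\<lambda>(x, y). f x y) \<in> borel_measurable (M \<Otimes>\<^sub>M N)"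
  shows "(\<integral>\<^sup>+ x. \<integral>\<^sup>+ y. f x y \<partial>N \<partial>M) = (\<integral>\<^sup>+ y. \<integral>\<^sup>+ x. f x y \<partial>M \<partial>N)"
proof -
  interpret pair_sigma_finite M N using assms by (simp add: pair_sigma_finite_def)
  show ?thesis using Fubini'[OF assms(3)] by simp
qed

lemma nn_integral_pair:
  assumes "sigma_finite_measure N" "f \<in> borel_measurable (M \<Otimes>\<^sub>M N)"
  shows "(\<integral>\<^sup>+ z. f z \<partial>(M \<Otimes>\<^sub>M N)) = (\<integral>\<^sup>+ x. \<integral>\<^sup>+ y. f (x, y) \<partial>N \<partial>M)"
proof -
  interpret sigma_finite_measure N by fact
  show ?thesis using nn_integral_fst[OF assms(2)] by simp
qed

lemma measurable_upd [measurable (raw)]: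
  assumes "f \<in> measurable L (PiM I M)" "g \<in> measurable L (M i)" "J = insert i I"
  shows "(\<lambda>x. (f x)(i := g x)) \<in> measurable L (PiM J M)"
  using assms by (auto intro!: measurable_fun_upd)

text \<open>One coordinate is split off all three products at a time. The only real step is a
  Tonelli swap that moves the new first component past the old second components. It serves to
  regroup channel rows and outputs into one tuple per antenna.\<close>

lemma nn_integral_PiM_pair:
  assumes M: "sigma_finite_measure M" and N: "sigma_finite_measure N" and "finite I"
    and F: "F \<in> borel_measurable (PiM I (\<lambda>_. M \<Otimes>\<^sub>M N))"
  shows "(\<integral>\<^sup>+ z. F z \<partial>PiM I (\<lambda>_. M \<Otimes>\<^sub>M N))
    = (\<integral>\<^sup>+ x. \<integral>\<^sup>+ y. F (\<lambda>i\<in>I. (x i, y i)) \<partial>PiM I (\<lambda>_. N) \<partial>PiM I (\<lambda>_. M))"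
  using assms(3,4)
proof (induction I arbitrary: F)
  case empty
  then show ?case by (simp add: PiM_empty nn_integral_count_space_finite)
next
  case (insert i I)
  note [measurable] = insert.prems
  note MI = sigma_finite_PiM_const[OF M \<open>finite I\<close>] and NI = sigma_finite_PiM_const[OF N \<open>finite I\<close>]
  interpret M: sigma_finite_measure M by fact
  interpret N: sigma_finite_measure N by fact
  interpret MN: sigma_finite_measure "M \<Otimes>\<^sub>M N" by (rule sigma_finite_pair[OF M N])
  interpret NI: sigma_finite_measure "PiM I (\<lambda>_. N)" by fact
  have eq: "(\<lambda>j\<in>insert i I. ((x(i := a)) j, (y(i := b)) j)) = (\<lambda>j\<in>I. (x j, y j))(i := (a, b))" for x y a b
    using insert.hyps by (auto simp: fun_eq_iff restrict_def)
  have "(\<integral>\<^sup>+ z. F z \<partial>PiM (insert i I) (\<lambda>_. M \<Otimes>\<^sub>M N))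
    = (\<integral>\<^sup>+ z. \<integral>\<^sup>+ p. F (z(i := p)) \<partial>(M \<Otimes>\<^sub>M N) \<partial>PiM I (\<lambda>_. M \<Otimes>\<^sub>M N))"
    by (rule nn_integral_PiM_insert[OF sigma_finite_pair[OF M N]]) (use insert in auto)
  also have "\<dots> = (\<integral>\<^sup>+ x. \<integral>\<^sup>+ y. \<integral>\<^sup>+ p. F ((\<lambda>j\<in>I. (x j, y j))(i := p)) \<partial>(M \<Otimes>\<^sub>M N)
      \<partial>PiM I (\<lambda>_. N) \<partial>PiM I (\<lambda>_. M))"
    by (rule insert.IH) measurable
  also have "\<dots> = (\<integral>\<^sup>+ x. \<integral>\<^sup>+ y. \<integral>\<^sup>+ a. \<integral>\<^sup>+ b. F ((\<lambda>j\<in>I. (x j, y j))(i := (a, b))) \<partial>N \<partial>M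
      \<partial>PiM I (\<lambda>_. N) \<partial>PiM I (\<lambda>_. M))"
  proof (intro nn_integral_cong nn_integral_pair[OF N])
    fix x y assume "x \<in> space (PiM I (\<lambda>_. M))" "y \<in> space (PiM I (\<lambda>_. N))"
    then have [measurable]: "(\<lambda>j\<in>I. (x j, y j)) \<in> space (PiM I (\<lambda>_. M \<Otimes>\<^sub>M N))"
      by (auto simp: space_PiM space_pair_measure)
    have "(\<lambda>p. (\<lambda>j\<in>I. (x j, y j))(i := p)) \<in> measurable (M \<Otimes>\<^sub>M N) (PiM (insert i I) (\<lambda>_. M \<Otimes>\<^sub>M N))"
      by (rule measurable_upd) auto
    then show "(\<lambda>p. F ((\<lambda>j\<in>I. (x j, y j))(i := p))) \<in> borel_measurable (M \<Otimes>\<^sub>M N)"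
      by measurable
  qed
  also have "\<dots> = (\<integral>\<^sup>+ x. \<integral>\<^sup>+ a. \<integral>\<^sup>+ y. \<integral>\<^sup>+ b. F ((\<lambda>j\<in>I. (x j, y j))(i := (a, b))) \<partial>N
      \<partial>PiM I (\<lambda>_. N) \<partial>M \<partial>PiM I (\<lambda>_. M))"
  proof (intro nn_integral_cong nn_integral_swap NI M)
    fix x assume x: "x \<in> space (PiM I (\<lambda>_. M))"
    have "(\<lambda>w. (\<lambda>j\<in>I. (x j, fst (fst w) j))(i := (snd (fst w), snd w)))
        \<in> measurable ((PiM I (\<lambda>_. N) \<Otimes>\<^sub>M M) \<Otimes>\<^sub>M N) (PiM (insert i I) (\<lambda>_. M \<Otimes>\<^sub>M N))"
      using x by (intro measurable_upd[where I=I] measurable_restrict measurable_Pair measurable_const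
          measurable_compose[OF measurable_compose[OF measurable_fst measurable_fst]]
          measurable_component_singleton) (auto simp: space_PiM)
    note [measurable] = measurable_compose[OF this insert.prems]
    show "(\<lambda>(y, a). \<integral>\<^sup>+ b. F ((\<lambda>j\<in>I. (x j, y j))(i := (a, b))) \<partial>N)
        \<in> borel_measurable (PiM I (\<lambda>_. N) \<Otimes>\<^sub>M M)"
      by (simp add: split_beta') measurable
  qed
  also have "\<dots> = (\<integral>\<^sup>+ x. \<integral>\<^sup>+ a. \<integral>\<^sup>+ y. F (\<lambda>j\<in>insert i I. ((x(i := a)) j, y j))
      \<partial>PiM (insert i I) (\<lambda>_. N) \<partial>M \<partial>PiM I (\<lambda>_. M))"
  proof (intro nn_integral_cong)
    fix x a assume xa: "x \<in> space (PiM I (\<lambda>_. M))" "a \<in> space M"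
    have "(\<lambda>y. \<lambda>j\<in>insert i I. ((x(i := a)) j, y j))
        \<in> measurable (PiM (insert i I) (\<lambda>_. N)) (PiM (insert i I) (\<lambda>_. M \<Otimes>\<^sub>M N))"
      using xa by (intro measurable_restrict measurable_Pair measurable_const measurable_component_singleton)
        (auto simp: space_PiM)
    note m = measurable_compose[OF this insert.prems]
    show "(\<integral>\<^sup>+ y. \<integral>\<^sup>+ b. F ((\<lambda>j\<in>I. (x j, y j))(i := (a, b))) \<partial>N \<partial>PiM I (\<lambda>_. N))
        = (\<integral>\<^sup>+ y. F (\<lambda>j\<in>insert i I. ((x(i := a)) j, y j)) \<partial>PiM (insert i I) (\<lambda>_. N))"
      by (simp only: nn_integral_PiM_insert[OF N insert.hyps m] eq)
  qed
  also have "\<dots> = (\<integral>\<^sup>+ x. \<integral>\<^sup>+ y. F (\<lambda>j\<in>insert i I. (x j, y j))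
      \<partial>PiM (insert i I) (\<lambda>_. N) \<partial>PiM (insert i I) (\<lambda>_. M))"
  proof (rule nn_integral_PiM_insert[OF M insert.hyps, symmetric])
    interpret sigma_finite_measure "PiM (insert i I) (\<lambda>_. N)"
      by (rule sigma_finite_PiM_const[OF N]) (use insert.hyps in simp)
    have "(\<lambda>w. \<lambda>j\<in>insert i I. (fst w j, snd w j)) \<in> measurable
        (PiM (insert i I) (\<lambda>_. M) \<Otimes>\<^sub>M PiM (insert i I) (\<lambda>_. N)) (PiM (insert i I) (\<lambda>_. M \<Otimes>\<^sub>M N))"
      by (intro measurable_restrict measurable_Pair measurable_compose[OF measurable_fst]
          measurable_compose[OF measurable_snd] measurable_component_singleton)
    note [measurable] = measurable_compose[OF this insert.prems]
    show "(\<lambda>x. \<integral>\<^sup>+ y. F (\<lambda>j\<in>insert i I. (x j, y j)) \<partial>PiM (insert i I) (\<lambda>_. N))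
        \<in> borel_measurable (PiM (insert i I) (\<lambda>_. M))"
      by (rule borel_measurable_nn_integral) (simp add: split_beta')
  qed
  finally show ?case .
qed

text \<open>Coordinatewise change of measure: \<open>tr\<close> says that \<open>M\<close> with
  density \<open>g i\<close> is the image of \<open>N\<close> under \<open>\<theta> i\<close>. With
  antenna densities it trades outputs for channel rows and noise; with \<open>g = 1\<close> it
  computes image measures.\<close>

lemma nn_integral_PiM_transport:
  assumes M: "sigma_finite_measure M" and N: "sigma_finite_measure N" and "finite I"
    and g: "\<And>i. i \<in> I \<Longrightarrow> g i \<in> borel_measurable M" and \<theta>: "\<And>i. i \<in> I \<Longrightarrow> \<theta> i \<in> measurable N M"
    and tr: "\<And>i F. i \<in> I \<Longrightarrow> F \<in> borel_measurable M \<Longrightarrow> (\<integral>\<^sup>+ z. g i z * F z \<partial>M) = (\<integral>\<^sup>+ w. F (\<theta> i w) \<partial>N)"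
    and F: "F \<in> borel_measurable (PiM I (\<lambda>_. M))"
  shows "(\<integral>\<^sup>+ z. (\<Prod>i\<in>I. g i (z i)) * F z \<partial>PiM I (\<lambda>_. M))
    = (\<integral>\<^sup>+ w. F (\<lambda>i\<in>I. \<theta> i (w i)) \<partial>PiM I (\<lambda>_. N))"
  using assms(3-)
proof (induction I arbitrary: F)
  case empty
  then show ?case by (simp add: PiM_empty nn_integral_count_space_finite)
next
  case (insert i I)
  have [measurable]: "g j \<in> borel_measurable M" "\<theta> j \<in> measurable N M" if "j \<in> insert i I" for j
    using that insert.prems by auto
  note [measurable] = insert.prems(4)
  have [measurable]: "g i \<in> borel_measurable M" "\<theta> i \<in> measurable N M"
    using insert.prems by auto
  interpret M: sigma_finite_measure M by fact
  interpret N: sigma_finite_measure N by fact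
  have "(\<integral>\<^sup>+ z. (\<Prod>j\<in>insert i I. g j (z j)) * F z \<partial>PiM (insert i I) (\<lambda>_. M))
    = (\<integral>\<^sup>+ z. \<integral>\<^sup>+ x. (\<Prod>j\<in>insert i I. g j ((z(i := x)) j)) * F (z(i := x)) \<partial>M \<partial>PiM I (\<lambda>_. M))"
    by (rule nn_integral_PiM_insert[OF M]) (use insert.hyps in \<open>auto intro!: borel_measurable_times_ennreal borel_measurable_prod_ennreal\<close>)
  also have "\<dots> = (\<integral>\<^sup>+ z. (\<Prod>j\<in>I. g j (z j)) * (\<integral>\<^sup>+ x. g i x * F (z(i := x)) \<partial>M) \<partial>PiM I (\<lambda>_. M))"
  proof (rule nn_integral_cong)
    fix z assume [measurable]: "z \<in> space (PiM I (\<lambda>_. M))"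
    have *: "(\<Prod>j\<in>insert i I. g j ((z(i := x)) j)) = g i x * (\<Prod>j\<in>I. g j (z j))" for x
      using insert.hyps by (simp add: prod.insert) (intro disjI2 arg_cong2[where f="(*)"] prod.cong refl, auto)
    show "(\<integral>\<^sup>+ x. (\<Prod>j\<in>insert i I. g j ((z(i := x)) j)) * F (z(i := x)) \<partial>M)
      = (\<Prod>j\<in>I. g j (z j)) * (\<integral>\<^sup>+ x. g i x * F (z(i := x)) \<partial>M)"
      unfolding * by (subst nn_integral_cmult[symmetric]) (auto simp: ac_simps)
  qed
  also have "\<dots> = (\<integral>\<^sup>+ z. (\<Prod>j\<in>I. g j (z j)) * (\<integral>\<^sup>+ w. F (z(i := \<theta> i w)) \<partial>N) \<partial>PiM I (\<lambda>_. M))"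
  proof (rule nn_integral_cong)
    fix z assume [measurable]: "z \<in> space (PiM I (\<lambda>_. M))"
    have "(\<integral>\<^sup>+ x. g i x * F (z(i := x)) \<partial>M) = (\<integral>\<^sup>+ w. F (z(i := \<theta> i w)) \<partial>N)"
      by (rule insert.prems(3)) auto
    then show "(\<Prod>j\<in>I. g j (z j)) * (\<integral>\<^sup>+ x. g i x * F (z(i := x)) \<partial>M)
      = (\<Prod>j\<in>I. g j (z j)) * (\<integral>\<^sup>+ w. F (z(i := \<theta> i w)) \<partial>N)" by simp
  qed
  also have "\<dots> = (\<integral>\<^sup>+ u. \<integral>\<^sup>+ w. F ((\<lambda>j\<in>I. \<theta> j (u j))(i := \<theta> i w)) \<partial>N \<partial>PiM I (\<lambda>_. N))"
  proof (rule insert.IH)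
    show "(\<lambda>z. \<integral>\<^sup>+ w. F (z(i := \<theta> i w)) \<partial>N) \<in> borel_measurable (PiM I (\<lambda>_. M))"
      by measurable
  qed (use insert.prems in auto)
  also have "\<dots> = (\<integral>\<^sup>+ u. \<integral>\<^sup>+ w. F (\<lambda>j\<in>insert i I. \<theta> j ((u(i := w)) j)) \<partial>N \<partial>PiM I (\<lambda>_. N))"
  proof -
    have "(\<lambda>j\<in>insert i I. \<theta> j ((u(i := w)) j)) = (\<lambda>j\<in>I. \<theta> j (u j))(i := \<theta> i w)" for u w
      using insert.hyps by (auto simp: fun_eq_iff restrict_def)
    then show ?thesis by simp
  qed
  also have "\<dots> = (\<integral>\<^sup>+ u. F (\<lambda>j\<in>insert i I. \<theta> j (u j)) \<partial>PiM (insert i I) (\<lambda>_. N))"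
    by (rule nn_integral_PiM_insert[OF N, symmetric])
      (use insert.hyps in \<open>auto intro!: measurable_compose[OF _ insert.prems(4)] measurable_restrict\<close>)
  finally show ?case .
qed

text \<open>Lets a Gaussian matrix be read as a family of independent Gaussian rows. In the
  induction the new row is a product over \<open>{i} \<times> J\<close>, which \<open>snd\<close>
  relabels to a product over \<open>J\<close>.\<close>

lemma nn_integral_PiM_Times:
  fixes F :: "('i \<times> 'j \<Rightarrow> 'a) \<Rightarrow> ennreal"
  assumes M: "prob_space M" and "finite I" "finite J"
    and F: "F \<in> borel_measurable (PiM (I \<times> J) (\<lambda>_. M))"
  shows "(\<integral>\<^sup>+ z. F z \<partial>PiM (I \<times> J) (\<lambda>_. M))
    = (\<integral>\<^sup>+ r. F (\<lambda>p\<in>I \<times> J. r (fst p) (snd p)) \<partial>PiM I (\<lambda>_. PiM J (\<lambda>_. M)))"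
  using assms(2-)
proof (induction I arbitrary: F)
  case empty
  then show ?case by (simp add: PiM_empty nn_integral_count_space_finite)
next
  case (insert i I)
  interpret M: prob_space M by fact
  note [measurable] = insert.prems(2)
  note Ms = M.sigma_finite_measure_axioms
  interpret P: product_sigma_finite "\<lambda>_::'i\<times>'j. M" using Ms by (simp add: product_sigma_finite_def)
  have J: "sigma_finite_measure (PiM J (\<lambda>_. M))" by (rule sigma_finite_PiM_const[OF Ms \<open>finite J\<close>])
  interpret J: sigma_finite_measure "PiM J (\<lambda>_. M)" by fact
  have un: "insert i I \<times> J = I \<times> J \<union> {i} \<times> J" by auto
  have r: "PiM ({i} \<times> J) (\<lambda>_. M) = distr (PiM J (\<lambda>_. M)) (PiM ({i} \<times> J) (\<lambda>_. M)) (\<lambda>\<omega>. \<lambda>n\<in>{i} \<times> J. \<omega> (snd n))"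
    by (rule distr_PiM_reindex[symmetric]) (auto simp: M inj_on_def)
  have m[measurable]: "(\<lambda>\<omega>. \<lambda>n\<in>{i} \<times> J. \<omega> (snd n)) \<in> measurable (PiM J (\<lambda>_. M)) (PiM ({i} \<times> J) (\<lambda>_. M))"
    by (intro measurable_restrict measurable_component_singleton) auto
  have Fm: "(\<lambda>x. F (merge (I \<times> J) ({i} \<times> J) (z, x))) \<in> borel_measurable (PiM ({i} \<times> J) (\<lambda>_. M))"
    if "z \<in> space (PiM (I \<times> J) (\<lambda>_. M))" for z
  proof (rule measurable_compose[OF _ insert.prems(2)])
    show "(\<lambda>x. merge (I \<times> J) ({i} \<times> J) (z, x)) \<in> measurable (PiM ({i} \<times> J) (\<lambda>_. M)) (PiM (insert i I \<times> J) (\<lambda>_. M))"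
      unfolding un by (rule measurable_compose[OF measurable_Pair1'[OF that] measurable_merge])
  qed
  have [measurable]: "(\<lambda>(z, y). (\<lambda>p\<in>insert i I \<times> J. if fst p = i then y (snd p) else z p)) \<in> measurable (PiM (I \<times> J) (\<lambda>_. M) \<Otimes>\<^sub>M PiM J (\<lambda>_. M)) (PiM (insert i I \<times> J) (\<lambda>_. M))"
    unfolding split_beta'
  proof (intro measurable_restrict)
    fix p assume p: "p \<in> insert i I \<times> J"
    show "(\<lambda>x. if fst p = i then snd x (snd p) else fst x p) \<in> measurable (PiM (I \<times> J) (\<lambda>_. M) \<Otimes>\<^sub>M PiM J (\<lambda>_. M)) M"
    proof (cases "fst p = i")
      case True then show ?thesis using p
        by (auto intro!: measurable_compose[OF measurable_snd measurable_component_singleton])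
    next
      case False then show ?thesis using p
        by (auto intro!: measurable_compose[OF measurable_fst measurable_component_singleton])
    qed
  qed
  have "(\<integral>\<^sup>+ z. F z \<partial>PiM (insert i I \<times> J) (\<lambda>_. M))
    = (\<integral>\<^sup>+ z. \<integral>\<^sup>+ x. F (merge (I \<times> J) ({i} \<times> J) (z, x)) \<partial>PiM ({i} \<times> J) (\<lambda>_. M) \<partial>PiM (I \<times> J) (\<lambda>_. M))"
    unfolding un by (rule P.product_nn_integral_fold) (use insert in \<open>auto simp flip: un\<close>)
  also have "\<dots> = (\<integral>\<^sup>+ z. \<integral>\<^sup>+ y. F (merge (I \<times> J) ({i} \<times> J) (z, \<lambda>n\<in>{i} \<times> J. y (snd n))) \<partial>PiM J (\<lambda>_. M) \<partial>PiM (I \<times> J) (\<lambda>_. M))"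
    by (subst r, intro nn_integral_cong nn_integral_distr m) (auto intro: Fm)
  also have "\<dots> = (\<integral>\<^sup>+ z. \<integral>\<^sup>+ y. F (\<lambda>p\<in>insert i I \<times> J. if fst p = i then y (snd p) else z p) \<partial>PiM J (\<lambda>_. M) \<partial>PiM (I \<times> J) (\<lambda>_. M))"
    using insert.hyps by (intro nn_integral_cong arg_cong[where f=F]) (auto simp: merge_def fun_eq_iff restrict_def)
  also have "\<dots> = (\<integral>\<^sup>+ r. \<integral>\<^sup>+ y. F (\<lambda>p\<in>insert i I \<times> J. if fst p = i then y (snd p) else (\<lambda>p\<in>I \<times> J. r (fst p) (snd p)) p) \<partial>PiM J (\<lambda>_. M) \<partial>PiM I (\<lambda>_. PiM J (\<lambda>_. M)))"
    by (rule insert.IH[OF \<open>finite J\<close>]) measurable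
  also have "\<dots> = (\<integral>\<^sup>+ r. \<integral>\<^sup>+ y. F (\<lambda>p\<in>insert i I \<times> J. (r(i := y)) (fst p) (snd p)) \<partial>PiM J (\<lambda>_. M) \<partial>PiM I (\<lambda>_. PiM J (\<lambda>_. M)))"
    using insert.hyps by (intro nn_integral_cong arg_cong[where f=F]) (auto simp: fun_eq_iff restrict_def)
  also have "\<dots> = (\<integral>\<^sup>+ r. F (\<lambda>p\<in>insert i I \<times> J. r (fst p) (snd p)) \<partial>PiM (insert i I) (\<lambda>_. PiM J (\<lambda>_. M)))"
    by (rule nn_integral_PiM_insert[OF J, symmetric])
      (use insert.hyps in \<open>auto intro!: measurable_compose[OF _ insert.prems(2)] measurable_restrict measurable_compose[OF measurable_component_singleton[where i="fst _"] measurable_component_singleton]\<close>)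
  finally show ?case .
qed

section \<open>Complex Gaussian integrals\<close>

text \<open>The factor is the normalising constant of the normal law with variance
  \<open>1/2\<close>, whose density relative to this measure becomes
  \<open>exp (- (x - m)\<^sup>2)\<close>.\<close>

definition real_ref :: "real measure" where
  "real_ref = density lborel (\<lambda>_. ennreal (1 / sqrt pi))"

definition cplx_ref :: "complex measure" where
  "cplx_ref = distr (real_ref \<Otimes>\<^sub>M real_ref) borel (\<lambda>(x, y). Complex x y)"

lemma sets_real_ref [simp, measurable_cong]: "sets real_ref = sets borel"
  by (simp add: real_ref_def)

lemma space_real_ref [simp]: "space real_ref = UNIV"
  by (simp add: real_ref_def)

lemma sets_cplx_ref [simp, measurable_cong]: "sets cplx_ref = sets borel"
  by (simp add: cplx_ref_def)

lemma space_cplx_ref [simp]: "space cplx_ref = UNIV"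
  by (simp add: cplx_ref_def)

lemma sets_complex_normal [simp, measurable_cong]: "sets complex_normal = sets borel"
  by (simp add: complex_normal_def Let_def)

lemma space_complex_normal [simp]: "space complex_normal = UNIV"
  by (simp add: complex_normal_def Let_def)

lemma measurable_Complex [measurable (raw)]:
  assumes "f \<in> borel_measurable M" "g \<in> borel_measurable M"
  shows "(\<lambda>x. Complex (f x) (g x)) \<in> borel_measurable M"
proof -
  have "(\<lambda>x. Complex (f x) (g x)) = (\<lambda>x. of_real (f x) + \<i> * of_real (g x))"
    by (simp add: complex_eq_iff fun_eq_iff)
  then show ?thesis using assms by simp
qed

lemma sigma_finite_real_ref: "sigma_finite_measure real_ref"
  unfolding real_ref_def
  by (subst sigma_finite_measure.sigma_finite_iff_density_finite'[OF lborel.sigma_finite_measure_axioms, symmetric, THEN sym]) auto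

lemma nn_integral_cplx_ref:
  assumes [measurable]: "F \<in> borel_measurable borel"
  shows "(\<integral>\<^sup>+ z. F z \<partial>cplx_ref) = (\<integral>\<^sup>+ x. \<integral>\<^sup>+ y. F (Complex x y) \<partial>real_ref \<partial>real_ref)"
proof -
  have "(\<integral>\<^sup>+ z. F z \<partial>cplx_ref) = (\<integral>\<^sup>+ p. F (Complex (fst p) (snd p)) \<partial>(real_ref \<Otimes>\<^sub>M real_ref))"
    unfolding cplx_ref_def by (subst nn_integral_distr) (auto simp: split_beta')
  also have "\<dots> = (\<integral>\<^sup>+ x. \<integral>\<^sup>+ y. F (Complex x y) \<partial>real_ref \<partial>real_ref)"
    by (subst nn_integral_pair[OF sigma_finite_real_ref]) auto
  finally show ?thesis .
qed

lemma sigma_finite_cplx_ref: "sigma_finite_measure cplx_ref"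
proof
  define A :: "nat \<Rightarrow> complex set" where "A n = {z. \<bar>Re z\<bar> \<le> real n \<and> \<bar>Im z\<bar> \<le> real n}" for n
  have A[measurable]: "A n \<in> sets borel" for n
    unfolding A_def by measurable
  have "emeasure cplx_ref (A n) < \<infinity>" for n
  proof -
    have "emeasure cplx_ref (A n) = (\<integral>\<^sup>+ z. indicator (A n) z \<partial>cplx_ref)"
      by simp
    also have "\<dots> = (\<integral>\<^sup>+ x. \<integral>\<^sup>+ y. indicator {-real n..real n} x * indicator {-real n..real n} y \<partial>real_ref \<partial>real_ref)"
      by (subst nn_integral_cplx_ref, measurable)
        (auto intro!: nn_integral_cong simp: A_def split: split_indicator)
    also have "\<dots> = emeasure real_ref {-real n..real n} * emeasure real_ref {-real n..real n}"
      by (simp add: nn_integral_cmult nn_integral_multc)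
    finally have "emeasure cplx_ref (A n) = emeasure real_ref {- real n..real n} * emeasure real_ref {- real n..real n}"
      "emeasure real_ref {- real n..real n} < \<top>"
      by (auto simp: real_ref_def emeasure_density nn_integral_cmult ennreal_mult_less_top)
    then show ?thesis by (simp add: ennreal_mult_less_top)
  qed
  then show "\<exists>A. countable A \<and> A \<subseteq> sets cplx_ref \<and> \<Union> A = space cplx_ref \<and> (\<forall>a\<in>A. emeasure cplx_ref a \<noteq> \<infinity>)"
  proof (intro exI[of _ "range A"] conjI)
    have "z \<in> A (nat \<lceil>max \<bar>Re z\<bar> \<bar>Im z\<bar>\<rceil>)" for z
      unfolding A_def by (simp add: le_max_iff_disj) linarith
    then show "\<Union> (range A) = space cplx_ref" by auto
  qed (auto simp: less_top)
qed

lemma nn_integral_real_normal_shift: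
  assumes [measurable]: "F \<in> borel_measurable borel"
  shows "(\<integral>\<^sup>+ x. F (m + x) \<partial>density lborel (normal_density 0 (1 / sqrt 2)))
    = (\<integral>\<^sup>+ x. ennreal (exp (- (x - m)\<^sup>2)) * F x \<partial>real_ref)"
proof -
  have nd: "normal_density 0 (1 / sqrt 2) x = 1 / sqrt pi * exp (- x\<^sup>2)" for x
    by (simp add: normal_density_def power_divide)
  have "(\<integral>\<^sup>+ x. F (m + x) \<partial>density lborel (normal_density 0 (1 / sqrt 2)))
    = (\<integral>\<^sup>+ x. ennreal (1 / sqrt pi * exp (- ((m + 1 * x) - m)\<^sup>2)) * F (m + 1 * x) \<partial>lborel)"
    by (subst nn_integral_density) (auto simp: nd)
  also have "\<dots> = (\<integral>\<^sup>+ x. ennreal (1 / sqrt pi * exp (- (x - m)\<^sup>2)) * F x \<partial>lborel)"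
    by (subst (2) nn_integral_real_affine[where c=1 and t=m]) auto
  also have "\<dots> = (\<integral>\<^sup>+ x. ennreal (exp (- (x - m)\<^sup>2)) * F x \<partial>real_ref)"
    unfolding real_ref_def by (subst nn_integral_density) (auto simp: ennreal_mult[symmetric] mult.assoc[symmetric])
  finally show ?thesis .
qed

lemma nn_integral_complex_normal:
  assumes [measurable]: "F \<in> borel_measurable borel"
  shows "(\<integral>\<^sup>+ z. F z \<partial>complex_normal)
    = (\<integral>\<^sup>+ x. \<integral>\<^sup>+ y. F (Complex x y) \<partial>density lborel (normal_density 0 (1 / sqrt 2))
        \<partial>density lborel (normal_density 0 (1 / sqrt 2)))"
proof -
  let ?N = "density lborel (normal_density 0 (1 / sqrt 2)) :: real measure"
  interpret N: prob_space ?N by (rule prob_space_normal_density) simp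
  have "(\<integral>\<^sup>+ z. F z \<partial>complex_normal) = (\<integral>\<^sup>+ p. F (Complex (fst p) (snd p)) \<partial>(?N \<Otimes>\<^sub>M ?N))"
    unfolding complex_normal_def Let_def by (subst nn_integral_distr) (auto simp: split_beta')
  also have "\<dots> = (\<integral>\<^sup>+ x. \<integral>\<^sup>+ y. F (Complex x y) \<partial>?N \<partial>?N)"
    by (subst nn_integral_pair[OF N.sigma_finite_measure_axioms]) auto
  finally show ?thesis .
qed

text \<open>Translation invariance, applied to real and imaginary part in turn, trades a signal
  \<open>\<mu>\<close> added to the noise for a density centred at \<open>\<mu>\<close>. The later
  passages between noise and output densities rest on this one.\<close>

lemma nn_integral_complex_normal_shift:
  assumes [measurable]: "F \<in> borel_measurable borel"
  shows "(\<integral>\<^sup>+ w. F (\<mu> + w) \<partial>complex_normal) = (\<integral>\<^sup>+ y. ennreal (exp (- (norm (y - \<mu>))\<^sup>2)) * F y \<partial>cplx_ref)"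
proof -
  let ?N = "density lborel (normal_density 0 (1 / sqrt 2)) :: real measure"
  have eq: "\<mu> + Complex x y = Complex (Re \<mu> + x) (Im \<mu> + y)" for x y
    by (simp add: complex_eq_iff)
  have "(\<integral>\<^sup>+ w. F (\<mu> + w) \<partial>complex_normal)
    = (\<integral>\<^sup>+ x. \<integral>\<^sup>+ y. F (Complex (Re \<mu> + x) (Im \<mu> + y)) \<partial>?N \<partial>?N)"
    by (subst nn_integral_complex_normal) (auto simp: eq)
  also have "\<dots> = (\<integral>\<^sup>+ x. \<integral>\<^sup>+ y. ennreal (exp (- (y - Im \<mu>)\<^sup>2)) * F (Complex (Re \<mu> + x) y) \<partial>real_ref \<partial>?N)"
    by (intro nn_integral_cong nn_integral_real_normal_shift) auto
  also have "\<dots> = (\<integral>\<^sup>+ x. ennreal (exp (- (x - Re \<mu>)\<^sup>2)) *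
      (\<integral>\<^sup>+ y. ennreal (exp (- (y - Im \<mu>)\<^sup>2)) * F (Complex x y) \<partial>real_ref) \<partial>real_ref)"
  proof (rule nn_integral_real_normal_shift)
    interpret sigma_finite_measure real_ref by (rule sigma_finite_real_ref)
    show "(\<lambda>x. \<integral>\<^sup>+ y. ennreal (exp (- (y - Im \<mu>)\<^sup>2)) * F (Complex x y) \<partial>real_ref) \<in> borel_measurable borel"
      by measurable
  qed
  also have "\<dots> = (\<integral>\<^sup>+ x. \<integral>\<^sup>+ y. ennreal (exp (- (norm (Complex x y - \<mu>))\<^sup>2)) * F (Complex x y) \<partial>real_ref \<partial>real_ref)"
    by (subst nn_integral_cmult[symmetric])
      (auto intro!: nn_integral_cong simp: cmod_power2 exp_add[symmetric] ennreal_mult[symmetric] mult.assoc[symmetric])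
  also have "\<dots> = (\<integral>\<^sup>+ y. ennreal (exp (- (norm (y - \<mu>))\<^sup>2)) * F y \<partial>cplx_ref)"
    by (subst nn_integral_cplx_ref) auto
  finally show ?thesis .
qed

lemma nn_integral_real_gauss:
  assumes v: "v > 0"
  shows "(\<integral>\<^sup>+ x. ennreal (exp (- (x - m)\<^sup>2 / v)) \<partial>real_ref) = ennreal (sqrt v)"
proof -
  have nd: "normal_density m (sqrt (v / 2)) x = 1 / (sqrt pi * sqrt v) * exp (- (x - m)\<^sup>2 / v)" for x
    using v by (simp add: normal_density_def real_sqrt_mult)
  have "(\<integral>\<^sup>+ x. ennreal (exp (- (x - m)\<^sup>2 / v)) \<partial>real_ref)
    = (\<integral>\<^sup>+ x. ennreal (sqrt v) * ennreal (normal_density m (sqrt (v / 2)) x) \<partial>lborel)"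
    unfolding real_ref_def using v
    by (subst nn_integral_density) (auto intro!: nn_integral_cong simp: nd ennreal_mult[symmetric])
  also have "\<dots> = ennreal (sqrt v) * (\<integral>\<^sup>+ x. ennreal (normal_density m (sqrt (v / 2)) x) \<partial>lborel)"
    by (rule nn_integral_cmult) auto
  also have "(\<integral>\<^sup>+ x. ennreal (normal_density m (sqrt (v / 2)) x) \<partial>lborel) = 1"
    using v by (subst nn_integral_eq_integral) auto
  finally show ?thesis by simp
qed

text \<open>Division by \<open>v\<close> yields a probability density relative to
  \<open>cplx_ref\<close>, with \<open>v\<close> as variance; the Gaussian test densities used later
  are built from it.\<close>

lemma nn_integral_cplx_gauss:
  assumes v: "v > 0"
  shows "(\<integral>\<^sup>+ y. ennreal (exp (- (norm (y - \<mu>))\<^sup>2 / v)) \<partial>cplx_ref) = ennreal v"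
proof -
  have "(\<integral>\<^sup>+ y. ennreal (exp (- (norm (y - \<mu>))\<^sup>2 / v)) \<partial>cplx_ref)
    = (\<integral>\<^sup>+ x. \<integral>\<^sup>+ y. ennreal (exp (- (x - Re \<mu>)\<^sup>2 / v)) * ennreal (exp (- (y - Im \<mu>)\<^sup>2 / v)) \<partial>real_ref \<partial>real_ref)"
    by (subst nn_integral_cplx_ref, measurable)
      (auto intro!: nn_integral_cong simp: cmod_power2 exp_add[symmetric] ennreal_mult[symmetric] diff_divide_distrib add_divide_distrib)
  also have "\<dots> = ennreal (sqrt v) * ennreal (sqrt v)"
    using nn_integral_real_gauss[OF v, simplified minus_divide_left[symmetric]]
    by (simp add: nn_integral_cmult nn_integral_multc)
  also have "\<dots> = ennreal v"
    using v by (simp add: ennreal_mult[symmetric])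
  finally show ?thesis .
qed

lemma prob_space_complex_normal: "prob_space complex_normal"
proof
  have "emeasure complex_normal (space complex_normal) = (\<integral>\<^sup>+ w. (\<lambda>_. 1) (0 + w) \<partial>complex_normal)"
    by simp
  also have "\<dots> = 1"
    using nn_integral_complex_normal_shift[of "\<lambda>_. 1" 0] nn_integral_cplx_gauss[of 1 0] by simp
  finally show "emeasure complex_normal (space complex_normal) = 1" .
qed

text \<open>With \<open>t = (norm y)\<^sup>2\<close>, the inequality
  \<open>t * exp (- t) \<le> 2 * exp (- t / 2)\<close> reduces the moment to the Gaussian integral
  for \<open>v = 2\<close>. The result \<open>2 * 2\<close> is a crude bound for the true value
  \<open>1\<close>.\<close>

lemma complex_normal_moment: "(\<integral>\<^sup>+ w. ennreal ((norm w)\<^sup>2) \<partial>complex_normal) \<le> 4"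
proof -
  have "(\<integral>\<^sup>+ w. ennreal ((norm w)\<^sup>2) \<partial>complex_normal)
    = (\<integral>\<^sup>+ y. ennreal (exp (- (norm y)\<^sup>2)) * ennreal ((norm y)\<^sup>2) \<partial>cplx_ref)"
    using nn_integral_complex_normal_shift[of "\<lambda>w. ennreal ((norm w)\<^sup>2)" 0] by simp
  also have "\<dots> \<le> (\<integral>\<^sup>+ y. 2 * ennreal (exp (- (norm (y - 0))\<^sup>2 / 2)) \<partial>cplx_ref)"
  proof (rule nn_integral_mono)
    fix y :: complex
    have "exp (- (norm y)\<^sup>2) * (norm y)\<^sup>2 \<le> exp (- (norm y)\<^sup>2) * (2 * exp ((norm y)\<^sup>2 / 2))"
      using exp_ge_add_one_self[of "(norm y)\<^sup>2 / 2"] by (intro mult_left_mono) (linarith, simp)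
    also have "\<dots> = 2 * exp (- (norm y)\<^sup>2 / 2)"
      by (simp add: exp_add[symmetric] field_simps)
    finally show "ennreal (exp (- (norm y)\<^sup>2)) * ennreal ((norm y)\<^sup>2) \<le> 2 * ennreal (exp (- (norm (y - 0))\<^sup>2 / 2))"
      by (simp add: ennreal_mult[symmetric] ennreal_leI flip: ennreal_numeral)
  qed
  also have "\<dots> = 2 * ennreal 2"
    using nn_integral_cplx_gauss[of 2 0] by (simp add: nn_integral_cmult)
  finally show ?thesis by simp
qed

section \<open>Moments of order \<open>-1/2\<close>\<close>

text \<open>The power \<open>-1/2\<close> is integrable at the origin. At the origin itself
  \<open>inverse\<close> has the value \<open>\<top>\<close>, but a single point is a null
  set.\<close>

lemma nn_integral_inverse_sqrt_Icc:
  "(\<integral>\<^sup>+ x. inverse (ennreal (sqrt \<bar>x\<bar>)) * indicator {0..1} x \<partial>lborel) = 2"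
proof -
  have "AE x in lborel. x \<noteq> (0::real)"
    by (rule AE_lborel_singleton)
  then have "(\<integral>\<^sup>+ x. inverse (ennreal (sqrt \<bar>x\<bar>)) * indicator {0..1} x \<partial>lborel)
    = (\<integral>\<^sup>+ x. ennreal (x powr (-1/2)) * indicator {0..1} x \<partial>lborel)"
    by (intro nn_integral_cong_AE, eventually_elim)
      (auto split: split_indicator simp: inverse_ennreal powr_minus powr_half_sqrt)
  also have "\<dots> = ennreal 2"
    using has_integral_powr_from_0[of "-1/2" 1]
    by (intro nn_integral_has_integral_lebesgue') auto
  finally show ?thesis by simp
qed

text \<open>The constant is \<open>1 + 2 + 2\<close>. Where \<open>\<bar>x\<bar> > 1\<close>, the
  inverse root is at most \<open>1\<close> and the Gaussian contributes at most its mass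
  \<open>1\<close>; on each half of the interval from \<open>-1\<close> to \<open>1\<close>, the
  exponential is at most \<open>1\<close> and the inverse root contributes at most \<open>2\<close>.
  The bound is uniform in the centre \<open>m\<close>.\<close>

lemma nn_integral_inverse_sqrt_real_ref:
  "(\<integral>\<^sup>+ x. ennreal (exp (- (x - m)\<^sup>2)) * inverse (ennreal (sqrt \<bar>x\<bar>)) \<partial>real_ref) \<le> 5"
proof -
  let ?h = "\<lambda>x::real. inverse (ennreal (sqrt \<bar>x\<bar>))"
  have "(\<integral>\<^sup>+ x. ?h x * indicator {-1..0} x \<partial>lborel) = (\<integral>\<^sup>+ x. ?h x * indicator {0..1} x \<partial>lborel)"
    by (subst nn_integral_real_affine[where c="-1" and t=0]) (auto intro!: nn_integral_cong split: split_indicator)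
  then have m1: "(\<integral>\<^sup>+ x. ?h x * indicator {-1..0} x \<partial>lborel) = 2"
    by (simp add: nn_integral_inverse_sqrt_Icc)
  have pi: "1 / sqrt pi \<le> 1" using pi_ge_two by simp
  have "(\<integral>\<^sup>+ x. ennreal (exp (- (x - m)\<^sup>2)) * ?h x \<partial>real_ref)
    \<le> (\<integral>\<^sup>+ x. ennreal (exp (- (x - m)\<^sup>2 / 1)) + (?h x * indicator {-1..0} x + ?h x * indicator {0..1} x) \<partial>real_ref)"
  proof (rule nn_integral_mono)
    fix x :: real
    show "ennreal (exp (- (x - m)\<^sup>2)) * ?h x
      \<le> ennreal (exp (- (x - m)\<^sup>2 / 1)) + (?h x * indicator {-1..0} x + ?h x * indicator {0..1} x)"
    proof (cases "\<bar>x\<bar> \<le> 1")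
      case True
      have "ennreal (exp (- (x - m)\<^sup>2)) * ?h x \<le> 1 * ?h x"
        by (intro mult_right_mono) auto
      also have "\<dots> \<le> ?h x * indicator {-1..0} x + ?h x * indicator {0..1} x"
        using True by (cases "x \<le> 0") (auto split: split_indicator)
      finally show ?thesis by (simp add: add_increasing)
    next
      case False
      then have "?h x \<le> 1"
        by (simp add: inverse_ennreal) (simp add: divide_simps)
      then have "ennreal (exp (- (x - m)\<^sup>2)) * ?h x \<le> ennreal (exp (- (x - m)\<^sup>2)) * 1"
        by (intro mult_left_mono) auto
      then show ?thesis by (simp add: add_increasing2)
    qed
  qed
  also have "\<dots> = 1 + ((\<integral>\<^sup>+ x. ?h x * indicator {-1..0} x \<partial>real_ref) + (\<integral>\<^sup>+ x. ?h x * indicator {0..1} x \<partial>real_ref))"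
    using nn_integral_real_gauss[of 1 m] by (simp add: nn_integral_add)
  also have "\<dots> \<le> 1 + ((\<integral>\<^sup>+ x. ?h x * indicator {-1..0} x \<partial>lborel) + (\<integral>\<^sup>+ x. ?h x * indicator {0..1} x \<partial>lborel))"
  proof -
    have "(\<integral>\<^sup>+ x. f x \<partial>real_ref) \<le> (\<integral>\<^sup>+ x. f x \<partial>lborel)" if [measurable]: "f \<in> borel_measurable borel" for f
    proof -
      have "(\<integral>\<^sup>+ x. f x \<partial>real_ref) = ennreal (1 / sqrt pi) * (\<integral>\<^sup>+ x. f x \<partial>lborel)"
        unfolding real_ref_def by (simp add: nn_integral_density nn_integral_cmult)
      also have "\<dots> \<le> 1 * (\<integral>\<^sup>+ x. f x \<partial>lborel)"
        using pi by (intro mult_right_mono) auto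
      finally show ?thesis by simp
    qed
    then show ?thesis by (intro add_mono order_refl) auto
  qed
  also have "\<dots> = 5" by (simp add: m1 nn_integral_inverse_sqrt_Icc)
  finally show ?thesis .
qed

lemma ennreal_inverse_antimono:
  "a \<le> b \<Longrightarrow> inverse b \<le> inverse (a :: ennreal)"
  by (cases a; cases b) (auto simp: inverse_ennreal le_less top_unique ennreal_less_iff intro!: ennreal_leI le_imp_inverse_le)

text \<open>Only the real part of \<open>b / a + z\<close> is kept, which reduces the claim to the
  real line. The bound does not depend on \<open>b\<close>; this uniformity lets the remaining
  entries of a determinant be treated as constants. For \<open>a = 0\<close> the right-hand side is
  \<open>\<top>\<close>.\<close>

lemma complex_normal_inverse_sqrt:
  "(\<integral>\<^sup>+ z. inverse (ennreal (sqrt (norm (a * z + b)))) \<partial>complex_normal) \<le> 5 * inverse (ennreal (sqrt (norm a)))"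
proof (cases "a = 0")
  case True
  then show ?thesis by (simp add: ennreal_mult_top)
next
  case False
  let ?N = "density lborel (normal_density 0 (1 / sqrt 2)) :: real measure"
  interpret N: prob_space ?N by (rule prob_space_normal_density) simp
  let ?h = "\<lambda>x::real. inverse (ennreal (sqrt \<bar>x\<bar>))"
  have "(\<integral>\<^sup>+ z. inverse (ennreal (sqrt (norm (a * z + b)))) \<partial>complex_normal)
    \<le> (\<integral>\<^sup>+ z. inverse (ennreal (sqrt (norm a))) * ?h (Re (b / a) + Re z) \<partial>complex_normal)"
  proof (rule nn_integral_mono)
    fix z
    have "norm (a * z + b) = norm a * norm (b / a + z)"
      using False by (simp add: norm_mult[symmetric] distrib_left add.commute)
    moreover have "\<bar>Re (b / a) + Re z\<bar> \<le> norm (b / a + z)"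
      using abs_Re_le_cmod[of "b / a + z"] by simp
    ultimately have "sqrt (norm a) * sqrt \<bar>Re (b / a) + Re z\<bar> \<le> sqrt (norm (a * z + b))"
      by (simp add: real_sqrt_mult[symmetric] mult_left_mono)
    then have "inverse (ennreal (sqrt (norm (a * z + b)))) \<le> inverse (ennreal (sqrt (norm a) * sqrt \<bar>Re (b / a) + Re z\<bar>))"
      by (intro ennreal_inverse_antimono ennreal_leI)
    also have "\<dots> = inverse (ennreal (sqrt (norm a))) * ?h (Re (b / a) + Re z)"
      using False by (simp add: ennreal_mult ennreal_inverse_mult)
    finally show "inverse (ennreal (sqrt (norm (a * z + b)))) \<le> inverse (ennreal (sqrt (norm a))) * ?h (Re (b / a) + Re z)" .
  qed
  also have "\<dots> = inverse (ennreal (sqrt (norm a))) * (\<integral>\<^sup>+ x. ?h (Re (b / a) + x) \<partial>?N)"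
    by (subst nn_integral_complex_normal) (auto simp: nn_integral_cmult N.emeasure_space_1[simplified])
  also have "\<dots> \<le> inverse (ennreal (sqrt (norm a))) * 5"
    by (intro mult_left_mono, subst nn_integral_real_normal_shift) (auto simp: nn_integral_inverse_sqrt_real_ref)
  finally show ?thesis by (simp add: ac_simps)
qed

section \<open>Entropies of conditionally independent observations\<close>

text \<open>Negative values, which occur for \<open>p > 1\<close>, are cut off by
  \<open>ennreal\<close>. The densities to which it is applied in the bounds never exceed
  \<open>1\<close>, so on them this is the usual entropy integrand.\<close>

definition phi :: "real \<Rightarrow> ennreal" where
  "phi p = ennreal (p * (- ln p))"

lemma phi_measurable [measurable]: "phi \<in> borel_measurable borel"
  unfolding phi_def by measurable

text \<open>In the application the hidden index is the unknown message, and \<open>g a\<close> is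
  the law of one antenna when \<open>a\<close> has been sent.\<close>

locale mixture =
  fixes \<nu> :: "'z measure" and A :: "'a set" and g :: "'a \<Rightarrow> 'z \<Rightarrow> real"
  assumes sigma_finite_nu: "sigma_finite_measure \<nu>" and finite_A: "finite A"
    and g_measurable [measurable]: "\<And>a. a \<in> A \<Longrightarrow> g a \<in> borel_measurable \<nu>"
    and g_pos: "\<And>a z. a \<in> A \<Longrightarrow> 0 < g a z" and g_le_1: "\<And>a z. a \<in> A \<Longrightarrow> g a z \<le> 1"
    and nn_integral_g: "\<And>a. a \<in> A \<Longrightarrow> (\<integral>\<^sup>+ z. ennreal (g a z) \<partial>\<nu>) = 1"
begin

text \<open>Differential entropy of \<open>k\<close> conditionally independent observations with common density
  \<open>g a\<close> given the hidden index \<open>a\<close> of (unnormalised) weight \<open>c a\<close>. Densities are at most \<open>1\<close>,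
  so that all entropies are nonnegative and need no integrability assumptions.\<close>

primrec entropy :: "nat \<Rightarrow> ('a \<Rightarrow> real) \<Rightarrow> ennreal" where
  "entropy 0 c = phi (\<Sum>a\<in>A. c a)"
| "entropy (Suc k) c = (\<integral>\<^sup>+ z. entropy k (\<lambda>a. c a * g a z) \<partial>\<nu>)"

text \<open>A total below \<open>1\<close> must be allowed: an observation \<open>z\<close> turns
  \<open>c\<close> into \<open>\<lambda>a. c a * g a z\<close>, whose sum is the joint density of
  the observations made so far. A positive total keeps the logarithms meaningful.\<close>

definition weights :: "('a \<Rightarrow> real) \<Rightarrow> bool" where
  "weights c \<longleftrightarrow> (\<forall>a\<in>A. 0 \<le> c a) \<and> 0 < (\<Sum>a\<in>A. c a) \<and> (\<Sum>a\<in>A. c a) \<le> 1"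

lemma entropy_cong: "(\<And>a. a \<in> A \<Longrightarrow> c a = d a) \<Longrightarrow> entropy k c = entropy k d"
proof (induction k arbitrary: c d)
  case 0
  then have "(\<Sum>a\<in>A. c a) = (\<Sum>a\<in>A. d a)" by (intro sum.cong) auto
  then show ?case by simp
next
  case (Suc k)
  have "entropy k (\<lambda>a. c a * g a z) = entropy k (\<lambda>a. d a * g a z)" for z
    by (rule Suc.IH) (simp add: Suc.prems)
  then show ?case by simp
qed

text \<open>Measurability in the weights justifies the iterated integrals behind the recursion.
  Restricting \<open>c\<close> to \<open>A\<close> turns it into a point of a product space, on
  which an integral with a parameter is measurable by Tonelli.\<close>

lemma entropy_measurable_PiM: "entropy k \<in> borel_measurable (PiM A (\<lambda>_. borel))"
proof (induction k)
  case 0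
  then show ?case by simp
next
  case (Suc k)
  note [measurable] = Suc
  interpret sigma_finite_measure \<nu> by (rule sigma_finite_nu)
  have "entropy (Suc k) c = (\<integral>\<^sup>+ z. entropy k (\<lambda>a\<in>A. c a * g a z) \<partial>\<nu>)" for c
    unfolding entropy.simps by (intro nn_integral_cong entropy_cong) simp
  moreover have "(\<lambda>c. \<integral>\<^sup>+ z. entropy k (\<lambda>a\<in>A. c a * g a z) \<partial>\<nu>) \<in> borel_measurable (PiM A (\<lambda>_. borel))"
    by measurable
  ultimately show ?case by simp
qed

lemma entropy_measurable [measurable (raw)]:
  assumes "\<And>a. a \<in> A \<Longrightarrow> (\<lambda>x. c x a) \<in> borel_measurable L"
  shows "(\<lambda>x. entropy k (c x)) \<in> borel_measurable L"
proof -
  have "(\<lambda>x. entropy k (\<lambda>a\<in>A. c x a)) \<in> borel_measurable L"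
    using assms by (intro measurable_compose[OF _ entropy_measurable_PiM] measurable_restrict) auto
  moreover have "entropy k (\<lambda>a\<in>A. c x a) = entropy k (c x)" for x
    by (rule entropy_cong) simp
  ultimately show ?thesis by simp
qed

lemma sum_g_le: "weights c \<Longrightarrow> (\<Sum>a\<in>A. c a * g a z) \<le> (\<Sum>a\<in>A. c a)"
  using g_le_1 by (intro sum_mono) (auto simp: weights_def mult_left_le)

lemma sum_g_pos: "weights c \<Longrightarrow> 0 < (\<Sum>a\<in>A. c a * g a z)"
proof -
  assume c: "weights c"
  then obtain a where "a \<in> A" "c a \<noteq> 0"
    by (metis less_irrefl sum.neutral weights_def)
  then show ?thesis
  proof (intro sum_pos2[OF finite_A])
    show "0 < c a * g a z"
      using c \<open>a \<in> A\<close> \<open>c a \<noteq> 0\<close> g_pos[of a z] by (auto simp: weights_def less_le)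
    show "0 \<le> c b * g b z" if "b \<in> A" for b
      using c g_pos[OF that, of z] that by (simp add: weights_def)
  qed
qed

lemma weights_g: "weights c \<Longrightarrow> weights (\<lambda>a. c a * g a z)"
proof -
  assume c: "weights c"
  have "0 \<le> c a * g a z" if "a \<in> A" for a
    using c g_pos[OF that, of z] that by (simp add: weights_def)
  then show ?thesis
    using order_trans[OF sum_g_le[OF c, of z], of 1] sum_g_pos[OF c, of z] c
    unfolding weights_def by blast
qed

lemma weights_prod_g:
  assumes "weights c" shows "weights (\<lambda>a. c a * (\<Prod>i\<in>I. g a (z i)))"
  using assms
proof (induction I arbitrary: c rule: infinite_finite_induct)
  case (insert i I)
  from insert.IH[OF weights_g[OF insert.prems, of "z i"]] insert.hyps show ?case
    by (simp add: mult.assoc)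
qed auto

lemma nn_integral_mixture:
  assumes "weights c"
  shows "(\<integral>\<^sup>+ z. ennreal (\<Sum>a\<in>A. c a * g a z) \<partial>\<nu>) = ennreal (\<Sum>a\<in>A. c a)"
proof -
  have c: "\<And>a. a \<in> A \<Longrightarrow> 0 \<le> c a" using assms by (auto simp: weights_def)
  have "(\<integral>\<^sup>+ z. ennreal (\<Sum>a\<in>A. c a * g a z) \<partial>\<nu>) = (\<integral>\<^sup>+ z. (\<Sum>a\<in>A. ennreal (c a) * ennreal (g a z)) \<partial>\<nu>)"
    using c less_imp_le[OF g_pos] by (auto intro!: nn_integral_cong sum.cong simp: sum_ennreal[symmetric] ennreal_mult simp del: sum_ennreal)
  also have "\<dots> = (\<Sum>a\<in>A. ennreal (c a))"
    by (subst nn_integral_sum) (auto simp: nn_integral_cmult nn_integral_g)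
  also have "\<dots> = ennreal (\<Sum>a\<in>A. c a)"
    using c by (simp add: sum_ennreal)
  finally show ?thesis .
qed

text \<open>This is \<open>ln x \<le> x - 1\<close> at \<open>x = S * Q / p\<close>, the pointwise
  form of Gibbs' inequality. The terms are arranged so that all of them are nonnegative when
  \<open>S\<close>, \<open>Q\<close> and \<open>p\<close> are at most \<open>1\<close>, as
  \<open>ennreal\<close> demands.\<close>

lemma ln_ratio_le:
  assumes "0 < S" "0 < Q" "0 < (p::real)"
  shows "p * (- ln p) + p \<le> S * Q + p * (- ln S) + p * (- ln Q)"
proof -
  have "ln (S * Q / p) \<le> S * Q / p - 1"
    using assms by (intro ln_le_minus_one) auto
  then have "p * (ln S + ln Q - ln p) \<le> p * (S * Q / p - 1)"
    using assms by (intro mult_left_mono) (auto simp: ln_mult ln_div)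
  also have "\<dots> = S * Q - p" using assms by (simp add: field_simps)
  finally show ?thesis by (simp add: algebra_simps)
qed

text \<open>Gibbs' inequality: \<open>entropy 1 c\<close> exceeds \<open>entropy 0 c\<close> by the
  mass of \<open>c\<close> times the entropy of the normalised observation, and the latter is at
  most the cross entropy with any test density \<open>Q\<close>.\<close>

lemma entropy_1_le:
  assumes c: "weights c" and Q: "\<And>z. 0 < Q z" "\<And>z. Q z \<le> 1"
    and [measurable]: "Q \<in> borel_measurable \<nu>" and int_Q: "(\<integral>\<^sup>+ z. ennreal (Q z) \<partial>\<nu>) \<le> 1"
  shows "entropy 1 c \<le> entropy 0 c + (\<integral>\<^sup>+ z. ennreal ((\<Sum>a\<in>A. c a * g a z) * (- ln (Q z))) \<partial>\<nu>)"
proof -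
  define S where "S = (\<Sum>a\<in>A. c a)"
  define p where "p z = (\<Sum>a\<in>A. c a * g a z)" for z
  have [measurable]: "p \<in> borel_measurable \<nu>" unfolding p_def by measurable
  have S: "0 < S" "S \<le> 1" using c by (auto simp: weights_def S_def)
  have p: "0 < p z" "p z \<le> S" for z using sum_g_pos[OF c] sum_g_le[OF c] by (auto simp: p_def S_def)
  have p1: "p z \<le> 1" for z using p(2)[of z] S by simp
  have int_p: "(\<integral>\<^sup>+ z. ennreal (p z) \<partial>\<nu>) = ennreal S"
    using nn_integral_mixture[OF c] by (simp add: p_def S_def)
  have "entropy 1 c + ennreal S = (\<integral>\<^sup>+ z. phi (p z) + ennreal (p z) \<partial>\<nu>)"
    by (simp add: nn_integral_add int_p flip: p_def)
  also have "\<dots> \<le> (\<integral>\<^sup>+ z. (ennreal S * ennreal (Q z) + ennreal (- ln S) * ennreal (p z)) + ennreal (p z * (- ln (Q z))) \<partial>\<nu>)"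
  proof (rule nn_integral_mono)
    fix z
    have "phi (p z) + ennreal (p z) = ennreal (p z * (- ln (p z)) + p z)"
      unfolding phi_def using p[of z] p1[of z] by (intro ennreal_plus[symmetric] mult_nonneg_nonneg) auto
    also have "\<dots> \<le> ennreal (S * Q z + p z * (- ln S) + p z * (- ln (Q z)))"
      using ln_ratio_le[OF S(1) Q(1) p(1)] by (intro ennreal_leI)
    also have "\<dots> = ennreal (S * Q z) + ennreal (p z * (- ln S)) + ennreal (p z * (- ln (Q z)))"
    proof -
      have a1: "0 \<le> S * Q z" and a2: "0 \<le> p z * (- ln S)" and a3: "0 \<le> p z * (- ln (Q z))"
        using p[of z] S Q[of z] by (auto intro!: mult_nonneg_nonneg mult_nonneg_nonpos simp del: mult_minus_right)
      show ?thesis by (simp only: ennreal_plus[OF add_nonneg_nonneg[OF a1 a2] a3] ennreal_plus[OF a1 a2])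
    qed
    also have "\<dots> = (ennreal S * ennreal (Q z) + ennreal (- ln S) * ennreal (p z)) + ennreal (p z * (- ln (Q z)))"
      using p[of z] S Q[of z] ln_le_zero_iff[of S] by (simp add: ennreal_mult[symmetric] mult.commute less_imp_le)
    finally show "phi (p z) + ennreal (p z) \<le> (ennreal S * ennreal (Q z) + ennreal (- ln S) * ennreal (p z)) + ennreal (p z * (- ln (Q z)))" .
  qed
  also have "\<dots> = ennreal S * (\<integral>\<^sup>+ z. ennreal (Q z) \<partial>\<nu>) + ennreal (- ln S) * ennreal S + (\<integral>\<^sup>+ z. ennreal (p z * (- ln (Q z))) \<partial>\<nu>)"
    by (simp add: nn_integral_add nn_integral_cmult int_p)
  also have "\<dots> \<le> ennreal S * 1 + phi S + (\<integral>\<^sup>+ z. ennreal (p z * (- ln (Q z))) \<partial>\<nu>)"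
    using S int_Q by (intro add_mono mult_left_mono) (auto simp: phi_def ennreal_mult[symmetric] mult.commute)
  \<comment> \<open>The mass \<open>S\<close> was carried on both sides to avoid subtraction in
    \<open>ennreal\<close>; being finite, it cancels.\<close>
  finally have "ennreal S + entropy 1 c \<le> ennreal S + (phi S + (\<integral>\<^sup>+ z. ennreal (p z * (- ln (Q z))) \<partial>\<nu>))"
    by (simp add: ac_simps)
  then show ?thesis
    by (simp add: ennreal_add_left_cancel_le S_def p_def)
qed

text \<open>Since \<open>g \<le> 1\<close>, the joint density \<open>p z\<close> never exceeds the
  density \<open>S\<close> of the past, so \<open>- ln\<close> can only grow. Relative to this
  reference measure, differential entropy behaves like the discrete one.\<close>

lemma entropy_mono_1: "weights c \<Longrightarrow> entropy 0 c \<le> entropy 1 c"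
proof -
  assume c: "weights c"
  define S where "S = (\<Sum>a\<in>A. c a)"
  define p where "p z = (\<Sum>a\<in>A. c a * g a z)" for z
  have [measurable]: "p \<in> borel_measurable \<nu>" unfolding p_def by measurable
  have S: "0 < S" "S \<le> 1" using c by (auto simp: weights_def S_def)
  have p: "0 < p z" "p z \<le> S" for z using sum_g_pos[OF c] sum_g_le[OF c] by (auto simp: p_def S_def)
  have "phi S = ennreal (- ln S) * (\<integral>\<^sup>+ z. ennreal (p z) \<partial>\<nu>)"
    using nn_integral_mixture[OF c] S by (simp add: p_def S_def phi_def ennreal_mult[symmetric] mult.commute)
  also have "\<dots> = (\<integral>\<^sup>+ z. ennreal (- ln S) * ennreal (p z) \<partial>\<nu>)"
    by (rule nn_integral_cmult[symmetric]) simp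
  also have "\<dots> \<le> (\<integral>\<^sup>+ z. phi (p z) \<partial>\<nu>)"
  proof (rule nn_integral_mono)
    fix z
    have "p z * (- ln S) \<le> p z * (- ln (p z))"
      using p[of z] by (intro mult_left_mono) auto
    then have "ennreal (p z * (- ln S)) \<le> phi (p z)"
      unfolding phi_def by (rule ennreal_leI)
    then show "ennreal (- ln S) * ennreal (p z) \<le> phi (p z)"
      using p[of z] S by (simp add: ennreal_mult[symmetric] mult.commute)
  qed
  finally show ?thesis by (simp add: S_def p_def)
qed

lemma entropy_mono: "weights c \<Longrightarrow> entropy k c \<le> entropy (Suc k) c"
proof (induction k arbitrary: c)
  case 0
  then show ?case using entropy_mono_1 by simp
next
  case (Suc k)
  have "entropy (Suc k) c = (\<integral>\<^sup>+ z. entropy k (\<lambda>a. c a * g a z) \<partial>\<nu>)" by simp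
  also have "\<dots> \<le> (\<integral>\<^sup>+ z. entropy (Suc k) (\<lambda>a. c a * g a z) \<partial>\<nu>)"
    by (intro nn_integral_mono Suc.IH weights_g Suc.prems)
  also have "\<dots> = entropy (Suc (Suc k)) c" by simp
  finally show ?case .
qed

text \<open>Conditioning reduces entropy: given the first observation, the second is compared with
  the test density \<open>p / S\<close>, its own marginal law. That this is also the marginal of the
  first observation comes from their being independent and identically distributed given the
  index.\<close>

lemma entropy_concave_0:
  assumes c: "weights c"
  shows "entropy 2 c + entropy 0 c \<le> entropy 1 c + entropy 1 c"
proof -
  interpret sigma_finite_measure \<nu> by (rule sigma_finite_nu)
  define S where "S = (\<Sum>a\<in>A. c a)"
  define p where "p z = (\<Sum>a\<in>A. c a * g a z)" for z
  have [measurable]: "p \<in> borel_measurable \<nu>" unfolding p_def by measurable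
  have S: "0 < S" "S \<le> 1" using c by (auto simp: weights_def S_def)
  have p: "0 < p z" "p z \<le> S" for z using sum_g_pos[OF c] sum_g_le[OF c] by (auto simp: p_def S_def)
  define Q where "Q z = p z / S" for z
  have [measurable]: "Q \<in> borel_measurable \<nu>" unfolding Q_def by measurable
  have Q: "0 < Q z" "Q z \<le> 1" for z using p[of z] S by (auto simp: Q_def)
  have lnQ: "- ln (Q z) = - ln (p z) + ln S" "0 \<le> - ln (Q z)" for z
    using p[of z] S Q[of z] by (auto simp: Q_def ln_div)
  have int_p: "(\<integral>\<^sup>+ z. ennreal (p z) \<partial>\<nu>) = ennreal S"
    using nn_integral_mixture[OF c] by (simp add: p_def S_def)
  have "(\<integral>\<^sup>+ z. ennreal (Q z) \<partial>\<nu>) = (\<integral>\<^sup>+ z. ennreal (1 / S) * ennreal (p z) \<partial>\<nu>)"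
    using S p by (intro nn_integral_cong) (simp add: Q_def ennreal_mult[symmetric] less_imp_le)
  also have "\<dots> = ennreal (1 / S) * ennreal S"
    by (simp add: nn_integral_cmult int_p)
  also have "\<dots> = 1" using S by (simp add: ennreal_mult[symmetric])
  finally have int_Q: "(\<integral>\<^sup>+ z. ennreal (Q z) \<partial>\<nu>) \<le> 1" by simp
  define q where "q z x = (\<Sum>a\<in>A. c a * g a z * g a x)" for z x
  have [measurable]: "(\<lambda>(z, x). q z x) \<in> borel_measurable (\<nu> \<Otimes>\<^sub>M \<nu>)" unfolding q_def by measurable
  have q0: "0 \<le> q z x" for z x
    using c less_imp_le[OF g_pos] by (auto simp: q_def weights_def intro!: sum_nonneg mult_nonneg_nonneg)
  have "entropy 2 c = (\<integral>\<^sup>+ z. entropy 1 (\<lambda>a. c a * g a z) \<partial>\<nu>)"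
    by (simp add: numeral_2_eq_2)
  also have "\<dots> \<le> (\<integral>\<^sup>+ z. entropy 0 (\<lambda>a. c a * g a z) + (\<integral>\<^sup>+ x. ennreal (q z x * (- ln (Q x))) \<partial>\<nu>) \<partial>\<nu>)"
    unfolding q_def by (intro nn_integral_mono entropy_1_le weights_g c Q int_Q) measurable
  also have "\<dots> = entropy 1 c + (\<integral>\<^sup>+ z. \<integral>\<^sup>+ x. ennreal (q z x * (- ln (Q x))) \<partial>\<nu> \<partial>\<nu>)"
    by (subst nn_integral_add) auto
  also have "(\<integral>\<^sup>+ z. \<integral>\<^sup>+ x. ennreal (q z x * (- ln (Q x))) \<partial>\<nu> \<partial>\<nu>)
    = (\<integral>\<^sup>+ x. \<integral>\<^sup>+ z. ennreal (q z x * (- ln (Q x))) \<partial>\<nu> \<partial>\<nu>)"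
    by (rule nn_integral_swap[OF sigma_finite_nu sigma_finite_nu]) measurable
  \<comment> \<open>Integrating out the first observation \<open>z\<close> leaves the marginal
    \<open>p\<close> of the second.\<close>
  also have "\<dots> = (\<integral>\<^sup>+ x. ennreal (p x * (- ln (Q x))) \<partial>\<nu>)"
  proof (rule nn_integral_cong)
    fix x assume [measurable]: "x \<in> space \<nu>"
    have "(\<integral>\<^sup>+ z. ennreal (q z x * (- ln (Q x))) \<partial>\<nu>) = (\<integral>\<^sup>+ z. ennreal (- ln (Q x)) * ennreal (q z x) \<partial>\<nu>)"
      using lnQ[of x] q0 by (simp add: ennreal_mult[symmetric] mult.commute)
    also have "\<dots> = ennreal (- ln (Q x)) * (\<integral>\<^sup>+ z. ennreal (\<Sum>a\<in>A. (c a * g a x) * g a z) \<partial>\<nu>)"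
      by (subst nn_integral_cmult) (auto simp: q_def ac_simps)
    also have "\<dots> = ennreal (- ln (Q x)) * ennreal (p x)"
      by (subst nn_integral_mixture[OF weights_g[OF c]]) (simp add: p_def)
    also have "\<dots> = ennreal (p x * (- ln (Q x)))"
      using lnQ[of x] p[of x] by (simp add: ennreal_mult[symmetric] mult.commute less_imp_le)
    finally show "(\<integral>\<^sup>+ z. ennreal (q z x * (- ln (Q x))) \<partial>\<nu>) = ennreal (p x * (- ln (Q x)))" .
  qed
  finally have "entropy 2 c + entropy 0 c \<le> entropy 1 c + ((\<integral>\<^sup>+ x. ennreal (p x * (- ln (Q x))) \<partial>\<nu>) + phi S)"
    by (simp add: S_def add.assoc[symmetric] add_right_mono)
  \<comment> \<open>\<open>phi S\<close> is spread over \<open>x\<close> with weight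
    \<open>p x\<close>, so that it merges with the cross entropy:
    \<open>- ln (Q x) - ln S = - ln (p x)\<close>.\<close>
  also have "phi S = (\<integral>\<^sup>+ x. ennreal (- ln S) * ennreal (p x) \<partial>\<nu>)"
    using S by (subst nn_integral_cmult) (auto simp: int_p phi_def ennreal_mult[symmetric] mult.commute)
  also have "(\<integral>\<^sup>+ x. ennreal (p x * (- ln (Q x))) \<partial>\<nu>) + \<dots> = (\<integral>\<^sup>+ x. phi (p x) \<partial>\<nu>)"
  proof (subst nn_integral_add[symmetric], measurable, rule nn_integral_cong)
    fix x
    have "ennreal (p x * (- ln (Q x))) + ennreal (- ln S) * ennreal (p x) = ennreal (p x * (- ln (Q x)) + p x * (- ln S))"
    proof -
      have "0 \<le> p x * (- ln (Q x))" "0 \<le> p x * (- ln S)"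
        using lnQ(2)[of x] p[of x] S by (auto intro!: mult_nonneg_nonpos)
      then show ?thesis
        using p[of x] S by (simp only: ennreal_plus) (simp add: ennreal_mult[symmetric] mult.commute)
    qed
    also have "\<dots> = phi (p x)" by (simp add: phi_def lnQ(1) algebra_simps)
    finally show "ennreal (p x * (- ln (Q x))) + ennreal (- ln S) * ennreal (p x) = phi (p x)" .
  qed
  also have "\<dots> = entropy 1 c" by (simp add: p_def)
  finally show ?thesis .
qed

text \<open>One observation turns admissible weights into admissible weights, so the inequality for
  \<open>k\<close> can be integrated over it to give the one for \<open>k + 1\<close>.\<close>

lemma entropy_concave:
  "weights c \<Longrightarrow> entropy (Suc (Suc k)) c + entropy k c \<le> entropy (Suc k) c + entropy (Suc k) c"
proof (induction k arbitrary: c)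
  case 0
  then show ?case using entropy_concave_0 by (simp add: numeral_2_eq_2)
next
  case (Suc k)
  interpret sigma_finite_measure \<nu> by (rule sigma_finite_nu)
  have "entropy (Suc (Suc (Suc k))) c + entropy (Suc k) c
    = (\<integral>\<^sup>+ z. entropy (Suc (Suc k)) (\<lambda>a. c a * g a z) \<partial>\<nu>) + (\<integral>\<^sup>+ z. entropy k (\<lambda>a. c a * g a z) \<partial>\<nu>)"
    by simp
  also have "\<dots> = (\<integral>\<^sup>+ z. entropy (Suc (Suc k)) (\<lambda>a. c a * g a z) + entropy k (\<lambda>a. c a * g a z) \<partial>\<nu>)"
    by (rule nn_integral_add[symmetric]) measurable
  also have "\<dots> \<le> (\<integral>\<^sup>+ z. entropy (Suc k) (\<lambda>a. c a * g a z) + entropy (Suc k) (\<lambda>a. c a * g a z) \<partial>\<nu>)"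
    by (intro nn_integral_mono Suc.IH weights_g Suc.prems)
  also have "\<dots> = (\<integral>\<^sup>+ z. entropy (Suc k) (\<lambda>a. c a * g a z) \<partial>\<nu>) + (\<integral>\<^sup>+ z. entropy (Suc k) (\<lambda>a. c a * g a z) \<partial>\<nu>)"
    by (rule nn_integral_add) measurable
  also have "\<dots> = entropy (Suc (Suc k)) c + entropy (Suc (Suc k)) c" by simp
  finally show ?case .
qed

lemma entropy_PiM:
  assumes "finite I"
  shows "(\<integral>\<^sup>+ z. entropy k (\<lambda>a. c a * (\<Prod>i\<in>I. g a (z i))) \<partial>PiM I (\<lambda>_. \<nu>)) = entropy (k + card I) c"
  using assms
proof (induction I arbitrary: k)
  case empty
  then show ?case by (simp add: PiM_empty nn_integral_count_space_finite)
next
  case (insert i I)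
  have "(\<integral>\<^sup>+ z. entropy k (\<lambda>a. c a * (\<Prod>j\<in>insert i I. g a (z j))) \<partial>PiM (insert i I) (\<lambda>_. \<nu>))
    = (\<integral>\<^sup>+ z. \<integral>\<^sup>+ x. entropy k (\<lambda>a. c a * (\<Prod>j\<in>insert i I. g a ((z(i := x)) j))) \<partial>\<nu> \<partial>PiM I (\<lambda>_. \<nu>))"
    by (rule nn_integral_PiM_insert[OF sigma_finite_nu insert.hyps(1,2)]) measurable
  also have "\<dots> = (\<integral>\<^sup>+ z. \<integral>\<^sup>+ x. entropy k (\<lambda>a. c a * (\<Prod>j\<in>I. g a (z j)) * g a x) \<partial>\<nu> \<partial>PiM I (\<lambda>_. \<nu>))"
  proof -
    have "(\<Prod>j\<in>insert i I. g a ((z(i := x)) j)) = (\<Prod>j\<in>I. g a (z j)) * g a x" for a z x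
    proof -
      have "(\<Prod>j\<in>I. g a ((z(i := x)) j)) = (\<Prod>j\<in>I. g a (z j))"
        using insert.hyps by (intro prod.cong) auto
      then show ?thesis using insert.hyps by simp
    qed
    then show ?thesis by (simp add: mult.assoc)
  qed
  also have "\<dots> = (\<integral>\<^sup>+ z. entropy (Suc k) (\<lambda>a. c a * (\<Prod>j\<in>I. g a (z j))) \<partial>PiM I (\<lambda>_. \<nu>))"
    by simp
  also have "\<dots> = entropy (Suc k + card I) c" by (rule insert.IH)
  finally show ?case using insert.hyps by simp
qed

text \<open>The test density for the new observation may depend on the earlier ones in
  \<open>z\<close>; extrapolation exploits this freedom. The cost is split over \<open>a\<close>,
  because for a fixed input it becomes an expectation over channels and noise.\<close>

lemma entropy_Suc_card_le:
  assumes c: "weights c" and I: "finite I"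
    and Q: "\<And>z x. 0 < Q z x" "\<And>z x. Q z x \<le> 1"
    and Q_meas: "(\<lambda>(z, x). Q z x) \<in> borel_measurable (PiM I (\<lambda>_. \<nu>) \<Otimes>\<^sub>M \<nu>)"
    and int_Q: "\<And>z. z \<in> space (PiM I (\<lambda>_. \<nu>)) \<Longrightarrow> (\<integral>\<^sup>+ x. ennreal (Q z x) \<partial>\<nu>) \<le> 1"
  shows "entropy (Suc (card I)) c \<le> entropy (card I) c
    + (\<Sum>a\<in>A. ennreal (c a) * (\<integral>\<^sup>+ z. (\<Prod>i\<in>I. ennreal (g a (z i))) *
         (\<integral>\<^sup>+ x. ennreal (g a x) * ennreal (- ln (Q z x)) \<partial>\<nu>) \<partial>PiM I (\<lambda>_. \<nu>)))"
proof -
  interpret sigma_finite_measure \<nu> by (rule sigma_finite_nu)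
  note [measurable] = Q_meas
  define d where "d z a = c a * (\<Prod>i\<in>I. g a (z i))" for z a
  have wd: "weights (d z)" for z :: "_ \<Rightarrow> 'z"
    unfolding d_def[abs_def] by (rule weights_prod_g[OF c])
  have c0: "\<And>a. a \<in> A \<Longrightarrow> 0 \<le> c a" using c by (auto simp: weights_def)
  have "entropy (Suc (card I)) c = (\<integral>\<^sup>+ z. entropy 1 (d z) \<partial>PiM I (\<lambda>_. \<nu>))"
    using entropy_PiM[OF I, of 1] by (simp add: d_def)
  also have "\<dots> \<le> (\<integral>\<^sup>+ z. entropy 0 (d z) + (\<integral>\<^sup>+ x. ennreal ((\<Sum>a\<in>A. d z a * g a x) * (- ln (Q z x))) \<partial>\<nu>) \<partial>PiM I (\<lambda>_. \<nu>))"
    by (intro nn_integral_mono entropy_1_le Q int_Q wd) auto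
  also have "\<dots> = (\<integral>\<^sup>+ z. entropy 0 (d z) \<partial>PiM I (\<lambda>_. \<nu>))
      + (\<integral>\<^sup>+ z. \<integral>\<^sup>+ x. ennreal ((\<Sum>a\<in>A. d z a * g a x) * (- ln (Q z x))) \<partial>\<nu> \<partial>PiM I (\<lambda>_. \<nu>))"
    unfolding d_def by (rule nn_integral_add) measurable
  also have "(\<integral>\<^sup>+ z. entropy 0 (d z) \<partial>PiM I (\<lambda>_. \<nu>)) = entropy (card I) c"
    using entropy_PiM[OF I, of 0] by (simp add: d_def)
  also have "(\<integral>\<^sup>+ z. \<integral>\<^sup>+ x. ennreal ((\<Sum>a\<in>A. d z a * g a x) * (- ln (Q z x))) \<partial>\<nu> \<partial>PiM I (\<lambda>_. \<nu>))
    = (\<integral>\<^sup>+ z. (\<Sum>a\<in>A. ennreal (c a) * ((\<Prod>i\<in>I. ennreal (g a (z i))) *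
         (\<integral>\<^sup>+ x. ennreal (g a x) * ennreal (- ln (Q z x)) \<partial>\<nu>))) \<partial>PiM I (\<lambda>_. \<nu>))"
  proof (rule nn_integral_cong)
    fix z assume [measurable]: "z \<in> space (PiM I (\<lambda>_. \<nu>))"
    have lnQ: "0 \<le> - ln (Q z x)" for x using Q[of z x] by simp
    have "(\<integral>\<^sup>+ x. ennreal ((\<Sum>a\<in>A. d z a * g a x) * (- ln (Q z x))) \<partial>\<nu>)
      = (\<integral>\<^sup>+ x. (\<Sum>a\<in>A. ennreal (d z a) * (ennreal (g a x) * ennreal (- ln (Q z x)))) \<partial>\<nu>)"
    proof (rule nn_integral_cong)
      fix x
      have "ennreal ((\<Sum>a\<in>A. d z a * g a x) * (- ln (Q z x))) = ennreal (\<Sum>a\<in>A. d z a * (g a x * (- ln (Q z x))))"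
        by (simp only: sum_distrib_right mult.assoc)
      also have "\<dots> = (\<Sum>a\<in>A. ennreal (d z a * (g a x * (- ln (Q z x)))))"
        using c0 lnQ less_imp_le[OF g_pos]
        by (intro sum_ennreal[symmetric] mult_nonneg_nonneg) (auto simp: d_def intro!: mult_nonneg_nonneg prod_nonneg)
      also have "\<dots> = (\<Sum>a\<in>A. ennreal (d z a) * (ennreal (g a x) * ennreal (- ln (Q z x))))"
        using c0 lnQ[of x] less_imp_le[OF g_pos]
        by (intro sum.cong refl) (simp add: ennreal_mult[symmetric] d_def prod_nonneg mult_nonneg_nonpos)
      finally show "ennreal ((\<Sum>a\<in>A. d z a * g a x) * (- ln (Q z x)))
        = (\<Sum>a\<in>A. ennreal (d z a) * (ennreal (g a x) * ennreal (- ln (Q z x))))" .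
    qed
    also have "\<dots> = (\<Sum>a\<in>A. ennreal (d z a) * (\<integral>\<^sup>+ x. ennreal (g a x) * ennreal (- ln (Q z x)) \<partial>\<nu>))"
      by (subst nn_integral_sum) (auto simp: nn_integral_cmult)
    also have "\<dots> = (\<Sum>a\<in>A. ennreal (c a) * ((\<Prod>i\<in>I. ennreal (g a (z i))) *
         (\<integral>\<^sup>+ x. ennreal (g a x) * ennreal (- ln (Q z x)) \<partial>\<nu>)))"
      using c0 less_imp_le[OF g_pos]
      by (intro sum.cong refl) (simp add: d_def ennreal_mult prod_nonneg prod_ennreal mult.assoc)
    finally show "(\<integral>\<^sup>+ x. ennreal ((\<Sum>a\<in>A. d z a * g a x) * (- ln (Q z x))) \<partial>\<nu>)
      = (\<Sum>a\<in>A. ennreal (c a) * ((\<Prod>i\<in>I. ennreal (g a (z i))) *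
         (\<integral>\<^sup>+ x. ennreal (g a x) * ennreal (- ln (Q z x)) \<partial>\<nu>)))" .
  qed
  also have "\<dots> = (\<Sum>a\<in>A. ennreal (c a) * (\<integral>\<^sup>+ z. (\<Prod>i\<in>I. ennreal (g a (z i))) *
         (\<integral>\<^sup>+ x. ennreal (g a x) * ennreal (- ln (Q z x)) \<partial>\<nu>) \<partial>PiM I (\<lambda>_. \<nu>)))"
    by (subst nn_integral_sum) (auto simp: nn_integral_cmult)
  finally show ?thesis .
qed

end

section \<open>Concave sequences of extended nonnegative reals\<close>

text \<open>Finiteness at one index \<open>s \<ge> 1\<close> spreads to all others: down to
  \<open>1\<close> by monotonicity, then upwards, since concavity bounds \<open>e (k + 2)\<close> by
  \<open>2 * e (k + 1)\<close>. After that, differences make sense and concavity says that the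
  increments decrease.\<close>

lemma ennreal_seq_real:
  fixes e :: "nat \<Rightarrow> ennreal"
  assumes conc: "\<And>k. e (Suc (Suc k)) + e k \<le> e (Suc k) + e (Suc k)"
    and mono: "\<And>k. e k \<le> e (Suc k)" and "e 0 = 0" and "e s \<noteq> \<top>" "1 \<le> s"
  obtains r where "\<And>k. e k = ennreal (r k)" "\<And>k. 0 \<le> r k" "r 0 = 0"
    "\<And>k l. k \<le> l \<Longrightarrow> r (Suc l) - r l \<le> r (Suc k) - r k"
proof -
  have "e 1 \<le> e s" by (rule lift_Suc_mono_le[of e, OF mono \<open>1 \<le> s\<close>])
  then have e1: "e 1 \<noteq> \<top>" using assms(4) by (auto simp: top_unique)
  have "e k \<noteq> \<top> \<and> e (Suc k) \<noteq> \<top>" for k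
  proof (induction k)
    case 0
    then show ?case using e1 \<open>e 0 = 0\<close> by simp
  next
    case (Suc k)
    have "e (Suc (Suc k)) \<le> e (Suc k) + e (Suc k)"
      using conc[of k] by (meson add_increasing2 order_trans zero_le order_refl)
    then show ?case using Suc by (auto simp: top_unique)
  qed
  then have fin: "e k \<noteq> \<top>" for k by blast
  define r where "r k = enn2real (e k)" for k
  have er: "e k = ennreal (r k)" for k using fin by (simp add: r_def less_top)
  have r0: "0 \<le> r k" for k by (simp add: r_def)
  have step: "r (Suc (Suc k)) - r (Suc k) \<le> r (Suc k) - r k" for k
    using conc[of k] r0 by (simp add: er ennreal_plus[symmetric] del: ennreal_plus)
  have "r (Suc l) - r l \<le> r (Suc k) - r k" if "k \<le> l" for k l
    using lift_Suc_antimono_le[of "\<lambda>k. r (Suc k) - r k" k l] step that by simp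
  moreover have "r 0 = 0" using \<open>e 0 = 0\<close> by (simp add: r_def)
  ultimately show ?thesis using er r0 that by blast
qed

text \<open>As the increments decrease and \<open>r 0 = 0\<close>, the value \<open>r k\<close> is
  at least \<open>k\<close> times the increment at \<open>k\<close>; this is the induction step for
  the decrease of \<open>r k / k\<close>. If \<open>e s = \<top>\<close>, the right-hand side is
  infinite.\<close>

lemma concave_seq_ratio:
  fixes e :: "nat \<Rightarrow> ennreal"
  assumes conc: "\<And>k. e (Suc (Suc k)) + e k \<le> e (Suc k) + e (Suc k)"
    and mono: "\<And>k. e k \<le> e (Suc k)" and e0: "e 0 = 0" and s: "1 \<le> s" "s \<le> k"
  shows "of_nat s * e k \<le> of_nat k * e s"
proof (cases "e s = \<top>")
  case True
  then show ?thesis using s by (simp add: ennreal_mult_top)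
next
  case False
  obtain r where er: "\<And>k. e k = ennreal (r k)" and r: "\<And>k. 0 \<le> r k" "r 0 = 0"
    and d: "\<And>k l. k \<le> l \<Longrightarrow> r (Suc l) - r l \<le> r (Suc k) - r k"
    using ennreal_seq_real[OF conc mono e0 False s(1)] by blast
  have sum: "real k * (r (Suc l) - r l) \<le> r k" if "k \<le> l" for k l
    using that
  proof (induction k)
    case (Suc k)
    then show ?case using d[of k l] by (simp add: algebra_simps)
  qed (simp add: r)
  have "real s * r k \<le> real k * r s"
    using s(2)
  proof (induction k rule: dec_induct)
    case (step k)
    have k: "0 < real k" using step s by simp
    have "real k * (real s * r (Suc k)) = real s * (real k * (r (Suc k) - r k) + real k * r k)"
      by (simp add: algebra_simps)
    also have "\<dots> \<le> real s * (r k + real k * r k)"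
      using sum[of k k] by (intro mult_left_mono) auto
    also have "\<dots> = (1 + real k) * (real s * r k)" by (simp add: algebra_simps)
    also have "\<dots> \<le> (1 + real k) * (real k * r s)"
      using step by (intro mult_left_mono) auto
    finally have "real k * (real s * r (Suc k)) \<le> real k * (real (Suc k) * r s)"
      by (simp add: algebra_simps)
    then show ?case using k by simp
  qed simp
  then show ?thesis using r by (simp add: er ennreal_mult[symmetric] ennreal_leI ennreal_of_nat_eq_real_of_nat)
qed

lemma concave_seq_increment:
  fixes e :: "nat \<Rightarrow> ennreal"
  assumes conc: "\<And>k. e (Suc (Suc k)) + e k \<le> e (Suc k) + e (Suc k)"
    and mono: "\<And>k. e k \<le> e (Suc k)" and e0: "e 0 = 0" and s: "1 \<le> s"
    and C: "e (Suc s) \<le> e s + ennreal C" "0 \<le> C"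
  shows "e (s + j) \<le> e s + ennreal (real j * C)"
proof (cases "e s = \<top>")
  case False
  obtain r where er: "\<And>k. e k = ennreal (r k)" and r: "\<And>k. 0 \<le> r k" "r 0 = 0"
    and d: "\<And>k l. k \<le> l \<Longrightarrow> r (Suc l) - r l \<le> r (Suc k) - r k"
    using ennreal_seq_real[OF conc mono e0 False s(1)] by blast
  have C': "r (Suc s) - r s \<le> C"
    using C r by (simp add: er ennreal_plus[symmetric] del: ennreal_plus)
  have "r (s + j) \<le> r s + real j * C"
  proof (induction j)
    case (Suc j)
    then show ?case using d[of s "s + j"] C' by (simp add: algebra_simps)
  qed simp
  then show ?thesis using r C(2)
    by (simp add: er ennreal_plus[symmetric] ennreal_leI del: ennreal_plus)
qed simp

section \<open>Random determinants and interpolation of rows\<close>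

lemma borel_measurable_vec_nth [measurable (raw)]:
  fixes f :: "'x \<Rightarrow> 'a::euclidean_space ^ 'n"
  assumes "f \<in> borel_measurable M"
  shows "(\<lambda>x. f x $ i) \<in> borel_measurable M"
  by (rule borel_measurable_continuous_on[OF _ assms]) (intro continuous_intros)

lemma borel_measurable_vec_lambda [measurable (raw)]:
  fixes f :: "'x \<Rightarrow> 'n::finite \<Rightarrow> 'a::euclidean_space"
  assumes "\<And>i. (\<lambda>x. f x i) \<in> borel_measurable M"
  shows "(\<lambda>x. \<chi> i. f x i) \<in> borel_measurable M"
proof (subst borel_measurable_euclidean_space, safe)
  fix b :: "'a ^ 'n" assume "b \<in> Basis"
  then obtain i u where "b = axis i u" by (auto simp: Basis_vec_def)
  then have "(\<lambda>x. (\<chi> i. f x i) \<bullet> b) = (\<lambda>x. f x i \<bullet> u)"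
    by (simp add: inner_axis)
  then show "(\<lambda>x. (\<chi> i. f x i) \<bullet> b) \<in> borel_measurable M"
    using assms[of i] by simp
qed

lemma borel_measurable_det [measurable (raw)]:
  fixes f :: "'x \<Rightarrow> complex ^ 'n ^ 'n"
  assumes [measurable]: "f \<in> borel_measurable M"
  shows "(\<lambda>x. det (f x)) \<in> borel_measurable M"
  unfolding det_def by measurable

lemma sets_noise_vector [simp, measurable_cong]: "sets (noise_vector :: (complex ^ 'n::finite) measure) = sets borel"
  by (simp add: noise_vector_def)

lemma space_noise_vector [simp]: "space (noise_vector :: (complex ^ 'n::finite) measure) = UNIV"
  by (simp add: noise_vector_def)

lemma measurable_PiM_vec [measurable]:
  "(\<lambda>v. \<chi> i. v i) \<in> borel_measurable (\<Pi>\<^sub>M i\<in>(UNIV :: 'n::finite set). complex_normal)"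
proof -
  have "(\<lambda>v. v i) \<in> borel_measurable (\<Pi>\<^sub>M i\<in>(UNIV :: 'n::finite set). complex_normal)" for i
    using measurable_component_singleton[of i UNIV "\<lambda>_. complex_normal"] by (simp cong: measurable_cong_sets)
  then show ?thesis by measurable
qed

lemma prob_space_noise_vector: "prob_space (noise_vector :: (complex ^ 'n::finite) measure)"
  unfolding noise_vector_def
  by (intro prob_space.prob_space_distr prob_space_PiM prob_space_complex_normal measurable_PiM_vec)

lemma sigma_finite_noise_vector: "sigma_finite_measure (noise_vector :: (complex ^ 'n::finite) measure)"
  by (rule prob_space_imp_sigma_finite[OF prob_space_noise_vector])

lemma sigma_finite_complex_normal: "sigma_finite_measure complex_normal"
  by (rule prob_space_imp_sigma_finite[OF prob_space_complex_normal])

lemma nn_integral_noise_vector: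
  assumes [measurable]: "F \<in> borel_measurable borel"
  shows "(\<integral>\<^sup>+ x. F x \<partial>(noise_vector :: (complex ^ 'n::finite) measure))
    = (\<integral>\<^sup>+ v. F (\<chi> i. v i) \<partial>PiM UNIV (\<lambda>_. complex_normal))"
  unfolding noise_vector_def by (subst nn_integral_distr) auto

lemma nn_integral_PiM_component:
  assumes M: "prob_space M" and "finite I" "i \<in> I" and [measurable]: "F \<in> borel_measurable M"
  shows "(\<integral>\<^sup>+ v. F (v i) \<partial>PiM I (\<lambda>_. M)) = (\<integral>\<^sup>+ x. F x \<partial>M)"
proof -
  have "(\<integral>\<^sup>+ x. F x \<partial>M) = (\<integral>\<^sup>+ x. F x \<partial>distr (PiM I (\<lambda>_. M)) M (\<lambda>v. v i))"
    by (subst distr_PiM_component[of I "\<lambda>_. M" i]) (use assms in auto)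
  also have "\<dots> = (\<integral>\<^sup>+ v. F (v i) \<partial>PiM I (\<lambda>_. M))"
    using assms(3) by (subst nn_integral_distr) auto
  finally show ?thesis by simp
qed

lemma norm_vec_power2: "(norm (x :: complex ^ 'n::finite))\<^sup>2 = (\<Sum>i\<in>UNIV. (norm (x $ i))\<^sup>2)"
  by (simp add: norm_vec_def L2_set_def sum_nonneg)

lemma noise_vector_moment:
  "(\<integral>\<^sup>+ x. ennreal ((norm x)\<^sup>2) \<partial>(noise_vector :: (complex ^ 'n::finite) measure)) \<le> 4 * of_nat CARD('n)"
proof -
  have "(\<integral>\<^sup>+ x. ennreal ((norm x)\<^sup>2) \<partial>(noise_vector :: (complex ^ 'n::finite) measure))
    = (\<integral>\<^sup>+ v. (\<Sum>i\<in>UNIV. ennreal ((norm (v i))\<^sup>2)) \<partial>PiM (UNIV :: 'n set) (\<lambda>_. complex_normal))"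
    by (subst nn_integral_noise_vector) (auto simp: norm_vec_power2 sum_ennreal)
  also have "\<dots> = (\<Sum>i\<in>UNIV. \<integral>\<^sup>+ v. ennreal ((norm (v i))\<^sup>2) \<partial>PiM (UNIV :: 'n set) (\<lambda>_. complex_normal))"
    by (rule nn_integral_sum) measurable
  also have "\<dots> = (\<Sum>i\<in>(UNIV::'n set). \<integral>\<^sup>+ w. ennreal ((norm w)\<^sup>2) \<partial>complex_normal)"
    by (intro sum.cong refl nn_integral_PiM_component[OF prob_space_complex_normal]) auto
  also have "\<dots> \<le> (\<Sum>i\<in>(UNIV::'n set). 4)"
    by (intro sum_mono complex_normal_moment)
  finally show ?thesis by (simp add: mult.commute)
qed

lemma noise_vector_norm:
  "(\<integral>\<^sup>+ x. ennreal (norm x) \<partial>(noise_vector :: (complex ^ 'n::finite) measure)) \<le> 1 + 4 * of_nat CARD('n)"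
proof -
  interpret prob_space "noise_vector :: (complex ^ 'n::finite) measure" by (rule prob_space_noise_vector)
  have "(\<integral>\<^sup>+ x. ennreal (norm x) \<partial>(noise_vector :: (complex ^ 'n::finite) measure))
    \<le> (\<integral>\<^sup>+ x. 1 + ennreal ((norm x)\<^sup>2) \<partial>(noise_vector :: (complex ^ 'n::finite) measure))"
  proof (rule nn_integral_mono)
    fix x :: "complex ^ 'n"
    have "norm x \<le> 1 + (norm x)\<^sup>2"
      using zero_le_power2[of "norm x - 1"] norm_ge_zero[of x] unfolding power2_diff by (simp only: power_one mult_1_right)
    then show "ennreal (norm x) \<le> 1 + ennreal ((norm x)\<^sup>2)"
      by (metis ennreal_1 ennreal_leI ennreal_plus zero_le_one zero_le_power2)
  qed
  also have "\<dots> = 1 + (\<integral>\<^sup>+ x. ennreal ((norm x)\<^sup>2) \<partial>(noise_vector :: (complex ^ 'n::finite) measure))"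
    using emeasure_space_1 by (subst nn_integral_add) auto
  also have "\<dots> \<le> 1 + 4 * of_nat CARD('n)"
    by (intro add_mono noise_vector_moment order_refl)
  finally show ?thesis .
qed

text \<open>A determinant is affine in a single entry. The coefficient of \<open>x $ k\<close> is a
  determinant of the same shape with \<open>axis k 1\<close> as row \<open>k\<close>, which is what
  an induction over the rows can continue with.\<close>

lemma det_row_split:
  fixes c :: "'n::finite \<Rightarrow> complex ^ 'n"
  shows "det (\<chi> i. if i = k then x else c i)
    = det (\<chi> i. if i = k then axis k 1 else c i) * x $ k + det (\<chi> i. if i = k then (\<chi> j. if j = k then 0 else x $ j) else c i)"
proof -
  have "x = x $ k *s axis k 1 + (\<chi> j. if j = k then 0 else x $ j)"
    by (simp add: vec_eq_iff axis_def)
  then have "det (\<chi> i. if i = k then x else c i)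
    = det (\<chi> i. if i = k then x $ k *s axis k 1 + (\<chi> j. if j = k then 0 else x $ j) else c i)"
    by (rule arg_cong[where f="\<lambda>y. det (\<chi> i. if i = k then y else c i)"])
  also have "\<dots> = x $ k * det (\<chi> i. if i = k then axis k 1 else c i) + det (\<chi> i. if i = k then (\<chi> j. if j = k then 0 else x $ j) else c i)"
    by (simp only: det_row_add[of k "\<lambda>_. _" "\<lambda>_. _"] det_row_mul[of k _ "\<lambda>_. _"])
  finally show ?thesis by (simp add: mult.commute)
qed

text \<open>Given all other entries, the determinant is affine in the diagonal entry
  \<open>x $ k\<close>. Integrating this one entry already gives the bound, whatever the constant
  term is, so the other entries of the row may stay arbitrary.\<close>

lemma det_row_inverse_sqrt:
  fixes c :: "'n::finite \<Rightarrow> complex ^ 'n"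
  shows "(\<integral>\<^sup>+ x. inverse (ennreal (sqrt (norm (det (\<chi> i. if i = k then x else c i))))) \<partial>noise_vector)
    \<le> 5 * inverse (ennreal (sqrt (norm (det (\<chi> i. if i = k then axis k 1 else c i)))))"
proof -
  let ?d = "\<lambda>x. inverse (ennreal (sqrt (norm (det (\<chi> i. if i = k then x else c i)))))"
  have "(\<lambda>x. if i = k then x else c i) \<in> borel_measurable borel" for i by (cases "i = k") auto
  then have d: "?d \<in> borel_measurable borel" by measurable
  have m: "(\<lambda>v. ?d (\<chi> j. v j)) \<in> borel_measurable (PiM (UNIV :: 'n set) (\<lambda>_. complex_normal))"
    by (rule measurable_compose[OF measurable_PiM_vec d])
  interpret P: prob_space "PiM (UNIV - {k} :: 'n set) (\<lambda>_. complex_normal)"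
    by (intro prob_space_PiM prob_space_complex_normal)
  have "(\<integral>\<^sup>+ x. ?d x \<partial>noise_vector) = (\<integral>\<^sup>+ v. ?d (\<chi> j. v j) \<partial>PiM (UNIV :: 'n set) (\<lambda>_. complex_normal))"
    by (rule nn_integral_noise_vector[OF d])
  also have "\<dots> = (\<integral>\<^sup>+ v. \<integral>\<^sup>+ u. ?d (\<chi> j. (v(k := u)) j) \<partial>complex_normal \<partial>PiM (UNIV - {k} :: 'n set) (\<lambda>_. complex_normal))"
    using nn_integral_PiM_insert[OF sigma_finite_complex_normal, of "UNIV - {k}" k "\<lambda>v. ?d (\<chi> j. v j)"] m
    by (simp add: insert_UNIV)
  also have "\<dots> \<le> (\<integral>\<^sup>+ v. 5 * ?d (axis k 1) \<partial>PiM (UNIV - {k} :: 'n set) (\<lambda>_. complex_normal))"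
  proof (rule nn_integral_mono)
    fix v :: "'n \<Rightarrow> complex"
    have "det (\<chi> i. if i = k then (\<chi> j. (v(k := u)) j) else c i)
      = det (\<chi> i. if i = k then axis k 1 else c i) * u
        + det (\<chi> i. if i = k then (\<chi> j. if j = k then 0 else v j) else c i)" for u
    proof -
      have "(\<chi> j. if j = k then 0 else (\<chi> j. (v(k := u)) j) $ j) = (\<chi> j. if j = k then 0 else v j)"
        by (simp add: vec_eq_iff)
      then show ?thesis by (subst det_row_split) (simp only: vec_lambda_beta fun_upd_same)
    qed
    then show "(\<integral>\<^sup>+ u. ?d (\<chi> j. (v(k := u)) j) \<partial>complex_normal) \<le> 5 * ?d (axis k 1)"
      by (simp only: complex_normal_inverse_sqrt)
  qed
  also have "\<dots> = 5 * ?d (axis k 1)" by (simp add: P.emeasure_space_1[simplified])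
  finally show ?thesis .
qed

text \<open>The rows of the identity matrix are replaced by Gaussian rows one at a time.\<close>

lemma det_inverse_sqrt_aux:
  fixes S :: "'n::finite set"
  shows "(\<integral>\<^sup>+ h. inverse (ennreal (sqrt (norm (det (\<chi> i. if i \<in> S then h i else axis i 1))))) \<partial>PiM S (\<lambda>_. noise_vector))
    \<le> (5 :: ennreal) ^ card S"
  using finite[of S]
proof (induction S)
  case empty
  have "((\<chi> i. axis i 1) :: complex ^ 'n ^ 'n) = mat 1"
    by (simp add: vec_eq_iff mat_def axis_def)
  then have "det ((\<chi> i. axis i 1) :: complex ^ 'n ^ 'n) = 1"
    by (simp add: det_I)
  then show ?case by (simp add: PiM_empty nn_integral_count_space_finite)
next
  case (insert s S)
  let ?f = "\<lambda>S h. inverse (ennreal (sqrt (norm (det (\<chi> i. if i \<in> S then h i else axis i 1)))))"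
  have m: "?f T \<in> borel_measurable (PiM T (\<lambda>_. noise_vector))" for T :: "'n set"
  proof -
    have "(\<lambda>h. if i \<in> T then h i else axis i 1) \<in> borel_measurable (PiM T (\<lambda>_. noise_vector :: (complex ^ 'n) measure))" for i
      using measurable_component_singleton[of i T "\<lambda>_. noise_vector :: (complex ^ 'n) measure"]
      by (cases "i \<in> T") (auto cong: measurable_cong_sets)
    then show ?thesis by measurable
  qed
  have "(\<integral>\<^sup>+ h. ?f (insert s S) h \<partial>PiM (insert s S) (\<lambda>_. noise_vector))
    = (\<integral>\<^sup>+ h. \<integral>\<^sup>+ x. ?f (insert s S) (h(s := x)) \<partial>noise_vector \<partial>PiM S (\<lambda>_. noise_vector))"
    by (rule nn_integral_PiM_insert[OF sigma_finite_noise_vector insert.hyps m])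
  also have "\<dots> \<le> (\<integral>\<^sup>+ h. 5 * ?f S h \<partial>PiM S (\<lambda>_. noise_vector))"
  proof (rule nn_integral_mono)
    fix h :: "'n \<Rightarrow> complex ^ 'n"
    have "(\<chi> i. if i \<in> insert s S then (h(s := x)) i else axis i 1)
      = (\<chi> i. if i = s then x else if i \<in> S then h i else axis i 1)" for x
      by (auto simp: vec_eq_iff)
    moreover have "(\<chi> i. if i \<in> S then h i else axis i 1)
      = (\<chi> i. if i = s then axis s 1 else if i \<in> S then h i else axis i 1)"
      using insert.hyps by (auto simp: vec_eq_iff)
    ultimately show "(\<integral>\<^sup>+ x. ?f (insert s S) (h(s := x)) \<partial>noise_vector) \<le> 5 * ?f S h"
      by (simp only: det_row_inverse_sqrt)
  qed
  also have "\<dots> = 5 * (\<integral>\<^sup>+ h. ?f S h \<partial>PiM S (\<lambda>_. noise_vector))"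
    by (rule nn_integral_cmult[OF m])
  also have "\<dots> \<le> 5 * 5 ^ card S"
    by (intro mult_left_mono insert.IH) simp
  finally show ?case using insert.hyps by simp
qed

lemma det_inverse_sqrt:
  "(\<integral>\<^sup>+ h. inverse (ennreal (sqrt (norm (det (\<chi> i. h i))))) \<partial>PiM (UNIV :: 'n::finite set) (\<lambda>_. noise_vector))
    \<le> (5 :: ennreal) ^ CARD('n)"
  using det_inverse_sqrt_aux[of "UNIV :: 'n set"] by simp

section \<open>Cramer coefficients and the logarithm of the extrapolation variance\<close>

text \<open>Cramer's formula for the coefficients of \<open>x\<close> with respect to the rows
  \<open>h\<close>. For a singular matrix the division yields \<open>0\<close>.\<close>

definition interp :: "('n::finite \<Rightarrow> complex ^ 'n) \<Rightarrow> complex ^ 'n \<Rightarrow> 'n \<Rightarrow> complex" where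
  "interp h x k = det (\<chi> i. if i = k then x else h i) / det (\<chi> i. h i)"

text \<open>Variance of the error when an antenna with channel row \<open>x\<close> is extrapolated
  from those with rows \<open>h\<close> and every antenna carries noise of variance
  \<open>1\<close>.\<close>

definition interp_var :: "('n::finite \<Rightarrow> complex ^ 'n) \<Rightarrow> complex ^ 'n \<Rightarrow> real" where
  "interp_var h x = 1 + (\<Sum>k\<in>UNIV. (norm (interp h x k))\<^sup>2)"

text \<open>Cramer's rule expresses a vector by the columns of a matrix; it is applied to the
  transpose, whose columns are the rows \<open>h i\<close>.\<close>

lemma interp:
  fixes h :: "'n::finite \<Rightarrow> complex ^ 'n"
  assumes "det (\<chi> i. h i) \<noteq> 0"
  shows "(\<Sum>k\<in>UNIV. interp h x k * h k $ j) = x $ j"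
proof -
  define A :: "complex ^ 'n ^ 'n" where "A = transpose (\<chi> i. h i)"
  have dA: "det A = det (\<chi> i. h i)" unfolding A_def by (rule det_transpose)
  have "det (\<chi> i j. if j = k then x $ i else A $ i $ j) = det (\<chi> i. if i = k then x else h i)" for k
    by (subst det_transpose[symmetric]) (auto simp: transpose_def A_def intro!: arg_cong[where f=det] simp: vec_eq_iff)
  then have "(\<chi> k. interp h x k) = (\<chi> k. det (\<chi> i j. if j = k then x $ i else A $ i $ j) / det A)"
    by (simp add: interp_def dA)
  then have "A *v (\<chi> k. interp h x k) = x"
    using cramer[of A "\<chi> k. interp h x k" x] assms dA by simp
  then have "(A *v (\<chi> k. interp h x k)) $ j = x $ j" by simp
  then show ?thesis by (simp add: matrix_vector_mult_def A_def transpose_def mult.commute)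
qed

lemma interp_var_ge_1: "1 \<le> interp_var h x"
  unfolding interp_var_def by (simp add: sum_nonneg)

text \<open>Each permutation in Leibniz' formula contributes at most \<open>B ^ CARD('n)\<close>.
  The bound is used only through its logarithm, where the sharper constant of Hadamard would gain
  nothing.\<close>

lemma norm_det_le:
  fixes A :: "complex ^ 'n::finite ^ 'n"
  assumes "\<And>i. norm (A $ i) \<le> B"
  shows "norm (det A) \<le> fact CARD('n) * B ^ CARD('n)"
proof -
  have "norm (det A) \<le> (\<Sum>p\<in>{p. p permutes (UNIV :: 'n set)}. norm (of_int (sign p) * (\<Prod>i\<in>UNIV. A $ i $ p i)))"
    unfolding det_def by (rule norm_sum)
  also have "\<dots> \<le> (\<Sum>p\<in>{p. p permutes (UNIV :: 'n set)}. B ^ CARD('n))"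
  proof (rule sum_mono)
    fix p :: "'n \<Rightarrow> 'n"
    have "norm (of_int (sign p) * (\<Prod>i\<in>UNIV. A $ i $ p i)) = (\<Prod>i\<in>UNIV. norm (A $ i $ p i))"
      by (simp add: norm_mult sign_def prod_norm)
    also have "\<dots> \<le> (\<Prod>i\<in>(UNIV::'n set). B)"
      by (intro prod_mono) (auto intro: order_trans[OF Finite_Cartesian_Product.norm_nth_le assms])
    finally show "norm (of_int (sign p) * (\<Prod>i\<in>UNIV. A $ i $ p i)) \<le> B ^ CARD('n)" by simp
  qed
  also have "\<dots> = fact CARD('n) * B ^ CARD('n)"
    by (simp add: card_permutations)
  finally show ?thesis .
qed

text \<open>Every Cramer coefficient is at most \<open>K / D\<close>, where \<open>D\<close> is the
  absolute determinant and \<open>K\<close> the Leibniz bound for all determinants involved. In the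
  logarithm, \<open>- 2 * ln D = 4 * ln (1 / sqrt D) \<le> 4 / sqrt D\<close> has finite mean over
  Gaussian rows, while the part from \<open>K\<close> grows at most linearly in the norms. For
  \<open>D = 0\<close> the right-hand side is \<open>\<top>\<close>.\<close>

lemma ln_interp_var_le:
  fixes h :: "'n::finite \<Rightarrow> complex ^ 'n"
  defines "n \<equiv> CARD('n)"
  shows "ennreal (ln (interp_var h x)) \<le> ennreal (ln (real n + 1) + 2 * ln (fact n) + 2 * real n)
    + (of_nat (2 * n) * ((\<Sum>i\<in>UNIV. ennreal (norm (h i))) + ennreal (norm x))
    + 4 * inverse (ennreal (sqrt (norm (det (\<chi> i. h i))))))"
proof (cases "det (\<chi> i. h i) = 0")
  case True
  then show ?thesis by (simp add: ennreal_mult_top)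
next
  case False
  define D where "D = norm (det (\<chi> i. h i))"
  define b where "b = (\<Sum>i\<in>UNIV. norm (h i)) + norm x"
  define K where "K = real (fact n) * (1 + b) ^ n"
  have D: "0 < D" using False by (simp add: D_def)
  have b: "0 \<le> b" by (auto simp: b_def intro!: add_nonneg_nonneg sum_nonneg)
  have hb: "norm (h i) \<le> 1 + b" for i
  proof -
    have "norm (h i) \<le> (\<Sum>i\<in>UNIV. norm (h i))" by (rule member_le_sum) auto
    then show ?thesis using norm_ge_zero[of x] unfolding b_def by linarith
  qed
  have xb: "norm x \<le> 1 + b" by (simp add: b_def sum_nonneg)
  have K1: "0 < K" using b by (simp add: K_def)
  have DK: "D \<le> K"
    unfolding D_def K_def n_def using norm_det_le[of "\<chi> i. h i" "1 + b"] hb by simp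
  have DkK: "norm (det (\<chi> i. if i = k then x else h i)) \<le> K" for k
    unfolding K_def n_def using norm_det_le[of "\<chi> i. if i = k then x else h i" "1 + b"] hb xb by simp
  have "interp_var h x \<le> (real n + 1) * (K / D)\<^sup>2"
  proof -
    have "interp_var h x \<le> (K / D)\<^sup>2 + (\<Sum>k\<in>(UNIV::'n set). (K / D)\<^sup>2)"
      unfolding interp_var_def
    proof (intro add_mono sum_mono)
      \<comment> \<open>\<open>D\<close> itself obeys the Leibniz bound, so
        \<open>K / D \<ge> 1\<close> and the summand \<open>1\<close> of \<open>interp_var\<close>
        is absorbed as well.\<close>
      show "1 \<le> (K / D)\<^sup>2" using DK D by (simp add: one_le_power)
      show "(norm (interp h x k))\<^sup>2 \<le> (K / D)\<^sup>2" for k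
        using DkK[of k] D unfolding interp_def norm_divide D_def[symmetric]
        by (intro power_mono divide_right_mono) auto
    qed
    then show ?thesis by (simp add: n_def algebra_simps)
  qed
  then have "ln (interp_var h x) \<le> ln ((real n + 1) * (K / D)\<^sup>2)"
    using interp_var_ge_1[of h x] by (intro ln_mono) auto
  also have "\<dots> = ln (real n + 1) + 2 * ln K - 2 * ln D"
    using D K1 by (simp add: ln_mult ln_div ln_realpow)
  finally have le0: "ln (interp_var h x) \<le> ln (real n + 1) + 2 * ln K - 2 * ln D" .
  have lnK: "ln K = ln (fact n) + real n * ln (1 + b)"
    using b by (simp add: K_def ln_mult ln_realpow)
  have lnD: "- 2 * ln D = 4 * ln (1 / sqrt D)"
    using D by (simp add: ln_div ln_sqrt)
  have "ln (1 / sqrt D) \<le> 1 / sqrt D"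
    using D by (intro less_imp_le ln_less_self) simp
  moreover have "real n * ln (1 + b) \<le> real n * (1 + b)"
    using b ln_add_one_self_le_self[of b] by (intro mult_left_mono) auto
  ultimately have le: "ln (interp_var h x) \<le> (ln (real n + 1) + 2 * ln (fact n) + 2 * real n) + (2 * real n * b + 4 * (1 / sqrt D))"
    using le0 lnK lnD by (simp add: algebra_simps)
  have nn: "0 \<le> ln (real n + 1) + 2 * ln (fact n) + 2 * real n"
    by (intro add_nonneg_nonneg) (auto simp: fact_ge_1)
  have "ennreal (ln (interp_var h x)) \<le> ennreal ((ln (real n + 1) + 2 * ln (fact n) + 2 * real n) + (2 * real n * b + 4 * (1 / sqrt D)))"
    by (rule ennreal_leI[OF le])
  also have "\<dots> = ennreal (ln (real n + 1) + 2 * ln (fact n) + 2 * real n) + (ennreal (2 * real n * b) + ennreal (4 * (1 / sqrt D)))"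
    using nn b D by (simp add: ennreal_plus)
  also have "ennreal (2 * real n * b) = ennreal (2 * real n) * ennreal b"
    using b by (intro ennreal_mult) auto
  also have "ennreal (4 * (1 / sqrt D)) = ennreal 4 * ennreal (1 / sqrt D)"
    using D by (intro ennreal_mult) auto
  also have "ennreal b = (\<Sum>i\<in>UNIV. ennreal (norm (h i))) + ennreal (norm x)"
    unfolding b_def by (simp add: sum_ennreal sum_nonneg)
  also have "ennreal (2 * real n) = of_nat (2 * n)"
    by (simp add: ennreal_of_nat_eq_real_of_nat)
  also have "ennreal (1 / sqrt D) = inverse (ennreal (sqrt D))"
    using D by (simp add: inverse_ennreal inverse_eq_divide)
  finally show ?thesis by (simp add: D_def)
qed

lemma interp_measurable [measurable (raw)]:
  assumes [measurable]: "\<And>i. (\<lambda>x. f x i) \<in> borel_measurable M" "g \<in> borel_measurable M"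
  shows "(\<lambda>x. interp (f x) (g x) k) \<in> borel_measurable M"
proof -
  have "(\<lambda>x. if i = k then g x else f x i) \<in> borel_measurable M" for i by (cases "i = k") auto
  then show ?thesis unfolding interp_def by measurable
qed

lemma interp_var_measurable [measurable (raw)]:
  assumes [measurable]: "\<And>i. (\<lambda>x. f x i) \<in> borel_measurable M" "g \<in> borel_measurable M"
  shows "(\<lambda>x. interp_var (f x) (g x)) \<in> borel_measurable M"
  unfolding interp_var_def by measurable

text \<open>The pointwise bound is integrated term by term: norms of Gaussian rows have finite mean,
  and the inverse root of the determinant has mean at most \<open>5 ^ CARD('n)\<close>. Because of
  this the extrapolation cost is a constant, independent of the power.\<close>

lemma interp_var_integral_finite:
  "(\<integral>\<^sup>+ h. \<integral>\<^sup>+ x. ennreal (ln (interp_var h x)) \<partial>noise_vector \<partial>PiM (UNIV :: 'n::finite set) (\<lambda>_. noise_vector)) < \<top>"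
proof -
  let ?N = "noise_vector :: (complex ^ 'n) measure" and ?n = "CARD('n)"
  interpret N: prob_space ?N by (rule prob_space_noise_vector)
  interpret P: prob_space "PiM (UNIV :: 'n set) (\<lambda>_. ?N)" by (intro prob_space_PiM prob_space_noise_vector)
  define K where "K = ennreal (ln (real ?n + 1) + 2 * ln (fact ?n) + 2 * real ?n)"
  let ?d = "\<lambda>h :: 'n \<Rightarrow> complex ^ 'n. 4 * inverse (ennreal (sqrt (norm (det (\<chi> i. h i)))))"
  have comp: "(\<integral>\<^sup>+ h. ennreal (norm (h i)) \<partial>PiM (UNIV :: 'n set) (\<lambda>_. ?N)) \<le> 1 + 4 * of_nat ?n" for i
  proof -
    have "(\<integral>\<^sup>+ h. ennreal (norm (h i)) \<partial>PiM (UNIV :: 'n set) (\<lambda>_. ?N)) = (\<integral>\<^sup>+ x. ennreal (norm x) \<partial>?N)"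
      by (rule nn_integral_PiM_component[OF prob_space_noise_vector finite UNIV_I]) measurable
    then show ?thesis by (simp add: noise_vector_norm)
  qed
  have aff: "(\<integral>\<^sup>+ x. K + (c * (s + f x) + d) \<partial>?N) = K + (c * (s + (\<integral>\<^sup>+ x. f x \<partial>?N)) + d)"
    if f: "f \<in> borel_measurable borel" for c s d :: ennreal and f :: "complex ^ 'n \<Rightarrow> ennreal"
  proof -
    have [measurable]: "f \<in> borel_measurable ?N"
      by (subst measurable_cong_sets[OF sets_noise_vector refl]) (rule f)
    show ?thesis
      by (subst nn_integral_add, measurable)+ (simp add: nn_integral_add nn_integral_cmult N.emeasure_space_1[simplified])
  qed
  have "(\<integral>\<^sup>+ h. \<integral>\<^sup>+ x. ennreal (ln (interp_var h x)) \<partial>?N \<partial>PiM (UNIV :: 'n set) (\<lambda>_. ?N))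
    \<le> (\<integral>\<^sup>+ h. \<integral>\<^sup>+ x. K + (of_nat (2 * ?n) * ((\<Sum>i\<in>UNIV. ennreal (norm (h i))) + ennreal (norm x)) + ?d h) \<partial>?N \<partial>PiM (UNIV :: 'n set) (\<lambda>_. ?N))"
    unfolding K_def by (intro nn_integral_mono ln_interp_var_le)
  also have "\<dots> = (\<integral>\<^sup>+ h. K + (of_nat (2 * ?n) * ((\<Sum>i\<in>UNIV. ennreal (norm (h i))) + (\<integral>\<^sup>+ x. ennreal (norm x) \<partial>?N)) + ?d h) \<partial>PiM (UNIV :: 'n set) (\<lambda>_. ?N))"
    by (intro nn_integral_cong aff) measurable
  also have "\<dots> = K + (of_nat (2 * ?n) * ((\<Sum>i\<in>(UNIV::'n set). (\<integral>\<^sup>+ h. ennreal (norm (h i)) \<partial>PiM (UNIV :: 'n set) (\<lambda>_. ?N))) + (\<integral>\<^sup>+ x. ennreal (norm x) \<partial>?N))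
      + 4 * (\<integral>\<^sup>+ h. inverse (ennreal (sqrt (norm (det (\<chi> i. h i))))) \<partial>PiM (UNIV :: 'n set) (\<lambda>_. ?N)))"
    by (simp add: nn_integral_add nn_integral_cmult nn_integral_sum P.emeasure_space_1[simplified] del: sum_ennreal)
  also have "\<dots> \<le> K + (of_nat (2 * ?n) * ((\<Sum>i\<in>(UNIV::'n set). 1 + 4 * of_nat ?n) + (1 + 4 * of_nat ?n)) + 4 * 5 ^ ?n)"
    by (intro add_mono mult_left_mono sum_mono order_refl det_inverse_sqrt noise_vector_norm comp) auto
  also have "\<dots> = K + of_nat (2 * ?n * (?n * (1 + 4 * ?n) + (1 + 4 * ?n)) + 4 * 5 ^ ?n)"
    by (simp only: of_nat_add of_nat_mult of_nat_power of_nat_numeral of_nat_1 sum_constant)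
  also have "\<dots> < \<top>"
    unfolding K_def by (subst ennreal_of_nat_eq_real_of_nat) simp
  finally show ?thesis .
qed

section \<open>One receive antenna\<close>

type_synonym ('a, 'b) row = "(complex ^ 'a) \<times> (complex ^ 'b)"

abbreviation row_law :: "('a::finite, 'b::finite) row measure" where
  "row_law \<equiv> noise_vector \<Otimes>\<^sub>M noise_vector"

text \<open>The channel coefficients keep their probability law, since they are observed but carry
  no signal; only the output coordinate gets the infinite reference measure.\<close>

abbreviation antenna_ref :: "(('a::finite, 'b::finite) row \<times> complex) measure" where
  "antenna_ref \<equiv> row_law \<Otimes>\<^sub>M cplx_ref"

abbreviation antenna_law :: "(('a::finite, 'b::finite) row \<times> complex) measure" where
  "antenna_law \<equiv> row_law \<Otimes>\<^sub>M complex_normal"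

text \<open>Bilinear, without conjugation, so that it is an entry of a matrix-vector
  product.\<close>

definition dotp :: "complex ^ 'a::finite \<Rightarrow> complex ^ 'a \<Rightarrow> complex" where
  "dotp h x = (\<Sum>j\<in>UNIV. h $ j * x $ j)"

definition antenna_density :: "complex ^ 'a::finite \<Rightarrow> complex ^ 'b::finite \<Rightarrow> ('a, 'b) row \<times> complex \<Rightarrow> real" where
  "antenna_density xa xb z = exp (- (norm (snd z - (dotp (fst (fst z)) xa + dotp (snd (fst z)) xb)))\<^sup>2)"

definition receive :: "complex ^ 'a::finite \<Rightarrow> complex ^ 'b::finite \<Rightarrow> ('a, 'b) row \<times> complex \<Rightarrow> ('a, 'b) row \<times> complex" where
  "receive xa xb w = (fst w, (dotp (fst (fst w)) xa + dotp (snd (fst w)) xb) + snd w)"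

lemma dotp_measurable [measurable (raw)]:
  assumes [measurable]: "f \<in> borel_measurable M" "g \<in> borel_measurable M"
  shows "(\<lambda>x. dotp (f x) (g x)) \<in> borel_measurable M"
  unfolding dotp_def by measurable

lemma norm_dotp_le: "norm (dotp h x) \<le> norm h * norm x"
proof -
  have "norm (dotp h x) \<le> (\<Sum>j\<in>UNIV. \<bar>norm (h $ j)\<bar> * \<bar>norm (x $ j)\<bar>)"
    unfolding dotp_def by (rule order_trans[OF norm_sum]) (simp add: norm_mult)
  also have "\<dots> \<le> norm h * norm x"
    unfolding norm_vec_def by (rule L2_set_mult_ineq)
  finally show ?thesis .
qed

lemma prob_space_pair:
  assumes "prob_space M" "prob_space N" shows "prob_space (M \<Otimes>\<^sub>M N)"
proof -
  interpret M: prob_space M by fact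
  interpret N: prob_space N by fact
  interpret pair_prob_space M N ..
  show ?thesis by (rule prob_space_axioms)
qed

lemma prob_space_row_law: "prob_space (row_law :: ('a::finite, 'b::finite) row measure)"
  by (intro prob_space_pair prob_space_noise_vector)

lemma prob_space_antenna_law: "prob_space (antenna_law :: (('a::finite, 'b::finite) row \<times> complex) measure)"
  by (intro prob_space_pair prob_space_row_law prob_space_complex_normal)

lemma sigma_finite_antenna_law: "sigma_finite_measure (antenna_law :: (('a::finite, 'b::finite) row \<times> complex) measure)"
  by (rule prob_space_imp_sigma_finite[OF prob_space_antenna_law])

lemma sigma_finite_row_law: "sigma_finite_measure (row_law :: ('a::finite, 'b::finite) row measure)"
  by (rule prob_space_imp_sigma_finite[OF prob_space_row_law])

lemma sigma_finite_antenna_ref: "sigma_finite_measure (antenna_ref :: (('a::finite, 'b::finite) row \<times> complex) measure)"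
  by (rule sigma_finite_pair[OF sigma_finite_row_law sigma_finite_cplx_ref])

lemma antenna_density_measurable [measurable (raw)]:
  assumes [measurable]: "f \<in> borel_measurable M" "g \<in> borel_measurable M"
    "z \<in> measurable M (antenna_ref :: (('a::finite, 'b::finite) row \<times> complex) measure)"
  shows "(\<lambda>x. antenna_density (f x) (g x) (z x)) \<in> borel_measurable M"
proof -
  have z1: "(\<lambda>x. fst (z x)) \<in> measurable M row_law"
    by (rule measurable_compose[OF assms(3) measurable_fst])
  have [measurable]: "(\<lambda>x. fst (fst (z x))) \<in> borel_measurable M" "(\<lambda>x. snd (fst (z x))) \<in> borel_measurable M"
    "(\<lambda>x. snd (z x)) \<in> borel_measurable M"
    using measurable_compose[OF z1 measurable_fst] measurable_compose[OF z1 measurable_snd]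
      measurable_compose[OF assms(3) measurable_snd] by (simp_all cong: measurable_cong_sets)
  show ?thesis unfolding antenna_density_def by measurable
qed

lemma antenna_density_measurable' [measurable]:
  "antenna_density xa xb \<in> borel_measurable (antenna_ref :: (('a::finite, 'b::finite) row \<times> complex) measure)"
  using antenna_density_measurable[where f="\<lambda>_. xa" and g="\<lambda>_. xb" and z="\<lambda>x. x" and M="antenna_ref :: (('a, 'b) row \<times> complex) measure"]
  by (simp add: measurable_ident_sets)

lemma receive_measurable [measurable]:
  "receive xa xb \<in> measurable antenna_law (antenna_ref :: (('a::finite, 'b::finite) row \<times> complex) measure)"
  unfolding receive_def by measurable

text \<open>For a fixed channel row this is the Gaussian shift with the noiseless output as centre.
  It turns integrals against the output density into expectations over row and noise.\<close>

lemma antenna_transport: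
  fixes F :: "('a::finite, 'b::finite) row \<times> complex \<Rightarrow> ennreal"
  assumes [measurable]: "F \<in> borel_measurable antenna_ref"
  shows "(\<integral>\<^sup>+ z. ennreal (antenna_density xa xb z) * F z \<partial>antenna_ref) = (\<integral>\<^sup>+ w. F (receive xa xb w) \<partial>antenna_law)"
proof -
  have "(\<integral>\<^sup>+ z. ennreal (antenna_density xa xb z) * F z \<partial>antenna_ref)
    = (\<integral>\<^sup>+ r. \<integral>\<^sup>+ y. ennreal (antenna_density xa xb (r, y)) * F (r, y) \<partial>cplx_ref \<partial>row_law)"
    by (rule nn_integral_pair[OF sigma_finite_cplx_ref]) measurable
  also have "\<dots> = (\<integral>\<^sup>+ r. \<integral>\<^sup>+ w. F (r, (dotp (fst r) xa + dotp (snd r) xb) + w) \<partial>complex_normal \<partial>row_law)"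
  proof (rule nn_integral_cong)
    fix r :: "('a, 'b) row" assume "r \<in> space row_law"
    have "(\<lambda>y. F (r, y)) \<in> borel_measurable borel"
      using measurable_compose[OF measurable_Pair1'[OF \<open>r \<in> space row_law\<close>] assms] by simp
    from nn_integral_complex_normal_shift[OF this, of "dotp (fst r) xa + dotp (snd r) xb"]
    show "(\<integral>\<^sup>+ y. ennreal (antenna_density xa xb (r, y)) * F (r, y) \<partial>cplx_ref)
      = (\<integral>\<^sup>+ w. F (r, (dotp (fst r) xa + dotp (snd r) xb) + w) \<partial>complex_normal)"
      by (simp add: antenna_density_def)
  qed
  also have "\<dots> = (\<integral>\<^sup>+ p. F (receive xa xb p) \<partial>antenna_law)"
    by (subst nn_integral_pair[OF sigma_finite_complex_normal]) (auto simp: receive_def[abs_def])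
  finally show ?thesis .
qed

lemma antenna_density_pos: "0 < antenna_density xa xb z"
  by (simp add: antenna_density_def)

lemma antenna_density_le_1: "antenna_density xa xb z \<le> 1"
  by (simp add: antenna_density_def)

lemma nn_integral_antenna_density:
  "(\<integral>\<^sup>+ z. ennreal (antenna_density xa xb z) \<partial>(antenna_ref :: (('a::finite, 'b::finite) row \<times> complex) measure)) = 1"
proof -
  interpret prob_space "antenna_law :: (('a, 'b) row \<times> complex) measure" by (rule prob_space_antenna_law)
  show ?thesis using antenna_transport[of "\<lambda>_. 1" xa xb] emeasure_space_1 by simp
qed

lemma mixture_antenna: "finite A \<Longrightarrow> mixture (antenna_ref :: (('a::finite, 'b::finite) row \<times> complex) measure) A (\<lambda>a. antenna_density (xa a) xb)"
  by (rule mixture.intro)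
    (simp_all only: sigma_finite_antenna_ref antenna_density_pos antenna_density_le_1 nn_integral_antenna_density antenna_density_measurable')

lemma nn_integral_antenna_law_fst:
  assumes [measurable]: "F \<in> borel_measurable (row_law :: ('a::finite, 'b::finite) row measure)"
  shows "(\<integral>\<^sup>+ w. F (fst w) \<partial>antenna_law) = (\<integral>\<^sup>+ r. F r \<partial>row_law)"
proof -
  interpret prob_space complex_normal by (rule prob_space_complex_normal)
  show ?thesis by (subst nn_integral_pair[OF sigma_finite_complex_normal]) (auto simp: emeasure_space_1[simplified])
qed

lemma nn_integral_row_law_fst:
  assumes [measurable]: "F \<in> borel_measurable borel"
  shows "(\<integral>\<^sup>+ w. F (fst w) \<partial>(row_law :: ('a::finite, 'b::finite) row measure)) = (\<integral>\<^sup>+ r. F r \<partial>noise_vector)"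
proof -
  interpret prob_space "noise_vector :: (complex ^ 'b) measure" by (rule prob_space_noise_vector)
  show ?thesis by (subst nn_integral_pair[OF sigma_finite_noise_vector]) (auto simp: emeasure_space_1[simplified])
qed

lemma nn_integral_row_law_snd:
  assumes [measurable]: "F \<in> borel_measurable borel"
  shows "(\<integral>\<^sup>+ w. F (snd w) \<partial>(row_law :: ('a::finite, 'b::finite) row measure)) = (\<integral>\<^sup>+ r. F r \<partial>noise_vector)"
proof -
  interpret prob_space "noise_vector :: (complex ^ 'a) measure" by (rule prob_space_noise_vector)
  show ?thesis by (subst nn_integral_pair[OF sigma_finite_noise_vector]) (auto simp: emeasure_space_1[simplified])
qed

lemma nn_integral_antenna_law_snd:
  assumes [measurable]: "F \<in> borel_measurable borel"
  shows "(\<integral>\<^sup>+ w. F (snd w) \<partial>(antenna_law :: (('a::finite, 'b::finite) row \<times> complex) measure)) = (\<integral>\<^sup>+ r. F r \<partial>complex_normal)"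
proof -
  interpret prob_space "row_law :: ('a, 'b) row measure" by (rule prob_space_row_law)
  show ?thesis by (subst nn_integral_pair[OF sigma_finite_complex_normal]) (auto simp: emeasure_space_1[simplified])
qed

lemma power2_sum3_le: "(a + b + c)\<^sup>2 \<le> 3 * (a\<^sup>2 + b\<^sup>2 + (c::real)\<^sup>2)"
proof -
  have "0 \<le> (a - b)\<^sup>2 + (b - c)\<^sup>2 + (a - c)\<^sup>2" by simp
  then show ?thesis by (simp add: power2_eq_square algebra_simps)
qed

text \<open>The constant is \<open>12 = 3 * 4\<close>: the factor \<open>3\<close> comes from
  squaring a sum of three terms, the factor \<open>4\<close> from the bound on the second moment of
  \<open>complex_normal\<close>.\<close>

definition power_bound :: "complex ^ 'a::finite \<Rightarrow> complex ^ 'b::finite \<Rightarrow> real" where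
  "power_bound xa xb = 12 * (real CARD('a) * (norm xa)\<^sup>2 + real CARD('b) * (norm xb)\<^sup>2 + 1)"

lemma power_bound_nonneg: "0 \<le> power_bound xa xb"
  by (simp add: power_bound_def)

lemma receive_power:
  "(\<integral>\<^sup>+ w. ennreal ((norm (snd (receive xa xb w)))\<^sup>2) \<partial>(antenna_law :: (('a::finite, 'b::finite) row \<times> complex) measure))
    \<le> ennreal (power_bound xa xb)"
proof -
  have "(\<integral>\<^sup>+ w. ennreal ((norm (snd (receive xa xb w)))\<^sup>2) \<partial>(antenna_law :: (('a, 'b) row \<times> complex) measure))
    \<le> (\<integral>\<^sup>+ w. 3 * (ennreal ((norm xa)\<^sup>2) * ennreal ((norm (fst (fst w)))\<^sup>2) + ennreal ((norm xb)\<^sup>2) * ennreal ((norm (snd (fst w)))\<^sup>2)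
        + ennreal ((norm (snd w))\<^sup>2)) \<partial>(antenna_law :: (('a, 'b) row \<times> complex) measure))"
  proof (rule nn_integral_mono)
    fix w :: "('a, 'b) row \<times> complex"
    have "norm (snd (receive xa xb w)) \<le> norm (fst (fst w)) * norm xa + norm (snd (fst w)) * norm xb + norm (snd w)"
      unfolding receive_def snd_conv
      by (intro order_trans[OF norm_triangle_ineq] add_mono norm_dotp_le order_refl)
    then have "(norm (snd (receive xa xb w)))\<^sup>2 \<le> (norm (fst (fst w)) * norm xa + norm (snd (fst w)) * norm xb + norm (snd w))\<^sup>2"
      by (intro power_mono) auto
    also have "\<dots> \<le> 3 * ((norm (fst (fst w)) * norm xa)\<^sup>2 + (norm (snd (fst w)) * norm xb)\<^sup>2 + (norm (snd w))\<^sup>2)"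
      by (rule power2_sum3_le)
    also have "\<dots> = 3 * ((norm xa)\<^sup>2 * (norm (fst (fst w)))\<^sup>2 + (norm xb)\<^sup>2 * (norm (snd (fst w)))\<^sup>2 + (norm (snd w))\<^sup>2)"
      by (simp add: power_mult_distrib mult.commute)
    finally have "ennreal ((norm (snd (receive xa xb w)))\<^sup>2)
      \<le> ennreal (3 * ((norm xa)\<^sup>2 * (norm (fst (fst w)))\<^sup>2 + (norm xb)\<^sup>2 * (norm (snd (fst w)))\<^sup>2 + (norm (snd w))\<^sup>2))"
      by (rule ennreal_leI)
    then show "ennreal ((norm (snd (receive xa xb w)))\<^sup>2)
      \<le> 3 * (ennreal ((norm xa)\<^sup>2) * ennreal ((norm (fst (fst w)))\<^sup>2) + ennreal ((norm xb)\<^sup>2) * ennreal ((norm (snd (fst w)))\<^sup>2)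
        + ennreal ((norm (snd w))\<^sup>2))"
      by (simp add: ennreal_mult)
  qed
  also have "\<dots> = 3 * (ennreal ((norm xa)\<^sup>2) * (\<integral>\<^sup>+ h. ennreal ((norm h)\<^sup>2) \<partial>(noise_vector :: (complex ^ 'a) measure))
      + ennreal ((norm xb)\<^sup>2) * (\<integral>\<^sup>+ h. ennreal ((norm h)\<^sup>2) \<partial>(noise_vector :: (complex ^ 'b) measure))
      + (\<integral>\<^sup>+ h. ennreal ((norm h)\<^sup>2) \<partial>complex_normal))"
  proof -
    have "(\<integral>\<^sup>+ w. ennreal ((norm (fst (fst w)))\<^sup>2) \<partial>(antenna_law :: (('a, 'b) row \<times> complex) measure))
      = (\<integral>\<^sup>+ h. ennreal ((norm h)\<^sup>2) \<partial>(noise_vector :: (complex ^ 'a) measure))"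
      by (subst nn_integral_antenna_law_fst[where F="\<lambda>r. ennreal ((norm (fst r))\<^sup>2)"], measurable)
        (rule nn_integral_row_law_fst, measurable)
    moreover have "(\<integral>\<^sup>+ w. ennreal ((norm (snd (fst w)))\<^sup>2) \<partial>(antenna_law :: (('a, 'b) row \<times> complex) measure))
      = (\<integral>\<^sup>+ h. ennreal ((norm h)\<^sup>2) \<partial>(noise_vector :: (complex ^ 'b) measure))"
      by (subst nn_integral_antenna_law_fst[where F="\<lambda>r. ennreal ((norm (snd r))\<^sup>2)"], measurable)
        (rule nn_integral_row_law_snd, measurable)
    moreover have "(\<integral>\<^sup>+ w. ennreal ((norm (snd w))\<^sup>2) \<partial>(antenna_law :: (('a, 'b) row \<times> complex) measure))
      = (\<integral>\<^sup>+ h. ennreal ((norm h)\<^sup>2) \<partial>complex_normal)"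
      by (rule nn_integral_antenna_law_snd) measurable
    ultimately show ?thesis by (simp add: nn_integral_add nn_integral_cmult)
  qed
  also have "\<dots> \<le> 3 * (ennreal ((norm xa)\<^sup>2) * (4 * of_nat CARD('a)) + ennreal ((norm xb)\<^sup>2) * (4 * of_nat CARD('b)) + 4)"
    by (intro mult_left_mono add_mono noise_vector_moment complex_normal_moment) auto
  also have "\<dots> = ennreal (3 * ((norm xa)\<^sup>2 * (4 * real CARD('a)) + (norm xb)\<^sup>2 * (4 * real CARD('b)) + 4))"
  proof -
    have n: "0 \<le> (norm xa)\<^sup>2 * (4 * real CARD('a))" "0 \<le> (norm xb)\<^sup>2 * (4 * real CARD('b))" by simp_all
    have "ennreal (3 * ((norm xa)\<^sup>2 * (4 * real CARD('a)) + (norm xb)\<^sup>2 * (4 * real CARD('b)) + 4))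
      = ennreal 3 * (ennreal ((norm xa)\<^sup>2 * (4 * real CARD('a))) + ennreal ((norm xb)\<^sup>2 * (4 * real CARD('b))) + ennreal 4)"
      using n by (subst ennreal_mult) (simp_all only: ennreal_plus add_nonneg_nonneg zero_le_numeral)
    moreover have "ennreal (x * (4 * real m)) = ennreal x * (4 * of_nat m)" if "0 \<le> x" for x m
      using that by (simp add: ennreal_mult ennreal_of_nat_eq_real_of_nat)
    ultimately show ?thesis by simp
  qed
  also have "\<dots> = ennreal (power_bound xa xb)"
    by (simp add: power_bound_def algebra_simps)
  finally show ?thesis .
qed

lemma neg_ln_gauss:
  assumes "0 < (v::real)"
  shows "- ln (exp (- a / v) / v) = ln v + a / v"
  using assms by (simp add: ln_div)

lemma gauss_bounds:
  assumes "1 \<le> (v::real)" "0 \<le> a"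
  shows "0 < exp (- a / v) / v" "exp (- a / v) / v \<le> 1"
proof -
  show "0 < exp (- a / v) / v" using assms by simp
  have "exp (- a / v) \<le> 1" using assms by simp
  then have "exp (- a / v) \<le> v" using assms(1) by (rule order_trans)
  then show "exp (- a / v) / v \<le> 1" using assms(1) by (simp add: divide_le_eq)
qed

lemma nn_integral_gauss_1:
  assumes "1 \<le> v"
  shows "(\<integral>\<^sup>+ y. ennreal (exp (- (norm (y - \<mu>))\<^sup>2 / v) / v) \<partial>cplx_ref) = 1"
proof -
  have "(\<integral>\<^sup>+ y. ennreal (exp (- (norm (y - \<mu>))\<^sup>2 / v) / v) \<partial>cplx_ref)
    = (\<integral>\<^sup>+ y. ennreal (1 / v) * ennreal (exp (- (norm (y - \<mu>))\<^sup>2 / v)) \<partial>cplx_ref)"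
    using assms by (intro nn_integral_cong) (simp add: ennreal_mult[symmetric])
  also have "\<dots> = ennreal (1 / v) * ennreal v"
    using assms nn_integral_cplx_gauss[of v \<mu>] by (subst nn_integral_cmult) auto
  also have "\<dots> = 1" using assms by (simp add: ennreal_mult[symmetric])
  finally show ?thesis .
qed

section \<open>Extrapolating one antenna from the others\<close>

text \<open>Cauchy-Schwarz for the vectors \<open>(1, c)\<close> and \<open>(u, - w)\<close>. When
  \<open>c\<close> consists of Cramer coefficients, the first factor is exactly
  \<open>interp_var\<close>.\<close>

lemma norm_residual_le:
  fixes c w :: "'n::finite \<Rightarrow> complex"
  shows "(norm (u - (\<Sum>k\<in>UNIV. c k * w k)))\<^sup>2 \<le> (1 + (\<Sum>k\<in>UNIV. (norm (c k))\<^sup>2)) * ((norm u)\<^sup>2 + (\<Sum>k\<in>UNIV. (norm (w k))\<^sup>2))"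
proof -
  define C W where "C = L2_set (\<lambda>k. norm (c k)) UNIV" and "W = L2_set (\<lambda>k. norm (w k)) UNIV"
  have "norm (\<Sum>k\<in>UNIV. c k * w k) \<le> (\<Sum>k\<in>UNIV. \<bar>norm (c k)\<bar> * \<bar>norm (w k)\<bar>)"
    by (rule order_trans[OF norm_sum]) (simp add: norm_mult)
  also have "\<dots> \<le> C * W" unfolding C_def W_def by (rule L2_set_mult_ineq)
  finally have "norm (u - (\<Sum>k\<in>UNIV. c k * w k)) \<le> norm u + C * W"
    using norm_triangle_ineq4[of u "\<Sum>k\<in>UNIV. c k * w k"] by linarith
  then have "(norm (u - (\<Sum>k\<in>UNIV. c k * w k)))\<^sup>2 \<le> (norm u + C * W)\<^sup>2"
    by (intro power_mono) auto
  \<comment> \<open>The difference of the two sides is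
    \<open>(C * norm u - W)\<^sup>2\<close>.\<close>
  also have "\<dots> \<le> (1 + C\<^sup>2) * ((norm u)\<^sup>2 + W\<^sup>2)"
    using zero_le_power2[of "C * norm u - W"] by (simp add: power2_eq_square algebra_simps)
  finally show ?thesis by (simp add: C_def W_def L2_set_def sum_nonneg)
qed

text \<open>Gaussian density for one more antenna, centred at the Cramer extrapolation of
  \<open>CARD('a)\<close> other antennas after cancelling the known signal \<open>xb\<close>. The extrapolation error is
  pure noise, whatever the power of \<open>xa\<close>.\<close>

definition extrapolation :: "complex ^ 'b::finite \<Rightarrow> ('a::finite \<Rightarrow> ('a, 'b) row \<times> complex) \<Rightarrow> ('a, 'b) row \<times> complex \<Rightarrow> complex" where
  "extrapolation xb z x = dotp (snd (fst x)) xb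
    + (\<Sum>k\<in>UNIV. interp (\<lambda>i. fst (fst (z i))) (fst (fst x)) k * (snd (z k) - dotp (snd (fst (z k))) xb))"

definition extrapolation_density :: "complex ^ 'b::finite \<Rightarrow> ('a::finite \<Rightarrow> ('a, 'b) row \<times> complex) \<Rightarrow> ('a, 'b) row \<times> complex \<Rightarrow> real" where
  "extrapolation_density xb z x =
    (let v = interp_var (\<lambda>i. fst (fst (z i))) (fst (fst x))
     in exp (- (norm (snd x - extrapolation xb z x))\<^sup>2 / v) / v)"

text \<open>By Cramer's identity the extrapolated value contains the same linear functional of
  \<open>xa\<close> as the new antenna, so the unknown signal cancels and only noise is left. The
  squared residual is at most \<open>v\<close> times the total noise energy, and the division by
  \<open>v\<close> in the exponent removes this factor.\<close>

lemma neg_ln_extrapolation_density: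
  fixes w :: "'a::finite \<Rightarrow> ('a, 'b::finite) row \<times> complex"
  assumes "det (\<chi> i. fst (fst (w i))) \<noteq> 0"
  shows "- ln (extrapolation_density xb (\<lambda>i. receive xa xb (w i)) (receive xa xb u))
    \<le> ln (interp_var (\<lambda>i. fst (fst (w i))) (fst (fst u))) + ((norm (snd u))\<^sup>2 + (\<Sum>k\<in>UNIV. (norm (snd (w k)))\<^sup>2))"
proof -
  define c where "c = interp (\<lambda>i. fst (fst (w i))) (fst (fst u))"
  define v where "v = interp_var (\<lambda>i. fst (fst (w i))) (fst (fst u))"
  have v: "1 \<le> v" unfolding v_def by (rule interp_var_ge_1)
  have "(\<Sum>k\<in>UNIV. c k * dotp (fst (fst (w k))) xa) = (\<Sum>j\<in>UNIV. (\<Sum>k\<in>UNIV. c k * fst (fst (w k)) $ j) * xa $ j)"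
    unfolding dotp_def sum_distrib_left sum_distrib_right by (subst sum.swap) (simp add: mult.assoc)
  also have "\<dots> = dotp (fst (fst u)) xa"
    unfolding dotp_def c_def using interp[OF assms, of "fst (fst u)"] by simp
  finally have c: "(\<Sum>k\<in>UNIV. c k * dotp (fst (fst (w k))) xa) = dotp (fst (fst u)) xa" .
  have ext: "snd (receive xa xb u) - extrapolation xb (\<lambda>i. receive xa xb (w i)) (receive xa xb u)
    = snd u - (\<Sum>k\<in>UNIV. c k * snd (w k))"
    using c by (simp add: extrapolation_def receive_def c_def[symmetric] distrib_left sum.distrib algebra_simps)
  have "- ln (extrapolation_density xb (\<lambda>i. receive xa xb (w i)) (receive xa xb u))
    = - ln (exp (- (norm (snd u - (\<Sum>k\<in>UNIV. c k * snd (w k))))\<^sup>2 / v) / v)"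
    unfolding extrapolation_density_def Let_def ext by (simp add: receive_def v_def)
  also have "\<dots> = ln v + (norm (snd u - (\<Sum>k\<in>UNIV. c k * snd (w k))))\<^sup>2 / v"
    using v by (intro neg_ln_gauss) simp
  also have "\<dots> \<le> ln v + (v * ((norm (snd u))\<^sup>2 + (\<Sum>k\<in>UNIV. (norm (snd (w k)))\<^sup>2))) / v"
    using v norm_residual_le[of "snd u" c "\<lambda>k. snd (w k)"]
    by (intro add_left_mono divide_right_mono) (auto simp: v_def interp_var_def c_def)
  finally show ?thesis using v by (simp add: v_def[symmetric])
qed

lemma extrapolation_density_measurable:
  "(\<lambda>(z, x). extrapolation_density xb z x)
    \<in> borel_measurable (PiM (UNIV :: 'a::finite set) (\<lambda>_. antenna_ref :: (('a, 'b::finite) row \<times> complex) measure) \<Otimes>\<^sub>M antenna_ref)"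
  unfolding extrapolation_density_def extrapolation_def Let_def split_beta' by measurable

lemma extrapolation_density_bounds:
  "0 < extrapolation_density xb z x" "extrapolation_density xb z x \<le> 1"
  unfolding extrapolation_density_def Let_def
  by (rule gauss_bounds[OF interp_var_ge_1 zero_le_power2])+

text \<open>For fixed earlier antennas and a fixed new row, the density is Gaussian in the new
  output, with some centre and a variance \<open>v \<ge> 1\<close>. This covers singular row
  matrices too.\<close>

lemma nn_integral_extrapolation_density:
  fixes z :: "'a::finite \<Rightarrow> ('a, 'b::finite) row \<times> complex"
  assumes "z \<in> space (PiM UNIV (\<lambda>_. antenna_ref))"
  shows "(\<integral>\<^sup>+ x. ennreal (extrapolation_density xb z x) \<partial>antenna_ref) = 1"
proof -
  interpret prob_space "row_law :: ('a, 'b) row measure" by (rule prob_space_row_law)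
  have m: "(\<lambda>x. ennreal (extrapolation_density xb z x)) \<in> borel_measurable antenna_ref"
    using measurable_compose[OF measurable_Pair1'[OF assms] extrapolation_density_measurable] by simp
  have "(\<integral>\<^sup>+ x. ennreal (extrapolation_density xb z x) \<partial>antenna_ref)
    = (\<integral>\<^sup>+ r. \<integral>\<^sup>+ y. ennreal (extrapolation_density xb z (r, y)) \<partial>cplx_ref \<partial>row_law)"
    by (rule nn_integral_pair[OF sigma_finite_cplx_ref m])
  also have "\<dots> = (\<integral>\<^sup>+ r. 1 \<partial>(row_law :: ('a, 'b) row measure))"
    unfolding extrapolation_density_def extrapolation_def Let_def fst_conv snd_conv
    by (intro nn_integral_cong nn_integral_gauss_1 interp_var_ge_1)
  finally show ?thesis using emeasure_space_1 by simp
qed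

text \<open>Mean of \<open>ln v\<close> plus the noise energies of the \<open>CARD('a) + 1\<close>
  antennas involved, each at most \<open>4\<close>. The integral is finite by
  \<open>interp_var_integral_finite\<close>, so \<open>enn2real\<close> loses nothing.\<close>

definition extrapolation_cost :: "'a::finite itself \<Rightarrow> real" where
  "extrapolation_cost _ = enn2real (\<integral>\<^sup>+ h. \<integral>\<^sup>+ x. ennreal (ln (interp_var h x)) \<partial>noise_vector \<partial>PiM (UNIV :: 'a set) (\<lambda>_. noise_vector))
    + 4 * (real CARD('a) + 1)"

lemma extrapolation_cost_nonneg: "0 \<le> extrapolation_cost TYPE('a::finite)"
  by (simp add: extrapolation_cost_def)

text \<open>The inverse root of the absolute determinant has finite mean, so it is almost surely
  finite, and its value at a singular matrix is \<open>\<top>\<close>.\<close>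

lemma AE_det_noise_vector:
  "AE h in PiM (UNIV :: 'a::finite set) (\<lambda>_. noise_vector). det (\<chi> i. h i) \<noteq> 0"
proof -
  have c: "(\<lambda>h. h i) \<in> borel_measurable (PiM (UNIV :: 'a set) (\<lambda>_. noise_vector :: (complex ^ 'a) measure))" for i
    using measurable_component_singleton[of i UNIV "\<lambda>_. noise_vector :: (complex ^ 'a) measure"] by (simp cong: measurable_cong_sets)
  have m: "(\<lambda>h. inverse (ennreal (sqrt (norm (det (\<chi> i. h i)))))) \<in> borel_measurable (PiM (UNIV :: 'a set) (\<lambda>_. noise_vector))"
    using c by measurable
  have "(\<integral>\<^sup>+ h. inverse (ennreal (sqrt (norm (det (\<chi> i. h i))))) \<partial>PiM (UNIV :: 'a set) (\<lambda>_. noise_vector)) \<noteq> \<infinity>"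
    using le_less_trans[OF det_inverse_sqrt[where 'n='a], of \<top>] by (simp add: power_less_top_ennreal)
  from nn_integral_PInf_AE[OF m this] show ?thesis
    by (rule AE_mp) (auto intro!: AE_I2)
qed

lemma nn_integral_PiM_antenna_rows:
  assumes "F \<in> borel_measurable (PiM (UNIV :: 'k::finite set) (\<lambda>_. noise_vector :: (complex ^ 'a::finite) measure))"
  shows "(\<integral>\<^sup>+ w. F (\<lambda>i. fst (fst (w i))) \<partial>PiM UNIV (\<lambda>_. antenna_law :: (('a, 'b::finite) row \<times> complex) measure))
    = (\<integral>\<^sup>+ h. F h \<partial>PiM UNIV (\<lambda>_. noise_vector))"
proof -
  have m: "(\<lambda>w. fst (fst w)) \<in> measurable (antenna_law :: (('a, 'b) row \<times> complex) measure) noise_vector"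
    by measurable
  have tr: "(\<integral>\<^sup>+ z. 1 * G z \<partial>noise_vector) = (\<integral>\<^sup>+ w. G (fst (fst w)) \<partial>(antenna_law :: (('a, 'b) row \<times> complex) measure))"
    if "G \<in> borel_measurable (noise_vector :: (complex ^ 'a) measure)" for G
  proof -
    have [measurable]: "G \<in> borel_measurable borel" using that by (simp cong: measurable_cong_sets)
    show ?thesis
      by (subst nn_integral_antenna_law_fst[where F="\<lambda>r. G (fst r)"], measurable)
        (subst nn_integral_row_law_fst, auto)
  qed
  have "(\<integral>\<^sup>+ h. (\<Prod>i\<in>(UNIV :: 'k set). 1) * F h \<partial>PiM UNIV (\<lambda>_. noise_vector))
    = (\<integral>\<^sup>+ w. F (\<lambda>i\<in>UNIV. fst (fst (w i))) \<partial>PiM UNIV (\<lambda>_. antenna_law :: (('a, 'b) row \<times> complex) measure))"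
    by (rule nn_integral_PiM_transport[OF sigma_finite_noise_vector sigma_finite_antenna_law finite _ m tr assms]) auto
  then show ?thesis by (simp add: restrict_UNIV)
qed

lemma nn_integral_interp_var_antennas:
  "(\<integral>\<^sup>+ w. \<integral>\<^sup>+ u. ennreal (ln (interp_var (\<lambda>i. fst (fst (w i))) (fst (fst u))))
        \<partial>(antenna_law :: (('a, 'b) row \<times> complex) measure) \<partial>PiM UNIV (\<lambda>_. antenna_law :: (('a::finite, 'b::finite) row \<times> complex) measure))
    = (\<integral>\<^sup>+ h. \<integral>\<^sup>+ x. ennreal (ln (interp_var h x)) \<partial>noise_vector \<partial>PiM (UNIV :: 'a set) (\<lambda>_. noise_vector))"
proof -
  interpret N: prob_space "noise_vector :: (complex ^ 'a) measure" by (rule prob_space_noise_vector)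
  have c[measurable]: "(\<lambda>h. h i) \<in> borel_measurable (PiM (UNIV :: 'a set) (\<lambda>_. noise_vector :: (complex ^ 'a) measure))" for i
    using measurable_component_singleton[of i UNIV "\<lambda>_. noise_vector :: (complex ^ 'a) measure"] by (simp cong: measurable_cong_sets)
  have "(\<integral>\<^sup>+ u. ennreal (ln (interp_var h (fst (fst u)))) \<partial>(antenna_law :: (('a, 'b) row \<times> complex) measure))
     = (\<integral>\<^sup>+ x. ennreal (ln (interp_var h x)) \<partial>noise_vector)" for h :: "'a \<Rightarrow> complex ^ 'a"
    by (subst nn_integral_antenna_law_fst[where F="\<lambda>r. ennreal (ln (interp_var h (fst r)))"], measurable)
      (rule nn_integral_row_law_fst, measurable)
  then have "(\<integral>\<^sup>+ w. \<integral>\<^sup>+ u. ennreal (ln (interp_var (\<lambda>i. fst (fst (w i))) (fst (fst u))))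
        \<partial>(antenna_law :: (('a, 'b) row \<times> complex) measure) \<partial>PiM UNIV (\<lambda>_. antenna_law :: (('a, 'b) row \<times> complex) measure))
    = (\<integral>\<^sup>+ w. \<integral>\<^sup>+ x. ennreal (ln (interp_var (\<lambda>i. fst (fst (w i))) x)) \<partial>noise_vector \<partial>PiM UNIV (\<lambda>_. antenna_law :: (('a, 'b) row \<times> complex) measure))"
    by (intro nn_integral_cong)
  also have "\<dots> = (\<integral>\<^sup>+ h. \<integral>\<^sup>+ x. ennreal (ln (interp_var h x)) \<partial>noise_vector \<partial>PiM (UNIV :: 'a set) (\<lambda>_. noise_vector))"
    by (intro nn_integral_PiM_antenna_rows[where F="\<lambda>h. \<integral>\<^sup>+ x. ennreal (ln (interp_var h x)) \<partial>noise_vector"])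
      measurable
  finally show ?thesis .
qed

text \<open>Transport replaces the earlier antennas and the new one by independent rows and noise.
  The pointwise estimate then separates into \<open>ln v\<close> and noise energies, neither of
  which involves \<open>xa\<close> or \<open>xb\<close>.\<close>

lemma extrapolation_cost_bound:
  fixes xa :: "complex ^ 'a::finite" and xb :: "complex ^ 'b::finite"
  shows "(\<integral>\<^sup>+ z. (\<Prod>i\<in>UNIV. ennreal (antenna_density xa xb (z i))) *
        (\<integral>\<^sup>+ x. ennreal (antenna_density xa xb x) * ennreal (- ln (extrapolation_density xb z x)) \<partial>antenna_ref)
        \<partial>PiM UNIV (\<lambda>_. antenna_ref)) \<le> ennreal (extrapolation_cost TYPE('a))"
proof -
  let ?R = "antenna_ref :: (('a, 'b) row \<times> complex) measure"
  let ?L = "antenna_law :: (('a, 'b) row \<times> complex) measure"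
  let ?PR = "PiM (UNIV :: 'a set) (\<lambda>_. ?R)" and ?PL = "PiM (UNIV :: 'a set) (\<lambda>_. ?L)"
  interpret L: prob_space ?L by (rule prob_space_antenna_law)
  interpret PL: prob_space ?PL by (intro prob_space_PiM prob_space_antenna_law)
  interpret R: sigma_finite_measure ?R by (rule sigma_finite_antenna_ref)
  note [measurable] = extrapolation_density_measurable
  let ?v = "\<lambda>w u. ennreal (ln (interp_var (\<lambda>i. fst (fst (w i))) (fst (fst u))))"
  have PLc[measurable]: "(\<lambda>w. w i) \<in> measurable ?PL ?L" for i
    by (rule measurable_component_singleton) simp
  have vm[measurable]: "(\<lambda>(w, u). ?v w u) \<in> borel_measurable (?PL \<Otimes>\<^sub>M ?L)"
  proof -
    have "(\<lambda>p. fst (fst (fst p i))) \<in> borel_measurable (?PL \<Otimes>\<^sub>M ?L)" for i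
      using measurable_compose[OF measurable_compose[OF measurable_compose[OF measurable_fst PLc[of i]] measurable_fst] measurable_fst]
      by (simp cong: measurable_cong_sets)
    then show ?thesis unfolding split_beta' by measurable
  qed
  have "(\<integral>\<^sup>+ z. (\<Prod>i\<in>UNIV. ennreal (antenna_density xa xb (z i))) *
        (\<integral>\<^sup>+ x. ennreal (antenna_density xa xb x) * ennreal (- ln (extrapolation_density xb z x)) \<partial>?R) \<partial>?PR)
    = (\<integral>\<^sup>+ z. (\<Prod>i\<in>UNIV. ennreal (antenna_density xa xb (z i))) *
        (\<integral>\<^sup>+ u. ennreal (- ln (extrapolation_density xb z (receive xa xb u))) \<partial>?L) \<partial>?PR)"
  proof (intro nn_integral_cong arg_cong2[where f="(*)"] refl)
    fix z assume z: "z \<in> space ?PR"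
    have "(\<lambda>x. ennreal (- ln (extrapolation_density xb z x))) \<in> borel_measurable ?R"
      using measurable_compose[OF measurable_Pair1'[OF z] extrapolation_density_measurable] by simp
    from antenna_transport[OF this]
    show "(\<integral>\<^sup>+ x. ennreal (antenna_density xa xb x) * ennreal (- ln (extrapolation_density xb z x)) \<partial>?R)
      = (\<integral>\<^sup>+ u. ennreal (- ln (extrapolation_density xb z (receive xa xb u))) \<partial>?L)" .
  qed
  also have "\<dots> = (\<integral>\<^sup>+ w. \<integral>\<^sup>+ u. ennreal (- ln (extrapolation_density xb (\<lambda>i\<in>UNIV. receive xa xb (w i)) (receive xa xb u))) \<partial>?L \<partial>?PL)"
  proof (rule nn_integral_PiM_transport[OF sigma_finite_antenna_ref sigma_finite_antenna_law finite])
    show "(\<lambda>z. \<integral>\<^sup>+ u. ennreal (- ln (extrapolation_density xb z (receive xa xb u))) \<partial>?L) \<in> borel_measurable ?PR"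
      by measurable
  qed (auto simp: antenna_transport)
  \<comment> \<open>Cramer's identity requires an invertible row matrix, so the pointwise estimate
    is available for almost every \<open>w\<close> only.\<close>
  also have "\<dots> \<le> (\<integral>\<^sup>+ w. \<integral>\<^sup>+ u. ?v w u + (ennreal ((norm (snd u))\<^sup>2) + (\<Sum>k\<in>UNIV. ennreal ((norm (snd (w k)))\<^sup>2))) \<partial>?L \<partial>?PL)"
  proof (rule nn_integral_mono_AE)
    let ?bad = "\<lambda>h :: 'a \<Rightarrow> complex ^ 'a. if det (\<chi> i. h i) = 0 then 1 else 0 :: ennreal"
    have c[measurable]: "(\<lambda>h. h i) \<in> borel_measurable (PiM (UNIV :: 'a set) (\<lambda>_. noise_vector :: (complex ^ 'a) measure))" for i
      using measurable_component_singleton[of i UNIV "\<lambda>_. noise_vector :: (complex ^ 'a) measure"] by (simp cong: measurable_cong_sets)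
    have badm: "?bad \<in> borel_measurable (PiM UNIV (\<lambda>_. noise_vector))" by measurable
    have rm: "(\<lambda>w. fst (fst (w i))) \<in> borel_measurable ?PL" for i
      using measurable_compose[OF measurable_compose[OF PLc[of i] measurable_fst] measurable_fst]
      by (simp cong: measurable_cong_sets)
    have "(\<integral>\<^sup>+ w. ?bad (\<lambda>i. fst (fst (w i))) \<partial>?PL) = (\<integral>\<^sup>+ h. ?bad h \<partial>PiM UNIV (\<lambda>_. noise_vector))"
      by (rule nn_integral_PiM_antenna_rows[OF badm])
    also have "\<dots> = 0"
      using AE_det_noise_vector by (subst nn_integral_0_iff_AE[OF badm]) (auto elim: AE_mp)
    finally have "AE w in ?PL. ?bad (\<lambda>i. fst (fst (w i))) = 0"
      using rm by (subst (asm) nn_integral_0_iff_AE) measurable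
    then have "AE w in ?PL. det (\<chi> i. fst (fst (w i))) \<noteq> 0"
      by (rule AE_mp) (auto intro!: AE_I2 split: if_splits)
    then show "AE w in ?PL. (\<integral>\<^sup>+ u. ennreal (- ln (extrapolation_density xb (\<lambda>i\<in>UNIV. receive xa xb (w i)) (receive xa xb u))) \<partial>?L)
      \<le> (\<integral>\<^sup>+ u. ?v w u + (ennreal ((norm (snd u))\<^sup>2) + (\<Sum>k\<in>UNIV. ennreal ((norm (snd (w k)))\<^sup>2))) \<partial>?L)"
    proof (rule AE_mp, intro AE_I2 impI nn_integral_mono)
      fix w :: "'a \<Rightarrow> ('a, 'b) row \<times> complex" and u :: "('a, 'b) row \<times> complex"
      assume d: "det (\<chi> i. fst (fst (w i))) \<noteq> 0"
      have "ennreal (- ln (extrapolation_density xb (\<lambda>i\<in>UNIV. receive xa xb (w i)) (receive xa xb u)))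
        \<le> ennreal (ln (interp_var (\<lambda>i. fst (fst (w i))) (fst (fst u))) + ((norm (snd u))\<^sup>2 + (\<Sum>k\<in>UNIV. (norm (snd (w k)))\<^sup>2)))"
        using neg_ln_extrapolation_density[OF d, of xb xa u] by (simp add: ennreal_leI restrict_UNIV)
      also have "\<dots> = ?v w u + (ennreal ((norm (snd u))\<^sup>2) + (\<Sum>k\<in>UNIV. ennreal ((norm (snd (w k)))\<^sup>2)))"
        using interp_var_ge_1[of "\<lambda>i. fst (fst (w i))" "fst (fst u)"]
        by (simp add: sum_nonneg add_nonneg_nonneg)
      finally show "ennreal (- ln (extrapolation_density xb (\<lambda>i\<in>UNIV. receive xa xb (w i)) (receive xa xb u)))
        \<le> ?v w u + (ennreal ((norm (snd u))\<^sup>2) + (\<Sum>k\<in>UNIV. ennreal ((norm (snd (w k)))\<^sup>2)))" .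
    qed
  qed
  also have "\<dots> = (\<integral>\<^sup>+ w. \<integral>\<^sup>+ u. ?v w u \<partial>?L \<partial>?PL) + ((\<integral>\<^sup>+ u. ennreal ((norm (snd u))\<^sup>2) \<partial>?L)
      + (\<Sum>k\<in>(UNIV :: 'a set). \<integral>\<^sup>+ w. ennreal ((norm (snd (w k)))\<^sup>2) \<partial>?PL))"
  proof -
    have v1: "(\<lambda>u. ?v w u) \<in> borel_measurable ?L" if "w \<in> space ?PL" for w
      using measurable_compose[OF measurable_Pair1'[OF that] vm] by simp
    have sm[measurable]: "(\<lambda>w. ennreal ((norm (snd (w k)))\<^sup>2)) \<in> borel_measurable ?PL" for k
    proof -
      have "(\<lambda>w. snd (w k)) \<in> borel_measurable ?PL"
        using measurable_compose[OF PLc[of k] measurable_snd] by (simp cong: measurable_cong_sets)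
      then show ?thesis by measurable
    qed
    have "(\<integral>\<^sup>+ u. ?v w u + (ennreal ((norm (snd u))\<^sup>2) + (\<Sum>k\<in>UNIV. ennreal ((norm (snd (w k)))\<^sup>2))) \<partial>?L)
      = (\<integral>\<^sup>+ u. ?v w u \<partial>?L) + ((\<integral>\<^sup>+ u. ennreal ((norm (snd u))\<^sup>2) \<partial>?L) + (\<Sum>k\<in>UNIV. ennreal ((norm (snd (w k)))\<^sup>2)))"
      if w: "w \<in> space ?PL" for w
    proof -
      have "(\<integral>\<^sup>+ u. ennreal ((norm (snd u))\<^sup>2) + (\<Sum>k\<in>UNIV. ennreal ((norm (snd (w k)))\<^sup>2)) \<partial>?L)
        = (\<integral>\<^sup>+ u. ennreal ((norm (snd u))\<^sup>2) \<partial>?L) + (\<Sum>k\<in>UNIV. ennreal ((norm (snd (w k)))\<^sup>2))"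
        using L.emeasure_space_1 by (subst nn_integral_add) auto
      then show ?thesis by (subst nn_integral_add[OF v1[OF w]]) auto
    qed
    then have "(\<integral>\<^sup>+ w. \<integral>\<^sup>+ u. ?v w u + (ennreal ((norm (snd u))\<^sup>2) + (\<Sum>k\<in>UNIV. ennreal ((norm (snd (w k)))\<^sup>2))) \<partial>?L \<partial>?PL)
      = (\<integral>\<^sup>+ w. (\<integral>\<^sup>+ u. ?v w u \<partial>?L) + ((\<integral>\<^sup>+ u. ennreal ((norm (snd u))\<^sup>2) \<partial>?L) + (\<Sum>k\<in>UNIV. ennreal ((norm (snd (w k)))\<^sup>2))) \<partial>?PL)"
      by (intro nn_integral_cong)
    also have "\<dots> = (\<integral>\<^sup>+ w. \<integral>\<^sup>+ u. ?v w u \<partial>?L \<partial>?PL) + (\<integral>\<^sup>+ w. (\<integral>\<^sup>+ u. ennreal ((norm (snd u))\<^sup>2) \<partial>?L) + (\<Sum>k\<in>UNIV. ennreal ((norm (snd (w k)))\<^sup>2)) \<partial>?PL)"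
      by (rule nn_integral_add) measurable
    also have "(\<integral>\<^sup>+ w. (\<integral>\<^sup>+ u. ennreal ((norm (snd u))\<^sup>2) \<partial>?L) + (\<Sum>k\<in>UNIV. ennreal ((norm (snd (w k)))\<^sup>2)) \<partial>?PL)
      = (\<integral>\<^sup>+ u. ennreal ((norm (snd u))\<^sup>2) \<partial>?L) + (\<Sum>k\<in>(UNIV :: 'a set). \<integral>\<^sup>+ w. ennreal ((norm (snd (w k)))\<^sup>2) \<partial>?PL)"
      using PL.emeasure_space_1 by (subst nn_integral_add) (auto simp: nn_integral_sum simp del: sum_ennreal)
    finally show ?thesis .
  qed
  also have "\<dots> \<le> (\<integral>\<^sup>+ w. \<integral>\<^sup>+ u. ?v w u \<partial>?L \<partial>?PL) + (4 + (\<Sum>k\<in>(UNIV :: 'a set). 4))"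
  proof -
    have u: "(\<integral>\<^sup>+ u. ennreal ((norm (snd u))\<^sup>2) \<partial>?L) \<le> 4"
      using complex_normal_moment by (subst nn_integral_antenna_law_snd[where F="\<lambda>y. ennreal ((norm y)\<^sup>2)"]) auto
    have "(\<integral>\<^sup>+ w. ennreal ((norm (snd (w k)))\<^sup>2) \<partial>?PL) \<le> 4" for k
      using u by (subst nn_integral_PiM_component[OF prob_space_antenna_law, where F="\<lambda>w. ennreal ((norm (snd w))\<^sup>2)"]) auto
    with u show ?thesis by (intro add_mono order_refl sum_mono)
  qed
  also have "\<dots> = ennreal (extrapolation_cost TYPE('a))"
  proof -
    have "4 + (\<Sum>k\<in>(UNIV :: 'a set). 4) = ennreal (4 * (real CARD('a) + 1))"
      by (simp add: ennreal_mult' ennreal_of_nat_eq_real_of_nat distrib_left mult.commute add.commute)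
    then show ?thesis
      unfolding extrapolation_cost_def nn_integral_interp_var_antennas
      using interp_var_integral_finite[where 'n='a] by simp
  qed
  finally show ?thesis .
qed

section \<open>Entropy of antennas under normalised weights\<close>

context
  fixes A :: "'m set" and xa :: "'m \<Rightarrow> complex ^ 'a::finite" and xb :: "complex ^ 'b::finite" and c :: "'m \<Rightarrow> real"
  assumes A: "finite A" and c: "mixture.weights A c" and c1: "(\<Sum>a\<in>A. c a) = 1"
begin

interpretation mixture "antenna_ref :: (('a, 'b) row \<times> complex) measure" A "\<lambda>a. antenna_density (xa a) xb"
  by (rule mixture_antenna[OF A])

lemma c_nonneg: "a \<in> A \<Longrightarrow> 0 \<le> c a"
  using c by (auto simp: weights_def)

lemma antenna_entropy_0: "entropy 0 c = 0"
  by (simp add: phi_def c1)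

text \<open>The test density is the extrapolation density. Its cost has the same bound for every
  \<open>a\<close>, and the weights sum to \<open>1\<close>.\<close>

lemma antenna_entropy_extrapolate:
  "entropy (Suc CARD('a)) c \<le> entropy CARD('a) c + ennreal (extrapolation_cost TYPE('a))"
proof -
  have "entropy (Suc CARD('a)) c \<le> entropy CARD('a) c
    + (\<Sum>a\<in>A. ennreal (c a) * (\<integral>\<^sup>+ z. (\<Prod>i\<in>(UNIV :: 'a set). ennreal (antenna_density (xa a) xb (z i))) *
         (\<integral>\<^sup>+ x. ennreal (antenna_density (xa a) xb x) * ennreal (- ln (extrapolation_density xb z x)) \<partial>antenna_ref)
         \<partial>PiM UNIV (\<lambda>_. antenna_ref)))"
    by (rule entropy_Suc_card_le[OF c finite extrapolation_density_bounds extrapolation_density_measurable])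
      (simp add: nn_integral_extrapolation_density)
  also have "\<dots> \<le> entropy CARD('a) c + (\<Sum>a\<in>A. ennreal (c a) * ennreal (extrapolation_cost TYPE('a)))"
    by (intro add_left_mono sum_mono mult_left_mono extrapolation_cost_bound) simp
  also have "(\<Sum>a\<in>A. ennreal (c a) * ennreal (extrapolation_cost TYPE('a))) = ennreal (extrapolation_cost TYPE('a))"
    by (simp add: sum_distrib_right[symmetric] c_nonneg c1)
  finally show ?thesis .
qed

text \<open>Comparison with a centred Gaussian of variance \<open>P\<close>: the cross entropy is
  \<open>ln P\<close> plus mean received power over \<open>P\<close>. If the inputs obey the power
  constraint, this is one degree of freedom up to a bounded term.\<close>

lemma antenna_entropy_1:
  assumes P: "1 \<le> P"
  shows "entropy 1 c \<le> ennreal (ln P) + (\<Sum>a\<in>A. ennreal (c a) * ennreal (power_bound (xa a) xb / P))"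
proof -
  define Q :: "('a, 'b) row \<times> complex \<Rightarrow> real" where "Q x = exp (- (norm (snd x - 0))\<^sup>2 / P) / P" for x
  have Qm: "Q \<in> borel_measurable antenna_ref" and Qe: "(\<lambda>x. ennreal (Q x)) \<in> borel_measurable antenna_ref"
    and Ql: "(\<lambda>x. ennreal (- ln (Q x))) \<in> borel_measurable antenna_ref"
    unfolding Q_def by measurable
  interpret row: prob_space "row_law :: ('a, 'b) row measure" by (rule prob_space_row_law)
  interpret L: prob_space "antenna_law :: (('a, 'b) row \<times> complex) measure" by (rule prob_space_antenna_law)
  have "(\<integral>\<^sup>+ x. ennreal (Q x) \<partial>antenna_ref) = (\<integral>\<^sup>+ r. \<integral>\<^sup>+ y. ennreal (Q (r, y)) \<partial>cplx_ref \<partial>(row_law :: ('a, 'b) row measure))"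
    by (rule nn_integral_pair[OF sigma_finite_cplx_ref Qe])
  also have "\<dots> = 1"
    unfolding Q_def snd_conv using nn_integral_gauss_1[OF P, of 0] row.emeasure_space_1 by simp
  finally have int_Q: "(\<integral>\<^sup>+ x. ennreal (Q x) \<partial>antenna_ref) \<le> 1" by simp
  \<comment> \<open>With the empty index set, no earlier antenna is available to the test
    density.\<close>
  have "entropy (Suc (card ({} :: unit set))) c \<le> entropy (card ({} :: unit set)) c
    + (\<Sum>a\<in>A. ennreal (c a) * (\<integral>\<^sup>+ z. (\<Prod>i\<in>({} :: unit set). ennreal (antenna_density (xa a) xb (z i))) *
         (\<integral>\<^sup>+ x. ennreal (antenna_density (xa a) xb x) * ennreal (- ln (Q x)) \<partial>antenna_ref) \<partial>PiM {} (\<lambda>_. antenna_ref)))"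
  proof (rule entropy_Suc_card_le[OF c, where Q="\<lambda>_. Q"])
    show "0 < Q x" "Q x \<le> 1" for x unfolding Q_def by (rule gauss_bounds[OF P zero_le_power2])+
    show "(\<lambda>(z, x). Q x) \<in> borel_measurable (PiM {} (\<lambda>_. antenna_ref) \<Otimes>\<^sub>M antenna_ref)"
      using measurable_compose[OF measurable_snd Qm] by (simp add: split_beta')
  qed (use int_Q in auto)
  then have "entropy 1 c \<le> entropy 0 c
    + (\<Sum>a\<in>A. ennreal (c a) * (\<integral>\<^sup>+ x. ennreal (antenna_density (xa a) xb x) * ennreal (- ln (Q x)) \<partial>antenna_ref))"
    by (simp add: PiM_empty nn_integral_count_space_finite del: entropy.simps)
  also have "\<dots> \<le> 0 + (\<Sum>a\<in>A. ennreal (c a) * (ennreal (ln P) + ennreal (power_bound (xa a) xb / P)))"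
  proof (intro add_mono sum_mono mult_left_mono)
    show "entropy 0 c \<le> 0" by (simp only: antenna_entropy_0)
    fix a assume "a \<in> A"
    have "(\<integral>\<^sup>+ x. ennreal (antenna_density (xa a) xb x) * ennreal (- ln (Q x)) \<partial>antenna_ref)
      = (\<integral>\<^sup>+ w. ennreal (- ln (Q (receive (xa a) xb w))) \<partial>antenna_law)"
      by (rule antenna_transport[OF Ql])
    also have "\<dots> = (\<integral>\<^sup>+ w. ennreal (ln P) + ennreal (1 / P) * ennreal ((norm (snd (receive (xa a) xb w)))\<^sup>2) \<partial>antenna_law)"
    proof (rule nn_integral_cong)
      fix w :: "('a, 'b) row \<times> complex"
      have "- ln (Q (receive (xa a) xb w)) = ln P + (norm (snd (receive (xa a) xb w) - 0))\<^sup>2 / P"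
        unfolding Q_def using P by (intro neg_ln_gauss) simp
      then show "ennreal (- ln (Q (receive (xa a) xb w))) = ennreal (ln P) + ennreal (1 / P) * ennreal ((norm (snd (receive (xa a) xb w)))\<^sup>2)"
        using P by (simp add: ennreal_mult[symmetric])
    qed
    also have "\<dots> = ennreal (ln P) + ennreal (1 / P) * (\<integral>\<^sup>+ w. ennreal ((norm (snd (receive (xa a) xb w)))\<^sup>2) \<partial>antenna_law)"
    proof -
      have m: "(\<lambda>w. ennreal ((norm (snd (receive (xa a) xb w)))\<^sup>2)) \<in> borel_measurable antenna_law"
        unfolding receive_def by measurable
      have "(\<integral>\<^sup>+ w. ennreal (ln P) + ennreal (1 / P) * ennreal ((norm (snd (receive (xa a) xb w)))\<^sup>2) \<partial>antenna_law)
        = (\<integral>\<^sup>+ w. ennreal (ln P) \<partial>(antenna_law :: (('a, 'b) row \<times> complex) measure))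
          + (\<integral>\<^sup>+ w. ennreal (1 / P) * ennreal ((norm (snd (receive (xa a) xb w)))\<^sup>2) \<partial>antenna_law)"
        by (rule nn_integral_add[OF measurable_const borel_measurable_times_ennreal[OF measurable_const m]]) auto
      then show ?thesis using L.emeasure_space_1 nn_integral_cmult[OF m, of "ennreal (1 / P)"] by simp
    qed
    also have "\<dots> \<le> ennreal (ln P) + ennreal (1 / P) * ennreal (power_bound (xa a) xb)"
      by (intro add_left_mono mult_left_mono receive_power) simp
    also have "\<dots> = ennreal (ln P) + ennreal (power_bound (xa a) xb / P)"
      using P by (simp add: ennreal_mult[symmetric] power_bound_nonneg)
    finally show "(\<integral>\<^sup>+ x. ennreal (antenna_density (xa a) xb x) * ennreal (- ln (Q x)) \<partial>antenna_ref)
      \<le> ennreal (ln P) + ennreal (power_bound (xa a) xb / P)" .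
  qed simp
  also have "\<dots> = ennreal (ln P) + (\<Sum>a\<in>A. ennreal (c a) * ennreal (power_bound (xa a) xb / P))"
    by (simp add: distrib_left sum.distrib sum_distrib_right[symmetric] c_nonneg c1 del: sum_ennreal)
      (simp add: c_nonneg c1)
  finally show ?thesis .
qed

end

section \<open>Channels with feedback\<close>

text \<open>Kernel \<open>s\<close> evaluates the letter at time \<open>Suc s\<close>. Its history
  is cut down to \<open>{1..s}\<close>, so that it is a point of the product space
  \<open>hist \<nu> s\<close>.\<close>

definition seqprod :: "(nat \<Rightarrow> (nat \<Rightarrow> 'z) \<Rightarrow> 'z \<Rightarrow> 'r::comm_monoid_mult) \<Rightarrow> nat \<Rightarrow> (nat \<Rightarrow> 'z) \<Rightarrow> 'r" where
  "seqprod \<kappa> t w = (\<Prod>s<t. \<kappa> s (restrict w {1..s}) (w (Suc s)))"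

abbreviation hist :: "'z measure \<Rightarrow> nat \<Rightarrow> (nat \<Rightarrow> 'z) measure" where
  "hist \<nu> t \<equiv> PiM {1..t} (\<lambda>_. \<nu>)"

lemma seqprod_0 [simp]: "seqprod \<kappa> 0 w = 1"
  by (simp add: seqprod_def)

lemma seqprod_Suc: "seqprod \<kappa> (Suc t) w = seqprod \<kappa> t w * \<kappa> t (restrict w {1..t}) (w (Suc t))"
  by (simp add: seqprod_def)

lemma seqprod_cong:
  assumes "\<And>i. 1 \<le> i \<Longrightarrow> i \<le> t \<Longrightarrow> w i = w' i"
  shows "seqprod \<kappa> t w = seqprod \<kappa> t w'"
proof -
  have "restrict w {1..s} = restrict w' {1..s}" if "s < t" for s
    using assms that by (auto simp: restrict_def fun_eq_iff)
  then show ?thesis unfolding seqprod_def using assms by (intro prod.cong) auto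
qed

lemma hist_restrict_id: "w \<in> space (hist \<nu> t) \<Longrightarrow> restrict w {1..t} = w"
  by (auto simp: space_PiM PiE_def extensional_restrict)

lemma hist_upd_restrict: "w \<in> space (hist \<nu> t) \<Longrightarrow> restrict (w(Suc t := z)) {1..t} = w"
proof -
  assume w: "w \<in> space (hist \<nu> t)"
  have "restrict (w(Suc t := z)) {1..t} = restrict w {1..t}"
    by (auto simp: restrict_def fun_eq_iff)
  then show ?thesis by (simp only: hist_restrict_id[OF w])
qed

lemma seqprod_upd:
  "w \<in> space (hist \<nu> t) \<Longrightarrow> seqprod \<kappa> (Suc t) (w(Suc t := z)) = seqprod \<kappa> t w * \<kappa> t w z"
proof -
  assume w: "w \<in> space (hist \<nu> t)"
  have "seqprod \<kappa> t (w(Suc t := z)) = seqprod \<kappa> t w"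
    by (rule seqprod_cong) auto
  then show ?thesis by (simp only: seqprod_Suc hist_upd_restrict[OF w] fun_upd_same)
qed

lemma measurable_hist_restrict:
  "s \<le> t \<Longrightarrow> (\<lambda>w. restrict w {1..s}) \<in> measurable (hist \<nu> t) (hist \<nu> s)"
  by (intro measurable_restrict_subset) auto

lemma measurable_hist_step:
  assumes "s < t" "(\<lambda>(w, z). f w z) \<in> measurable (hist \<nu> s \<Otimes>\<^sub>M \<nu>) N"
  shows "(\<lambda>w. f (restrict w {1..s}) (w (Suc s))) \<in> measurable (hist \<nu> t) N"
proof -
  have "(\<lambda>w. (restrict w {1..s}, w (Suc s))) \<in> measurable (hist \<nu> t) (hist \<nu> s \<Otimes>\<^sub>M \<nu>)"
    using assms(1) by (intro measurable_Pair measurable_hist_restrict measurable_component_singleton) auto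
  from measurable_compose[OF this assms(2)] show ?thesis by simp
qed

lemma measurable_hist_upd:
  "w \<in> space (hist \<nu> t) \<Longrightarrow> (\<lambda>z. w(Suc t := z)) \<in> measurable \<nu> (hist \<nu> (Suc t))"
  by (rule measurable_upd[OF measurable_const measurable_ident_sets[OF refl]]) auto

lemma measurable_hist_upd':
  "(\<lambda>(w, z). w(Suc t := z)) \<in> measurable (hist \<nu> t \<Otimes>\<^sub>M \<nu>) (hist \<nu> (Suc t))"
  unfolding split_beta' by (rule measurable_upd[OF measurable_fst measurable_snd]) auto

lemma seqprod_measurable_ennreal:
  fixes \<kappa> :: "nat \<Rightarrow> (nat \<Rightarrow> 'z) \<Rightarrow> 'z \<Rightarrow> ennreal"
  assumes "\<And>s. s < t \<Longrightarrow> (\<lambda>(w, z). \<kappa> s w z) \<in> borel_measurable (hist \<nu> s \<Otimes>\<^sub>M \<nu>)" and "t \<le> m"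
  shows "seqprod \<kappa> t \<in> borel_measurable (hist \<nu> m)"
  unfolding seqprod_def[abs_def] using assms
  by (intro borel_measurable_prod_ennreal measurable_hist_step) auto

lemma seqprod_measurable_real:
  fixes \<kappa> :: "nat \<Rightarrow> (nat \<Rightarrow> 'z) \<Rightarrow> 'z \<Rightarrow> real"
  assumes "\<And>s. s < t \<Longrightarrow> (\<lambda>(w, z). \<kappa> s w z) \<in> borel_measurable (hist \<nu> s \<Otimes>\<^sub>M \<nu>)" and "t \<le> m"
  shows "seqprod \<kappa> t \<in> borel_measurable (hist \<nu> m)"
  unfolding seqprod_def[abs_def] using assms
  by (intro borel_measurable_prod measurable_hist_step) auto

lemma nn_integral_hist_Suc:
  assumes "sigma_finite_measure \<nu>" "F \<in> borel_measurable (hist \<nu> (Suc t))"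
  shows "(\<integral>\<^sup>+ w. F w \<partial>hist \<nu> (Suc t)) = (\<integral>\<^sup>+ w. \<integral>\<^sup>+ z. F (w(Suc t := z)) \<partial>\<nu> \<partial>hist \<nu> t)"
proof -
  have "{1..Suc t} = insert (Suc t) {1..t}" by auto
  then show ?thesis using nn_integral_PiM_insert[OF assms(1), of "{1..t}" "Suc t" F] assms(2) by simp
qed

lemma nn_integral_seqprod_Suc:
  fixes \<kappa> :: "nat \<Rightarrow> (nat \<Rightarrow> 'z) \<Rightarrow> 'z \<Rightarrow> ennreal"
  assumes "sigma_finite_measure \<nu>"
    and m: "\<And>s. s < Suc t \<Longrightarrow> (\<lambda>(w, z). \<kappa> s w z) \<in> borel_measurable (hist \<nu> s \<Otimes>\<^sub>M \<nu>)"
    and F: "F \<in> borel_measurable (hist \<nu> (Suc t))"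
  shows "(\<integral>\<^sup>+ w. seqprod \<kappa> (Suc t) w * F w \<partial>hist \<nu> (Suc t))
    = (\<integral>\<^sup>+ w. seqprod \<kappa> t w * (\<integral>\<^sup>+ z. \<kappa> t w z * F (w(Suc t := z)) \<partial>\<nu>) \<partial>hist \<nu> t)"
proof -
  have "(\<integral>\<^sup>+ w. seqprod \<kappa> (Suc t) w * F w \<partial>hist \<nu> (Suc t))
    = (\<integral>\<^sup>+ w. \<integral>\<^sup>+ z. seqprod \<kappa> (Suc t) (w(Suc t := z)) * F (w(Suc t := z)) \<partial>\<nu> \<partial>hist \<nu> t)"
    by (rule nn_integral_hist_Suc[OF assms(1)])
      (intro borel_measurable_times_ennreal F seqprod_measurable_ennreal m, auto)
  also have "\<dots> = (\<integral>\<^sup>+ w. seqprod \<kappa> t w * (\<integral>\<^sup>+ z. \<kappa> t w z * F (w(Suc t := z)) \<partial>\<nu>) \<partial>hist \<nu> t)"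
  proof (rule nn_integral_cong)
    fix w assume w: "w \<in> space (hist \<nu> t)"
    have "(\<lambda>z. \<kappa> t w z * F (w(Suc t := z))) \<in> borel_measurable \<nu>"
      using measurable_compose[OF measurable_Pair1'[OF w] m[of t]] measurable_compose[OF measurable_hist_upd[OF w] F]
      by (intro borel_measurable_times_ennreal) auto
    then show "(\<integral>\<^sup>+ z. seqprod \<kappa> (Suc t) (w(Suc t := z)) * F (w(Suc t := z)) \<partial>\<nu>)
      = seqprod \<kappa> t w * (\<integral>\<^sup>+ z. \<kappa> t w z * F (w(Suc t := z)) \<partial>\<nu>)"
      by (simp only: seqprod_upd[OF w] mult.assoc nn_integral_cmult)
  qed
  finally show ?thesis .
qed

text \<open>The kernels after time \<open>t\<close> integrate to \<open>1\<close> one after another,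
  beginning with the last.\<close>

lemma nn_integral_seqprod_marginal:
  fixes \<kappa> :: "nat \<Rightarrow> (nat \<Rightarrow> 'z) \<Rightarrow> 'z \<Rightarrow> ennreal"
  assumes sf: "sigma_finite_measure \<nu>"
    and m: "\<And>s. s < m \<Longrightarrow> (\<lambda>(w, z). \<kappa> s w z) \<in> borel_measurable (hist \<nu> s \<Otimes>\<^sub>M \<nu>)"
    and i: "\<And>s w. s < m \<Longrightarrow> w \<in> space (hist \<nu> s) \<Longrightarrow> (\<integral>\<^sup>+ z. \<kappa> s w z \<partial>\<nu>) = 1"
    and F: "F \<in> borel_measurable (hist \<nu> t)" and "t \<le> m"
  shows "(\<integral>\<^sup>+ w. seqprod \<kappa> m w * F (restrict w {1..t}) \<partial>hist \<nu> m) = (\<integral>\<^sup>+ w. seqprod \<kappa> t w * F w \<partial>hist \<nu> t)"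
  using \<open>t \<le> m\<close> m i
proof (induction m rule: dec_induct)
  case base
  show ?case by (intro nn_integral_cong) (simp only: hist_restrict_id)
next
  case (step m)
  have Fr: "(\<lambda>w. F (restrict w {1..t})) \<in> borel_measurable (hist \<nu> (Suc m))"
    using step.hyps by (intro measurable_compose[OF measurable_hist_restrict F]) auto
  have "(\<integral>\<^sup>+ w. seqprod \<kappa> (Suc m) w * F (restrict w {1..t}) \<partial>hist \<nu> (Suc m))
    = (\<integral>\<^sup>+ w. seqprod \<kappa> m w * (\<integral>\<^sup>+ z. \<kappa> m w z * F (restrict (w(Suc m := z)) {1..t}) \<partial>\<nu>) \<partial>hist \<nu> m)"
    by (rule nn_integral_seqprod_Suc[OF sf step.prems(1) Fr])
  also have "\<dots> = (\<integral>\<^sup>+ w. seqprod \<kappa> m w * F (restrict w {1..t}) \<partial>hist \<nu> m)"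
  proof (intro nn_integral_cong arg_cong2[where f="(*)"] refl)
    fix w assume w: "w \<in> space (hist \<nu> m)"
    have "restrict (w(Suc m := z)) {1..t} = restrict w {1..t}" for z
      using step.hyps by (auto simp: restrict_def fun_eq_iff)
    moreover have "(\<lambda>z. \<kappa> m w z) \<in> borel_measurable \<nu>"
      using measurable_compose[OF measurable_Pair1'[OF w] step.prems(1)[of m]] by simp
    ultimately show "(\<integral>\<^sup>+ z. \<kappa> m w z * F (restrict (w(Suc m := z)) {1..t}) \<partial>\<nu>) = F (restrict w {1..t})"
      using step.prems(2)[of m w] w by (simp add: nn_integral_multc)
  qed
  also have "\<dots> = (\<integral>\<^sup>+ w. seqprod \<kappa> t w * F w \<partial>hist \<nu> t)"
    by (rule step.IH) (use step.prems in auto)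
  finally show ?case .
qed

text \<open>If every kernel carries \<open>\<nu>\<close> to \<open>V\<close> along \<open>v\<close>,
  whatever the history, then the whole path density carries the product of copies of
  \<open>\<nu>\<close> to the product of copies of \<open>V\<close>: the dependence on the past
  becomes invisible after mapping. This removes the feedback in Fano's inequality for a partial
  observation.\<close>

lemma nn_integral_seqprod_map:
  fixes \<kappa> :: "nat \<Rightarrow> (nat \<Rightarrow> 'z) \<Rightarrow> 'z \<Rightarrow> ennreal"
  assumes sf: "sigma_finite_measure \<nu>" "sigma_finite_measure V"
    and m: "\<And>s. s < m \<Longrightarrow> (\<lambda>(w, z). \<kappa> s w z) \<in> borel_measurable (hist \<nu> s \<Otimes>\<^sub>M \<nu>)"
    and v: "v \<in> measurable \<nu> V"
    and i: "\<And>s w F. s < m \<Longrightarrow> w \<in> space (hist \<nu> s) \<Longrightarrow> F \<in> borel_measurable V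
      \<Longrightarrow> (\<integral>\<^sup>+ z. \<kappa> s w z * F (v z) \<partial>\<nu>) = (\<integral>\<^sup>+ x. F x \<partial>V)"
    and F: "F \<in> borel_measurable (hist V m)"
  shows "(\<integral>\<^sup>+ w. seqprod \<kappa> m w * F (\<lambda>i\<in>{1..m}. v (w i)) \<partial>hist \<nu> m) = (\<integral>\<^sup>+ x. F x \<partial>hist V m)"
  using m i F
proof (induction m arbitrary: F)
  case 0
  then show ?case by (simp add: PiM_empty nn_integral_count_space_finite)
next
  case (Suc m)
  interpret V: sigma_finite_measure V by fact
  have vm: "(\<lambda>w. \<lambda>i\<in>{1..k}. v (w i)) \<in> measurable (hist \<nu> k) (hist V k)" for k
    by (intro measurable_restrict measurable_compose[OF _ v] measurable_component_singleton)
  have upd: "(\<lambda>i\<in>{1..Suc m}. v ((w(Suc m := z)) i)) = (\<lambda>i\<in>{1..m}. v (w i))(Suc m := v z)" for w z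
    by (auto simp: restrict_def fun_eq_iff)
  have "(\<integral>\<^sup>+ w. seqprod \<kappa> (Suc m) w * F (\<lambda>i\<in>{1..Suc m}. v (w i)) \<partial>hist \<nu> (Suc m))
    = (\<integral>\<^sup>+ w. seqprod \<kappa> m w * (\<integral>\<^sup>+ z. \<kappa> m w z * F (\<lambda>i\<in>{1..Suc m}. v ((w(Suc m := z)) i)) \<partial>\<nu>) \<partial>hist \<nu> m)"
    by (rule nn_integral_seqprod_Suc[OF sf(1) Suc.prems(1) measurable_compose[OF vm Suc.prems(3)]])
  also have "\<dots> = (\<integral>\<^sup>+ w. seqprod \<kappa> m w * (\<integral>\<^sup>+ x. F ((\<lambda>i\<in>{1..m}. v (w i))(Suc m := x)) \<partial>V) \<partial>hist \<nu> m)"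
  proof (intro nn_integral_cong arg_cong2[where f="(*)"] refl)
    fix w assume w: "w \<in> space (hist \<nu> m)"
    have "(\<lambda>i\<in>{1..m}. v (w i)) \<in> space (hist V m)"
      using measurable_space[OF vm w] .
    then have "(\<lambda>x. F ((\<lambda>i\<in>{1..m}. v (w i))(Suc m := x))) \<in> borel_measurable V"
      by (intro measurable_compose[OF measurable_hist_upd Suc.prems(3)])
    from Suc.prems(2)[OF _ w this]
    show "(\<integral>\<^sup>+ z. \<kappa> m w z * F (\<lambda>i\<in>{1..Suc m}. v ((w(Suc m := z)) i)) \<partial>\<nu>)
      = (\<integral>\<^sup>+ x. F ((\<lambda>i\<in>{1..m}. v (w i))(Suc m := x)) \<partial>V)"
      by (simp only: upd lessI)
  qed
  also have "\<dots> = (\<integral>\<^sup>+ y. \<integral>\<^sup>+ x. F (y(Suc m := x)) \<partial>V \<partial>hist V m)"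
  proof (rule Suc.IH)
    show "(\<lambda>y. \<integral>\<^sup>+ x. F (y(Suc m := x)) \<partial>V) \<in> borel_measurable (hist V m)"
      using measurable_compose[OF measurable_hist_upd' Suc.prems(3)]
      by (intro V.borel_measurable_nn_integral) (simp only: split_beta')
  qed (use Suc.prems in auto)
  also have "\<dots> = (\<integral>\<^sup>+ x. F x \<partial>hist V (Suc m))"
    by (rule nn_integral_hist_Suc[OF sf(2) Suc.prems(3), symmetric])
  finally show ?case .
qed

lemma nn_integral_seqprod_le_1:
  fixes \<kappa> :: "nat \<Rightarrow> (nat \<Rightarrow> 'z) \<Rightarrow> 'z \<Rightarrow> ennreal"
  assumes sf: "sigma_finite_measure \<nu>"
    and m: "\<And>s. s < m \<Longrightarrow> (\<lambda>(w, z). \<kappa> s w z) \<in> borel_measurable (hist \<nu> s \<Otimes>\<^sub>M \<nu>)"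
    and i: "\<And>s w. s < m \<Longrightarrow> w \<in> space (hist \<nu> s) \<Longrightarrow> (\<integral>\<^sup>+ z. \<kappa> s w z \<partial>\<nu>) \<le> 1"
  shows "(\<integral>\<^sup>+ w. seqprod \<kappa> m w \<partial>hist \<nu> m) \<le> 1"
  using m i
proof (induction m)
  case 0
  then show ?case by (simp add: PiM_empty)
next
  case (Suc m)
  have "(\<integral>\<^sup>+ w. seqprod \<kappa> (Suc m) w \<partial>hist \<nu> (Suc m))
    = (\<integral>\<^sup>+ w. seqprod \<kappa> m w * (\<integral>\<^sup>+ z. \<kappa> m w z \<partial>\<nu>) \<partial>hist \<nu> m)"
    using nn_integral_seqprod_Suc[OF sf Suc.prems(1), of m "\<lambda>_. 1"] by simp
  also have "\<dots> \<le> (\<integral>\<^sup>+ w. seqprod \<kappa> m w * 1 \<partial>hist \<nu> m)"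
    by (intro nn_integral_mono mult_left_mono Suc.prems(2)) auto
  also have "\<dots> \<le> 1" using Suc by simp
  finally show ?case .
qed

lemma seqprod_pos:
  fixes \<kappa> :: "nat \<Rightarrow> (nat \<Rightarrow> 'z) \<Rightarrow> 'z \<Rightarrow> real"
  shows "(\<And>s w z. s < t \<Longrightarrow> 0 < \<kappa> s w z) \<Longrightarrow> 0 < seqprod \<kappa> t w"
  unfolding seqprod_def by (intro prod_pos) auto

lemma seqprod_le_1:
  fixes \<kappa> :: "nat \<Rightarrow> (nat \<Rightarrow> 'z) \<Rightarrow> 'z \<Rightarrow> real"
  shows "(\<And>s w z. s < t \<Longrightarrow> 0 < \<kappa> s w z) \<Longrightarrow> (\<And>s w z. s < t \<Longrightarrow> \<kappa> s w z \<le> 1) \<Longrightarrow> seqprod \<kappa> t w \<le> 1"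
  unfolding seqprod_def by (intro prod_le_1) (auto simp: less_imp_le)

lemma ennreal_seqprod:
  fixes \<kappa> :: "nat \<Rightarrow> (nat \<Rightarrow> 'z) \<Rightarrow> 'z \<Rightarrow> real"
  assumes "\<And>s w z. s < t \<Longrightarrow> 0 < \<kappa> s w z"
  shows "ennreal (seqprod \<kappa> t w) = seqprod (\<lambda>s w z. ennreal (\<kappa> s w z)) t w"
  unfolding seqprod_def using assms by (intro prod_ennreal[symmetric]) (auto simp: less_imp_le)

lemma neg_ln_seqprod:
  fixes \<kappa> :: "nat \<Rightarrow> (nat \<Rightarrow> 'z) \<Rightarrow> 'z \<Rightarrow> real"
  assumes pos: "\<And>s w z. s < t \<Longrightarrow> 0 < \<kappa> s w z" and le: "\<And>s w z. s < t \<Longrightarrow> \<kappa> s w z \<le> 1"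
  shows "ennreal (- ln (seqprod \<kappa> t w)) = (\<Sum>s<t. ennreal (- ln (\<kappa> s (restrict w {1..s}) (w (Suc s)))))"
proof -
  have eq: "- ln (seqprod \<kappa> t w) = (\<Sum>s<t. - ln (\<kappa> s (restrict w {1..s}) (w (Suc s))))"
    unfolding seqprod_def using less_imp_neq[OF pos] by (subst ln_prod) (auto simp: sum_negf)
  have "0 \<le> - ln (\<kappa> s (restrict w {1..s}) (w (Suc s)))" if "s < t" for s
    using pos[OF that] le[OF that] by simp
  then show ?thesis unfolding eq by (intro sum_ennreal[symmetric]) auto
qed

text \<open>A memoryful channel with kernels \<open>k t a b\<close>: \<open>a\<close> and \<open>b\<close> are the two messages, \<open>A\<close>
  and \<open>B\<close> their alphabets, and the third argument of \<open>k t a b\<close> is the history of outputs at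
  times \<open>1, \<dots>, t\<close> that precedes the output at time \<open>t + 1\<close>.\<close>

locale feedback =
  fixes \<nu> :: "'z measure" and n :: nat and A :: "'a set" and B :: "'b set"
    and k :: "nat \<Rightarrow> 'a \<Rightarrow> 'b \<Rightarrow> (nat \<Rightarrow> 'z) \<Rightarrow> 'z \<Rightarrow> real"
  assumes sf: "sigma_finite_measure \<nu>"
    and A: "finite A" "A \<noteq> {}" and B: "finite B" "B \<noteq> {}"
    and k_meas: "\<And>t a b. t < n \<Longrightarrow> a \<in> A \<Longrightarrow> b \<in> B \<Longrightarrow> (\<lambda>(w, z). k t a b w z) \<in> borel_measurable (hist \<nu> t \<Otimes>\<^sub>M \<nu>)"
    and k_pos: "\<And>t a b w z. 0 < k t a b w z" and k_le_1: "\<And>t a b w z. k t a b w z \<le> 1"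
    and k_int: "\<And>t a b w. t < n \<Longrightarrow> a \<in> A \<Longrightarrow> b \<in> B \<Longrightarrow> w \<in> space (hist \<nu> t) \<Longrightarrow> (\<integral>\<^sup>+ z. ennreal (k t a b w z) \<partial>\<nu>) = 1"
begin

definition dens :: "nat \<Rightarrow> 'a \<Rightarrow> 'b \<Rightarrow> (nat \<Rightarrow> 'z) \<Rightarrow> real" where
  "dens t a b w = seqprod (\<lambda>s. k s a b) t w"

text \<open>Uniform independent messages, followed by a history of length \<open>t\<close> with
  density \<open>dens\<close>. Working with finite histories only, the expectation is a finite sum
  of integrals over a product measure.\<close>

definition expect :: "nat \<Rightarrow> ('a \<Rightarrow> 'b \<Rightarrow> (nat \<Rightarrow> 'z) \<Rightarrow> ennreal) \<Rightarrow> ennreal" where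
  "expect t F = ennreal (1 / (real (card A) * real (card B)))
    * (\<Sum>a\<in>A. \<Sum>b\<in>B. \<integral>\<^sup>+ w. ennreal (dens t a b w) * F a b w \<partial>hist \<nu> t)"

text \<open>Bayes' formula for \<open>a\<close> given \<open>b\<close> and the history; the uniform
  prior cancels.\<close>

definition posterior :: "nat \<Rightarrow> 'b \<Rightarrow> (nat \<Rightarrow> 'z) \<Rightarrow> 'a \<Rightarrow> real" where
  "posterior t b w a = dens t a b w / (\<Sum>a\<in>A. dens t a b w)"

definition pmix :: "nat \<Rightarrow> 'b \<Rightarrow> (nat \<Rightarrow> 'z) \<Rightarrow> 'z \<Rightarrow> real" where
  "pmix t b w z = (\<Sum>a\<in>A. posterior t b w a * k t a b w z)"

lemma dens_pos: "0 < dens t a b w"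
  unfolding dens_def by (intro seqprod_pos k_pos)

lemma dens_measurable: "t \<le> m \<Longrightarrow> m \<le> n \<Longrightarrow> a \<in> A \<Longrightarrow> b \<in> B \<Longrightarrow> dens t a b \<in> borel_measurable (hist \<nu> m)"
  unfolding dens_def[abs_def] by (intro seqprod_measurable_real k_meas) auto

lemma sum_dens_pos: "0 < (\<Sum>a\<in>A. dens t a b w)"
  using A by (intro sum_pos dens_pos) auto

lemma posterior_pos: "0 < posterior t b w a"
  unfolding posterior_def using dens_pos sum_dens_pos by simp

lemma posterior_sum: "(\<Sum>a\<in>A. posterior t b w a) = 1"
  unfolding posterior_def sum_divide_distrib[symmetric] using sum_dens_pos[of t b w] by simp

lemma posterior_measurable:
  "t \<le> m \<Longrightarrow> m \<le> n \<Longrightarrow> a \<in> A \<Longrightarrow> b \<in> B \<Longrightarrow> (\<lambda>w. posterior t b w a) \<in> borel_measurable (hist \<nu> m)"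
  unfolding posterior_def by (intro borel_measurable_divide borel_measurable_sum dens_measurable) auto

lemma pmix_pos: "0 < pmix t b w z"
  unfolding pmix_def using A posterior_pos k_pos by (intro sum_pos mult_pos_pos) auto

lemma pmix_le_1: "pmix t b w z \<le> 1"
proof -
  have "pmix t b w z \<le> (\<Sum>a\<in>A. posterior t b w a)"
    unfolding pmix_def using less_imp_le[OF posterior_pos] k_le_1 by (intro sum_mono mult_left_le) auto
  then show ?thesis by (simp add: posterior_sum)
qed

lemma pmix_measurable:
  assumes "t < n" "b \<in> B"
  shows "(\<lambda>(w, z). pmix t b w z) \<in> borel_measurable (hist \<nu> t \<Otimes>\<^sub>M \<nu>)"
proof -
  have "(\<lambda>x. posterior t b (fst x) a) \<in> borel_measurable (hist \<nu> t \<Otimes>\<^sub>M \<nu>)" if "a \<in> A" for a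
    using assms that by (intro measurable_compose[OF measurable_fst posterior_measurable]) auto
  then show ?thesis
    unfolding pmix_def split_beta' using k_meas[unfolded split_beta'] assms
    by (intro borel_measurable_sum borel_measurable_times) auto
qed

lemma expect_mono:
  "(\<And>a b w. a \<in> A \<Longrightarrow> b \<in> B \<Longrightarrow> w \<in> space (hist \<nu> t) \<Longrightarrow> F a b w \<le> G a b w) \<Longrightarrow> expect t F \<le> expect t G"
  unfolding expect_def by (intro mult_left_mono sum_mono nn_integral_mono) auto

lemma expect_cong:
  "(\<And>a b w. a \<in> A \<Longrightarrow> b \<in> B \<Longrightarrow> w \<in> space (hist \<nu> t) \<Longrightarrow> F a b w = G a b w) \<Longrightarrow> expect t F = expect t G"
  by (intro antisym expect_mono) auto

lemma expect_add:
  assumes "t \<le> n" "\<And>a b. a \<in> A \<Longrightarrow> b \<in> B \<Longrightarrow> F a b \<in> borel_measurable (hist \<nu> t)"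
    "\<And>a b. a \<in> A \<Longrightarrow> b \<in> B \<Longrightarrow> G a b \<in> borel_measurable (hist \<nu> t)"
  shows "expect t (\<lambda>a b w. F a b w + G a b w) = expect t F + expect t G"
proof -
  have "(\<integral>\<^sup>+ w. ennreal (dens t a b w) * (F a b w + G a b w) \<partial>hist \<nu> t)
    = (\<integral>\<^sup>+ w. ennreal (dens t a b w) * F a b w \<partial>hist \<nu> t) + (\<integral>\<^sup>+ w. ennreal (dens t a b w) * G a b w \<partial>hist \<nu> t)"
    if "a \<in> A" "b \<in> B" for a b
  proof -
    note [measurable] = dens_measurable[OF order_refl assms(1) that] assms(2)[OF that] assms(3)[OF that]
    show ?thesis unfolding distrib_left by (rule nn_integral_add) measurable
  qed
  then show ?thesis unfolding expect_def by (simp add: sum.distrib distrib_left)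
qed

lemma expect_cmult:
  assumes "t \<le> n" "\<And>a b. a \<in> A \<Longrightarrow> b \<in> B \<Longrightarrow> F a b \<in> borel_measurable (hist \<nu> t)"
  shows "expect t (\<lambda>a b w. C * F a b w) = C * expect t F"
proof -
  have "(\<integral>\<^sup>+ w. ennreal (dens t a b w) * (C * F a b w) \<partial>hist \<nu> t) = C * (\<integral>\<^sup>+ w. ennreal (dens t a b w) * F a b w \<partial>hist \<nu> t)"
    if "a \<in> A" "b \<in> B" for a b
  proof -
    note [measurable] = dens_measurable[OF order_refl assms(1) that] assms(2)[OF that]
    show ?thesis unfolding mult.left_commute[of _ C] by (rule nn_integral_cmult) measurable
  qed
  then show ?thesis unfolding expect_def by (simp add: sum_distrib_left mult.left_commute)
qed

lemma expect_sum:
  assumes "t \<le> n" "finite I" "\<And>i a b. i \<in> I \<Longrightarrow> a \<in> A \<Longrightarrow> b \<in> B \<Longrightarrow> F i a b \<in> borel_measurable (hist \<nu> t)"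
  shows "expect t (\<lambda>a b w. \<Sum>i\<in>I. F i a b w) = (\<Sum>i\<in>I. expect t (F i))"
  using assms(2,3)
proof (induction I)
  case empty
  then show ?case by (simp add: expect_def)
next
  case (insert i I)
  have "expect t (\<lambda>a b w. \<Sum>i\<in>insert i I. F i a b w) = expect t (\<lambda>a b w. F i a b w + (\<Sum>i\<in>I. F i a b w))"
    using insert.hyps by simp
  also have "\<dots> = expect t (F i) + expect t (\<lambda>a b w. \<Sum>i\<in>I. F i a b w)"
    using insert.prems by (intro expect_add assms(1) borel_measurable_sum) auto
  finally show ?case using insert by simp
qed

text \<open>A function of the first \<open>Suc t\<close> letters does not see the later kernels,
  which integrate out. The kernel of the last letter is then split off the density.\<close>

lemma expect_step:
  assumes "t < n" "\<And>a b. a \<in> A \<Longrightarrow> b \<in> B \<Longrightarrow> (\<lambda>(w, z). F a b w z) \<in> borel_measurable (hist \<nu> t \<Otimes>\<^sub>M \<nu>)"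
  shows "expect n (\<lambda>a b w. F a b (restrict w {1..t}) (w (Suc t)))
    = expect t (\<lambda>a b w. \<integral>\<^sup>+ z. ennreal (k t a b w z) * F a b w z \<partial>\<nu>)"
proof -
  have "(\<integral>\<^sup>+ w. ennreal (dens n a b w) * F a b (restrict w {1..t}) (w (Suc t)) \<partial>hist \<nu> n)
    = (\<integral>\<^sup>+ w. ennreal (dens t a b w) * (\<integral>\<^sup>+ z. ennreal (k t a b w z) * F a b w z \<partial>\<nu>) \<partial>hist \<nu> t)"
    if ab: "a \<in> A" "b \<in> B" for a b
  proof -
    let ?\<kappa> = "\<lambda>s w z. ennreal (k s a b w z)"
    have km: "(\<lambda>(w, z). ?\<kappa> s w z) \<in> borel_measurable (hist \<nu> s \<Otimes>\<^sub>M \<nu>)" if "s < n" for s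
      using k_meas[OF that ab] by (simp add: split_beta')
    have d: "ennreal (dens s a b w) = seqprod ?\<kappa> s w" for s w
      unfolding dens_def by (rule ennreal_seqprod) (rule k_pos)
    let ?G = "\<lambda>w. F a b (restrict w {1..t}) (w (Suc t))"
    have Gm: "?G \<in> borel_measurable (hist \<nu> (Suc t))"
      by (rule measurable_hist_step[OF _ assms(2)[OF ab]]) simp
    have "(\<integral>\<^sup>+ w. seqprod ?\<kappa> n w * ?G w \<partial>hist \<nu> n) = (\<integral>\<^sup>+ w. seqprod ?\<kappa> n w * ?G (restrict w {1..Suc t}) \<partial>hist \<nu> n)"
    proof -
      have "restrict (restrict w {1..Suc t}) {1..t} = restrict w {1..t}" for w :: "nat \<Rightarrow> 'z"
        by (auto simp: restrict_def fun_eq_iff)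
      then show ?thesis by simp
    qed
    also have "\<dots> = (\<integral>\<^sup>+ w. seqprod ?\<kappa> (Suc t) w * ?G w \<partial>hist \<nu> (Suc t))"
      using assms(1) by (intro nn_integral_seqprod_marginal[OF sf km _ Gm] k_int ab) auto
    also have "\<dots> = (\<integral>\<^sup>+ w. seqprod ?\<kappa> t w * (\<integral>\<^sup>+ z. ?\<kappa> t w z * ?G (w(Suc t := z)) \<partial>\<nu>) \<partial>hist \<nu> t)"
      using assms(1) by (intro nn_integral_seqprod_Suc[OF sf km Gm]) auto
    also have "\<dots> = (\<integral>\<^sup>+ w. seqprod ?\<kappa> t w * (\<integral>\<^sup>+ z. ?\<kappa> t w z * F a b w z \<partial>\<nu>) \<partial>hist \<nu> t)"
      by (intro nn_integral_cong arg_cong2[where f="(*)"] refl) (simp only: hist_upd_restrict fun_upd_same)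
    finally show ?thesis by (simp only: d)
  qed
  then show ?thesis unfolding expect_def by simp
qed

lemma expect_1: "t \<le> n \<Longrightarrow> expect t (\<lambda>_ _ _. C) = C"
proof -
  assume t: "t \<le> n"
  have "(\<integral>\<^sup>+ w. ennreal (dens t a b w) * C \<partial>hist \<nu> t) = C" if ab: "a \<in> A" "b \<in> B" for a b
  proof -
    let ?\<kappa> = "\<lambda>s w z. ennreal (k s a b w z)"
    have km: "(\<lambda>(w, z). ?\<kappa> s w z) \<in> borel_measurable (hist \<nu> s \<Otimes>\<^sub>M \<nu>)" if "s < t" for s
      using k_meas[of s, OF _ ab] that t by (simp add: split_beta')
    have d: "ennreal (dens s a b w) = seqprod ?\<kappa> s w" for s w
      unfolding dens_def by (rule ennreal_seqprod) (rule k_pos)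
    have "(\<integral>\<^sup>+ w. seqprod ?\<kappa> t w * C \<partial>hist \<nu> t) = (\<integral>\<^sup>+ w. seqprod ?\<kappa> 0 w * C \<partial>hist \<nu> 0)"
      using t by (intro nn_integral_seqprod_marginal[OF sf km, where F="\<lambda>_. C" and t=0] k_int ab) auto
    then show ?thesis by (simp add: d PiM_empty)
  qed
  then have "expect t (\<lambda>_ _ _. C) = ennreal (1 / (real (card A) * real (card B))) * (of_nat (card A) * (of_nat (card B) * C))"
    unfolding expect_def by simp
  also have "\<dots> = ennreal (1 / (real (card A) * real (card B)) * (real (card A) * real (card B))) * C"
    by (simp only: ennreal_of_nat_eq_real_of_nat ennreal_mult[OF of_nat_0_le_iff of_nat_0_le_iff]
      ennreal_mult[OF zero_le_divide_1_iff[THEN iffD2, OF mult_nonneg_nonneg[OF of_nat_0_le_iff of_nat_0_le_iff]]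
        mult_nonneg_nonneg[OF of_nat_0_le_iff of_nat_0_le_iff]] mult.assoc)
  also have "\<dots> = C" using A B by (simp add: card_gt_0_iff)
  finally show ?thesis .
qed

text \<open>Tower property: redrawing \<open>a\<close> from its posterior given \<open>b\<close> and
  the history does not change expectations. It is the passage from quantities averaged over the
  posterior to the signal actually sent, whose power is constrained.\<close>

lemma expect_posterior:
  assumes "t \<le> n" "\<And>a b. a \<in> A \<Longrightarrow> b \<in> B \<Longrightarrow> G a b \<in> borel_measurable (hist \<nu> t)"
  shows "expect t (\<lambda>a b w. \<Sum>a'\<in>A. ennreal (posterior t b w a') * G a' b w) = expect t G"
proof -
  have "(\<Sum>a\<in>A. \<integral>\<^sup>+ w. ennreal (dens t a b w) * (\<Sum>a'\<in>A. ennreal (posterior t b w a') * G a' b w) \<partial>hist \<nu> t)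
    = (\<Sum>a\<in>A. \<integral>\<^sup>+ w. ennreal (dens t a b w) * G a b w \<partial>hist \<nu> t)" if b: "b \<in> B" for b
  proof -
    have dm[measurable]: "a \<in> A \<Longrightarrow> dens t a b \<in> borel_measurable (hist \<nu> t)" for a
      using assms(1) b by (intro dens_measurable) auto
    have Gm[measurable]: "a \<in> A \<Longrightarrow> G a b \<in> borel_measurable (hist \<nu> t)" for a
      using assms(2) b by auto
    have pm[measurable]: "a \<in> A \<Longrightarrow> (\<lambda>w. posterior t b w a) \<in> borel_measurable (hist \<nu> t)" for a
      using assms(1) b by (intro posterior_measurable) auto
    have "(\<Sum>a\<in>A. \<integral>\<^sup>+ w. ennreal (dens t a b w) * (\<Sum>a'\<in>A. ennreal (posterior t b w a') * G a' b w) \<partial>hist \<nu> t)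
      = (\<integral>\<^sup>+ w. (\<Sum>a\<in>A. ennreal (dens t a b w) * (\<Sum>a'\<in>A. ennreal (posterior t b w a') * G a' b w)) \<partial>hist \<nu> t)"
      by (rule nn_integral_sum[symmetric]) measurable
    also have "\<dots> = (\<integral>\<^sup>+ w. (\<Sum>a\<in>A. ennreal (dens t a b w) * G a b w) \<partial>hist \<nu> t)"
    proof (rule nn_integral_cong)
      fix w
      have "(\<Sum>a\<in>A. ennreal (dens t a b w)) * ennreal (posterior t b w a') = ennreal (dens t a' b w)" for a'
        using sum_dens_pos[of t b w] less_imp_le[OF dens_pos]
        by (simp add: sum_ennreal posterior_def ennreal_mult[symmetric] sum_nonneg)
      then have "(\<Sum>a\<in>A. ennreal (dens t a b w)) * (ennreal (posterior t b w a') * G a' b w) = ennreal (dens t a' b w) * G a' b w" for a'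
        by (simp only: mult.assoc[symmetric])
      then show "(\<Sum>a\<in>A. ennreal (dens t a b w) * (\<Sum>a'\<in>A. ennreal (posterior t b w a') * G a' b w))
        = (\<Sum>a\<in>A. ennreal (dens t a b w) * G a b w)"
        unfolding sum_distrib_right[symmetric] by (simp only: sum_distrib_left)
    qed
    also have "\<dots> = (\<Sum>a\<in>A. \<integral>\<^sup>+ w. ennreal (dens t a b w) * G a b w \<partial>hist \<nu> t)"
      by (rule nn_integral_sum) measurable
    finally show ?thesis .
  qed
  then show ?thesis unfolding expect_def by (subst (1 2) sum.swap) simp
qed

text \<open>As \<open>F\<close> does not involve \<open>a\<close>, the tower property averages the
  true kernel over the posterior, and the average is the predictive density.\<close>

lemma expect_step_pmix:
  assumes "t < n" and F: "\<And>b. b \<in> B \<Longrightarrow> (\<lambda>(w, z). F b w z) \<in> borel_measurable (hist \<nu> t \<Otimes>\<^sub>M \<nu>)"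
  shows "expect n (\<lambda>a b w. F b (restrict w {1..t}) (w (Suc t)))
    = expect t (\<lambda>a b w. \<integral>\<^sup>+ z. ennreal (pmix t b w z) * F b w z \<partial>\<nu>)"
proof -
  interpret sigma_finite_measure \<nu> by (rule sf)
  let ?G = "\<lambda>a b w. \<integral>\<^sup>+ z. ennreal (k t a b w z) * F b w z \<partial>\<nu>"
  have kF: "(\<lambda>(w, z). ennreal (k t a b w z) * F b w z) \<in> borel_measurable (hist \<nu> t \<Otimes>\<^sub>M \<nu>)" if "a \<in> A" "b \<in> B" for a b
    using k_meas[OF assms(1) that] F[OF that(2)] by (simp add: split_beta')
  have Gm: "?G a b \<in> borel_measurable (hist \<nu> t)" if "a \<in> A" "b \<in> B" for a b
    by (rule borel_measurable_nn_integral[OF kF[OF that]])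
  have "expect n (\<lambda>a b w. F b (restrict w {1..t}) (w (Suc t))) = expect t ?G"
    by (rule expect_step[OF assms])
  also have "\<dots> = expect t (\<lambda>a b w. \<Sum>a'\<in>A. ennreal (posterior t b w a') * ?G a' b w)"
    using assms(1) by (intro expect_posterior[symmetric] Gm) auto
  also have "\<dots> = expect t (\<lambda>a b w. \<integral>\<^sup>+ z. ennreal (pmix t b w z) * F b w z \<partial>\<nu>)"
  proof (rule expect_cong)
    fix a b w assume b: "b \<in> B" and w: "w \<in> space (hist \<nu> t)"
    have m: "(\<lambda>z. ennreal (k t a' b w z) * F b w z) \<in> borel_measurable \<nu>" if "a' \<in> A" for a'
      using measurable_compose[OF measurable_Pair1'[OF w] kF[OF that b]] by simp
    have "(\<Sum>a'\<in>A. ennreal (posterior t b w a') * ?G a' b w)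
      = (\<Sum>a'\<in>A. \<integral>\<^sup>+ z. ennreal (posterior t b w a') * (ennreal (k t a' b w z) * F b w z) \<partial>\<nu>)"
      by (intro sum.cong refl nn_integral_cmult[symmetric] m)
    also have "\<dots> = (\<integral>\<^sup>+ z. (\<Sum>a'\<in>A. ennreal (posterior t b w a') * (ennreal (k t a' b w z) * F b w z)) \<partial>\<nu>)"
      by (intro nn_integral_sum[symmetric] borel_measurable_times_ennreal[OF measurable_const m]) auto
    also have "\<dots> = (\<integral>\<^sup>+ z. ennreal (pmix t b w z) * F b w z \<partial>\<nu>)"
    proof (rule nn_integral_cong)
      fix z
      have "ennreal (pmix t b w z) = (\<Sum>a'\<in>A. ennreal (posterior t b w a' * k t a' b w z))"
        unfolding pmix_def using less_imp_le[OF posterior_pos] less_imp_le[OF k_pos] by (intro sum_ennreal[symmetric]) auto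
      also have "\<dots> = (\<Sum>a'\<in>A. ennreal (posterior t b w a') * ennreal (k t a' b w z))"
        using less_imp_le[OF posterior_pos] less_imp_le[OF k_pos] by (intro sum.cong refl ennreal_mult) auto
      finally show "(\<Sum>a'\<in>A. ennreal (posterior t b w a') * (ennreal (k t a' b w z) * F b w z)) = ennreal (pmix t b w z) * F b w z"
        by (simp only: sum_distrib_right mult.assoc)
    qed
    finally show "(\<Sum>a'\<in>A. ennreal (posterior t b w a') * ?G a' b w) = (\<integral>\<^sup>+ z. ennreal (pmix t b w z) * F b w z \<partial>\<nu>)" .
  qed
  finally show ?thesis .
qed

text \<open>Chain rule: each predictive density is a quotient of successive sums of
  \<open>dens\<close>, so the product telescopes. The initial sum is \<open>card A\<close>.\<close>

lemma seqprod_pmix: "t \<le> n \<Longrightarrow> seqprod (\<lambda>s. pmix s b) t w = (\<Sum>a\<in>A. dens t a b w) / real (card A)"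
proof (induction t)
  case 0
  then show ?case using A by (simp add: dens_def)
next
  case (Suc t)
  have r: "dens t a b (restrict w {1..t}) = dens t a b w" for a
    unfolding dens_def by (rule seqprod_cong) auto
  have dS: "dens (Suc t) a b w = dens t a b w * k t a b (restrict w {1..t}) (w (Suc t))" for a
    unfolding dens_def by (rule seqprod_Suc)
  have "(\<Sum>a\<in>A. dens t a b w) * pmix t b (restrict w {1..t}) (w (Suc t)) = (\<Sum>a\<in>A. dens (Suc t) a b w)"
    unfolding pmix_def posterior_def r dS sum_distrib_left using sum_dens_pos[of t b w] by simp
  then show ?case using Suc by (simp add: seqprod_Suc)
qed

end

section \<open>Two forms of Fano's inequality\<close>

context feedback
begin

text \<open>Common core of both Fano bounds. With \<open>R = f * Q / S\<close>, the inequality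
  \<open>ln (R / 2) \<le> R / 2 - 1\<close> is averaged, and \<open>bound\<close> makes the mean of
  its right-hand side at most \<open>0\<close>; every logarithm then goes to the side on which it is
  nonnegative. The factor \<open>2\<close> is the loss in the decoding test function and costs
  \<open>ln 2\<close> once per block, not per letter.\<close>

lemma expect_log_le:
  assumes f: "\<And>a b w. 1 \<le> f a b w" and S: "\<And>a b w. 0 < S a b w" "\<And>a b w. S a b w \<le> 1"
    and Q: "\<And>a b w. 0 < Q a b w" "\<And>a b w. Q a b w \<le> (1 :: real)"
    and fm: "\<And>a b. a \<in> A \<Longrightarrow> b \<in> B \<Longrightarrow> f a b \<in> borel_measurable (hist \<nu> n)"
    and Sm: "\<And>a b. a \<in> A \<Longrightarrow> b \<in> B \<Longrightarrow> S a b \<in> borel_measurable (hist \<nu> n)"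
    and Qm: "\<And>a b. a \<in> A \<Longrightarrow> b \<in> B \<Longrightarrow> Q a b \<in> borel_measurable (hist \<nu> n)"
    and bound: "expect n (\<lambda>a b w. ennreal (f a b w * Q a b w / S a b w)) \<le> 2"
  shows "expect n (\<lambda>a b w. ennreal (ln (f a b w))) + expect n (\<lambda>a b w. ennreal (- ln (S a b w)))
    \<le> ennreal (ln 2) + expect n (\<lambda>a b w. ennreal (- ln (Q a b w)))"
proof -
  note m[measurable] = fm Sm Qm
  define R where "R a b w = f a b w * Q a b w / S a b w" for a b w
  have Rm: "(\<lambda>w. ennreal (R a b w)) \<in> borel_measurable (hist \<nu> n)" if "a \<in> A" "b \<in> B" for a b
    using m[OF that] unfolding R_def by measurable
  have R: "0 < R a b w" for a b w
    unfolding R_def using f[of a b w] S Q by (intro divide_pos_pos mult_pos_pos) auto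
  have lm: "(\<lambda>w. ennreal (ln (f a b w))) \<in> borel_measurable (hist \<nu> n)"
    "(\<lambda>w. ennreal (- ln (S a b w))) \<in> borel_measurable (hist \<nu> n)"
    "(\<lambda>w. ennreal (- ln (Q a b w))) \<in> borel_measurable (hist \<nu> n)" if "a \<in> A" "b \<in> B" for a b
    using m[OF that] by measurable
  have "expect n (\<lambda>a b w. ennreal (ln (f a b w))) + expect n (\<lambda>a b w. ennreal (- ln (S a b w))) + 1
    = expect n (\<lambda>a b w. ennreal (ln (f a b w)) + ennreal (- ln (S a b w)) + 1)"
  proof -
    have "expect n (\<lambda>a b w. ennreal (ln (f a b w)) + ennreal (- ln (S a b w)))
      = expect n (\<lambda>a b w. ennreal (ln (f a b w))) + expect n (\<lambda>a b w. ennreal (- ln (S a b w)))"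
      by (rule expect_add[OF order_refl]) (use lm in auto)
    moreover have "expect n (\<lambda>a b w. ennreal (ln (f a b w)) + ennreal (- ln (S a b w)) + 1)
      = expect n (\<lambda>a b w. ennreal (ln (f a b w)) + ennreal (- ln (S a b w))) + expect n (\<lambda>_ _ _. 1)"
      by (rule expect_add[OF order_refl]) (use lm in auto)
    ultimately show ?thesis by (simp only: expect_1 order_refl)
  qed
  also have "\<dots> \<le> expect n (\<lambda>a b w. ennreal (1 / 2) * ennreal (R a b w) + (ennreal (ln 2) + ennreal (- ln (Q a b w))))"
  proof (rule expect_mono)
    fix a b w
    have "ln (R a b w / 2) \<le> R a b w / 2 - 1"
      using R[of a b w] by (intro ln_le_minus_one) simp
    moreover have "ln (R a b w / 2) = ln (f a b w) + ln (Q a b w) - ln (S a b w) - ln 2"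
      using f[of a b w] S(1)[of a b w] Q(1)[of a b w] unfolding R_def by (simp add: ln_div ln_mult)
    ultimately have "ln (f a b w) + (- ln (S a b w)) + 1 \<le> 1 / 2 * R a b w + (ln 2 + (- ln (Q a b w)))"
      by simp
    moreover have "0 \<le> ln (f a b w)" "0 \<le> - ln (S a b w)" "0 \<le> - ln (Q a b w)" "0 \<le> 1 / 2 * R a b w" "0 \<le> ln (2 :: real)"
      using f[of a b w] S[of a b w] Q[of a b w] R[of a b w] by auto
    ultimately show "ennreal (ln (f a b w)) + ennreal (- ln (S a b w)) + 1
      \<le> ennreal (1 / 2) * ennreal (R a b w) + (ennreal (ln 2) + ennreal (- ln (Q a b w)))"
      using R[of a b w] by (simp only: ennreal_1[symmetric] ennreal_plus[symmetric] ennreal_mult[symmetric] zero_le_one add_nonneg_nonneg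
          less_imp_le zero_le_divide_1_iff zero_le_numeral ennreal_leI)
  qed
  also have "\<dots> = ennreal (1 / 2) * expect n (\<lambda>a b w. ennreal (R a b w)) + (ennreal (ln 2) + expect n (\<lambda>a b w. ennreal (- ln (Q a b w))))"
    using lm Rm by (subst expect_add; (subst expect_cmult)?; (subst expect_add)?) (auto simp: expect_1)
  also have "\<dots> \<le> ennreal (1 / 2) * 2 + (ennreal (ln 2) + expect n (\<lambda>a b w. ennreal (- ln (Q a b w))))"
    using bound unfolding R_def by (intro add_right_mono mult_left_mono) auto
  also have "ennreal (1 / 2) * 2 = 1"
    by (metis ennreal_1 ennreal_mult' ennreal_numeral field_sum_of_halves mult_2_right mult.commute times_divide_eq_left mult_1 zero_le_numeral nonzero_eq_divide_eq zero_neq_numeral)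
  finally have "1 + (expect n (\<lambda>a b w. ennreal (ln (f a b w))) + expect n (\<lambda>a b w. ennreal (- ln (S a b w))))
    \<le> 1 + (ennreal (ln 2) + expect n (\<lambda>a b w. ennreal (- ln (Q a b w))))"
    by (simp add: ac_simps)
  then show ?thesis by (simp add: ennreal_add_left_cancel_le)
qed

lemma nn_integral_pmix:
  assumes "t < n" "b \<in> B" "w \<in> space (hist \<nu> t)"
  shows "(\<integral>\<^sup>+ z. ennreal (pmix t b w z) \<partial>\<nu>) = 1"
proof -
  have km: "(\<lambda>z. ennreal (k t a b w z)) \<in> borel_measurable \<nu>" if "a \<in> A" for a
    using measurable_compose[OF measurable_Pair1'[OF assms(3)] k_meas[OF assms(1) that assms(2)]] by simp
  have "(\<integral>\<^sup>+ z. ennreal (pmix t b w z) \<partial>\<nu>) = (\<integral>\<^sup>+ z. (\<Sum>a\<in>A. ennreal (posterior t b w a) * ennreal (k t a b w z)) \<partial>\<nu>)"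
  proof (rule nn_integral_cong)
    fix z
    have "ennreal (pmix t b w z) = (\<Sum>a\<in>A. ennreal (posterior t b w a * k t a b w z))"
      unfolding pmix_def using less_imp_le[OF posterior_pos] less_imp_le[OF k_pos] by (intro sum_ennreal[symmetric]) auto
    also have "\<dots> = (\<Sum>a\<in>A. ennreal (posterior t b w a) * ennreal (k t a b w z))"
      using less_imp_le[OF posterior_pos] less_imp_le[OF k_pos] by (intro sum.cong refl ennreal_mult) auto
    finally show "ennreal (pmix t b w z) = (\<Sum>a\<in>A. ennreal (posterior t b w a) * ennreal (k t a b w z))" .
  qed
  also have "\<dots> = (\<Sum>a\<in>A. \<integral>\<^sup>+ z. ennreal (posterior t b w a) * ennreal (k t a b w z) \<partial>\<nu>)"
    by (intro nn_integral_sum borel_measurable_times_ennreal[OF measurable_const km]) auto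
  also have "\<dots> = (\<Sum>a\<in>A. ennreal (posterior t b w a))"
    using assms by (intro sum.cong refl) (simp add: nn_integral_cmult km k_int)
  also have "\<dots> = 1"
    using less_imp_le[OF posterior_pos] by (subst sum_ennreal) (auto simp: posterior_sum)
  finally show ?thesis .
qed

lemma expect_swap_sum:
  assumes "t \<le> n" "\<And>a b. a \<in> A \<Longrightarrow> b \<in> B \<Longrightarrow> F a b \<in> borel_measurable (hist \<nu> t)"
  shows "expect t F = ennreal (1 / (real (card A) * real (card B)))
    * (\<Sum>b\<in>B. \<integral>\<^sup>+ w. (\<Sum>a\<in>A. ennreal (dens t a b w) * F a b w) \<partial>hist \<nu> t)"
  unfolding expect_def
proof (subst sum.swap, intro arg_cong2[where f="(*)"] refl sum.cong nn_integral_sum[symmetric])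
  fix a b assume "b \<in> B" "a \<in> A"
  then show "(\<lambda>w. ennreal (dens t a b w) * F a b w) \<in> borel_measurable (hist \<nu> t)"
    using dens_measurable[OF order_refl assms(1)] assms(2) by auto
qed

text \<open>At most one message equals the guess \<open>d\<close>, so the value
  \<open>card X\<close> occurs at most once and all other terms together give at most
  \<open>card X\<close>.\<close>

lemma guess_sum_le:
  assumes "finite X"
  shows "(\<Sum>a\<in>X. if d = a then real (card X) else 1) \<le> 2 * real (card X)"
proof -
  have "(\<Sum>a\<in>X. if d = a then real (card X) else 1) \<le> (\<Sum>a\<in>X. (if d = a then real (card X) else 0) + 1)"
    by (intro sum_mono) auto
  also have "\<dots> \<le> 2 * real (card X)"
    using assms by (simp add: sum.distrib sum.delta' sum.delta)
  finally show ?thesis .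
qed

text \<open>In this form of Fano's inequality, comparing with the test function that is \<open>card A\<close> on
  correct decoding and \<open>1\<close> otherwise makes \<open>ln x \<le> x - 1\<close> sufficient.\<close>

lemma fano_known_message:
  assumes dec: "\<And>a. a \<in> A \<Longrightarrow> Measurable.pred (hist \<nu> n) (\<lambda>w. dec w = a)"
  shows "ennreal (ln (real (card A))) * expect n (\<lambda>a b w. if dec w = a then 1 else 0)
    \<le> ennreal (ln 2) + (\<Sum>t<n. expect t (\<lambda>a b w. \<integral>\<^sup>+ z. phi (pmix t b w z) \<partial>\<nu>))"
proof -
  define f where "f a b w = (if dec w = a then real (card A) else 1)" for a and b :: 'b and w
  define Q where "Q a b w = seqprod (\<lambda>s. pmix s b) n w" for a :: 'a and b w
  have cA: "1 \<le> real (card A)" using A by (simp add: Suc_leI card_gt_0_iff)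
  have f1: "1 \<le> f a b w" for a b w using cA by (simp add: f_def)
  have fm: "f a b \<in> borel_measurable (hist \<nu> n)" if "a \<in> A" for a b
    unfolding f_def[abs_def] using dec[OF that] by measurable
  have Qm: "Q a b \<in> borel_measurable (hist \<nu> n)" if "b \<in> B" for a b
    unfolding Q_def[abs_def] using that by (intro seqprod_measurable_real pmix_measurable) auto
  have Q: "0 < Q a b w" "Q a b w \<le> 1" for a b w
    unfolding Q_def using pmix_pos pmix_le_1 by (auto intro!: seqprod_pos seqprod_le_1)
  have dm: "dens n a b \<in> borel_measurable (hist \<nu> n)" if "a \<in> A" "b \<in> B" for a b
    using that by (intro dens_measurable) auto
  have d1: "dens n a b w \<le> 1" for a b w
    unfolding dens_def by (intro seqprod_le_1 k_pos k_le_1)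
  \<comment> \<open>Change of measure: the path density cancels and leaves the sum of
    \<open>f\<close> over \<open>a\<close> times \<open>Q\<close>. Here \<open>Q\<close>, the law of
    the outputs given \<open>b\<close> alone, has total mass at most \<open>1\<close>, and
    \<open>f\<close> sums to at most \<open>2 * card A\<close>.\<close>
  have "expect n (\<lambda>a b w. ennreal (f a b w * Q a b w / dens n a b w))
    = ennreal (1 / (real (card A) * real (card B)))
    * (\<Sum>b\<in>B. \<integral>\<^sup>+ w. (\<Sum>a\<in>A. ennreal (dens n a b w) * ennreal (f a b w * Q a b w / dens n a b w)) \<partial>hist \<nu> n)"
    using fm Qm dm by (intro expect_swap_sum) auto
  also have "\<dots> \<le> ennreal (1 / (real (card A) * real (card B))) * (\<Sum>b\<in>B. ennreal (2 * real (card A)))"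
  proof (intro mult_left_mono sum_mono)
    fix b assume b: "b \<in> B"
    have pm: "(\<lambda>(w, z). ennreal (pmix s b w z)) \<in> borel_measurable (hist \<nu> s \<Otimes>\<^sub>M \<nu>)" if "s < n" for s
      using pmix_measurable[OF that b] by (simp add: split_beta')
    have "(\<integral>\<^sup>+ w. (\<Sum>a\<in>A. ennreal (dens n a b w) * ennreal (f a b w * Q a b w / dens n a b w)) \<partial>hist \<nu> n)
      \<le> (\<integral>\<^sup>+ w. ennreal (2 * real (card A)) * seqprod (\<lambda>s w z. ennreal (pmix s b w z)) n w \<partial>hist \<nu> n)"
    proof (rule nn_integral_mono)
      fix w
      have "(\<Sum>a\<in>A. ennreal (dens n a b w) * ennreal (f a b w * Q a b w / dens n a b w)) = (\<Sum>a\<in>A. ennreal (f a b w * Q a b w))"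
        using dens_pos[of n _ b w] f1 Q(1) by (intro sum.cong refl) (simp add: ennreal_mult[symmetric] less_imp_le order_trans[OF zero_le_one f1] less_imp_neq[THEN not_sym])
      also have "\<dots> = ennreal ((\<Sum>a\<in>A. f a b w) * seqprod (\<lambda>s. pmix s b) n w)"
        unfolding sum_distrib_right Q_def[of _ b w, symmetric]
        using order_trans[OF zero_le_one f1] less_imp_le[OF Q(1)] by (subst sum_ennreal) (auto simp: Q_def)
      also have "\<dots> \<le> ennreal (2 * real (card A) * seqprod (\<lambda>s. pmix s b) n w)"
        using guess_sum_le[OF A(1), of "dec w"] pmix_pos
        by (intro ennreal_leI mult_right_mono) (auto simp: f_def intro!: less_imp_le[OF seqprod_pos])
      also have "\<dots> = ennreal (2 * real (card A)) * seqprod (\<lambda>s w z. ennreal (pmix s b w z)) n w"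
        using pmix_pos by (subst ennreal_mult) (auto simp: ennreal_seqprod intro!: less_imp_le[OF seqprod_pos])
      finally show "(\<Sum>a\<in>A. ennreal (dens n a b w) * ennreal (f a b w * Q a b w / dens n a b w))
        \<le> ennreal (2 * real (card A)) * seqprod (\<lambda>s w z. ennreal (pmix s b w z)) n w" .
    qed
    also have "\<dots> = ennreal (2 * real (card A)) * (\<integral>\<^sup>+ w. seqprod (\<lambda>s w z. ennreal (pmix s b w z)) n w \<partial>hist \<nu> n)"
      by (intro nn_integral_cmult seqprod_measurable_ennreal pm) auto
    also have "\<dots> \<le> ennreal (2 * real (card A)) * 1"
      using b by (intro mult_left_mono nn_integral_seqprod_le_1[OF sf pm]) (auto simp: nn_integral_pmix)
    finally show "(\<integral>\<^sup>+ w. (\<Sum>a\<in>A. ennreal (dens n a b w) * ennreal (f a b w * Q a b w / dens n a b w)) \<partial>hist \<nu> n)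
      \<le> ennreal (2 * real (card A))" by simp
  qed simp
  also have "\<dots> = ennreal (1 / (real (card A) * real (card B)) * (real (card B) * (2 * real (card A))))"
    by (subst ennreal_mult) (auto simp: ennreal_mult ennreal_of_nat_eq_real_of_nat)
  also have "1 / (real (card A) * real (card B)) * (real (card B) * (2 * real (card A))) = 2"
    using A B by (simp add: card_gt_0_iff)
  finally have bound: "expect n (\<lambda>a b w. ennreal (f a b w * Q a b w / dens n a b w)) \<le> 2" by simp
  have "ennreal (ln (real (card A))) * expect n (\<lambda>a b w. if dec w = a then 1 else 0)
    = expect n (\<lambda>a b w. ennreal (ln (real (card A))) * (if dec w = a then 1 else 0))"
    using dec by (intro expect_cmult[symmetric]) auto
  also have "\<dots> = expect n (\<lambda>a b w. ennreal (ln (f a b w)))"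
    by (intro expect_cong) (simp add: f_def)
  \<comment> \<open>The entropy of the outputs given both messages is nonnegative, so it may be
    added.\<close>
  also have "\<dots> \<le> expect n (\<lambda>a b w. ennreal (ln (f a b w))) + expect n (\<lambda>a b w. ennreal (- ln (dens n a b w)))"
    by (simp add: add_increasing2)
  also have "\<dots> \<le> ennreal (ln 2) + expect n (\<lambda>a b w. ennreal (- ln (Q a b w)))"
    by (rule expect_log_le) (use f1 dens_pos d1 Q fm dm Qm bound in auto)
  also have "expect n (\<lambda>a b w. ennreal (- ln (Q a b w))) = (\<Sum>t<n. expect n (\<lambda>a b w. ennreal (- ln (pmix t b (restrict w {1..t}) (w (Suc t))))))"
  proof -
    have "expect n (\<lambda>a b w. ennreal (- ln (Q a b w))) = expect n (\<lambda>a b w. \<Sum>t<n. ennreal (- ln (pmix t b (restrict w {1..t}) (w (Suc t)))))"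
      unfolding Q_def by (intro expect_cong neg_ln_seqprod pmix_pos pmix_le_1)
    also have "\<dots> = (\<Sum>t<n. expect n (\<lambda>a b w. ennreal (- ln (pmix t b (restrict w {1..t}) (w (Suc t))))))"
    proof (rule expect_sum)
      fix t a b assume "t \<in> {..<n}" "b \<in> B"
      then show "(\<lambda>w. ennreal (- ln (pmix t b (restrict w {1..t}) (w (Suc t))))) \<in> borel_measurable (hist \<nu> n)"
        using pmix_measurable[of t b] by (intro measurable_hist_step[where f="\<lambda>w z. ennreal (- ln (pmix t b w z))"]) (auto simp: split_beta')
    qed auto
    finally show ?thesis .
  qed
  \<comment> \<open>Each letter contributes the entropy of its predictive density, because
    \<open>pmix t\<close> is the density of the next letter given \<open>b\<close> and the
    past.\<close>
  also have "\<dots> = (\<Sum>t<n. expect t (\<lambda>a b w. \<integral>\<^sup>+ z. phi (pmix t b w z) \<partial>\<nu>))"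
  proof (intro sum.cong refl)
    fix t assume t: "t \<in> {..<n}"
    have "expect n (\<lambda>a b w. ennreal (- ln (pmix t b (restrict w {1..t}) (w (Suc t)))))
      = expect t (\<lambda>a b w. \<integral>\<^sup>+ z. ennreal (pmix t b w z) * ennreal (- ln (pmix t b w z)) \<partial>\<nu>)"
      using t pmix_measurable[of t] by (intro expect_step_pmix) (auto simp: split_beta')
    also have "\<dots> = expect t (\<lambda>a b w. \<integral>\<^sup>+ z. phi (pmix t b w z) \<partial>\<nu>)"
      using pmix_pos pmix_le_1 by (simp add: phi_def ennreal_mult[symmetric] less_imp_le)
    finally show "expect n (\<lambda>a b w. ennreal (- ln (pmix t b (restrict w {1..t}) (w (Suc t)))))
      = expect t (\<lambda>a b w. \<integral>\<^sup>+ z. phi (pmix t b w z) \<partial>\<nu>)" .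
  qed
  finally show ?thesis .
qed

text \<open>The receiver of \<open>b\<close> observes only \<open>v z\<close>. Its output density given \<open>b\<close> is replaced by the product of the conditional densities \<open>\<sigma>\<close> given \<open>b\<close> and the
  full history, and its output density by the memoryless \<open>q\<close>.\<close>

lemma fano_partial_observation:
  assumes V: "sigma_finite_measure V" and v: "v \<in> measurable \<nu> V"
    and dec: "\<And>b. b \<in> B \<Longrightarrow> Measurable.pred (hist V n) (\<lambda>x. dec x = b)"
    and \<sigma>m: "\<And>t b. t < n \<Longrightarrow> b \<in> B \<Longrightarrow> (\<lambda>(w, x). \<sigma> t b w x) \<in> borel_measurable (hist \<nu> t \<Otimes>\<^sub>M V)"
    and \<sigma>: "\<And>t b w x. 0 < \<sigma> t b w x" "\<And>t b w x. \<sigma> t b w x \<le> 1"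
    and qm: "q \<in> borel_measurable V" and q: "\<And>x. 0 < q x" "\<And>x. q x \<le> 1" and q1: "(\<integral>\<^sup>+ x. ennreal (q x) \<partial>V) \<le> 1"
    and marg: "\<And>t b w F. t < n \<Longrightarrow> b \<in> B \<Longrightarrow> w \<in> space (hist \<nu> t) \<Longrightarrow> F \<in> borel_measurable V
      \<Longrightarrow> (\<integral>\<^sup>+ z. ennreal (pmix t b w z) * F (v z) \<partial>\<nu>) = (\<integral>\<^sup>+ x. ennreal (\<sigma> t b w x) * F x \<partial>V)"
  shows "ennreal (ln (real (card B))) * expect n (\<lambda>a b w. if dec (\<lambda>i\<in>{1..n}. v (w i)) = b then 1 else 0)
      + (\<Sum>t<n. expect t (\<lambda>a b w. \<integral>\<^sup>+ x. phi (\<sigma> t b w x) \<partial>V))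
    \<le> ennreal (ln 2) + (\<Sum>t<n. expect t (\<lambda>a b w. \<integral>\<^sup>+ z. ennreal (k t a b w z) * ennreal (- ln (q (v z))) \<partial>\<nu>))"
proof -
  define vs where "vs w = (\<lambda>i\<in>{1..n}. v (w i))" for w :: "nat \<Rightarrow> 'z"
  have vsm: "vs \<in> measurable (hist \<nu> n) (hist V n)"
    unfolding vs_def by (intro measurable_restrict measurable_compose[OF _ v] measurable_component_singleton)
  define \<kappa> where "\<kappa> t b w z = \<sigma> t b w (v z)" for t b w z
  have \<kappa>m: "(\<lambda>(w, z). \<kappa> t b w z) \<in> borel_measurable (hist \<nu> t \<Otimes>\<^sub>M \<nu>)" if "t < n" "b \<in> B" for t b
  proof -
    have "(\<lambda>p. (fst p, v (snd p))) \<in> measurable (hist \<nu> t \<Otimes>\<^sub>M \<nu>) (hist \<nu> t \<Otimes>\<^sub>M V)"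
      by (intro measurable_Pair measurable_fst measurable_compose[OF measurable_snd v])
    from measurable_compose[OF this \<sigma>m[OF that]] show ?thesis
      by (simp add: \<kappa>_def split_beta')
  qed
  have \<kappa>: "0 < \<kappa> t b w z" "\<kappa> t b w z \<le> 1" for t b w z using \<sigma> by (auto simp: \<kappa>_def)
  define g where "g b x = (if dec x = b then real (card B) else 1)" for b and x :: "nat \<Rightarrow> _"
  define f where "f a b w = g b (vs w)" for a :: 'a and b w
  \<comment> \<open>This is not the density of the observed path but a product of one-step densities
    given \<open>b\<close> and the full past of \<open>z\<close>. Its mean logarithm produces the
    entropies on the left-hand side.\<close>
  define S where "S a b w = seqprod (\<lambda>s. \<kappa> s b) n w" for a :: 'a and b w
  define q' where "q' x = seqprod (\<lambda>s _. q) n x" for x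
  define Q where "Q a b w = q' (vs w)" for a :: 'a and b :: 'b and w
  have cB: "1 \<le> real (card B)" using B by (simp add: Suc_leI card_gt_0_iff)
  have g1: "1 \<le> g b x" for b x using cB by (simp add: g_def)
  have gm: "g b \<in> borel_measurable (hist V n)" if "b \<in> B" for b
    unfolding g_def[abs_def] using dec[OF that] by measurable
  have q'm: "q' \<in> borel_measurable (hist V n)"
    unfolding q'_def[abs_def] using measurable_compose[OF measurable_snd qm]
    by (intro seqprod_measurable_real) (auto simp: split_beta')
  have q': "0 < q' x" "q' x \<le> 1" for x
    unfolding q'_def using q by (auto intro!: seqprod_pos seqprod_le_1)
  have f1: "1 \<le> f a b w" for a b w using g1 by (simp add: f_def)
  have fm: "f a b \<in> borel_measurable (hist \<nu> n)" if "b \<in> B" for a b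
    unfolding f_def[abs_def] by (rule measurable_compose[OF vsm gm[OF that]])
  have Sm: "S a b \<in> borel_measurable (hist \<nu> n)" if "b \<in> B" for a b
    unfolding S_def[abs_def] using that by (intro seqprod_measurable_real \<kappa>m) auto
  have Qm: "Q a b \<in> borel_measurable (hist \<nu> n)" for a b
    unfolding Q_def[abs_def] by (rule measurable_compose[OF vsm q'm])
  have S: "0 < S a b w" "S a b w \<le> 1" for a b w
    unfolding S_def using \<kappa> by (auto intro!: seqprod_pos seqprod_le_1)
  have Q: "0 < Q a b w" "Q a b w \<le> 1" for a b w
    unfolding Q_def using q' by auto
  \<comment> \<open>Dividing by \<open>\<kappa>\<close> removes the density of the observed part:
    whatever the history, \<open>v\<close> carries \<open>?r\<close> times \<open>\<nu>\<close> to
    the reference measure \<open>V\<close>.\<close>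
  let ?r = "\<lambda>b s w z. ennreal (pmix s b w z / \<kappa> s b w z)"
  have rm: "(\<lambda>(w, z). ?r b s w z) \<in> borel_measurable (hist \<nu> s \<Otimes>\<^sub>M \<nu>)" if "s < n" "b \<in> B" for s b
    using pmix_measurable[OF that] \<kappa>m[OF that] by (simp add: split_beta')
  have rint: "(\<integral>\<^sup>+ z. ?r b s w z * F (v z) \<partial>\<nu>) = (\<integral>\<^sup>+ x. F x \<partial>V)"
    if "s < n" "b \<in> B" and w: "w \<in> space (hist \<nu> s)" and F: "F \<in> borel_measurable V" for s b w F
  proof -
    have \<sigma>w: "(\<lambda>x. \<sigma> s b w x) \<in> borel_measurable V"
      using measurable_compose[OF measurable_Pair1'[OF w] \<sigma>m[OF that(1,2)]] by simp
    have "(\<integral>\<^sup>+ z. ?r b s w z * F (v z) \<partial>\<nu>) = (\<integral>\<^sup>+ z. ennreal (pmix s b w z) * (ennreal (1 / \<sigma> s b w (v z)) * F (v z)) \<partial>\<nu>)"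
    proof (rule nn_integral_cong)
      fix z
      have "?r b s w z = ennreal (pmix s b w z) * ennreal (1 / \<sigma> s b w (v z))"
        using less_imp_le[OF \<sigma>(1)] less_imp_le[OF pmix_pos] by (subst ennreal_mult[symmetric]) (auto simp: \<kappa>_def)
      then show "?r b s w z * F (v z) = ennreal (pmix s b w z) * (ennreal (1 / \<sigma> s b w (v z)) * F (v z))"
        by (simp add: mult.assoc)
    qed
    also have "\<dots> = (\<integral>\<^sup>+ x. ennreal (\<sigma> s b w x) * (ennreal (1 / \<sigma> s b w x) * F x) \<partial>V)"
      using \<sigma>w F by (intro marg that borel_measurable_times_ennreal) auto
    also have "\<dots> = (\<integral>\<^sup>+ x. F x \<partial>V)"
    proof (rule nn_integral_cong)
      fix x
      have "ennreal (\<sigma> s b w x) * ennreal (1 / \<sigma> s b w x) = 1"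
        using \<sigma>(1)[of s b w x] by (simp add: ennreal_mult[symmetric])
      then show "ennreal (\<sigma> s b w x) * (ennreal (1 / \<sigma> s b w x) * F x) = F x"
        by (simp add: mult.assoc[symmetric])
    qed
    finally show ?thesis .
  qed
  have "expect n (\<lambda>a b w. ennreal (f a b w * Q a b w / S a b w))
    = ennreal (1 / (real (card A) * real (card B)))
    * (\<Sum>b\<in>B. \<integral>\<^sup>+ w. (\<Sum>a\<in>A. ennreal (dens n a b w) * ennreal (f a b w * Q a b w / S a b w)) \<partial>hist \<nu> n)"
    using fm Qm Sm by (intro expect_swap_sum) auto
  \<comment> \<open>Summed over \<open>a\<close>, the path density becomes a product of predictive
    densities; together with \<open>1 / S\<close> it is the product of the ratio kernels
    \<open>?r\<close>. The history of \<open>z\<close> then disappears, and an integral over the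
    observed path remains.\<close>
  also have "\<dots> = ennreal (1 / (real (card A) * real (card B)))
    * (\<Sum>b\<in>B. ennreal (real (card A)) * (\<integral>\<^sup>+ x. ennreal (g b x * q' x) \<partial>hist V n))"
  proof (intro arg_cong2[where f="(*)"] refl sum.cong)
    fix b assume b: "b \<in> B"
    have gq: "(\<lambda>x. ennreal (g b x * q' x)) \<in> borel_measurable (hist V n)"
      using gm[OF b] q'm by measurable
    have "(\<integral>\<^sup>+ w. (\<Sum>a\<in>A. ennreal (dens n a b w) * ennreal (f a b w * Q a b w / S a b w)) \<partial>hist \<nu> n)
      = (\<integral>\<^sup>+ w. ennreal (real (card A)) * (seqprod (?r b) n w * ennreal (g b (vs w) * q' (vs w))) \<partial>hist \<nu> n)"
    proof (rule nn_integral_cong)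
      fix w
      define D where "D = (\<Sum>a\<in>A. dens n a b w)"
      have D: "0 < D" unfolding D_def by (rule sum_dens_pos)
      have gq0: "0 \<le> g b (vs w) * q' (vs w)"
        using order_trans[OF zero_le_one g1] q'(1)[of "vs w"] by simp
      have pr: "seqprod (\<lambda>s. pmix s b) n w = D / real (card A)"
        unfolding D_def by (rule seqprod_pmix) simp
      have "seqprod (?r b) n w = ennreal (seqprod (\<lambda>s w z. pmix s b w z / \<kappa> s b w z) n w)"
        using pmix_pos \<kappa> by (intro ennreal_seqprod[symmetric]) auto
      \<comment> \<open>\<open>S\<close> ignores its first argument, hence the dummy
        \<open>undefined\<close>.\<close>
      also have "seqprod (\<lambda>s w z. pmix s b w z / \<kappa> s b w z) n w = D / real (card A) / S undefined b w"
        unfolding pr[symmetric] S_def seqprod_def by (rule prod_dividef)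
      finally have r: "seqprod (?r b) n w = ennreal (D / real (card A) / S undefined b w)" .
      have "(\<Sum>a\<in>A. ennreal (dens n a b w) * ennreal (f a b w * Q a b w / S a b w))
        = ennreal D * ennreal (g b (vs w) * q' (vs w) / S undefined b w)"
        unfolding D_def f_def Q_def S_def using less_imp_le[OF dens_pos]
        by (simp add: sum_distrib_right[symmetric])
      also have "\<dots> = ennreal (D * (g b (vs w) * q' (vs w) / S undefined b w))"
        using D gq0 S(1)[of undefined b w] by (intro ennreal_mult[symmetric]) auto
      also have "D * (g b (vs w) * q' (vs w) / S undefined b w)
        = real (card A) * (D / real (card A) / S undefined b w * (g b (vs w) * q' (vs w)))"
        using A by (simp add: card_gt_0_iff)
      also have "ennreal \<dots> = ennreal (real (card A)) * (seqprod (?r b) n w * ennreal (g b (vs w) * q' (vs w)))"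
        unfolding r using D gq0 S(1)[of undefined b w] by (subst ennreal_mult; (subst ennreal_mult)?) auto
      finally show "(\<Sum>a\<in>A. ennreal (dens n a b w) * ennreal (f a b w * Q a b w / S a b w))
        = ennreal (real (card A)) * (seqprod (?r b) n w * ennreal (g b (vs w) * q' (vs w)))" .
    qed
    also have "\<dots> = ennreal (real (card A)) * (\<integral>\<^sup>+ w. seqprod (?r b) n w * ennreal (g b (vs w) * q' (vs w)) \<partial>hist \<nu> n)"
      using b by (intro nn_integral_cmult borel_measurable_times_ennreal seqprod_measurable_ennreal rm measurable_compose[OF vsm gq]) auto
    also have "(\<integral>\<^sup>+ w. seqprod (?r b) n w * ennreal (g b (vs w) * q' (vs w)) \<partial>hist \<nu> n) = (\<integral>\<^sup>+ x. ennreal (g b x * q' x) \<partial>hist V n)"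
      unfolding vs_def using b by (intro nn_integral_seqprod_map[OF sf V _ v _ gq] rm rint) auto
    finally show "(\<integral>\<^sup>+ w. (\<Sum>a\<in>A. ennreal (dens n a b w) * ennreal (f a b w * Q a b w / S a b w)) \<partial>hist \<nu> n)
      = ennreal (real (card A)) * (\<integral>\<^sup>+ x. ennreal (g b x * q' x) \<partial>hist V n)" .
  qed
  also have "(\<Sum>b\<in>B. ennreal (real (card A)) * (\<integral>\<^sup>+ x. ennreal (g b x * q' x) \<partial>hist V n))
    = ennreal (real (card A)) * (\<integral>\<^sup>+ x. (\<Sum>b\<in>B. ennreal (g b x * q' x)) \<partial>hist V n)"
    using gm q'm by (subst nn_integral_sum) (auto simp: sum_distrib_left)
  \<comment> \<open>What is left is memoryless: \<open>q'\<close> has total mass at most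
    \<open>1\<close>, and \<open>g\<close> sums to at most \<open>2 * card B\<close> over the
    messages.\<close>
  also have "(\<integral>\<^sup>+ x. (\<Sum>b\<in>B. ennreal (g b x * q' x)) \<partial>hist V n)
    \<le> (\<integral>\<^sup>+ x. ennreal (2 * real (card B)) * seqprod (\<lambda>s _ x. ennreal (q x)) n x \<partial>hist V n)"
  proof (rule nn_integral_mono)
    fix x
    have "(\<Sum>b\<in>B. ennreal (g b x * q' x)) = ennreal ((\<Sum>b\<in>B. g b x) * q' x)"
      unfolding sum_distrib_right using order_trans[OF zero_le_one g1] less_imp_le[OF q'(1)]
      by (intro sum_ennreal) auto
    also have "\<dots> \<le> ennreal (2 * real (card B) * q' x)"
      using guess_sum_le[OF B(1), of "dec x"] less_imp_le[OF q'(1)] by (intro ennreal_leI mult_right_mono) (auto simp: g_def)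
    also have "\<dots> = ennreal (2 * real (card B)) * seqprod (\<lambda>s _ x. ennreal (q x)) n x"
      unfolding q'_def using q by (subst ennreal_mult) (auto simp: ennreal_seqprod intro!: less_imp_le[OF seqprod_pos])
    finally show "(\<Sum>b\<in>B. ennreal (g b x * q' x)) \<le> ennreal (2 * real (card B)) * seqprod (\<lambda>s _ x. ennreal (q x)) n x" .
  qed
  also have "\<dots> \<le> ennreal (2 * real (card B))"
  proof -
    have qm': "(\<lambda>(w, x). ennreal (q x)) \<in> borel_measurable (hist V s \<Otimes>\<^sub>M V)" for s
      unfolding split_beta' by (rule measurable_compose[OF measurable_compose[OF measurable_snd qm] measurable_ennreal])
    have "(\<integral>\<^sup>+ x. ennreal (2 * real (card B)) * seqprod (\<lambda>s _ x. ennreal (q x)) n x \<partial>hist V n)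
      = ennreal (2 * real (card B)) * (\<integral>\<^sup>+ x. seqprod (\<lambda>s _ x. ennreal (q x)) n x \<partial>hist V n)"
      by (intro nn_integral_cmult seqprod_measurable_ennreal qm') auto
    also have "\<dots> \<le> ennreal (2 * real (card B)) * 1"
      by (intro mult_left_mono nn_integral_seqprod_le_1[OF V qm'] q1) auto
    finally show ?thesis by simp
  qed
  finally have "expect n (\<lambda>a b w. ennreal (f a b w * Q a b w / S a b w))
    \<le> ennreal (1 / (real (card A) * real (card B))) * (ennreal (real (card A)) * ennreal (2 * real (card B)))"
    by (simp add: mult_left_mono)
  also have "\<dots> = ennreal (1 / (real (card A) * real (card B)) * (real (card A) * (2 * real (card B))))"
    by (subst (1 2) ennreal_mult) auto
  also have "1 / (real (card A) * real (card B)) * (real (card A) * (2 * real (card B))) = 2"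
    using A B by (simp add: card_gt_0_iff)
  finally have bound: "expect n (\<lambda>a b w. ennreal (f a b w * Q a b w / S a b w)) \<le> 2" by simp
  have "ennreal (ln (real (card B))) * expect n (\<lambda>a b w. if dec (vs w) = b then 1 else 0)
    = expect n (\<lambda>a b w. ennreal (ln (real (card B))) * (if dec (vs w) = b then 1 else 0))"
  proof (intro expect_cmult[symmetric])
    fix a b assume "b \<in> B"
    have "Measurable.pred (hist \<nu> n) (\<lambda>w. dec (vs w) = b)"
      by (rule measurable_compose[OF vsm dec[OF \<open>b \<in> B\<close>]])
    then show "(\<lambda>w. if dec (vs w) = b then 1 else 0) \<in> borel_measurable (hist \<nu> n)" by measurable
  qed simp
  also have "\<dots> = expect n (\<lambda>a b w. ennreal (ln (f a b w)))"
    by (intro expect_cong) (simp add: f_def g_def)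
  finally have e1: "ennreal (ln (real (card B))) * expect n (\<lambda>a b w. if dec (vs w) = b then 1 else 0)
    = expect n (\<lambda>a b w. ennreal (ln (f a b w)))" .
  have e2: "expect n (\<lambda>a b w. ennreal (- ln (S a b w))) = (\<Sum>t<n. expect t (\<lambda>a b w. \<integral>\<^sup>+ x. phi (\<sigma> t b w x) \<partial>V))"
  proof -
    have "expect n (\<lambda>a b w. ennreal (- ln (S a b w))) = expect n (\<lambda>a b w. \<Sum>t<n. ennreal (- ln (\<kappa> t b (restrict w {1..t}) (w (Suc t)))))"
      unfolding S_def by (intro expect_cong neg_ln_seqprod \<kappa>)
    also have "\<dots> = (\<Sum>t<n. expect n (\<lambda>a b w. ennreal (- ln (\<kappa> t b (restrict w {1..t}) (w (Suc t))))))"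
    proof (rule expect_sum)
      fix t a b assume "t \<in> {..<n}" "b \<in> B"
      then show "(\<lambda>w. ennreal (- ln (\<kappa> t b (restrict w {1..t}) (w (Suc t))))) \<in> borel_measurable (hist \<nu> n)"
        using \<kappa>m[of t b] by (intro measurable_hist_step[where f="\<lambda>w z. ennreal (- ln (\<kappa> t b w z))"]) (auto simp: split_beta')
    qed auto
    also have "\<dots> = (\<Sum>t<n. expect t (\<lambda>a b w. \<integral>\<^sup>+ x. phi (\<sigma> t b w x) \<partial>V))"
    proof (intro sum.cong refl)
      fix t assume t: "t \<in> {..<n}"
      have "expect n (\<lambda>a b w. ennreal (- ln (\<kappa> t b (restrict w {1..t}) (w (Suc t)))))
        = expect t (\<lambda>a b w. \<integral>\<^sup>+ z. ennreal (pmix t b w z) * ennreal (- ln (\<kappa> t b w z)) \<partial>\<nu>)"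
        using t \<kappa>m[of t] by (intro expect_step_pmix) (auto simp: split_beta')
      \<comment> \<open>Given \<open>b\<close> and the past, the observed letter has density
        \<open>\<sigma> t b w\<close>, so the mean of its negative logarithm is the entropy of that
        density.\<close>
      also have "\<dots> = expect t (\<lambda>a b w. \<integral>\<^sup>+ x. phi (\<sigma> t b w x) \<partial>V)"
      proof (rule expect_cong)
        fix a b w assume b: "b \<in> B" and w: "w \<in> space (hist \<nu> t)"
        have "(\<lambda>x. ennreal (- ln (\<sigma> t b w x))) \<in> borel_measurable V"
          using measurable_compose[OF measurable_Pair1'[OF w] \<sigma>m[of t b]] t b by simp
        from marg[OF _ b w this] t
        show "(\<integral>\<^sup>+ z. ennreal (pmix t b w z) * ennreal (- ln (\<kappa> t b w z)) \<partial>\<nu>) = (\<integral>\<^sup>+ x. phi (\<sigma> t b w x) \<partial>V)"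
          using \<sigma> by (simp add: phi_def ennreal_mult[symmetric] less_imp_le \<kappa>_def)
      qed
      finally show "expect n (\<lambda>a b w. ennreal (- ln (\<kappa> t b (restrict w {1..t}) (w (Suc t)))))
        = expect t (\<lambda>a b w. \<integral>\<^sup>+ x. phi (\<sigma> t b w x) \<partial>V)" .
    qed
    finally show ?thesis .
  qed
  have e3: "expect n (\<lambda>a b w. ennreal (- ln (Q a b w)))
    = (\<Sum>t<n. expect t (\<lambda>a b w. \<integral>\<^sup>+ z. ennreal (k t a b w z) * ennreal (- ln (q (v z))) \<partial>\<nu>))"
  proof -
    have "ennreal (- ln (Q a b w)) = (\<Sum>t<n. ennreal (- ln (q (v (w (Suc t))))))" for a b w
    proof -
      have "ennreal (- ln (Q a b w)) = (\<Sum>t<n. ennreal (- ln (q (vs w (Suc t)))))"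
        unfolding Q_def q'_def by (intro neg_ln_seqprod q)
      also have "\<dots> = (\<Sum>t<n. ennreal (- ln (q (v (w (Suc t))))))"
        by (intro sum.cong refl) (simp add: vs_def)
      finally show ?thesis .
    qed
    then have "expect n (\<lambda>a b w. ennreal (- ln (Q a b w))) = expect n (\<lambda>a b w. \<Sum>t<n. ennreal (- ln (q (v (w (Suc t))))))"
      by simp
    also have "\<dots> = (\<Sum>t<n. expect n (\<lambda>a b w. ennreal (- ln (q (v (w (Suc t)))))))"
    proof (rule expect_sum)
      fix t assume "t \<in> {..<n}"
      then have "(\<lambda>w. q (v (w (Suc t)))) \<in> borel_measurable (hist \<nu> n)"
        by (intro measurable_compose[OF _ qm] measurable_compose[OF _ v] measurable_component_singleton) auto
      then show "(\<lambda>w. ennreal (- ln (q (v (w (Suc t)))))) \<in> borel_measurable (hist \<nu> n)" by measurable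
    qed auto
    also have "\<dots> = (\<Sum>t<n. expect t (\<lambda>a b w. \<integral>\<^sup>+ z. ennreal (k t a b w z) * ennreal (- ln (q (v z))) \<partial>\<nu>))"
    proof (intro sum.cong refl)
      fix t assume t: "t \<in> {..<n}"
      have m: "(\<lambda>p. q (v (snd p))) \<in> borel_measurable (hist \<nu> t \<Otimes>\<^sub>M \<nu>)"
        by (intro measurable_compose[OF _ qm] measurable_compose[OF _ v] measurable_snd)
      show "expect n (\<lambda>a b w. ennreal (- ln (q (v (w (Suc t))))))
        = expect t (\<lambda>a b w. \<integral>\<^sup>+ z. ennreal (k t a b w z) * ennreal (- ln (q (v z))) \<partial>\<nu>)"
        using t m by (intro expect_step[where F="\<lambda>a b w z. ennreal (- ln (q (v z)))"]) (auto simp: split_beta')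
    qed
    finally show ?thesis .
  qed
  have "expect n (\<lambda>a b w. ennreal (ln (f a b w))) + expect n (\<lambda>a b w. ennreal (- ln (S a b w)))
    \<le> ennreal (ln 2) + expect n (\<lambda>a b w. ennreal (- ln (Q a b w)))"
    by (rule expect_log_le) (use f1 S Q fm Sm Qm bound in auto)
  then show ?thesis unfolding e1[symmetric] e2 e3 vs_def .
qed

end

section \<open>One channel use\<close>

definition vec_ref :: "(complex ^ 'n::finite) measure" where
  "vec_ref = distr (PiM UNIV (\<lambda>_. cplx_ref)) borel (\<lambda>v. \<chi> i. v i)"

lemma sets_vec_ref [simp, measurable_cong]: "sets (vec_ref :: (complex ^ 'n::finite) measure) = sets borel"
  by (simp add: vec_ref_def)

lemma space_vec_ref [simp]: "space (vec_ref :: (complex ^ 'n::finite) measure) = UNIV"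
  by (simp add: vec_ref_def)

lemma measurable_PiM_vec_ref:
  "(\<lambda>v. \<chi> i. v i) \<in> borel_measurable (\<Pi>\<^sub>M i\<in>(UNIV :: 'n::finite set). cplx_ref)"
proof -
  have "(\<lambda>v. v i) \<in> borel_measurable (\<Pi>\<^sub>M i\<in>(UNIV :: 'n::finite set). cplx_ref)" for i
    using measurable_component_singleton[of i UNIV "\<lambda>_. cplx_ref"] by (simp cong: measurable_cong_sets)
  then show ?thesis by measurable
qed

lemma nn_integral_vec_ref:
  assumes "F \<in> borel_measurable borel"
  shows "(\<integral>\<^sup>+ y. F y \<partial>(vec_ref :: (complex ^ 'n::finite) measure)) = (\<integral>\<^sup>+ v. F (\<chi> i. v i) \<partial>PiM UNIV (\<lambda>_. cplx_ref))"
  unfolding vec_ref_def using assms by (subst nn_integral_distr[OF measurable_PiM_vec_ref]) auto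

text \<open>Taking coordinates inverts the map in the definition. The image of
  \<open>vec_ref\<close> under it is the product measure, whose sigma-finiteness pulls back.\<close>

lemma sigma_finite_vec_ref: "sigma_finite_measure (vec_ref :: (complex ^ 'n::finite) measure)"
proof (rule sigma_finite_measure_distr)
  let ?P = "PiM (UNIV :: 'n set) (\<lambda>_. cplx_ref)"
  have f: "(\<lambda>x i. x $ i) \<in> measurable (vec_ref :: (complex ^ 'n) measure) ?P"
  proof (rule measurable_PiM_single')
    show "(\<lambda>x. x $ i) \<in> measurable (vec_ref :: (complex ^ 'n) measure) cplx_ref" for i
      by (simp cong: measurable_cong_sets) measurable
  qed auto
  then show "(\<lambda>x i. x $ i) \<in> measurable (vec_ref :: (complex ^ 'n) measure) ?P" .
  have "distr vec_ref ?P (\<lambda>x i. x $ i) = distr ?P ?P ((\<lambda>x i. x $ i) \<circ> (\<lambda>v. \<chi> i. v i))"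
    unfolding vec_ref_def using f
    by (intro distr_distr measurable_PiM_vec_ref) (simp cong: measurable_cong_sets)
  also have "\<dots> = distr ?P ?P (\<lambda>x. x)"
  proof -
    have "(\<lambda>x i. x $ i) \<circ> (\<lambda>v. \<chi> i. v i) = (\<lambda>x :: 'n \<Rightarrow> complex. x)"
      by (rule ext, rule ext) simp
    then show ?thesis by (simp only:)
  qed
  also have "\<dots> = ?P" by (rule distr_id)
  finally show "sigma_finite_measure (distr vec_ref ?P (\<lambda>x i. x $ i))"
    using sigma_finite_PiM_const[OF sigma_finite_cplx_ref, of "UNIV :: 'n set"] by simp
qed

text \<open>The squared norm is a sum over coordinates, so the density is a product and each
  coordinate is shifted separately.\<close>

lemma noise_vector_shift:
  fixes \<mu> :: "complex ^ 'n::finite"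
  assumes F: "F \<in> borel_measurable borel"
  shows "(\<integral>\<^sup>+ w. F (\<mu> + w) \<partial>noise_vector) = (\<integral>\<^sup>+ y. ennreal (exp (- (norm (y - \<mu>))\<^sup>2)) * F y \<partial>vec_ref)"
proof -
  let ?P = "PiM (UNIV :: 'n set) (\<lambda>_. cplx_ref)"
  have Fm: "(\<lambda>v. F (\<chi> i. v i)) \<in> borel_measurable ?P"
    by (rule measurable_compose[OF measurable_PiM_vec_ref F])
  have "(\<integral>\<^sup>+ y. ennreal (exp (- (norm (y - \<mu>))\<^sup>2)) * F y \<partial>vec_ref)
    = (\<integral>\<^sup>+ v. ennreal (exp (- (norm ((\<chi> i. v i) - \<mu>))\<^sup>2)) * F (\<chi> i. v i) \<partial>?P)"
    using F by (intro nn_integral_vec_ref) measurable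
  also have "\<dots> = (\<integral>\<^sup>+ v. (\<Prod>i\<in>UNIV. ennreal (exp (- (norm (v i - \<mu> $ i))\<^sup>2))) * F (\<chi> i. v i) \<partial>?P)"
    by (simp add: norm_vec_power2 prod_ennreal sum_negf[symmetric] exp_sum)
  also have "\<dots> = (\<integral>\<^sup>+ w. F (\<chi> i. (\<lambda>i\<in>UNIV. \<mu> $ i + w i) i) \<partial>PiM UNIV (\<lambda>_. complex_normal))"
  proof (rule nn_integral_PiM_transport[OF sigma_finite_cplx_ref sigma_finite_complex_normal finite _ _ _ Fm])
    fix i and G :: "complex \<Rightarrow> ennreal" assume "G \<in> borel_measurable cplx_ref"
    then have "G \<in> borel_measurable borel" by (simp cong: measurable_cong_sets)
    then show "(\<integral>\<^sup>+ z. ennreal (exp (- (norm (z - \<mu> $ i))\<^sup>2)) * G z \<partial>cplx_ref) = (\<integral>\<^sup>+ w. G (\<mu> $ i + w) \<partial>complex_normal)"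
      by (rule nn_integral_complex_normal_shift[symmetric])
  qed auto
  also have "\<dots> = (\<integral>\<^sup>+ w. F (\<mu> + (\<chi> i. w i)) \<partial>PiM UNIV (\<lambda>_. complex_normal))"
    by (intro nn_integral_cong arg_cong[where f=F]) (simp add: vec_eq_iff)
  also have "\<dots> = (\<integral>\<^sup>+ w. F (\<mu> + w) \<partial>noise_vector)"
    by (intro nn_integral_noise_vector[symmetric] measurable_compose[OF _ F]) measurable
  finally show ?thesis by simp
qed

lemma sets_rayleigh_matrix [simp, measurable_cong]: "sets (rayleigh_matrix :: (complex ^ 'm::finite ^ 'n::finite) measure) = sets borel"
  by (simp add: rayleigh_matrix_def)

lemma space_rayleigh_matrix [simp]: "space (rayleigh_matrix :: (complex ^ 'm::finite ^ 'n::finite) measure) = UNIV"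
  by (simp add: rayleigh_matrix_def)

lemma measurable_PiM_matrix:
  "(\<lambda>h. \<chi> i j. h (i, j)) \<in> borel_measurable (PiM (UNIV :: ('n::finite \<times> 'm::finite) set) (\<lambda>_. complex_normal))"
proof -
  have "(\<lambda>v. v p) \<in> borel_measurable (PiM (UNIV :: ('n \<times> 'm) set) (\<lambda>_. complex_normal))" for p
    using measurable_component_singleton[of p UNIV "\<lambda>_. complex_normal"] by (simp cong: measurable_cong_sets)
  then show ?thesis by measurable
qed

lemma prob_space_rayleigh_matrix: "prob_space (rayleigh_matrix :: (complex ^ 'm::finite ^ 'n::finite) measure)"
  unfolding rayleigh_matrix_def
  by (intro prob_space.prob_space_distr prob_space_PiM prob_space_complex_normal measurable_PiM_matrix)

lemma sigma_finite_rayleigh_matrix: "sigma_finite_measure (rayleigh_matrix :: (complex ^ 'm::finite ^ 'n::finite) measure)"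
  by (rule prob_space_imp_sigma_finite[OF prob_space_rayleigh_matrix])

lemma measurable_PiM_rows:
  "(\<lambda>r. \<chi> i. r i) \<in> borel_measurable (PiM (UNIV :: 'n::finite set) (\<lambda>_. noise_vector :: (complex ^ 'm::finite) measure))"
proof -
  have "(\<lambda>v. v i) \<in> borel_measurable (PiM (UNIV :: 'n set) (\<lambda>_. noise_vector :: (complex ^ 'm) measure))" for i
    using measurable_component_singleton[of i UNIV "\<lambda>_. noise_vector :: (complex ^ 'm) measure"] by (simp cong: measurable_cong_sets)
  then show ?thesis by measurable
qed

text \<open>The double index is split into rows, and each row is then bundled into a vector; this
  brings the matrix into the form in which antennas are handled.\<close>

lemma nn_integral_rayleigh_matrix:
  assumes F: "F \<in> borel_measurable borel"
  shows "(\<integral>\<^sup>+ H. F H \<partial>(rayleigh_matrix :: (complex ^ 'm::finite ^ 'n::finite) measure))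
    = (\<integral>\<^sup>+ r. F (\<chi> i. r i) \<partial>PiM UNIV (\<lambda>_. noise_vector))"
proof -
  let ?C = "PiM (UNIV :: 'm set) (\<lambda>_. complex_normal)"
  have C: "sigma_finite_measure ?C"
    by (intro sigma_finite_PiM_const sigma_finite_complex_normal finite)
  have "(\<integral>\<^sup>+ H. F H \<partial>(rayleigh_matrix :: (complex ^ 'm ^ 'n) measure))
    = (\<integral>\<^sup>+ h. F (\<chi> i j. h (i, j)) \<partial>PiM (UNIV \<times> UNIV) (\<lambda>_. complex_normal))"
    unfolding rayleigh_matrix_def using F by (subst nn_integral_distr[OF measurable_PiM_matrix]) auto
  also have "\<dots> = (\<integral>\<^sup>+ r. F (\<chi> i j. (\<lambda>p\<in>UNIV \<times> UNIV. r (fst p) (snd p)) (i, j)) \<partial>PiM UNIV (\<lambda>_. ?C))"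
    using measurable_compose[OF measurable_PiM_matrix F]
    by (intro nn_integral_PiM_Times prob_space_complex_normal finite) simp
  also have "\<dots> = (\<integral>\<^sup>+ r. F (\<chi> i. (\<lambda>i\<in>UNIV. \<chi> j. r i j) i) \<partial>PiM UNIV (\<lambda>_. ?C))"
    by simp
  also have "\<dots> = (\<integral>\<^sup>+ r. (\<Prod>i\<in>(UNIV :: 'n set). 1) * F (\<chi> i. r i) \<partial>PiM UNIV (\<lambda>_. noise_vector))"
  proof (rule nn_integral_PiM_transport[OF sigma_finite_noise_vector C finite, symmetric])
    show "(\<lambda>v. \<chi> j. v j) \<in> measurable ?C noise_vector"
      using measurable_PiM_vec by (simp cong: measurable_cong_sets)
    fix G :: "complex ^ 'm \<Rightarrow> ennreal" assume "G \<in> borel_measurable noise_vector"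
    then have "G \<in> borel_measurable borel" by (simp cong: measurable_cong_sets)
    then show "(\<integral>\<^sup>+ z. 1 * G z \<partial>noise_vector) = (\<integral>\<^sup>+ w. G (\<chi> j. w j) \<partial>?C)"
      by (simp add: nn_integral_noise_vector)
  qed (auto intro: measurable_compose[OF measurable_PiM_rows F])
  finally show ?thesis by simp
qed

lemma block_measurable:
  fixes G :: "('n::finite \<Rightarrow> ('a::finite, 'b::finite) row \<times> complex) \<Rightarrow> ennreal"
  assumes G: "G \<in> borel_measurable (PiM UNIV (\<lambda>_. antenna_ref))"
    and [measurable]: "f \<in> borel_measurable M" "g \<in> borel_measurable M" "h \<in> borel_measurable M"
  shows "(\<lambda>x. G (\<lambda>i. ((f x $ i, g x $ i), h x $ i))) \<in> borel_measurable M"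
proof (rule measurable_compose[OF _ G], rule measurable_PiM_single')
  show "(\<lambda>x. ((f x $ i, g x $ i), h x $ i)) \<in> measurable M antenna_ref" for i
    by measurable
qed (auto simp: space_pair_measure)

text \<open>The model groups coefficients by matrices, the entropy argument by antennas. Antenna
  \<open>i\<close> collects row \<open>i\<close> of both matrices and entry \<open>i\<close> of the
  output.\<close>

lemma nn_integral_block:
  fixes G :: "('n::finite \<Rightarrow> ('a::finite, 'b::finite) row \<times> complex) \<Rightarrow> ennreal"
  assumes G: "G \<in> borel_measurable (PiM UNIV (\<lambda>_. antenna_ref))"
  shows "(\<integral>\<^sup>+ Ha. \<integral>\<^sup>+ Hb. \<integral>\<^sup>+ y. G (\<lambda>i. ((Ha $ i, Hb $ i), y $ i)) \<partial>vec_ref \<partial>rayleigh_matrix \<partial>rayleigh_matrix)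
    = (\<integral>\<^sup>+ z. G z \<partial>PiM UNIV (\<lambda>_. antenna_ref))"
proof -
  let ?A = "PiM (UNIV :: 'n set) (\<lambda>_. noise_vector :: (complex ^ 'a) measure)"
  let ?B = "PiM (UNIV :: 'n set) (\<lambda>_. noise_vector :: (complex ^ 'b) measure)"
  let ?R = "PiM (UNIV :: 'n set) (\<lambda>_. row_law :: ('a, 'b) row measure)"
  let ?C = "PiM (UNIV :: 'n set) (\<lambda>_. cplx_ref)"
  interpret vr: sigma_finite_measure "vec_ref :: (complex ^ 'n) measure" by (rule sigma_finite_vec_ref)
  interpret rb: sigma_finite_measure "rayleigh_matrix :: (complex ^ 'b ^ 'n) measure" by (rule sigma_finite_rayleigh_matrix)
  interpret pc: sigma_finite_measure ?C
    by (intro sigma_finite_PiM_const sigma_finite_cplx_ref finite)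
  have m1: "(\<lambda>y. G (\<lambda>i. ((Ha $ i, Hb $ i), y $ i))) \<in> borel_measurable borel" for Ha Hb
    by (intro block_measurable G) auto
  have m2: "(\<lambda>Hb. \<integral>\<^sup>+ y. G (\<lambda>i. ((Ha $ i, Hb $ i), y $ i)) \<partial>vec_ref) \<in> borel_measurable borel" for Ha
    by (intro vr.borel_measurable_nn_integral) (unfold split_beta', intro block_measurable[OF G], measurable)
  have m3: "(\<lambda>Ha. \<integral>\<^sup>+ Hb. \<integral>\<^sup>+ y. G (\<lambda>i. ((Ha $ i, Hb $ i), y $ i)) \<partial>vec_ref \<partial>rayleigh_matrix) \<in> borel_measurable borel"
    by (intro rb.borel_measurable_nn_integral, unfold split_beta', intro vr.borel_measurable_nn_integral)
      (unfold split_beta', intro block_measurable[OF G], measurable)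
  have "(\<integral>\<^sup>+ Ha. \<integral>\<^sup>+ Hb. \<integral>\<^sup>+ y. G (\<lambda>i. ((Ha $ i, Hb $ i), y $ i)) \<partial>vec_ref \<partial>rayleigh_matrix \<partial>rayleigh_matrix)
    = (\<integral>\<^sup>+ r. \<integral>\<^sup>+ s. \<integral>\<^sup>+ v. G (\<lambda>i. ((r i, s i), v i)) \<partial>?C \<partial>?B \<partial>?A)"
    by (subst nn_integral_rayleigh_matrix[OF m3], intro nn_integral_cong,
        subst nn_integral_rayleigh_matrix[OF m2], intro nn_integral_cong, subst nn_integral_vec_ref[OF m1]) simp
  also have "\<dots> = (\<integral>\<^sup>+ x. \<integral>\<^sup>+ v. G (\<lambda>i. (x i, v i)) \<partial>?C \<partial>?R)"
  proof -
    have "(\<lambda>p i. (fst p i, snd p i)) \<in> measurable (?R \<Otimes>\<^sub>M ?C) (PiM UNIV (\<lambda>_. antenna_ref))"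
    proof (rule measurable_PiM_single')
      show "(\<lambda>p. (fst p i, snd p i)) \<in> measurable (?R \<Otimes>\<^sub>M ?C) antenna_ref" for i
        by (intro measurable_Pair measurable_compose[OF measurable_fst] measurable_compose[OF measurable_snd] measurable_component_singleton) auto
    qed (auto simp: space_pair_measure)
    from measurable_compose[OF this G]
    have m: "(\<lambda>x. \<integral>\<^sup>+ v. G (\<lambda>i. (x i, v i)) \<partial>?C) \<in> borel_measurable ?R"
      by (intro pc.borel_measurable_nn_integral) (simp add: split_beta')
    show ?thesis
      using nn_integral_PiM_pair[OF sigma_finite_noise_vector sigma_finite_noise_vector finite m] by (simp add: restrict_UNIV)
  qed
  also have "\<dots> = (\<integral>\<^sup>+ z. G z \<partial>PiM UNIV (\<lambda>_. antenna_ref))"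
    using nn_integral_PiM_pair[OF sigma_finite_row_law sigma_finite_cplx_ref finite G] by (simp add: restrict_UNIV)
  finally show ?thesis .
qed

section \<open>The outputs of both receivers in one channel use\<close>

type_synonym ('m1, 'm2, 'n1, 'n2) step = "('m1, 'm2, 'n1, 'n2) channel \<times> (complex ^ 'n1) \<times> (complex ^ 'n2)"

abbreviation step_ref :: "('m1::finite, 'm2::finite, 'n1::finite, 'n2::finite) step measure" where
  "step_ref \<equiv> channel_dist \<Otimes>\<^sub>M (vec_ref \<Otimes>\<^sub>M vec_ref)"

lemma prob_space_channel_dist: "prob_space (channel_dist :: ('m1::finite, 'm2::finite, 'n1::finite, 'n2::finite) channel measure)"
  unfolding channel_dist_def by (intro prob_space_pair prob_space_rayleigh_matrix)

lemma sigma_finite_channel_dist: "sigma_finite_measure (channel_dist :: ('m1::finite, 'm2::finite, 'n1::finite, 'n2::finite) channel measure)"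
  by (rule prob_space_imp_sigma_finite[OF prob_space_channel_dist])

lemma prob_space_noise_dist: "prob_space (noise_dist :: ((complex ^ 'n1::finite) \<times> (complex ^ 'n2::finite)) measure)"
  unfolding noise_dist_def by (intro prob_space_pair prob_space_noise_vector)

lemma sigma_finite_noise_dist: "sigma_finite_measure (noise_dist :: ((complex ^ 'n1::finite) \<times> (complex ^ 'n2::finite)) measure)"
  by (rule prob_space_imp_sigma_finite[OF prob_space_noise_dist])

lemma sigma_finite_step_ref: "sigma_finite_measure (step_ref :: ('m1::finite, 'm2::finite, 'n1::finite, 'n2::finite) step measure)"
  by (intro sigma_finite_pair sigma_finite_channel_dist sigma_finite_vec_ref)

lemma sets_channel_dist [measurable_cong]:
  "sets (channel_dist :: ('m1::finite, 'm2::finite, 'n1::finite, 'n2::finite) channel measure)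
    = sets (borel \<Otimes>\<^sub>M (borel \<Otimes>\<^sub>M (borel \<Otimes>\<^sub>M borel)))"
  unfolding channel_dist_def by (intro sets_pair_measure_cong) auto

lemma sets_channel_dist_borel:
  "sets (channel_dist :: ('m1::finite, 'm2::finite, 'n1::finite, 'n2::finite) channel measure) = sets borel"
  by (simp only: sets_channel_dist borel_prod)

lemma space_channel_dist [simp]: "space (channel_dist :: ('m1::finite, 'm2::finite, 'n1::finite, 'n2::finite) channel measure) = UNIV"
  unfolding channel_dist_def by (auto simp: space_pair_measure)

lemma sets_noise_dist [measurable_cong]:
  "sets (noise_dist :: ((complex ^ 'n1::finite) \<times> (complex ^ 'n2::finite)) measure) = sets (borel \<Otimes>\<^sub>M borel)"
  unfolding noise_dist_def by (intro sets_pair_measure_cong) auto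

lemma nn_integral_channel_dist:
  assumes F: "F \<in> borel_measurable (channel_dist :: ('m1::finite, 'm2::finite, 'n1::finite, 'n2::finite) channel measure)"
  shows "(\<integral>\<^sup>+ H. F H \<partial>channel_dist) = (\<integral>\<^sup>+ H11. \<integral>\<^sup>+ H12. \<integral>\<^sup>+ H21. \<integral>\<^sup>+ H22. F (H11, H12, H21, H22)
    \<partial>rayleigh_matrix \<partial>rayleigh_matrix \<partial>rayleigh_matrix \<partial>rayleigh_matrix)"
proof -
  note sf = sigma_finite_rayleigh_matrix
  have F4: "F \<in> borel_measurable (borel \<Otimes>\<^sub>M (borel \<Otimes>\<^sub>M (borel \<Otimes>\<^sub>M borel)))"
    using F by (simp cong: measurable_cong_sets add: sets_channel_dist)
  have F1: "(\<lambda>x. F (a, x)) \<in> borel_measurable (borel \<Otimes>\<^sub>M (borel \<Otimes>\<^sub>M borel))" for a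
    by (rule measurable_compose[OF measurable_Pair1' F4]) simp
  have F2: "(\<lambda>x. F (a, b, x)) \<in> borel_measurable (borel \<Otimes>\<^sub>M borel)" for a b
    by (rule measurable_compose[OF measurable_Pair1' F1]) simp
  have r: "sets (rayleigh_matrix \<Otimes>\<^sub>M rayleigh_matrix) = sets (borel \<Otimes>\<^sub>M borel)"
     "sets (rayleigh_matrix \<Otimes>\<^sub>M (rayleigh_matrix \<Otimes>\<^sub>M rayleigh_matrix)) = sets (borel \<Otimes>\<^sub>M (borel \<Otimes>\<^sub>M borel))"
    by (intro sets_pair_measure_cong; simp)+
  show ?thesis
    unfolding channel_dist_def
    apply (subst nn_integral_pair[OF sigma_finite_pair[OF sf sigma_finite_pair[OF sf sf]] F[unfolded channel_dist_def]])
    apply (intro nn_integral_cong)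
    apply (subst nn_integral_pair[OF sigma_finite_pair[OF sf sf]])
     apply (subst measurable_cong_sets[OF _ refl, where M'="borel \<Otimes>\<^sub>M (borel \<Otimes>\<^sub>M borel)"])
      apply (intro sets_pair_measure_cong; simp)
     apply (rule F1)
    apply (intro nn_integral_cong)
    apply (rule nn_integral_pair[OF sf])
    apply (subst measurable_cong_sets[OF _ refl, where M'="borel \<Otimes>\<^sub>M borel"])
     apply (intro sets_pair_measure_cong; simp)
    apply (rule F2)
    done
qed

lemma measurable_mult_vec [measurable (raw)]:
  fixes f :: "'x \<Rightarrow> complex ^ 'm::finite ^ 'n::finite"
  assumes [measurable]: "f \<in> borel_measurable M" "g \<in> borel_measurable M"
  shows "(\<lambda>x. f x *v g x) \<in> borel_measurable M"
  unfolding matrix_vector_mult_def by measurable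

definition rx_density :: "complex ^ 'a::finite ^ 'n::finite \<Rightarrow> complex ^ 'b::finite ^ 'n \<Rightarrow> complex ^ 'a \<Rightarrow> complex ^ 'b \<Rightarrow> complex ^ 'n \<Rightarrow> real" where
  "rx_density Ha Hb xa xb y = exp (- (norm (y - (Ha *v xa + Hb *v xb)))\<^sup>2)"

text \<open>The observation contains all four matrices, since a receiver knows every channel, but
  the density involves only \<open>H\<^sub>2\<^sub>1\<close> and
  \<open>H\<^sub>2\<^sub>2\<close>.\<close>

definition rx2_density :: "complex ^ 'a::finite \<Rightarrow> complex ^ 'b::finite
    \<Rightarrow> ('a, 'b, 'n1::finite, 'n2::finite) channel \<times> (complex ^ 'n2) \<Rightarrow> real" where
  "rx2_density xa xb v = rx_density (fst (snd (snd (fst v)))) (snd (snd (snd (fst v)))) xa xb (snd v)"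

definition step_density :: "complex ^ 'a::finite \<Rightarrow> complex ^ 'b::finite \<Rightarrow> ('a, 'b, 'n1::finite, 'n2::finite) step \<Rightarrow> real" where
  "step_density xa xb z = rx_density (fst (fst z)) (fst (snd (fst z))) xa xb (fst (snd z)) * rx2_density xa xb (fst z, snd (snd z))"

abbreviation rx2_ref :: "(('a::finite, 'b::finite, 'n1::finite, 'n2::finite) channel \<times> (complex ^ 'n2)) measure" where
  "rx2_ref \<equiv> channel_dist \<Otimes>\<^sub>M vec_ref"

definition block :: "complex ^ 'a ^ 'n \<Rightarrow> complex ^ 'b ^ 'n \<Rightarrow> complex ^ 'n \<Rightarrow> 'n::finite \<Rightarrow> ('a::finite, 'b::finite) row \<times> complex" where
  "block Ha Hb y = (\<lambda>i. ((Ha $ i, Hb $ i), y $ i))"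

definition block2 :: "('a::finite, 'b::finite, 'n1::finite, 'n2::finite) channel \<times> (complex ^ 'n2) \<Rightarrow> 'n2 \<Rightarrow> ('a, 'b) row \<times> complex" where
  "block2 v = block (fst (snd (snd (fst v)))) (snd (snd (snd (fst v)))) (snd v)"

lemma rx_density_pos: "0 < rx_density Ha Hb xa xb y"
  and rx_density_le_1: "rx_density Ha Hb xa xb y \<le> 1"
  by (auto simp: rx_density_def)

lemma rx2_density_pos: "0 < rx2_density xa xb v"
  and rx2_density_le_1: "rx2_density xa xb v \<le> 1"
  by (auto simp: rx2_density_def rx_density_pos rx_density_le_1)

lemma step_density_pos: "0 < step_density xa xb v"
  and step_density_le_1: "step_density xa xb v \<le> 1"
  by (auto simp: step_density_def rx2_density_pos rx2_density_le_1 rx_density_pos rx_density_le_1 less_imp_le intro!: mult_pos_pos mult_le_one)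

lemma rx_density_prod: "rx_density Ha Hb xa xb y = (\<Prod>i\<in>UNIV. antenna_density xa xb (block Ha Hb y i))"
  by (simp add: rx_density_def antenna_density_def block_def norm_vec_power2 sum_negf[symmetric] exp_sum
      dotp_def matrix_vector_mult_def)

lemma rx2_density_prod: "rx2_density xa xb v = (\<Prod>i\<in>UNIV. antenna_density xa xb (block2 v i))"
  by (simp add: rx2_density_def rx_density_prod block2_def)

lemma rx_density_measurable:
  assumes [measurable]: "Ha \<in> borel_measurable M" "Hb \<in> borel_measurable M" "f \<in> borel_measurable M"
    "g \<in> borel_measurable M" "y \<in> borel_measurable M"
  shows "(\<lambda>x. rx_density (Ha x) (Hb x) (f x) (g x) (y x)) \<in> borel_measurable M"
  unfolding rx_density_def by measurable

lemma measurable_channel_parts: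
  assumes "H \<in> measurable M (channel_dist :: ('a::finite, 'b::finite, 'n1::finite, 'n2::finite) channel measure)"
  shows "(\<lambda>x. fst (H x)) \<in> borel_measurable M" "(\<lambda>x. fst (snd (H x))) \<in> borel_measurable M"
    "(\<lambda>x. fst (snd (snd (H x)))) \<in> borel_measurable M" "(\<lambda>x. snd (snd (snd (H x)))) \<in> borel_measurable M"
proof -
  have H[measurable]: "H \<in> measurable M (borel \<Otimes>\<^sub>M (borel \<Otimes>\<^sub>M (borel \<Otimes>\<^sub>M borel)))"
    using assms by (simp cong: measurable_cong_sets add: sets_channel_dist)
  show "(\<lambda>x. fst (H x)) \<in> borel_measurable M" "(\<lambda>x. fst (snd (H x))) \<in> borel_measurable M"
    "(\<lambda>x. fst (snd (snd (H x)))) \<in> borel_measurable M" "(\<lambda>x. snd (snd (snd (H x)))) \<in> borel_measurable M"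
    by measurable
qed

lemma rx2_density_measurable:
  assumes "f \<in> borel_measurable M" "g \<in> borel_measurable M"
    and v: "v \<in> measurable M (rx2_ref :: (('a::finite, 'b::finite, 'n1::finite, 'n2::finite) channel \<times> (complex ^ 'n2)) measure)"
  shows "(\<lambda>x. rx2_density (f x) (g x) (v x)) \<in> borel_measurable M"
proof -
  have y: "(\<lambda>x. snd (v x)) \<in> borel_measurable M"
    using measurable_compose[OF v measurable_snd] by (simp cong: measurable_cong_sets)
  note H = measurable_channel_parts[OF measurable_compose[OF v measurable_fst]]
  show ?thesis unfolding rx2_density_def by (intro rx_density_measurable H y assms)
qed

lemma step_parts_measurable:
  assumes z: "z \<in> measurable M (step_ref :: ('a::finite, 'b::finite, 'n1::finite, 'n2::finite) step measure)"
  shows "(\<lambda>x. fst (z x)) \<in> measurable M channel_dist" "(\<lambda>x. fst (snd (z x))) \<in> borel_measurable M"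
    "(\<lambda>x. snd (snd (z x))) \<in> borel_measurable M" "(\<lambda>x. (fst (z x), snd (snd (z x)))) \<in> measurable M rx2_ref"
proof -
  show f: "(\<lambda>x. fst (z x)) \<in> measurable M channel_dist" by (rule measurable_compose[OF z measurable_fst])
  show "(\<lambda>x. fst (snd (z x))) \<in> borel_measurable M"
    using measurable_compose[OF measurable_compose[OF z measurable_snd] measurable_fst] by (simp cong: measurable_cong_sets)
  have s: "(\<lambda>x. snd (snd (z x))) \<in> measurable M vec_ref"
    by (rule measurable_compose[OF measurable_compose[OF z measurable_snd] measurable_snd])
  then show "(\<lambda>x. snd (snd (z x))) \<in> borel_measurable M" by (simp cong: measurable_cong_sets)
  show "(\<lambda>x. (fst (z x), snd (snd (z x)))) \<in> measurable M rx2_ref"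
    by (intro measurable_Pair f s)
qed

lemma step_density_measurable:
  assumes "f \<in> borel_measurable M" "g \<in> borel_measurable M"
    and z: "z \<in> measurable M (step_ref :: ('a::finite, 'b::finite, 'n1::finite, 'n2::finite) step measure)"
  shows "(\<lambda>x. step_density (f x) (g x) (z x)) \<in> borel_measurable M"
  unfolding step_density_def
  by (intro borel_measurable_times rx_density_measurable rx2_density_measurable assms step_parts_measurable[OF z]
      measurable_channel_parts[OF step_parts_measurable(1)[OF z]])

lemma nn_integral_step_ref:
  assumes F: "F \<in> borel_measurable (step_ref :: ('a::finite, 'b::finite, 'n1::finite, 'n2::finite) step measure)"
  shows "(\<integral>\<^sup>+ z. F z \<partial>step_ref) = (\<integral>\<^sup>+ H. \<integral>\<^sup>+ y1. \<integral>\<^sup>+ y2. F (H, y1, y2) \<partial>vec_ref \<partial>vec_ref \<partial>channel_dist)"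
proof -
  have "(\<integral>\<^sup>+ z. F z \<partial>step_ref) = (\<integral>\<^sup>+ H. \<integral>\<^sup>+ y. F (H, y) \<partial>(vec_ref \<Otimes>\<^sub>M vec_ref) \<partial>channel_dist)"
    by (rule nn_integral_pair[OF sigma_finite_pair[OF sigma_finite_vec_ref sigma_finite_vec_ref] F])
  also have "\<dots> = (\<integral>\<^sup>+ H. \<integral>\<^sup>+ y1. \<integral>\<^sup>+ y2. F (H, y1, y2) \<partial>vec_ref \<partial>vec_ref \<partial>channel_dist)"
    by (intro nn_integral_cong nn_integral_pair[OF sigma_finite_vec_ref] measurable_compose[OF measurable_Pair1' F])
  finally show ?thesis .
qed

lemma block_measurable':
  assumes [measurable]: "f \<in> borel_measurable M" "g \<in> borel_measurable M" "h \<in> borel_measurable M"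
  shows "(\<lambda>x. block (f x) (g x) (h x)) \<in> measurable M (PiM (UNIV :: 'n::finite set) (\<lambda>_. antenna_ref :: (('a::finite, 'b::finite) row \<times> complex) measure))"
  unfolding block_def
proof (rule measurable_PiM_single')
  show "(\<lambda>x. ((f x $ i, g x $ i), h x $ i)) \<in> measurable M antenna_ref" for i :: 'n
    by measurable
qed (auto simp: space_pair_measure)

text \<open>A step lists all four matrices before the outputs. Two swaps bring \<open>y1\<close>
  next to the matrices of the first receiver, after which each receiver forms a block of
  antennas.\<close>

lemma nn_integral_step_blocks:
  fixes \<Psi> :: "('n1::finite \<Rightarrow> ('a::finite, 'b::finite) row \<times> complex) \<Rightarrow> ('n2::finite \<Rightarrow> ('a, 'b) row \<times> complex) \<Rightarrow> ennreal"
  assumes \<Psi>: "(\<lambda>p. \<Psi> (fst p) (snd p)) \<in> borel_measurable (PiM UNIV (\<lambda>_. antenna_ref) \<Otimes>\<^sub>M PiM UNIV (\<lambda>_. antenna_ref))"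
  shows "(\<integral>\<^sup>+ z. \<Psi> (block (fst (fst z)) (fst (snd (fst z))) (fst (snd z))) (block2 (fst z, snd (snd z))) \<partial>step_ref)
    = (\<integral>\<^sup>+ z1. \<integral>\<^sup>+ z2. \<Psi> z1 z2 \<partial>PiM UNIV (\<lambda>_. antenna_ref) \<partial>PiM UNIV (\<lambda>_. antenna_ref))"
proof -
  interpret P2: sigma_finite_measure "PiM (UNIV :: 'n2 set) (\<lambda>_. antenna_ref :: (('a, 'b) row \<times> complex) measure)"
    by (intro sigma_finite_PiM_const sigma_finite_antenna_ref finite)
  interpret v1: sigma_finite_measure "vec_ref :: (complex ^ 'n1) measure" by (rule sigma_finite_vec_ref)
  interpret v2: sigma_finite_measure "vec_ref :: (complex ^ 'n2) measure" by (rule sigma_finite_vec_ref)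
  interpret r22: sigma_finite_measure "rayleigh_matrix :: (complex ^ 'b ^ 'n2) measure" by (rule sigma_finite_rayleigh_matrix)
  interpret r21: sigma_finite_measure "rayleigh_matrix :: (complex ^ 'a ^ 'n2) measure" by (rule sigma_finite_rayleigh_matrix)
  have \<Psi>m: "(\<lambda>x. \<Psi> (block (f x) (g x) (h x)) (block (f' x) (g' x) (h' x))) \<in> borel_measurable M"
    if "f \<in> borel_measurable M" "g \<in> borel_measurable M" "h \<in> borel_measurable M"
      "f' \<in> borel_measurable M" "g' \<in> borel_measurable M" "h' \<in> borel_measurable M" for f g h f' g' h' and M :: "'q measure"
    using measurable_compose[OF measurable_Pair[OF block_measurable'[OF that(1-3)] block_measurable'[OF that(4-6)]] \<Psi>] by simp
  let ?F = "\<lambda>z :: ('a, 'b, 'n1, 'n2) step. \<Psi> (block (fst (fst z)) (fst (snd (fst z))) (fst (snd z))) (block2 (fst z, snd (snd z)))"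
  have Fm: "?F \<in> borel_measurable step_ref"
  proof -
    have id: "(\<lambda>z. z) \<in> measurable step_ref (step_ref :: ('a, 'b, 'n1, 'n2) step measure)" by simp
    note p = step_parts_measurable[OF id]
    have b1: "(\<lambda>z :: ('a, 'b, 'n1, 'n2) step. block (fst (fst z)) (fst (snd (fst z))) (fst (snd z))) \<in> measurable step_ref (PiM UNIV (\<lambda>_. antenna_ref))"
      by (intro block_measurable' measurable_channel_parts[OF p(1)] p(2))
    have b2: "(\<lambda>z :: ('a, 'b, 'n1, 'n2) step. block2 (fst z, snd (snd z))) \<in> measurable step_ref (PiM UNIV (\<lambda>_. antenna_ref))"
      unfolding block2_def fst_conv snd_conv by (intro block_measurable' measurable_channel_parts[OF p(1)] p(3))
    from measurable_compose[OF measurable_Pair[OF b1 b2] \<Psi>] show ?thesis by simp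
  qed
  let ?ra = "rayleigh_matrix :: (complex ^ 'a ^ 'n1) measure" and ?rb = "rayleigh_matrix :: (complex ^ 'b ^ 'n1) measure"
  let ?rc = "rayleigh_matrix :: (complex ^ 'a ^ 'n2) measure" and ?rd = "rayleigh_matrix :: (complex ^ 'b ^ 'n2) measure"
  let ?y1 = "vec_ref :: (complex ^ 'n1) measure" and ?y2 = "vec_ref :: (complex ^ 'n2) measure"
  have "(\<integral>\<^sup>+ z. ?F z \<partial>step_ref) = (\<integral>\<^sup>+ H. \<integral>\<^sup>+ y1. \<integral>\<^sup>+ y2. ?F (H, y1, y2) \<partial>?y2 \<partial>?y1 \<partial>channel_dist)"
    by (rule nn_integral_step_ref[OF Fm])
  also have "\<dots> = (\<integral>\<^sup>+ A. \<integral>\<^sup>+ B. \<integral>\<^sup>+ C. \<integral>\<^sup>+ D. \<integral>\<^sup>+ y1. \<integral>\<^sup>+ y2. \<Psi> (block A B y1) (block C D y2) \<partial>?y2 \<partial>?y1 \<partial>?rd \<partial>?rc \<partial>?rb \<partial>?ra)"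
  proof -
    have "(\<lambda>p. ?F (fst (fst p), snd (fst p), snd p)) \<in> borel_measurable ((channel_dist \<Otimes>\<^sub>M ?y1) \<Otimes>\<^sub>M ?y2)"
      by (rule measurable_compose[OF _ Fm]) measurable
    then have "(\<lambda>p. \<integral>\<^sup>+ y2. ?F (fst p, snd p, y2) \<partial>?y2) \<in> borel_measurable (channel_dist \<Otimes>\<^sub>M ?y1)"
      by (intro v2.borel_measurable_nn_integral) (simp only: split_beta')
    then have "(\<lambda>H. \<integral>\<^sup>+ y1. \<integral>\<^sup>+ y2. ?F (H, y1, y2) \<partial>?y2 \<partial>?y1) \<in> borel_measurable channel_dist"
      by (intro v1.borel_measurable_nn_integral) (simp only: split_beta')
    from nn_integral_channel_dist[OF this] show ?thesis by (simp add: block2_def)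
  qed
  also have "\<dots> = (\<integral>\<^sup>+ A. \<integral>\<^sup>+ B. \<integral>\<^sup>+ C. \<integral>\<^sup>+ y1. \<integral>\<^sup>+ D. \<integral>\<^sup>+ y2. \<Psi> (block A B y1) (block C D y2) \<partial>?y2 \<partial>?rd \<partial>?y1 \<partial>?rc \<partial>?rb \<partial>?ra)"
  proof (intro nn_integral_cong nn_integral_swap sigma_finite_vec_ref sigma_finite_rayleigh_matrix)
    fix A :: "complex ^ 'a ^ 'n1" and B :: "complex ^ 'b ^ 'n1" and C :: "complex ^ 'a ^ 'n2"
    show "(\<lambda>(D, y1). \<integral>\<^sup>+ y2. \<Psi> (block A B y1) (block C D y2) \<partial>?y2) \<in> borel_measurable (?rd \<Otimes>\<^sub>M ?y1)"
      unfolding split_beta'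
      by (intro v2.borel_measurable_nn_integral, unfold split_beta', intro \<Psi>m) measurable
  qed
  also have "\<dots> = (\<integral>\<^sup>+ A. \<integral>\<^sup>+ B. \<integral>\<^sup>+ y1. \<integral>\<^sup>+ C. \<integral>\<^sup>+ D. \<integral>\<^sup>+ y2. \<Psi> (block A B y1) (block C D y2) \<partial>?y2 \<partial>?rd \<partial>?rc \<partial>?y1 \<partial>?rb \<partial>?ra)"
  proof (intro nn_integral_cong nn_integral_swap sigma_finite_vec_ref sigma_finite_rayleigh_matrix)
    fix A :: "complex ^ 'a ^ 'n1" and B :: "complex ^ 'b ^ 'n1"
    show "(\<lambda>(C, y1). \<integral>\<^sup>+ D. \<integral>\<^sup>+ y2. \<Psi> (block A B y1) (block C D y2) \<partial>?y2 \<partial>?rd) \<in> borel_measurable (?rc \<Otimes>\<^sub>M ?y1)"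
      unfolding split_beta'
      by (intro r22.borel_measurable_nn_integral, unfold split_beta', intro v2.borel_measurable_nn_integral, unfold split_beta', intro \<Psi>m) measurable
  qed
  also have "\<dots> = (\<integral>\<^sup>+ A. \<integral>\<^sup>+ B. \<integral>\<^sup>+ y1. (\<integral>\<^sup>+ z2. \<Psi> (block A B y1) z2 \<partial>PiM UNIV (\<lambda>_. antenna_ref)) \<partial>?y1 \<partial>?rb \<partial>?ra)"
  proof (intro nn_integral_cong)
    fix A :: "complex ^ 'a ^ 'n1" and B :: "complex ^ 'b ^ 'n1" and y1 :: "complex ^ 'n1"
    have "block A B y1 \<in> space (PiM UNIV (\<lambda>_. antenna_ref))"
      by (auto simp: space_PiM space_pair_measure)
    from measurable_compose[OF measurable_Pair1'[OF this] \<Psi>]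
    have "(\<lambda>z2. \<Psi> (block A B y1) z2) \<in> borel_measurable (PiM UNIV (\<lambda>_. antenna_ref))" by simp
    from nn_integral_block[OF this]
    show "(\<integral>\<^sup>+ C. \<integral>\<^sup>+ D. \<integral>\<^sup>+ y2. \<Psi> (block A B y1) (block C D y2) \<partial>?y2 \<partial>?rd \<partial>?rc)
      = (\<integral>\<^sup>+ z2. \<Psi> (block A B y1) z2 \<partial>PiM UNIV (\<lambda>_. antenna_ref))"
      by (simp add: block_def[abs_def])
  qed
  also have "\<dots> = (\<integral>\<^sup>+ z1. \<integral>\<^sup>+ z2. \<Psi> z1 z2 \<partial>PiM UNIV (\<lambda>_. antenna_ref) \<partial>PiM UNIV (\<lambda>_. antenna_ref))"
  proof -
    have "(\<lambda>z1. \<integral>\<^sup>+ z2. \<Psi> z1 z2 \<partial>PiM UNIV (\<lambda>_. antenna_ref)) \<in> borel_measurable (PiM UNIV (\<lambda>_. antenna_ref))"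
      using \<Psi> by (intro P2.borel_measurable_nn_integral) (simp only: split_beta')
    from nn_integral_block[OF this] show ?thesis by (simp add: block_def[abs_def])
  qed
  finally show ?thesis .
qed

text \<open>The matrices of the first receiver do not enter \<open>block2\<close>; their probability
  laws integrate to \<open>1\<close>.\<close>

lemma nn_integral_rx2_block:
  fixes G :: "('n2::finite \<Rightarrow> ('a::finite, 'b::finite) row \<times> complex) \<Rightarrow> ennreal"
  assumes G: "G \<in> borel_measurable (PiM UNIV (\<lambda>_. antenna_ref))"
  shows "(\<integral>\<^sup>+ v. G (block2 v) \<partial>(rx2_ref :: (('a, 'b, 'n1::finite, 'n2) channel \<times> (complex ^ 'n2)) measure)) = (\<integral>\<^sup>+ z. G z \<partial>PiM UNIV (\<lambda>_. antenna_ref))"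
proof -
  interpret v2: sigma_finite_measure "vec_ref :: (complex ^ 'n2) measure" by (rule sigma_finite_vec_ref)
  interpret ra: prob_space "rayleigh_matrix :: (complex ^ 'a ^ 'n1) measure" by (rule prob_space_rayleigh_matrix)
  interpret rb: prob_space "rayleigh_matrix :: (complex ^ 'b ^ 'n1) measure" by (rule prob_space_rayleigh_matrix)
  have id: "(\<lambda>z. z) \<in> measurable rx2_ref (rx2_ref :: (('a, 'b, 'n1::finite, 'n2) channel \<times> (complex ^ 'n2)) measure)" by simp
  have "(block2 :: ('a, 'b, 'n1, 'n2) channel \<times> (complex ^ 'n2) \<Rightarrow> _) \<in> measurable rx2_ref (PiM UNIV (\<lambda>_. antenna_ref))"
    unfolding block2_def[abs_def]
    by (intro block_measurable' measurable_channel_parts[OF measurable_fst]) (use measurable_snd in \<open>simp cong: measurable_cong_sets\<close>)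
  note m = measurable_compose[OF this G]
  have "(\<integral>\<^sup>+ v. G (block2 v) \<partial>(rx2_ref :: (('a, 'b, 'n1, 'n2) channel \<times> (complex ^ 'n2)) measure))
    = (\<integral>\<^sup>+ H. \<integral>\<^sup>+ y. G (block2 (H :: ('a, 'b, 'n1, 'n2) channel, y)) \<partial>vec_ref \<partial>channel_dist)"
    by (rule nn_integral_pair[OF sigma_finite_vec_ref m])
  also have "\<dots> = (\<integral>\<^sup>+ A. \<integral>\<^sup>+ B. \<integral>\<^sup>+ C. \<integral>\<^sup>+ D. \<integral>\<^sup>+ y. G (block C D y) \<partial>vec_ref \<partial>rayleigh_matrix \<partial>rayleigh_matrix
       \<partial>(rayleigh_matrix :: (complex ^ 'b ^ 'n1) measure) \<partial>(rayleigh_matrix :: (complex ^ 'a ^ 'n1) measure))"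
  proof -
    have "(\<lambda>H. \<integral>\<^sup>+ y. G (block2 (H :: ('a, 'b, 'n1, 'n2) channel, y)) \<partial>vec_ref) \<in> borel_measurable channel_dist"
      using m by (intro v2.borel_measurable_nn_integral) (simp only: split_beta' prod.collapse)
    from nn_integral_channel_dist[OF this] show ?thesis by (simp add: block2_def)
  qed
  also have "\<dots> = (\<integral>\<^sup>+ C. \<integral>\<^sup>+ D. \<integral>\<^sup>+ y. G (block C D y) \<partial>vec_ref \<partial>rayleigh_matrix \<partial>rayleigh_matrix)"
    using ra.emeasure_space_1 rb.emeasure_space_1 by simp
  also have "\<dots> = (\<integral>\<^sup>+ z. G z \<partial>PiM UNIV (\<lambda>_. antenna_ref))"
    using nn_integral_block[OF G] by (simp add: block_def[abs_def])
  finally show ?thesis .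
qed

lemma measurable_component_compose:
  "i \<in> I \<Longrightarrow> f \<in> measurable M N \<Longrightarrow> (\<lambda>z. f (z i)) \<in> measurable (PiM I (\<lambda>_. M)) N"
  by (rule measurable_compose[OF measurable_component_singleton])

lemma nn_integral_vec_gauss:
  fixes \<mu> :: "complex ^ 'n::finite"
  shows "(\<integral>\<^sup>+ y. ennreal (exp (- (norm (y - \<mu>))\<^sup>2)) \<partial>vec_ref) = 1"
proof -
  interpret prob_space "noise_vector :: (complex ^ 'n) measure" by (rule prob_space_noise_vector)
  show ?thesis using noise_vector_shift[of "\<lambda>_. 1" \<mu>] emeasure_space_1 by simp
qed

text \<open>Given channels and inputs, the two outputs are independent and the first has mass
  \<open>1\<close>, so it integrates out. The mixture form serves for posterior weights, a
  one-element index set for a fixed pair of inputs.\<close>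

lemma step_marginal:
  fixes xa :: "'i \<Rightarrow> complex ^ 'a::finite" and xb :: "complex ^ 'b::finite"
    and F :: "('a, 'b, 'n1::finite, 'n2::finite) channel \<times> (complex ^ 'n2) \<Rightarrow> ennreal"
  assumes A: "finite A" and c: "\<And>a. a \<in> A \<Longrightarrow> 0 \<le> c a" and F: "F \<in> borel_measurable rx2_ref"
  shows "(\<integral>\<^sup>+ z. ennreal (\<Sum>a\<in>A. c a * step_density (xa a) xb z) * F (fst z, snd (snd z)) \<partial>step_ref)
    = (\<integral>\<^sup>+ v. ennreal (\<Sum>a\<in>A. c a * rx2_density (xa a) xb v) * F v \<partial>rx2_ref)"
proof -
  let ?S = "step_ref :: ('a, 'b, 'n1, 'n2) step measure"
  let ?V = "rx2_ref :: (('a, 'b, 'n1, 'n2) channel \<times> (complex ^ 'n2)) measure"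
  let ?y1 = "vec_ref :: (complex ^ 'n1) measure" and ?y2 = "vec_ref :: (complex ^ 'n2) measure"
  have idS: "(\<lambda>z. z) \<in> measurable ?S ?S" and idV: "(\<lambda>z. z) \<in> measurable ?V ?V" by simp_all
  have sm: "(\<lambda>z. step_density (xa a) xb z) \<in> borel_measurable ?S" for a
    by (rule step_density_measurable[OF _ _ idS]) simp_all
  have vm: "(\<lambda>v. rx2_density (xa a) xb v) \<in> borel_measurable ?V" for a
    by (rule rx2_density_measurable[OF _ _ idV]) simp_all
  have FS: "(\<lambda>z. F (fst z, snd (snd z))) \<in> borel_measurable ?S"
    by (rule measurable_compose[OF step_parts_measurable(4)[OF idS] F])
  have one: "(\<integral>\<^sup>+ z. ennreal (step_density (xa a) xb z) * F (fst z, snd (snd z)) \<partial>?S)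
    = (\<integral>\<^sup>+ v. ennreal (rx2_density (xa a) xb v) * F v \<partial>?V)" for a
  proof -
    have "(\<integral>\<^sup>+ z. ennreal (step_density (xa a) xb z) * F (fst z, snd (snd z)) \<partial>?S)
      = (\<integral>\<^sup>+ H. \<integral>\<^sup>+ y1. \<integral>\<^sup>+ y2. ennreal (step_density (xa a) xb (H, y1, y2)) * F (H, y2) \<partial>?y2 \<partial>?y1 \<partial>channel_dist)"
      by (subst nn_integral_step_ref) (use sm FS in auto)
    also have "\<dots> = (\<integral>\<^sup>+ H. \<integral>\<^sup>+ y2. ennreal (rx2_density (xa a) xb (H, y2)) * F (H, y2) \<partial>?y2 \<partial>channel_dist)"
    proof (rule nn_integral_cong)
      fix H :: "('a, 'b, 'n1, 'n2) channel"
      let ?r = "\<lambda>y1. rx_density (fst H) (fst (snd H)) (xa a) xb y1"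
      have g: "(\<lambda>y2. ennreal (rx2_density (xa a) xb (H, y2)) * F (H, y2)) \<in> borel_measurable ?y2"
        by (intro borel_measurable_times_ennreal measurable_compose[OF measurable_compose[OF measurable_Pair1' vm] measurable_ennreal]
           measurable_compose[OF measurable_Pair1' F]) auto
      have r: "?r \<in> borel_measurable ?y1"
        by (intro rx_density_measurable) auto
      have "(\<integral>\<^sup>+ y1. \<integral>\<^sup>+ y2. ennreal (step_density (xa a) xb (H, y1, y2)) * F (H, y2) \<partial>?y2 \<partial>?y1)
        = (\<integral>\<^sup>+ y1. \<integral>\<^sup>+ y2. ennreal (?r y1) * (ennreal (rx2_density (xa a) xb (H, y2)) * F (H, y2)) \<partial>?y2 \<partial>?y1)"
        by (simp add: step_density_def ennreal_mult less_imp_le[OF rx_density_pos] less_imp_le[OF rx2_density_pos] mult.assoc)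
      also have "\<dots> = (\<integral>\<^sup>+ y1. ennreal (?r y1) * (\<integral>\<^sup>+ y2. ennreal (rx2_density (xa a) xb (H, y2)) * F (H, y2) \<partial>?y2) \<partial>?y1)"
        by (intro nn_integral_cong nn_integral_cmult g)
      also have "\<dots> = (\<integral>\<^sup>+ y1. ennreal (?r y1) \<partial>?y1) * (\<integral>\<^sup>+ y2. ennreal (rx2_density (xa a) xb (H, y2)) * F (H, y2) \<partial>?y2)"
        using r by (intro nn_integral_multc) auto
      also have "(\<integral>\<^sup>+ y1. ennreal (?r y1) \<partial>?y1) = 1"
        unfolding rx_density_def by (rule nn_integral_vec_gauss)
      finally show "(\<integral>\<^sup>+ y1. \<integral>\<^sup>+ y2. ennreal (step_density (xa a) xb (H, y1, y2)) * F (H, y2) \<partial>?y2 \<partial>?y1)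
        = (\<integral>\<^sup>+ y2. ennreal (rx2_density (xa a) xb (H, y2)) * F (H, y2) \<partial>?y2)" by simp
    qed
    also have "\<dots> = (\<integral>\<^sup>+ v. ennreal (rx2_density (xa a) xb v) * F v \<partial>?V)"
      by (subst nn_integral_pair[OF sigma_finite_vec_ref]) (use vm F in auto)
    finally show ?thesis .
  qed
  have "(\<integral>\<^sup>+ z. ennreal (\<Sum>a\<in>A. c a * step_density (xa a) xb z) * F (fst z, snd (snd z)) \<partial>?S)
    = (\<integral>\<^sup>+ z. (\<Sum>a\<in>A. ennreal (c a) * (ennreal (step_density (xa a) xb z) * F (fst z, snd (snd z)))) \<partial>?S)"
  proof (rule nn_integral_cong)
    fix z :: "('a, 'b, 'n1, 'n2) step"
    have "ennreal (\<Sum>a\<in>A. c a * step_density (xa a) xb z) = (\<Sum>a\<in>A. ennreal (c a * step_density (xa a) xb z))"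
      by (intro sum_ennreal[symmetric] mult_nonneg_nonneg c less_imp_le[OF step_density_pos])
    also have "\<dots> = (\<Sum>a\<in>A. ennreal (c a) * ennreal (step_density (xa a) xb z))"
      by (intro sum.cong refl ennreal_mult c less_imp_le[OF step_density_pos])
    finally show "ennreal (\<Sum>a\<in>A. c a * step_density (xa a) xb z) * F (fst z, snd (snd z))
      = (\<Sum>a\<in>A. ennreal (c a) * (ennreal (step_density (xa a) xb z) * F (fst z, snd (snd z))))"
      by (simp only: sum_distrib_right mult.assoc)
  qed
  also have "\<dots> = (\<Sum>a\<in>A. ennreal (c a) * (\<integral>\<^sup>+ z. ennreal (step_density (xa a) xb z) * F (fst z, snd (snd z)) \<partial>?S))"
    using sm FS by (subst nn_integral_sum) (auto intro!: sum.cong nn_integral_cmult)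
  also have "\<dots> = (\<Sum>a\<in>A. ennreal (c a) * (\<integral>\<^sup>+ v. ennreal (rx2_density (xa a) xb v) * F v \<partial>?V))"
    by (simp only: one)
  also have "\<dots> = (\<integral>\<^sup>+ v. (\<Sum>a\<in>A. ennreal (c a) * (ennreal (rx2_density (xa a) xb v) * F v)) \<partial>?V)"
    using vm F by (subst nn_integral_sum) (auto intro!: sum.cong nn_integral_cmult[symmetric])
  also have "\<dots> = (\<integral>\<^sup>+ v. ennreal (\<Sum>a\<in>A. c a * rx2_density (xa a) xb v) * F v \<partial>?V)"
  proof (rule nn_integral_cong)
    fix v :: "('a, 'b, 'n1, 'n2) channel \<times> (complex ^ 'n2)"
    have "ennreal (\<Sum>a\<in>A. c a * rx2_density (xa a) xb v) = (\<Sum>a\<in>A. ennreal (c a * rx2_density (xa a) xb v))"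
      by (intro sum_ennreal[symmetric] mult_nonneg_nonneg c less_imp_le[OF rx2_density_pos])
    also have "\<dots> = (\<Sum>a\<in>A. ennreal (c a) * ennreal (rx2_density (xa a) xb v))"
      by (intro sum.cong refl ennreal_mult c less_imp_le[OF rx2_density_pos])
    finally show "(\<Sum>a\<in>A. ennreal (c a) * (ennreal (rx2_density (xa a) xb v) * F v))
      = ennreal (\<Sum>a\<in>A. c a * rx2_density (xa a) xb v) * F v"
      by (simp only: sum_distrib_right mult.assoc)
  qed
  finally show ?thesis .
qed

lemma nn_integral_rx2_density:
  "(\<integral>\<^sup>+ v. ennreal (rx2_density xa xb v) \<partial>(rx2_ref :: (('a::finite, 'b::finite, 'n1::finite, 'n2::finite) channel \<times> (complex ^ 'n2)) measure)) = 1"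
proof -
  let ?V = "rx2_ref :: (('a, 'b, 'n1, 'n2) channel \<times> (complex ^ 'n2)) measure"
  interpret prob_space "channel_dist :: ('a, 'b, 'n1, 'n2) channel measure" by (rule prob_space_channel_dist)
  have idV: "(\<lambda>z. z) \<in> measurable ?V ?V" by simp
  have vm: "(\<lambda>v. ennreal (rx2_density xa xb v)) \<in> borel_measurable ?V"
    by (intro measurable_compose[OF rx2_density_measurable[OF _ _ idV] measurable_ennreal]) simp_all
  show ?thesis
    using emeasure_space_1
    by (subst nn_integral_pair[OF sigma_finite_vec_ref vm]) (simp add: rx2_density_def rx_density_def nn_integral_vec_gauss)
qed

lemma nn_integral_step_density:
  "(\<integral>\<^sup>+ z. ennreal (step_density xa xb z) \<partial>(step_ref :: ('a::finite, 'b::finite, 'n1::finite, 'n2::finite) step measure)) = 1"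
  using step_marginal[of "{()}" "\<lambda>_. 1" "\<lambda>_ :: ('a, 'b, 'n1, 'n2) channel \<times> (complex ^ 'n2). 1" "\<lambda>_. xa" xb] nn_integral_rx2_density by simp

text \<open>Memoryless test density: each antenna of the second receiver is compared with a centred
  Gaussian of variance \<open>P\<close>, independently of the channel.\<close>

definition gauss_rx2 :: "real \<Rightarrow> ('a::finite, 'b::finite, 'n1::finite, 'n2::finite) channel \<times> (complex ^ 'n2) \<Rightarrow> real" where
  "gauss_rx2 P v = (\<Prod>i\<in>UNIV. exp (- (norm (snd (block2 v i)))\<^sup>2 / P) / P)"

lemma gauss_rx2_bounds: "1 \<le> P \<Longrightarrow> 0 < gauss_rx2 P v" "1 \<le> P \<Longrightarrow> gauss_rx2 P v \<le> 1"
  unfolding gauss_rx2_def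
  by (intro prod_pos gauss_bounds ballI; simp) (intro prod_le_1 conjI less_imp_le[OF gauss_bounds(1)] gauss_bounds(2); simp)

lemma gauss_rx2_measurable: "gauss_rx2 P \<in> borel_measurable (rx2_ref :: (('a::finite, 'b::finite, 'n1::finite, 'n2::finite) channel \<times> (complex ^ 'n2)) measure)"
proof -
  have [measurable]: "snd \<in> borel_measurable (rx2_ref :: (('a, 'b, 'n1, 'n2) channel \<times> (complex ^ 'n2)) measure)"
    using measurable_snd[of "channel_dist :: ('a, 'b, 'n1, 'n2) channel measure" "vec_ref :: (complex ^ 'n2) measure"]
    by (simp cong: measurable_cong_sets)
  show ?thesis unfolding gauss_rx2_def[abs_def] block2_def block_def by simp
qed

lemma nn_integral_gauss_rx2:
  assumes P: "1 \<le> P"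
  shows "(\<integral>\<^sup>+ v. ennreal (gauss_rx2 P v) \<partial>(rx2_ref :: (('a::finite, 'b::finite, 'n1::finite, 'n2::finite) channel \<times> (complex ^ 'n2)) measure)) = 1"
proof -
  interpret row: prob_space "row_law :: ('a, 'b) row measure" by (rule prob_space_row_law)
  interpret product_sigma_finite "\<lambda>_ :: 'n2. antenna_ref :: (('a, 'b) row \<times> complex) measure"
    by (simp add: product_sigma_finite_def sigma_finite_antenna_ref)
  let ?g = "\<lambda>x :: ('a, 'b) row \<times> complex. ennreal (exp (- (norm (snd x))\<^sup>2 / P) / P)"
  have gm: "?g \<in> borel_measurable antenna_ref" by measurable
  have "(\<integral>\<^sup>+ v. ennreal (gauss_rx2 P v) \<partial>(rx2_ref :: (('a, 'b, 'n1, 'n2) channel \<times> (complex ^ 'n2)) measure))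
    = (\<integral>\<^sup>+ v. (\<lambda>z. \<Prod>i\<in>UNIV. ?g (z i)) (block2 v) \<partial>(rx2_ref :: (('a, 'b, 'n1, 'n2) channel \<times> (complex ^ 'n2)) measure))"
    using P unfolding gauss_rx2_def by (intro nn_integral_cong) (subst prod_ennreal, auto)
  also have "\<dots> = (\<integral>\<^sup>+ z. (\<Prod>i\<in>(UNIV :: 'n2 set). ?g (z i)) \<partial>PiM UNIV (\<lambda>_. antenna_ref))"
    by (rule nn_integral_rx2_block)
      (intro borel_measurable_prod_ennreal measurable_component_compose[OF UNIV_I gm])
  also have "\<dots> = (\<Prod>i\<in>(UNIV :: 'n2 set). \<integral>\<^sup>+ x. ?g x \<partial>antenna_ref)"
    by (rule product_nn_integral_prod) (use gm in auto)
  also have "(\<integral>\<^sup>+ x. ?g x \<partial>antenna_ref) = 1"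
    using row.emeasure_space_1 nn_integral_gauss_1[OF P, of 0]
    by (subst nn_integral_pair[OF sigma_finite_cplx_ref gm]) simp
  finally show ?thesis by simp
qed

text \<open>The cross entropy is additive over antennas, and each costs \<open>ln P\<close> plus
  mean received power over \<open>P\<close>. This is the origin of the term
  \<open>CARD('n2) * ln P\<close> in the rate bound.\<close>

lemma gauss_rx2_cost:
  fixes xa :: "complex ^ 'a::finite" and xb :: "complex ^ 'b::finite"
  assumes P: "1 \<le> P"
  shows "(\<integral>\<^sup>+ z. ennreal (step_density xa xb z) * ennreal (- ln (gauss_rx2 P (fst z, snd (snd z))))
      \<partial>(step_ref :: ('a, 'b, 'n1::finite, 'n2::finite) step measure))
    \<le> ennreal (real CARD('n2) * (ln P + power_bound xa xb / P))"
proof -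
  let ?V = "rx2_ref :: (('a, 'b, 'n1, 'n2) channel \<times> (complex ^ 'n2)) measure"
  let ?R = "antenna_ref :: (('a, 'b) row \<times> complex) measure" and ?L = "antenna_law :: (('a, 'b) row \<times> complex) measure"
  interpret L: prob_space ?L by (rule prob_space_antenna_law)
  let ?h = "\<lambda>x :: ('a, 'b) row \<times> complex. ennreal (ln P + (norm (snd x))\<^sup>2 / P)"
  have hm: "?h \<in> borel_measurable ?R" by measurable
  have qm: "(\<lambda>v. ennreal (- ln (gauss_rx2 P v))) \<in> borel_measurable ?V"
    using gauss_rx2_measurable by measurable
  have lnq: "ennreal (- ln (gauss_rx2 P v)) = (\<Sum>i\<in>UNIV. ?h (block2 v i))" for v :: "('a, 'b, 'n1, 'n2) channel \<times> (complex ^ 'n2)"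
  proof -
    have "- ln (gauss_rx2 P v) = (\<Sum>i\<in>UNIV. - ln (exp (- (norm (snd (block2 v i)))\<^sup>2 / P) / P))"
      unfolding gauss_rx2_def using P by (subst ln_prod) (auto simp: sum_negf)
    also have "\<dots> = (\<Sum>i\<in>UNIV. ln P + (norm (snd (block2 v i)))\<^sup>2 / P)"
      using P by (intro sum.cong refl neg_ln_gauss) simp
    finally have eq: "- ln (gauss_rx2 P v) = (\<Sum>i\<in>UNIV. ln P + (norm (snd (block2 v i)))\<^sup>2 / P)" .
    show ?thesis unfolding eq using P by (intro sum_ennreal[symmetric] add_nonneg_nonneg) auto
  qed
  have "(\<integral>\<^sup>+ z. ennreal (step_density xa xb z) * ennreal (- ln (gauss_rx2 P (fst z, snd (snd z))))
      \<partial>(step_ref :: ('a, 'b, 'n1, 'n2) step measure))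
    = (\<integral>\<^sup>+ v. ennreal (rx2_density xa xb v) * ennreal (- ln (gauss_rx2 P v)) \<partial>?V)"
    using step_marginal[of "{()}" "\<lambda>_. 1" "\<lambda>v :: ('a, 'b, 'n1, 'n2) channel \<times> (complex ^ 'n2). ennreal (- ln (gauss_rx2 P v))" "\<lambda>_. xa" xb] qm by simp
  also have "\<dots> = (\<integral>\<^sup>+ v. (\<lambda>z. (\<Prod>i\<in>UNIV. ennreal (antenna_density xa xb (z i))) * (\<Sum>i\<in>UNIV. ?h (z i))) (block2 v) \<partial>?V)"
    by (intro nn_integral_cong) (simp only: lnq rx2_density_prod, subst prod_ennreal, auto simp: less_imp_le[OF antenna_density_pos])
  also have "\<dots> = (\<integral>\<^sup>+ z. (\<Prod>i\<in>UNIV. ennreal (antenna_density xa xb (z i))) * (\<Sum>i\<in>(UNIV :: 'n2 set). ?h (z i)) \<partial>PiM UNIV (\<lambda>_. ?R))"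
    by (rule nn_integral_rx2_block)
      (intro borel_measurable_times_ennreal borel_measurable_prod_ennreal borel_measurable_sum
        measurable_component_compose[OF UNIV_I hm]
        measurable_component_compose[OF UNIV_I measurable_compose[OF antenna_density_measurable' measurable_ennreal]])
  also have "\<dots> = (\<integral>\<^sup>+ w. (\<Sum>i\<in>(UNIV :: 'n2 set). ?h ((\<lambda>i\<in>UNIV. receive xa xb (w i)) i)) \<partial>PiM UNIV (\<lambda>_. ?L))"
  proof (rule nn_integral_PiM_transport[OF sigma_finite_antenna_ref sigma_finite_antenna_law finite])
    show "(\<lambda>z. \<Sum>i\<in>(UNIV :: 'n2 set). ?h (z i)) \<in> borel_measurable (PiM UNIV (\<lambda>_. ?R))"
      by (intro borel_measurable_sum measurable_component_compose[OF UNIV_I hm])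
  qed (auto simp: antenna_transport)
  also have "\<dots> = (\<Sum>i\<in>(UNIV :: 'n2 set). \<integral>\<^sup>+ w. ?h (receive xa xb (w i)) \<partial>PiM UNIV (\<lambda>_. ?L))"
    unfolding restrict_UNIV
    by (rule nn_integral_sum) (rule measurable_component_compose[OF UNIV_I measurable_compose[OF receive_measurable hm]])
  also have "\<dots> = (\<Sum>i\<in>(UNIV :: 'n2 set). \<integral>\<^sup>+ w. ?h (receive xa xb w) \<partial>?L)"
    by (intro sum.cong refl nn_integral_PiM_component[OF prob_space_antenna_law finite UNIV_I measurable_compose[OF receive_measurable hm]])
  also have "(\<integral>\<^sup>+ w. ?h (receive xa xb w) \<partial>?L) \<le> ennreal (ln P + power_bound xa xb / P)"
  proof -
    have m: "(\<lambda>w. ennreal ((norm (snd (receive xa xb w)))\<^sup>2)) \<in> borel_measurable ?L"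
      unfolding receive_def by measurable
    have "(\<integral>\<^sup>+ w. ?h (receive xa xb w) \<partial>?L) = (\<integral>\<^sup>+ w. ennreal (ln P) + ennreal (1 / P) * ennreal ((norm (snd (receive xa xb w)))\<^sup>2) \<partial>?L)"
      using P by (intro nn_integral_cong) (simp add: ennreal_mult[symmetric])
    also have "\<dots> = (\<integral>\<^sup>+ w. ennreal (ln P) \<partial>?L) + (\<integral>\<^sup>+ w. ennreal (1 / P) * ennreal ((norm (snd (receive xa xb w)))\<^sup>2) \<partial>?L)"
      by (rule nn_integral_add[OF measurable_const borel_measurable_times_ennreal[OF measurable_const m]]) auto
    also have "\<dots> = ennreal (ln P) + ennreal (1 / P) * (\<integral>\<^sup>+ w. ennreal ((norm (snd (receive xa xb w)))\<^sup>2) \<partial>?L)"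
      using L.emeasure_space_1 nn_integral_cmult[OF m, of "ennreal (1 / P)"] by simp
    also have "\<dots> \<le> ennreal (ln P) + ennreal (1 / P) * ennreal (power_bound xa xb)"
      by (intro add_left_mono mult_left_mono receive_power) simp
    also have "\<dots> = ennreal (ln P + power_bound xa xb / P)"
      using P by (simp add: ennreal_mult[symmetric] power_bound_nonneg)
    finally show ?thesis .
  qed
  finally have "(\<integral>\<^sup>+ z. ennreal (step_density xa xb z) * ennreal (- ln (gauss_rx2 P (fst z, snd (snd z))))
      \<partial>(step_ref :: ('a, 'b, 'n1, 'n2) step measure)) \<le> (\<Sum>i\<in>(UNIV :: 'n2 set). ennreal (ln P + power_bound xa xb / P))"
    by (simp add: sum_mono mult_left_mono)
  also have "\<dots> = ennreal (real CARD('n2) * (ln P + power_bound xa xb / P))"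
    using P power_bound_nonneg[of xa xb] by (simp add: ennreal_mult ennreal_of_nat_eq_real_of_nat)
  finally show ?thesis .
qed

context
  fixes A :: "'m set" and xa :: "'m \<Rightarrow> complex ^ 'a::finite" and xb :: "complex ^ 'b::finite" and c :: "'m \<Rightarrow> real"
  assumes A: "finite A"
begin

interpretation mixture "antenna_ref :: (('a, 'b) row \<times> complex) measure" A "\<lambda>a. antenna_density (xa a) xb"
  by (rule mixture_antenna[OF A])

text \<open>Given the inputs, the antennas of both receivers are independent copies of one another.
  Hence unrolling the recursion of \<open>entropy\<close> over both blocks leaves only their total
  number.\<close>

lemma entropy_step:
  "(\<integral>\<^sup>+ z. phi (\<Sum>a\<in>A. c a * step_density (xa a) xb z) \<partial>(step_ref :: ('a, 'b, 'n1::finite, 'n2::finite) step measure))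
    = entropy (CARD('n1) + CARD('n2)) c"
proof -
  let ?R = "antenna_ref :: (('a, 'b) row \<times> complex) measure"
  let ?\<Psi> = "\<lambda>(z1 :: 'n1 \<Rightarrow> ('a, 'b) row \<times> complex) (z2 :: 'n2 \<Rightarrow> ('a, 'b) row \<times> complex).
    phi (\<Sum>a\<in>A. c a * (\<Prod>i\<in>UNIV. antenna_density (xa a) xb (z1 i)) * (\<Prod>i\<in>UNIV. antenna_density (xa a) xb (z2 i)))"
  have "(\<integral>\<^sup>+ z. phi (\<Sum>a\<in>A. c a * step_density (xa a) xb z) \<partial>(step_ref :: ('a, 'b, 'n1, 'n2) step measure))
    = (\<integral>\<^sup>+ z. ?\<Psi> (block (fst (fst z)) (fst (snd (fst z))) (fst (snd z))) (block2 (fst z, snd (snd z))) \<partial>(step_ref :: ('a, 'b, 'n1, 'n2) step measure))"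
    unfolding step_density_def rx_density_prod rx2_density_prod by (simp only: mult.assoc)
  also have "\<dots> = (\<integral>\<^sup>+ z1. \<integral>\<^sup>+ z2. ?\<Psi> z1 z2 \<partial>PiM UNIV (\<lambda>_. ?R) \<partial>PiM UNIV (\<lambda>_. ?R))"
  proof (rule nn_integral_step_blocks)
    have 1: "(\<lambda>p. antenna_density (xa a) xb (fst p i)) \<in> borel_measurable (PiM (UNIV :: 'n1 set) (\<lambda>_. ?R) \<Otimes>\<^sub>M PiM (UNIV :: 'n2 set) (\<lambda>_. ?R))" for a i
      by (rule measurable_compose[OF measurable_fst measurable_component_compose[OF UNIV_I antenna_density_measurable']])
    have 2: "(\<lambda>p. antenna_density (xa a) xb (snd p i)) \<in> borel_measurable (PiM (UNIV :: 'n1 set) (\<lambda>_. ?R) \<Otimes>\<^sub>M PiM (UNIV :: 'n2 set) (\<lambda>_. ?R))" for a i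
      by (rule measurable_compose[OF measurable_snd measurable_component_compose[OF UNIV_I antenna_density_measurable']])
    show "(\<lambda>p. ?\<Psi> (fst p) (snd p)) \<in> borel_measurable (PiM UNIV (\<lambda>_. ?R) \<Otimes>\<^sub>M PiM UNIV (\<lambda>_. ?R))"
      by (intro measurable_compose[OF _ phi_measurable] borel_measurable_sum borel_measurable_times borel_measurable_prod measurable_const 1 2) auto
  qed
  also have "\<dots> = (\<integral>\<^sup>+ z1. entropy (0 + CARD('n2)) (\<lambda>a. c a * (\<Prod>i\<in>(UNIV :: 'n1 set). antenna_density (xa a) xb (z1 i))) \<partial>PiM UNIV (\<lambda>_. ?R))"
    by (subst entropy_PiM[OF finite, symmetric]) simp
  also have "\<dots> = entropy (0 + CARD('n2) + CARD('n1)) c"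
    by (rule entropy_PiM[OF finite])
  finally show ?thesis by (simp add: add.commute)
qed

lemma entropy_rx2:
  "(\<integral>\<^sup>+ v. phi (\<Sum>a\<in>A. c a * rx2_density (xa a) xb v) \<partial>(rx2_ref :: (('a, 'b, 'n1::finite, 'n2::finite) channel \<times> (complex ^ 'n2)) measure))
    = entropy CARD('n2) c"
proof -
  let ?R = "antenna_ref :: (('a, 'b) row \<times> complex) measure"
  let ?\<Psi> = "\<lambda>z2 :: 'n2 \<Rightarrow> ('a, 'b) row \<times> complex. entropy 0 (\<lambda>a. c a * (\<Prod>i\<in>UNIV. antenna_density (xa a) xb (z2 i)))"
  have "(\<integral>\<^sup>+ v. phi (\<Sum>a\<in>A. c a * rx2_density (xa a) xb v) \<partial>(rx2_ref :: (('a, 'b, 'n1, 'n2) channel \<times> (complex ^ 'n2)) measure))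
    = (\<integral>\<^sup>+ v. ?\<Psi> (block2 v) \<partial>(rx2_ref :: (('a, 'b, 'n1, 'n2) channel \<times> (complex ^ 'n2)) measure))"
    by (simp add: rx2_density_prod)
  also have "\<dots> = (\<integral>\<^sup>+ z. ?\<Psi> z \<partial>PiM UNIV (\<lambda>_. ?R))"
  proof (rule nn_integral_rx2_block)
    have "(\<lambda>p. antenna_density (xa a) xb (p i)) \<in> borel_measurable (PiM (UNIV :: 'n2 set) (\<lambda>_. ?R))" for a i
      by (rule measurable_component_compose[OF UNIV_I antenna_density_measurable'])
    then show "?\<Psi> \<in> borel_measurable (PiM UNIV (\<lambda>_. ?R))"
      unfolding entropy.simps
      by (intro measurable_compose[OF _ phi_measurable] borel_measurable_sum borel_measurable_times borel_measurable_prod measurable_const) auto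
  qed
  also have "\<dots> = entropy (0 + CARD('n2)) c" by (rule entropy_PiM[OF finite])
  finally show ?thesis by simp
qed

end

text \<open>Here \<open>e k\<close> stands for the entropy of \<open>k\<close> antennas and \<open>M\<close> for the dimension of the unknown
  signal: \<open>conc\<close> comes from exchangeability, \<open>C\<close> from extrapolation.\<close>

lemma entropy_seq_bounds:
  fixes e :: "nat \<Rightarrow> ennreal"
  assumes conc: "\<And>k. e (Suc (Suc k)) + e k \<le> e (Suc k) + e (Suc k)"
    and mono: "\<And>k. e k \<le> e (Suc k)" and e0: "e 0 = 0"
    and M: "1 \<le> M" and C: "e (Suc M) \<le> e M + ennreal C" "0 \<le> C" and L: "1 \<le> L" "L \<le> N"
  shows "ennreal (1 / real (min N M)) * e N \<le> ennreal (1 / real (min L M)) * e L + ennreal (real N * C)"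
    and "e N \<le> of_nat M * e 1 + ennreal (real N * C)"
proof -
  have mono': "k \<le> l \<Longrightarrow> e k \<le> e l" for k l
    by (rule lift_Suc_mono_le[of e, OF mono])
  \<comment> \<open>Multiplication by \<open>1 / (s * k)\<close> turns the division-free form into a
    statement about averages.\<close>
  have ratio: "ennreal (1 / real k) * e k \<le> ennreal (1 / real s) * e s" if "1 \<le> s" "s \<le> k" for s k
  proof -
    have "ennreal (1 / (real s * real k)) * (of_nat s * e k) \<le> ennreal (1 / (real s * real k)) * (of_nat k * e s)"
      by (intro mult_left_mono concave_seq_ratio[OF conc mono e0 that]) simp
    moreover have "ennreal (1 / (real s * real k)) * (of_nat s * x) = ennreal (1 / real k) * x"
      "ennreal (1 / (real s * real k)) * (of_nat k * x) = ennreal (1 / real s) * x" for x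
      using that by (simp_all add: ennreal_of_nat_eq_real_of_nat mult.assoc[symmetric] ennreal_mult[symmetric])
    ultimately show ?thesis by simp
  qed
  have eN: "e N \<le> e M + ennreal (real N * C)" if "M \<le> N"
  proof -
    have "e (M + (N - M)) \<le> e M + ennreal (real (N - M) * C)"
      by (rule concave_seq_increment[OF conc mono e0 M C])
    also have "\<dots> \<le> e M + ennreal (real N * C)"
      using C(2) by (intro add_left_mono ennreal_leI mult_right_mono) auto
    finally show ?thesis using that by simp
  qed
  have div: "ennreal (1 / real M) * (x + ennreal (real N * C)) \<le> ennreal (1 / real M) * x + ennreal (real N * C)" for x
  proof -
    have "ennreal (1 / real M) * ennreal (real N * C) \<le> 1 * ennreal (real N * C)"
      using M by (intro mult_right_mono) (auto simp: ennreal_le_1)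
    then show ?thesis by (simp add: distrib_left add_left_mono)
  qed
  \<comment> \<open>For \<open>N \<le> M\<close> the minima are \<open>N\<close> and
    \<open>L\<close>, and the decrease of the averages suffices. Otherwise the antennas beyond
    \<open>M\<close> cost at most \<open>N * C\<close>, and \<open>e M\<close> is compared with
    \<open>e L\<close> by averages or by monotonicity, according to the order of \<open>L\<close>
    and \<open>M\<close>.\<close>
  show "ennreal (1 / real (min N M)) * e N \<le> ennreal (1 / real (min L M)) * e L + ennreal (real N * C)"
  proof (cases "N \<le> M")
    case True
    then have "min N M = N" "min L M = L" using L by auto
    then show ?thesis using ratio[OF L] by (simp add: add_increasing2)
  next
    case False
    then have "ennreal (1 / real (min N M)) * e N \<le> ennreal (1 / real M) * (e M + ennreal (real N * C))"
      using eN by (simp add: min_absorb2 mult_left_mono)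
    also note div
    also have "ennreal (1 / real M) * e M + ennreal (real N * C) \<le> ennreal (1 / real (min L M)) * e L + ennreal (real N * C)"
    proof (intro add_right_mono)
      show "ennreal (1 / real M) * e M \<le> ennreal (1 / real (min L M)) * e L"
      proof (cases "L \<le> M")
        case True
        then show ?thesis using ratio[OF L(1) True] by (simp add: min_absorb1)
      next
        case False
        then show ?thesis using mono'[of M L] by (simp add: min_absorb2 mult_left_mono)
      qed
    qed
    finally show ?thesis .
  qed
  have lin: "e k \<le> of_nat k * e 1" if "1 \<le> k" for k
    using concave_seq_ratio[OF conc mono e0 _ that] by simp
  show "e N \<le> of_nat M * e 1 + ennreal (real N * C)"
  proof (cases "N \<le> M")
    case True
    have "e N \<le> of_nat N * e 1" using lin L by simp
    also have "\<dots> \<le> of_nat M * e 1" using True by (intro mult_right_mono) auto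
    finally show ?thesis by (simp add: add_increasing2)
  next
    case False
    then have "e N \<le> e M + ennreal (real N * C)" by (intro eN) simp
    also have "\<dots> \<le> of_nat M * e 1 + ennreal (real N * C)" by (intro add_right_mono lin M)
    finally show ?thesis .
  qed
qed

section \<open>Rate bounds for one order of the users\<close>

text \<open>One of the two orders of the users: the receiver of \<open>b\<close> observes the second block of
  antennas. The map \<open>\<tau>\<close> is the identity or exchanges the users.\<close>

locale mimo_coding =
  fixes \<nu> :: "'z measure" and n :: nat and A :: "'i set" and B :: "'j set"
    and \<tau> :: "'z \<Rightarrow> ('a::finite, 'b::finite, 'n1::finite, 'n2::finite) step"
    and Xa :: "nat \<Rightarrow> 'i \<Rightarrow> (nat \<Rightarrow> 'z) \<Rightarrow> complex ^ 'a" and Xb :: "nat \<Rightarrow> 'j \<Rightarrow> (nat \<Rightarrow> 'z) \<Rightarrow> complex ^ 'b"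
  assumes sf_nu: "sigma_finite_measure \<nu>"
    and finA: "finite A" "A \<noteq> {}" and finB: "finite B" "B \<noteq> {}"
    and tau: "\<tau> \<in> measurable \<nu> step_ref"
    and tau_int: "\<And>F. F \<in> borel_measurable step_ref \<Longrightarrow> (\<integral>\<^sup>+ z. F (\<tau> z) \<partial>\<nu>) = (\<integral>\<^sup>+ z. F z \<partial>step_ref)"
    and Xa: "\<And>t a. t < n \<Longrightarrow> a \<in> A \<Longrightarrow> Xa t a \<in> borel_measurable (hist \<nu> t)"
    and Xb: "\<And>t b. t < n \<Longrightarrow> b \<in> B \<Longrightarrow> Xb t b \<in> borel_measurable (hist \<nu> t)"
begin

definition kern :: "nat \<Rightarrow> 'i \<Rightarrow> 'j \<Rightarrow> (nat \<Rightarrow> 'z) \<Rightarrow> 'z \<Rightarrow> real" where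
  "kern t a b w z = step_density (Xa t a w) (Xb t b w) (\<tau> z)"

lemma step_density_const_measurable:
  "(\<lambda>z. step_density xa xb z) \<in> borel_measurable (step_ref :: ('a, 'b, 'n1, 'n2) step measure)"
proof -
  have "(\<lambda>z. z) \<in> measurable step_ref (step_ref :: ('a, 'b, 'n1, 'n2) step measure)" by simp
  from step_density_measurable[OF measurable_const measurable_const this] show ?thesis by simp
qed

lemma kern_pos: "0 < kern t a b w z"
  unfolding kern_def by (rule step_density_pos)

lemma kern_le_1: "kern t a b w z \<le> 1"
  unfolding kern_def by (rule step_density_le_1)

sublocale feedback \<nu> n A B kern
proof (rule feedback.intro)
  fix t a b assume t: "t < n" and a: "a \<in> A" and b: "b \<in> B"
  show "(\<lambda>(w, z). kern t a b w z) \<in> borel_measurable (hist \<nu> t \<Otimes>\<^sub>M \<nu>)"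
    unfolding split_beta' kern_def
    by (intro step_density_measurable measurable_compose[OF measurable_fst Xa] measurable_compose[OF measurable_fst Xb]
        measurable_compose[OF measurable_snd tau] t a b)
  fix w
  show "(\<integral>\<^sup>+ z. ennreal (kern t a b w z) \<partial>\<nu>) = 1"
    unfolding kern_def
    using tau_int[OF measurable_compose[OF step_density_const_measurable measurable_ennreal]]
    by (simp only: nn_integral_step_density)
qed (rule sf_nu finA finB kern_pos kern_le_1)+

definition v :: "'z \<Rightarrow> ('a, 'b, 'n1, 'n2) channel \<times> (complex ^ 'n2)" where
  "v z = (fst (\<tau> z), snd (snd (\<tau> z)))"

text \<open>Density of the next observation of the second receiver given \<open>b\<close> and the
  complete past of both receivers. Its weights are the same posterior as in \<open>pmix\<close>, so
  the entropies of both densities belong to one sequence.\<close>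

definition \<sigma> :: "nat \<Rightarrow> 'j \<Rightarrow> (nat \<Rightarrow> 'z) \<Rightarrow> ('a, 'b, 'n1, 'n2) channel \<times> (complex ^ 'n2) \<Rightarrow> real" where
  "\<sigma> t b w x = (\<Sum>a\<in>A. posterior t b w a * rx2_density (Xa t a w) (Xb t b w) x)"

abbreviation entropy_at :: "nat \<Rightarrow> 'j \<Rightarrow> (nat \<Rightarrow> 'z) \<Rightarrow> nat \<Rightarrow> ennreal" where
  "entropy_at t b w k \<equiv> mixture.entropy (antenna_ref :: (('a, 'b) row \<times> complex) measure) A
     (\<lambda>a. antenna_density (Xa t a w) (Xb t b w)) k (posterior t b w)"

lemma weights_posterior: "mixture.weights A (posterior t b w)"
  unfolding mixture.weights_def[OF mixture_antenna[OF finA(1)]]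
  using posterior_pos by (simp add: posterior_sum less_imp_le)

lemma v_measurable: "v \<in> measurable \<nu> rx2_ref"
  unfolding v_def[abs_def] by (rule step_parts_measurable(4)[OF tau])

text \<open>The predictive density is a mixture of step densities with posterior weights, and
  \<open>\<tau>\<close> carries \<open>\<nu>\<close> to the reference measure.\<close>

lemma nn_integral_phi_pmix:
  "(\<integral>\<^sup>+ z. phi (pmix t b w z) \<partial>\<nu>) = entropy_at t b w (CARD('n1) + CARD('n2))"
proof -
  have "(\<integral>\<^sup>+ z. phi (pmix t b w z) \<partial>\<nu>)
    = (\<integral>\<^sup>+ z. phi (\<Sum>a\<in>A. posterior t b w a * step_density (Xa t a w) (Xb t b w) z) \<partial>(step_ref :: ('a, 'b, 'n1, 'n2) step measure))"
    unfolding pmix_def kern_def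
    by (rule tau_int) (intro measurable_compose[OF _ phi_measurable] borel_measurable_sum borel_measurable_times measurable_const step_density_const_measurable, simp)
  then show ?thesis by (simp only: entropy_step[OF finA(1)])
qed

lemma nn_integral_phi_sigma:
  "(\<integral>\<^sup>+ x. phi (\<sigma> t b w x) \<partial>rx2_ref) = entropy_at t b w CARD('n2)"
  unfolding \<sigma>_def by (rule entropy_rx2[OF finA(1)])

lemma sigma_measurable:
  assumes "t < n" "b \<in> B"
  shows "(\<lambda>(w, x). \<sigma> t b w x) \<in> borel_measurable (hist \<nu> t \<Otimes>\<^sub>M rx2_ref)"
  unfolding split_beta' \<sigma>_def
  using assms
  by (intro borel_measurable_sum borel_measurable_times rx2_density_measurable measurable_snd
      measurable_compose[OF measurable_fst Xa] measurable_compose[OF measurable_fst Xb]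
      measurable_compose[OF measurable_fst posterior_measurable]) auto

lemma sigma_bounds: "0 < \<sigma> t b w x" "\<sigma> t b w x \<le> 1"
proof -
  show "0 < \<sigma> t b w x"
    unfolding \<sigma>_def by (intro sum_pos mult_pos_pos posterior_pos rx2_density_pos finA)
  have "\<sigma> t b w x \<le> (\<Sum>a\<in>A. posterior t b w a)"
    unfolding \<sigma>_def by (intro sum_mono mult_left_le less_imp_le[OF posterior_pos] rx2_density_le_1)
  then show "\<sigma> t b w x \<le> 1" by (simp add: posterior_sum)
qed

text \<open>Joins exchangeability and extrapolation for posterior weights. These sum to
  \<open>1\<close>, so the entropy of no antenna at all is \<open>0\<close>, as the sequence
  argument requires.\<close>

lemma entropy_at_bounds:
  defines "N \<equiv> CARD('n1) + CARD('n2)" and "C \<equiv> extrapolation_cost TYPE('a)"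
  shows "ennreal (1 / real (min N CARD('a))) * entropy_at t b w N
      \<le> ennreal (1 / real (min CARD('n2) CARD('a))) * entropy_at t b w CARD('n2) + ennreal (real N * C)"
    and "entropy_at t b w N \<le> of_nat CARD('a) * entropy_at t b w 1 + ennreal (real N * C)"
proof -
  interpret mixture "antenna_ref :: (('a, 'b) row \<times> complex) measure" A "\<lambda>a. antenna_density (Xa t a w) (Xb t b w)"
    by (rule mixture_antenna[OF finA(1)])
  note W = weights_posterior[of t b w] and S = posterior_sum[of t b w]
  have c: "1 \<le> CARD('a)" "1 \<le> CARD('n2)" by (simp_all add: Suc_leI)
  show "ennreal (1 / real (min N CARD('a))) * entropy_at t b w N
      \<le> ennreal (1 / real (min CARD('n2) CARD('a))) * entropy_at t b w CARD('n2) + ennreal (real N * C)"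
    "entropy_at t b w N \<le> of_nat CARD('a) * entropy_at t b w 1 + ennreal (real N * C)"
    unfolding C_def
    by (rule entropy_seq_bounds[OF entropy_concave[OF W] entropy_mono[OF W] antenna_entropy_0[OF finA(1) W S] c(1)
          antenna_entropy_extrapolate[OF finA(1) W S] extrapolation_cost_nonneg c(2)], simp add: N_def)+
qed

lemma entropy_at_measurable:
  assumes "t < n" "b \<in> B"
  shows "(\<lambda>w. entropy_at t b w CARD('n2)) \<in> borel_measurable (hist \<nu> t)"
proof -
  interpret sigma_finite_measure "rx2_ref :: (('a, 'b, 'n1, 'n2) channel \<times> (complex ^ 'n2)) measure"
    by (rule sigma_finite_pair[OF sigma_finite_channel_dist sigma_finite_vec_ref])
  have "(\<lambda>w. \<integral>\<^sup>+ x. phi (\<sigma> t b w x) \<partial>rx2_ref) \<in> borel_measurable (hist \<nu> t)"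
    using measurable_compose[OF sigma_measurable[OF assms] phi_measurable]
    by (intro borel_measurable_nn_integral) (simp only: split_beta')
  then show ?thesis by (simp only: nn_integral_phi_sigma)
qed

context
  fixes P :: real
  assumes P: "1 \<le> P"
    and powa: "\<And>t. t < n \<Longrightarrow> expect t (\<lambda>a b w. ennreal ((norm (Xa t a w))\<^sup>2)) \<le> ennreal P"
    and powb: "\<And>t. t < n \<Longrightarrow> expect t (\<lambda>a b w. ennreal ((norm (Xb t b w))\<^sup>2)) \<le> ennreal P"
begin

text \<open>Division by \<open>P\<close> turns both power constraints into constants, and
  \<open>P \<ge> 1\<close> bounds the noise term \<open>12 / P\<close>.\<close>

lemma expect_power_bound:
  assumes t: "t < n"
  shows "expect t (\<lambda>a b w. ennreal (power_bound (Xa t a w) (Xb t b w) / P)) \<le> ennreal (12 * (real CARD('a) + real CARD('b) + 1))"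
proof -
  have ma: "(\<lambda>w. ennreal ((norm (Xa t a w))\<^sup>2)) \<in> borel_measurable (hist \<nu> t)" if "a \<in> A" for a
    using Xa[OF t that] by measurable
  have mb: "(\<lambda>w. ennreal ((norm (Xb t b w))\<^sup>2)) \<in> borel_measurable (hist \<nu> t)" if "b \<in> B" for b
    using Xb[OF t that] by measurable
  let ?ca = "ennreal (12 * real CARD('a) / P)" and ?cb = "ennreal (12 * real CARD('b) / P)"
  have "expect t (\<lambda>a b w. ennreal (power_bound (Xa t a w) (Xb t b w) / P))
    = expect t (\<lambda>a b w. ?ca * ennreal ((norm (Xa t a w))\<^sup>2) + (?cb * ennreal ((norm (Xb t b w))\<^sup>2) + ennreal (12 / P)))"
  proof (rule expect_cong)
    fix a b w
    have "power_bound (Xa t a w) (Xb t b w) / P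
      = 12 * real CARD('a) / P * (norm (Xa t a w))\<^sup>2 + (12 * real CARD('b) / P * (norm (Xb t b w))\<^sup>2 + 12 / P)"
      using P by (simp add: power_bound_def field_simps)
    then show "ennreal (power_bound (Xa t a w) (Xb t b w) / P)
      = ?ca * ennreal ((norm (Xa t a w))\<^sup>2) + (?cb * ennreal ((norm (Xb t b w))\<^sup>2) + ennreal (12 / P))"
      using P by (simp add: ennreal_mult[symmetric])
  qed
  also have "\<dots> = expect t (\<lambda>a b w. ?ca * ennreal ((norm (Xa t a w))\<^sup>2)) + (expect t (\<lambda>a b w. ?cb * ennreal ((norm (Xb t b w))\<^sup>2)) + expect t (\<lambda>_ _ _. ennreal (12 / P)))"
  proof -
    have "expect t (\<lambda>a b w. ?cb * ennreal ((norm (Xb t b w))\<^sup>2) + ennreal (12 / P))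
      = expect t (\<lambda>a b w. ?cb * ennreal ((norm (Xb t b w))\<^sup>2)) + expect t (\<lambda>_ _ _. ennreal (12 / P))"
      using t mb by (intro expect_add) auto
    moreover have "expect t (\<lambda>a b w. ?ca * ennreal ((norm (Xa t a w))\<^sup>2) + (?cb * ennreal ((norm (Xb t b w))\<^sup>2) + ennreal (12 / P)))
      = expect t (\<lambda>a b w. ?ca * ennreal ((norm (Xa t a w))\<^sup>2)) + expect t (\<lambda>a b w. ?cb * ennreal ((norm (Xb t b w))\<^sup>2) + ennreal (12 / P))"
      using t ma mb by (intro expect_add) auto
    ultimately show ?thesis by (simp only:)
  qed
  also have "\<dots> = ?ca * expect t (\<lambda>a b w. ennreal ((norm (Xa t a w))\<^sup>2)) + (?cb * expect t (\<lambda>a b w. ennreal ((norm (Xb t b w))\<^sup>2)) + ennreal (12 / P))"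
    using t ma mb by (simp add: expect_cmult[of t "\<lambda>a b w. ennreal ((norm (Xa t a w))\<^sup>2)"] expect_cmult[of t "\<lambda>a b w. ennreal ((norm (Xb t b w))\<^sup>2)"] expect_1)
  also have "\<dots> \<le> ?ca * ennreal P + (?cb * ennreal P + ennreal 12)"
    using P t by (intro add_mono mult_left_mono powa powb ennreal_leI) (auto simp: divide_le_eq)
  also have "\<dots> = ennreal (12 * (real CARD('a) + real CARD('b) + 1))"
    using P by (simp add: ennreal_mult[symmetric] algebra_simps flip: ennreal_plus ennreal_numeral)
  finally show ?thesis .
qed

text \<open>Even with \<open>b\<close> known and both receivers cooperating, a letter carries at
  most \<open>CARD('a)\<close> times the entropy of one antenna plus the extrapolation cost. Here
  \<open>r\<close> is a lower bound for the probability of correct decoding. The result leads to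
  \<open>d\<^sub>1 \<le> M\<^sub>1\<close>.\<close>

lemma rate_known_message:
  assumes dec: "\<And>a. a \<in> A \<Longrightarrow> Measurable.pred (hist \<nu> n) (\<lambda>w. dec w = a)"
    and r: "0 \<le> r" "ennreal r \<le> expect n (\<lambda>a b w. if dec w = a then 1 else 0)"
  shows "r * ln (real (card A)) \<le> ln 2 + real n * (real CARD('a) * (ln P + 12 * (real CARD('a) + real CARD('b) + 1))
    + real (CARD('n1) + CARD('n2)) * extrapolation_cost TYPE('a))"
proof -
  define K where "K = 12 * (real CARD('a) + real CARD('b) + 1)"
  define D where "D = real (CARD('n1) + CARD('n2)) * extrapolation_cost TYPE('a)"
  have D0: "0 \<le> D" using extrapolation_cost_nonneg[where 'a='a] by (simp add: D_def)
  have K0: "0 \<le> K" by (simp add: K_def)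
  have cA: "1 \<le> real (card A)" using finA by (simp add: Suc_leI card_gt_0_iff)
  have letter: "expect t (\<lambda>a b w. \<integral>\<^sup>+ z. phi (pmix t b w z) \<partial>\<nu>) \<le> ennreal (real CARD('a) * (ln P + K) + D)" if t: "t < n" for t
  proof -
    let ?G = "\<lambda>a b w. ennreal (power_bound (Xa t a w) (Xb t b w) / P)"
    have Gm: "?G a b \<in> borel_measurable (hist \<nu> t)" if "a \<in> A" "b \<in> B" for a b
      using Xa[OF t that(1)] Xb[OF t that(2)] unfolding power_bound_def by measurable
    have Sm: "(\<lambda>w. \<Sum>a'\<in>A. ennreal (posterior t b w a') * ?G a' b w) \<in> borel_measurable (hist \<nu> t)" if "b \<in> B" for b
      using t that Gm posterior_measurable[of t t _ b]
      by (intro borel_measurable_sum borel_measurable_times_ennreal[OF measurable_compose[OF posterior_measurable measurable_ennreal] Gm]) auto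
    have "expect t (\<lambda>a b w. \<integral>\<^sup>+ z. phi (pmix t b w z) \<partial>\<nu>)
      \<le> expect t (\<lambda>a b w. ennreal (real CARD('a)) * (\<Sum>a'\<in>A. ennreal (posterior t b w a') * ?G a' b w) + ennreal (real CARD('a) * ln P + D))"
    proof (rule expect_mono)
      fix a b w
      have "(\<integral>\<^sup>+ z. phi (pmix t b w z) \<partial>\<nu>) \<le> of_nat CARD('a) * entropy_at t b w 1 + ennreal D"
        unfolding nn_integral_phi_pmix D_def by (rule entropy_at_bounds(2))
      also have "\<dots> \<le> of_nat CARD('a) * (ennreal (ln P) + (\<Sum>a'\<in>A. ennreal (posterior t b w a') * ?G a' b w)) + ennreal D"
        by (intro add_right_mono mult_left_mono antenna_entropy_1[OF finA(1) weights_posterior posterior_sum P]) simp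
      also have "\<dots> = ennreal (real CARD('a)) * (\<Sum>a'\<in>A. ennreal (posterior t b w a') * ?G a' b w) + ennreal (real CARD('a) * ln P + D)"
        using P D0 by (simp add: ennreal_of_nat_eq_real_of_nat distrib_left ennreal_mult ac_simps)
      finally show "(\<integral>\<^sup>+ z. phi (pmix t b w z) \<partial>\<nu>)
        \<le> ennreal (real CARD('a)) * (\<Sum>a'\<in>A. ennreal (posterior t b w a') * ?G a' b w) + ennreal (real CARD('a) * ln P + D)" .
    qed
    also have "\<dots> = expect t (\<lambda>a b w. ennreal (real CARD('a)) * (\<Sum>a'\<in>A. ennreal (posterior t b w a') * ?G a' b w)) + expect t (\<lambda>_ _ _. ennreal (real CARD('a) * ln P + D))"
      using t Sm by (intro expect_add) auto
    also have "\<dots> = ennreal (real CARD('a)) * expect t (\<lambda>a b w. \<Sum>a'\<in>A. ennreal (posterior t b w a') * ?G a' b w) + ennreal (real CARD('a) * ln P + D)"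
      using t Sm by (subst expect_cmult) (auto simp: expect_1)
    \<comment> \<open>The one-antenna bound contains power averaged over the posterior; the tower
      property replaces it by the power actually transmitted.\<close>
    also have "expect t (\<lambda>a b w. \<Sum>a'\<in>A. ennreal (posterior t b w a') * ?G a' b w) = expect t ?G"
      using t Gm by (intro expect_posterior) auto
    also have "ennreal (real CARD('a)) * expect t ?G + ennreal (real CARD('a) * ln P + D)
      \<le> ennreal (real CARD('a)) * ennreal K + ennreal (real CARD('a) * ln P + D)"
      unfolding K_def by (intro add_right_mono mult_left_mono expect_power_bound t) simp
    also have "\<dots> = ennreal (real CARD('a) * (ln P + K) + D)"
      using P D0 K0 by (simp add: ennreal_mult[symmetric] ennreal_plus[symmetric] algebra_simps del: ennreal_plus)
    finally show ?thesis .
  qed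
  have "ennreal (r * ln (real (card A))) = ennreal (ln (real (card A))) * ennreal r"
    using cA r(1) by (simp add: ennreal_mult mult.commute)
  also have "\<dots> \<le> ennreal (ln (real (card A))) * expect n (\<lambda>a b w. if dec w = a then 1 else 0)"
    by (intro mult_left_mono r) simp
  also have "\<dots> \<le> ennreal (ln 2) + (\<Sum>t<n. expect t (\<lambda>a b w. \<integral>\<^sup>+ z. phi (pmix t b w z) \<partial>\<nu>))"
    by (rule fano_known_message[OF dec])
  also have "\<dots> \<le> ennreal (ln 2) + (\<Sum>t<n. ennreal (real CARD('a) * (ln P + K) + D))"
    by (intro add_left_mono sum_mono letter) simp
  also have "\<dots> = ennreal (ln 2 + real n * (real CARD('a) * (ln P + K) + D))"
  proof -
    have "ennreal (ln 2) + (\<Sum>t<n. ennreal c) = ennreal (ln 2 + real n * c)" if "0 \<le> c" for c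
      using that by (simp add: ennreal_of_nat_eq_real_of_nat ennreal_mult)
    moreover have "0 \<le> real CARD('a) * (ln P + K) + D"
      using P D0 K0 by simp
    ultimately show ?thesis by blast
  qed
  finally show ?thesis
    using P D0 K0 unfolding K_def[symmetric] D_def[symmetric] by (subst (asm) ennreal_le_iff) auto
qed

text \<open>The entropies \<open>X\<close> of the second receiver occur as
  \<open>\<beta> * X\<close> on the larger side of the bound for \<open>a\<close>, and on the
  smaller side of the bound for \<open>b\<close>. Scaling the latter by \<open>\<beta>\<close> and
  adding cancels them.\<close>

lemma weighted_sum_rate:
  fixes r :: real
  defines "\<alpha> \<equiv> 1 / real (min (CARD('n1) + CARD('n2)) CARD('a))" and "\<beta> \<equiv> 1 / real (min CARD('n2) CARD('a))"
  assumes decA: "\<And>a. a \<in> A \<Longrightarrow> Measurable.pred (hist \<nu> n) (\<lambda>w. decA w = a)"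
    and decB: "\<And>b. b \<in> B \<Longrightarrow> Measurable.pred (hist rx2_ref n) (\<lambda>x. decB x = b)"
    and r: "0 \<le> r" "ennreal r \<le> expect n (\<lambda>a b w. if decA w = a then 1 else 0)"
       "ennreal r \<le> expect n (\<lambda>a b w. if decB (\<lambda>i\<in>{1..n}. v (w i)) = b then 1 else 0)"
  shows "r * (\<alpha> * ln (real (card A)) + \<beta> * ln (real (card B))) \<le> (\<alpha> + \<beta>) * ln 2
    + real n * (\<beta> * (real CARD('n2) * (ln P + 12 * (real CARD('a) + real CARD('b) + 1)))
      + real (CARD('n1) + CARD('n2)) * extrapolation_cost TYPE('a))"
proof -
  define K where "K = 12 * (real CARD('a) + real CARD('b) + 1)"
  define D where "D = real (CARD('n1) + CARD('n2)) * extrapolation_cost TYPE('a)"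
  define L where "L = real CARD('n2) * (ln P + K)"
  define N where "N = CARD('n1) + CARD('n2)"
  have D0: "0 \<le> D" using extrapolation_cost_nonneg[where 'a='a] by (simp add: D_def)
  have L0: "0 \<le> L" using P by (simp add: L_def K_def)
  have \<alpha>\<beta>: "0 \<le> \<alpha>" "0 \<le> \<beta>" by (simp_all add: \<alpha>_def \<beta>_def)
  have cA: "1 \<le> real (card A)" using finA by (simp add: Suc_leI card_gt_0_iff)
  have cB: "1 \<le> real (card B)" using finB by (simp add: Suc_leI card_gt_0_iff)
  let ?h = "\<lambda>t. expect t (\<lambda>a b w. entropy_at t b w CARD('n2))"
  define X where "X = (\<Sum>t<n. ?h t)"
  \<comment> \<open>For each history and each \<open>b\<close>, all antennas of both receivers are
    compared with those of the second receiver alone.\<close>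
  have letter: "ennreal \<alpha> * expect t (\<lambda>a b w. \<integral>\<^sup>+ z. phi (pmix t b w z) \<partial>\<nu>) \<le> ennreal \<beta> * ?h t + ennreal D" if t: "t < n" for t
  proof -
    interpret sigma_finite_measure \<nu> by (rule sf_nu)
    have pm: "(\<lambda>w. \<integral>\<^sup>+ z. phi (pmix t b w z) \<partial>\<nu>) \<in> borel_measurable (hist \<nu> t)" if "b \<in> B" for b
      using measurable_compose[OF pmix_measurable[OF t that] phi_measurable]
      by (intro borel_measurable_nn_integral) (simp only: split_beta')
    have em: "(\<lambda>w. ennreal \<beta> * entropy_at t b w CARD('n2)) \<in> borel_measurable (hist \<nu> t)" if "b \<in> B" for b
      by (intro borel_measurable_times_ennreal measurable_const entropy_at_measurable[OF t that]) simp
    have "ennreal \<alpha> * expect t (\<lambda>a b w. \<integral>\<^sup>+ z. phi (pmix t b w z) \<partial>\<nu>)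
      = expect t (\<lambda>a b w. ennreal \<alpha> * (\<integral>\<^sup>+ z. phi (pmix t b w z) \<partial>\<nu>))"
      using t pm by (intro expect_cmult[symmetric]) auto
    also have "\<dots> \<le> expect t (\<lambda>a b w. ennreal \<beta> * entropy_at t b w CARD('n2) + ennreal D)"
      unfolding nn_integral_phi_pmix D_def \<alpha>_def \<beta>_def by (intro expect_mono entropy_at_bounds(1))
    also have "\<dots> = expect t (\<lambda>a b w. ennreal \<beta> * entropy_at t b w CARD('n2)) + expect t (\<lambda>_ _ _. ennreal D)"
      using t em by (intro expect_add) auto
    also have "\<dots> = ennreal \<beta> * ?h t + ennreal D"
      using t entropy_at_measurable[OF t] by (subst expect_cmult) (auto simp: expect_1)
    finally show ?thesis .
  qed
  have "ennreal (ln (real (card B))) * ennreal r + X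
    \<le> ennreal (ln (real (card B))) * expect n (\<lambda>a b w. if decB (\<lambda>i\<in>{1..n}. v (w i)) = b then 1 else 0)
      + (\<Sum>t<n. expect t (\<lambda>a b w. \<integral>\<^sup>+ x. phi (\<sigma> t b w x) \<partial>rx2_ref))"
    unfolding X_def nn_integral_phi_sigma by (intro add_right_mono mult_left_mono r) simp
  also have "\<dots> \<le> ennreal (ln 2) + (\<Sum>t<n. expect t (\<lambda>a b w. \<integral>\<^sup>+ z. ennreal (kern t a b w z) * ennreal (- ln (gauss_rx2 P (v z))) \<partial>\<nu>))"
  proof (rule fano_partial_observation)
    show "sigma_finite_measure (rx2_ref :: (('a, 'b, 'n1, 'n2) channel \<times> (complex ^ 'n2)) measure)"
      by (rule sigma_finite_pair[OF sigma_finite_channel_dist sigma_finite_vec_ref])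
    show "(\<integral>\<^sup>+ x. ennreal (gauss_rx2 P x) \<partial>(rx2_ref :: (('a, 'b, 'n1, 'n2) channel \<times> (complex ^ 'n2)) measure)) \<le> 1"
      by (simp add: nn_integral_gauss_rx2[OF P])
    fix t b w and F :: "('a, 'b, 'n1, 'n2) channel \<times> (complex ^ 'n2) \<Rightarrow> ennreal"
    assume F: "F \<in> borel_measurable rx2_ref"
    have idS: "(\<lambda>z. z) \<in> measurable step_ref (step_ref :: ('a, 'b, 'n1, 'n2) step measure)" by simp
    have "(\<integral>\<^sup>+ z. ennreal (pmix t b w z) * F (v z) \<partial>\<nu>)
      = (\<integral>\<^sup>+ z. ennreal (\<Sum>a\<in>A. posterior t b w a * step_density (Xa t a w) (Xb t b w) z) * F (fst z, snd (snd z)) \<partial>step_ref)"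
      unfolding pmix_def kern_def v_def
      by (rule tau_int, intro borel_measurable_times_ennreal measurable_compose[OF _ measurable_ennreal] borel_measurable_sum
          borel_measurable_times measurable_const step_density_const_measurable measurable_compose[OF step_parts_measurable(4)[OF idS] F]) simp
    also have "\<dots> = (\<integral>\<^sup>+ x. ennreal (\<sigma> t b w x) * F x \<partial>rx2_ref)"
      unfolding \<sigma>_def by (rule step_marginal[OF finA(1) less_imp_le[OF posterior_pos] F])
    finally show "(\<integral>\<^sup>+ z. ennreal (pmix t b w z) * F (v z) \<partial>\<nu>) = (\<integral>\<^sup>+ x. ennreal (\<sigma> t b w x) * F x \<partial>rx2_ref)" .
  qed (use v_measurable decB sigma_measurable sigma_bounds gauss_rx2_measurable gauss_rx2_bounds[OF P] in auto)
  also have "\<dots> \<le> ennreal (ln 2) + (\<Sum>t<n. ennreal L)"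
  proof (intro add_left_mono sum_mono)
    fix t assume "t \<in> {..<n}"
    then have t: "t < n" by simp
    let ?G = "\<lambda>a b w. ennreal (power_bound (Xa t a w) (Xb t b w) / P)"
    have Gm: "?G a b \<in> borel_measurable (hist \<nu> t)" if "a \<in> A" "b \<in> B" for a b
      using Xa[OF t that(1)] Xb[OF t that(2)] unfolding power_bound_def by measurable
    have "expect t (\<lambda>a b w. \<integral>\<^sup>+ z. ennreal (kern t a b w z) * ennreal (- ln (gauss_rx2 P (v z))) \<partial>\<nu>)
      \<le> expect t (\<lambda>a b w. ennreal (real CARD('n2)) * ?G a b w + ennreal (real CARD('n2) * ln P))"
    proof (rule expect_mono)
      fix a b w
      have idS: "(\<lambda>z. z) \<in> measurable step_ref (step_ref :: ('a, 'b, 'n1, 'n2) step measure)" by simp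
      have qm: "(\<lambda>x. ennreal (- ln (gauss_rx2 P x))) \<in> borel_measurable (rx2_ref :: (('a, 'b, 'n1, 'n2) channel \<times> (complex ^ 'n2)) measure)"
        using gauss_rx2_measurable by measurable
      have "(\<integral>\<^sup>+ z. ennreal (kern t a b w z) * ennreal (- ln (gauss_rx2 P (v z))) \<partial>\<nu>)
        = (\<integral>\<^sup>+ z. ennreal (step_density (Xa t a w) (Xb t b w) z) * ennreal (- ln (gauss_rx2 P (fst z, snd (snd z)))) \<partial>(step_ref :: ('a, 'b, 'n1, 'n2) step measure))"
        unfolding kern_def v_def
        by (rule tau_int, intro borel_measurable_times_ennreal measurable_compose[OF step_density_const_measurable measurable_ennreal]
            measurable_compose[OF step_parts_measurable(4)[OF idS] qm])
      also have "\<dots> \<le> ennreal (real CARD('n2) * (ln P + power_bound (Xa t a w) (Xb t b w) / P))"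
        by (rule gauss_rx2_cost[OF P])
      also have "\<dots> = ennreal (real CARD('n2)) * ?G a b w + ennreal (real CARD('n2) * ln P)"
        using P power_bound_nonneg[of "Xa t a w" "Xb t b w"]
        by (simp add: ennreal_mult[symmetric] ennreal_plus[symmetric] distrib_left add.commute del: ennreal_plus)
      finally show "(\<integral>\<^sup>+ z. ennreal (kern t a b w z) * ennreal (- ln (gauss_rx2 P (v z))) \<partial>\<nu>)
        \<le> ennreal (real CARD('n2)) * ?G a b w + ennreal (real CARD('n2) * ln P)" .
    qed
    also have "\<dots> = expect t (\<lambda>a b w. ennreal (real CARD('n2)) * ?G a b w) + expect t (\<lambda>_ _ _. ennreal (real CARD('n2) * ln P))"
      using t Gm by (intro expect_add) auto
    also have "\<dots> = ennreal (real CARD('n2)) * expect t ?G + ennreal (real CARD('n2) * ln P)"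
      using t Gm by (subst expect_cmult) (auto simp: expect_1)
    also have "\<dots> \<le> ennreal (real CARD('n2)) * ennreal K + ennreal (real CARD('n2) * ln P)"
      unfolding K_def by (intro add_right_mono mult_left_mono expect_power_bound t) simp
    also have "\<dots> = ennreal L"
      using P by (simp add: L_def K_def ennreal_mult[symmetric] ennreal_plus[symmetric] distrib_left add.commute del: ennreal_plus)
    finally show "expect t (\<lambda>a b w. \<integral>\<^sup>+ z. ennreal (kern t a b w z) * ennreal (- ln (gauss_rx2 P (v z))) \<partial>\<nu>) \<le> ennreal L" .
  qed
  also have "\<dots> = ennreal (ln 2 + real n * L)"
    using L0 by (simp add: ennreal_of_nat_eq_real_of_nat ennreal_mult[symmetric])
  finally have B: "ennreal (ln (real (card B))) * ennreal r + X \<le> ennreal (ln 2 + real n * L)" .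
  \<comment> \<open>The bound for \<open>b\<close> makes \<open>X\<close> finite, which permits its
    cancellation over the reals below.\<close>
  then have "X \<noteq> \<top>" by (auto simp: top_unique)
  then obtain x where x: "X = ennreal x" "0 \<le> x" by (cases X) auto
  have "ln (real (card B)) * r + x \<le> ln 2 + real n * L"
    using B cB r(1) x L0 by (simp add: ennreal_mult[symmetric] ennreal_plus[symmetric] del: ennreal_plus)
  then have B': "\<beta> * (ln (real (card B)) * r + x) \<le> \<beta> * (ln 2 + real n * L)"
    using \<alpha>\<beta> by (intro mult_left_mono)
  have "ennreal \<alpha> * (ennreal (ln (real (card A))) * ennreal r)
    \<le> ennreal \<alpha> * (ennreal (ln (real (card A))) * expect n (\<lambda>a b w. if decA w = a then 1 else 0))"
    by (intro mult_left_mono r) auto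
  also have "\<dots> \<le> ennreal \<alpha> * (ennreal (ln 2) + (\<Sum>t<n. expect t (\<lambda>a b w. \<integral>\<^sup>+ z. phi (pmix t b w z) \<partial>\<nu>)))"
    by (intro mult_left_mono fano_known_message[OF decA]) auto
  also have "\<dots> = ennreal \<alpha> * ennreal (ln 2) + (\<Sum>t<n. ennreal \<alpha> * expect t (\<lambda>a b w. \<integral>\<^sup>+ z. phi (pmix t b w z) \<partial>\<nu>))"
    by (simp only: distrib_left sum_distrib_left)
  also have "\<dots> \<le> ennreal \<alpha> * ennreal (ln 2) + (\<Sum>t<n. ennreal \<beta> * ?h t + ennreal D)"
    by (intro add_left_mono sum_mono letter) simp
  also have "\<dots> = ennreal \<alpha> * ennreal (ln 2) + (ennreal \<beta> * X + of_nat n * ennreal D)"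
    by (simp add: sum.distrib X_def sum_distrib_left)
  also have "\<dots> = ennreal (\<alpha> * ln 2 + (\<beta> * x + real n * D))"
    using \<alpha>\<beta> x D0 by (simp add: ennreal_of_nat_eq_real_of_nat ennreal_mult[symmetric] ennreal_plus[symmetric] del: ennreal_plus)
  finally have "\<alpha> * (ln (real (card A)) * r) \<le> \<alpha> * ln 2 + (\<beta> * x + real n * D)"
  proof -
    assume le: "ennreal \<alpha> * (ennreal (ln (real (card A))) * ennreal r) \<le> ennreal (\<alpha> * ln 2 + (\<beta> * x + real n * D))"
    have "ennreal \<alpha> * (ennreal (ln (real (card A))) * ennreal r) = ennreal (\<alpha> * (ln (real (card A)) * r))"
      using \<alpha>\<beta> cA r(1) by (simp add: ennreal_mult[symmetric])
    moreover have "0 \<le> \<alpha> * ln 2 + (\<beta> * x + real n * D)"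
      using \<alpha>\<beta> x D0 by (intro add_nonneg_nonneg mult_nonneg_nonneg) auto
    ultimately show ?thesis using le by (simp only: ennreal_le_iff)
  qed
  with B' show ?thesis
    unfolding K_def[symmetric] D_def[symmetric] L_def[symmetric] by (simp add: algebra_simps)
qed

end

end

section \<open>The law induced by a code\<close>

text \<open>Connects the model, where noise is added to a noiseless output, with step densities. For
  fixed channels the two noise vectors are shifted one after the other.\<close>

lemma nn_integral_step_transport:
  fixes F :: "('m1::finite, 'm2::finite, 'n1::finite, 'n2::finite) step \<Rightarrow> ennreal"
  assumes F: "F \<in> borel_measurable step_ref"
  shows "(\<integral>\<^sup>+ H. \<integral>\<^sup>+ w. F (H, channel_output H x1 x2 w) \<partial>noise_dist \<partial>channel_dist)
    = (\<integral>\<^sup>+ z. ennreal (step_density x1 x2 z) * F z \<partial>step_ref)"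
proof -
  let ?y1 = "vec_ref :: (complex ^ 'n1) measure" and ?y2 = "vec_ref :: (complex ^ 'n2) measure"
  interpret v2: sigma_finite_measure ?y2 by (rule sigma_finite_vec_ref)
  interpret n2: sigma_finite_measure "noise_vector :: (complex ^ 'n2) measure" by (rule sigma_finite_noise_vector)
  have id: "(\<lambda>z. z) \<in> measurable step_ref (step_ref :: ('m1, 'm2, 'n1, 'n2) step measure)" by simp
  have dm: "(\<lambda>z. ennreal (step_density x1 x2 z)) \<in> borel_measurable (step_ref :: ('m1, 'm2, 'n1, 'n2) step measure)"
    by (rule measurable_compose[OF step_density_measurable[OF measurable_const measurable_const id] measurable_ennreal]) auto
  have "(\<integral>\<^sup>+ z. ennreal (step_density x1 x2 z) * F z \<partial>step_ref)
    = (\<integral>\<^sup>+ H. \<integral>\<^sup>+ y1. \<integral>\<^sup>+ y2. ennreal (step_density x1 x2 (H, y1, y2)) * F (H, y1, y2) \<partial>?y2 \<partial>?y1 \<partial>channel_dist)"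
    by (rule nn_integral_step_ref[OF borel_measurable_times_ennreal[OF dm F]])
  also have "\<dots> = (\<integral>\<^sup>+ H. \<integral>\<^sup>+ w. F (H, channel_output H x1 x2 w) \<partial>noise_dist \<partial>channel_dist)"
  proof (rule nn_integral_cong)
    fix H :: "('m1, 'm2, 'n1, 'n2) channel"
    define \<mu>1 where "\<mu>1 = fst H *v x1 + fst (snd H) *v x2"
    define \<mu>2 where "\<mu>2 = fst (snd (snd H)) *v x1 + snd (snd (snd H)) *v x2"
    have FH: "(\<lambda>y. F (H, y)) \<in> borel_measurable (borel \<Otimes>\<^sub>M borel)"
      using measurable_compose[OF measurable_Pair1'[of H channel_dist "?y1 \<Otimes>\<^sub>M ?y2"] F]
      by (simp cong: measurable_cong_sets sets_pair_measure_cong)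
    have F2: "(\<lambda>y2. F (H, y1, y2)) \<in> borel_measurable borel" for y1
      using measurable_compose[OF measurable_Pair1'[of y1 borel borel] FH] by simp
    have F2s: "(\<lambda>p. F (H, fst p, \<mu>2 + snd p)) \<in> borel_measurable (borel \<Otimes>\<^sub>M borel)"
      by (rule measurable_compose[OF _ FH, of "\<lambda>p. (fst p, \<mu>2 + snd p)", simplified]) measurable
    have g2: "(\<lambda>y1. \<integral>\<^sup>+ w2. F (H, y1, \<mu>2 + w2) \<partial>noise_vector) \<in> borel_measurable borel"
      using F2s by (intro n2.borel_measurable_nn_integral) (simp add: split_beta' cong: measurable_cong_sets sets_pair_measure_cong)
    have gm: "(\<lambda>y2. ennreal (exp (- (norm (y2 - \<mu>2))\<^sup>2)) * F (H, y1, y2)) \<in> borel_measurable ?y2" for y1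
      using F2[of y1] by simp
    have dens: "ennreal (step_density x1 x2 (H, y1, y2))
      = ennreal (exp (- (norm (y1 - \<mu>1))\<^sup>2)) * ennreal (exp (- (norm (y2 - \<mu>2))\<^sup>2))" for y1 y2
      by (simp add: step_density_def rx2_density_def rx_density_def \<mu>1_def \<mu>2_def ennreal_mult)
    have "(\<integral>\<^sup>+ y1. \<integral>\<^sup>+ y2. ennreal (step_density x1 x2 (H, y1, y2)) * F (H, y1, y2) \<partial>?y2 \<partial>?y1)
      = (\<integral>\<^sup>+ y1. ennreal (exp (- (norm (y1 - \<mu>1))\<^sup>2)) * (\<integral>\<^sup>+ y2. ennreal (exp (- (norm (y2 - \<mu>2))\<^sup>2)) * F (H, y1, y2) \<partial>?y2) \<partial>?y1)"
      by (intro nn_integral_cong) (simp only: dens mult.assoc nn_integral_cmult[OF gm])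
    also have "\<dots> = (\<integral>\<^sup>+ y1. ennreal (exp (- (norm (y1 - \<mu>1))\<^sup>2)) * (\<integral>\<^sup>+ w2. F (H, y1, \<mu>2 + w2) \<partial>noise_vector) \<partial>?y1)"
      by (simp only: noise_vector_shift[OF F2])
    also have "\<dots> = (\<integral>\<^sup>+ w1. \<integral>\<^sup>+ w2. F (H, \<mu>1 + w1, \<mu>2 + w2) \<partial>noise_vector \<partial>noise_vector)"
      by (rule noise_vector_shift[OF g2, symmetric])
    also have "\<dots> = (\<integral>\<^sup>+ w. F (H, channel_output H x1 x2 w) \<partial>noise_dist)"
    proof -
      have eq: "channel_output H x1 x2 w = (\<mu>1 + fst w, \<mu>2 + snd w)" for w
        by (simp add: channel_output_def \<mu>1_def \<mu>2_def split_beta)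
      have m: "(\<lambda>w. F (H, \<mu>1 + fst w, \<mu>2 + snd w)) \<in> borel_measurable (noise_vector \<Otimes>\<^sub>M noise_vector)"
        by (rule measurable_compose[OF _ FH]) measurable
      show ?thesis
        unfolding noise_dist_def eq by (subst nn_integral_pair[OF sigma_finite_noise_vector m]) simp
    qed
    finally show "(\<integral>\<^sup>+ y1. \<integral>\<^sup>+ y2. ennreal (step_density x1 x2 (H, y1, y2)) * F (H, y1, y2) \<partial>?y2 \<partial>?y1)
      = (\<integral>\<^sup>+ w. F (H, channel_output H x1 x2 w) \<partial>noise_dist)" .
  qed
  finally show ?thesis by simp
qed

text \<open>Encoders and decoders take channels and outputs as separate sequences, while the
  argument runs over one sequence of joint steps.\<close>

definition view :: "nat \<Rightarrow> (nat \<Rightarrow> ('m1, 'm2, 'n1, 'n2) step)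
    \<Rightarrow> (nat \<Rightarrow> ('m1, 'm2, 'n1, 'n2) channel) \<times> (nat \<Rightarrow> complex ^ 'n1) \<times> (nat \<Rightarrow> complex ^ 'n2)" where
  "view t z = (\<lambda>s\<in>{1..t}. fst (z s), \<lambda>s\<in>{1..t}. fst (snd (z s)), \<lambda>s\<in>{1..t}. snd (snd (z s)))"

text \<open>The path produced by the code for fixed messages, as a deterministic function of channel
  and noise sequences. Its law is then a property of these two sequences alone.\<close>

primrec step_trace :: "('m1::finite, 'm2::finite, 'n1::finite, 'n2::finite) ic_code \<Rightarrow> nat \<Rightarrow> nat
    \<Rightarrow> (nat \<Rightarrow> ('m1, 'm2, 'n1, 'n2) channel) \<Rightarrow> (nat \<Rightarrow> (complex ^ 'n1) \<times> (complex ^ 'n2)) \<Rightarrow> nat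
    \<Rightarrow> nat \<Rightarrow> ('m1, 'm2, 'n1, 'n2) step" where
  "step_trace c a b h w 0 = (\<lambda>_. undefined)"
| "step_trace c a b h w (Suc t) = (step_trace c a b h w t)(Suc t := (h (Suc t),
     channel_output (h (Suc t)) (enc1 c (Suc t) (a, view t (step_trace c a b h w t)))
       (enc2 c (Suc t) (b, view t (step_trace c a b h w t))) (w (Suc t))))"

lemma view_upd: "view (Suc t) (z(Suc t := (H, y))) =
    ((fst (view t z))(Suc t := H), (fst (snd (view t z)))(Suc t := fst y), (snd (snd (view t z)))(Suc t := snd y))"
  by (auto simp: view_def fun_eq_iff restrict_def)

text \<open>Ties the recursion over joint steps to the recursion \<open>outputs_upto\<close> of the
  model, so that power constraint and error event can be expressed through
  \<open>step_trace\<close>.\<close>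

lemma view_step_trace:
  "view t (step_trace c a b h w t) = (channels_upto ((a, b), h, w) t, outputs_upto c ((a, b), h, w) t)"
proof (induction t)
  case 0
  then show ?case by (simp add: view_def channels_upto_def restrict_def)
next
  case (Suc t)
  have ch: "channels_upto ((a, b), h, w) (Suc t) = (channels_upto ((a, b), h, w) t)(Suc t := h (Suc t))"
    by (auto simp: channels_upto_def fun_eq_iff restrict_def)
  obtain y1 y2 where y: "outputs_upto c ((a, b), h, w) t = (y1, y2)" by fastforce
  obtain z1 z2 where z: "channel_output (h (Suc t)) (enc1 c (Suc t) (a, channels_upto ((a, b), h, w) t, y1, y2))
      (enc2 c (Suc t) (b, channels_upto ((a, b), h, w) t, y1, y2)) (w (Suc t)) = (z1, z2)" by fastforce
  show ?case
    unfolding step_trace.simps view_upd Suc.IH ch by (simp add: y z Let_def fun_upd_def)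
qed

lemma step_trace_cong:
  "(\<And>s. 1 \<le> s \<Longrightarrow> s \<le> t \<Longrightarrow> h s = h' s) \<Longrightarrow> (\<And>s. 1 \<le> s \<Longrightarrow> s \<le> t \<Longrightarrow> w s = w' s)
    \<Longrightarrow> step_trace c a b h w t = step_trace c a b h' w' t"
  by (induction t) auto

locale coded =
  fixes n K1 K2 :: nat and c :: "('m1::finite, 'm2::finite, 'n1::finite, 'n2::finite) ic_code"
  assumes K: "1 \<le> K1" "1 \<le> K2"
    and enc1: "\<And>t. t \<in> {1..n} \<Longrightarrow> enc1 c t \<in> borel_measurable (count_space {1..K1} \<Otimes>\<^sub>M ((\<Pi>\<^sub>M s\<in>{1..t-1}. borel) \<Otimes>\<^sub>M
        ((\<Pi>\<^sub>M s\<in>{1..t-1}. borel) \<Otimes>\<^sub>M (\<Pi>\<^sub>M s\<in>{1..t-1}. borel))))"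
    and enc2: "\<And>t. t \<in> {1..n} \<Longrightarrow> enc2 c t \<in> borel_measurable (count_space {1..K2} \<Otimes>\<^sub>M ((\<Pi>\<^sub>M s\<in>{1..t-1}. borel) \<Otimes>\<^sub>M
        ((\<Pi>\<^sub>M s\<in>{1..t-1}. borel) \<Otimes>\<^sub>M (\<Pi>\<^sub>M s\<in>{1..t-1}. borel))))"
begin

text \<open>The input at time \<open>Suc t\<close>: feedback arrives with a delay of one symbol,
  hence a view of length \<open>t\<close>.\<close>

definition X1 :: "nat \<Rightarrow> nat \<Rightarrow> (nat \<Rightarrow> ('m1, 'm2, 'n1, 'n2) step) \<Rightarrow> complex ^ 'm1" where
  "X1 t a z = enc1 c (Suc t) (a, view t z)"

definition X2 :: "nat \<Rightarrow> nat \<Rightarrow> (nat \<Rightarrow> ('m1, 'm2, 'n1, 'n2) step) \<Rightarrow> complex ^ 'm2" where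
  "X2 t b z = enc2 c (Suc t) (b, view t z)"

abbreviation SR :: "('m1, 'm2, 'n1, 'n2) step measure" where "SR \<equiv> step_ref"
abbreviation CD :: "('m1, 'm2, 'n1, 'n2) channel measure" where "CD \<equiv> channel_dist"
abbreviation ND :: "((complex ^ 'n1) \<times> (complex ^ 'n2)) measure" where "ND \<equiv> noise_dist"

lemma view_measurable:
  "view t \<in> measurable (hist SR t) ((\<Pi>\<^sub>M s\<in>{1..t}. borel) \<Otimes>\<^sub>M ((\<Pi>\<^sub>M s\<in>{1..t}. borel) \<Otimes>\<^sub>M (\<Pi>\<^sub>M s\<in>{1..t}. borel)))"
  unfolding view_def[abs_def]
proof (intro measurable_Pair measurable_restrict)
  fix s assume s: "s \<in> {1..t}"
  have z: "(\<lambda>z. z s) \<in> measurable (hist SR t) SR"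
    using s by (rule measurable_component_singleton)
  show "(\<lambda>z. fst (z s)) \<in> borel_measurable (hist SR t)"
    using step_parts_measurable(1)[OF z] by (simp cong: measurable_cong_sets add: sets_channel_dist_borel)
  show "(\<lambda>z. fst (snd (z s))) \<in> borel_measurable (hist SR t)" "(\<lambda>z. snd (snd (z s))) \<in> borel_measurable (hist SR t)"
    by (rule step_parts_measurable[OF z])+
qed

lemma X1_measurable: "t < n \<Longrightarrow> a \<in> {1..K1} \<Longrightarrow> X1 t a \<in> borel_measurable (hist SR t)"
  unfolding X1_def[abs_def]
proof (rule measurable_compose[OF measurable_Pair[OF measurable_const view_measurable]])
  assume "t < n"
  then show "enc1 c (Suc t) \<in> borel_measurable (count_space {1..K1} \<Otimes>\<^sub>M ((\<Pi>\<^sub>M s\<in>{1..t}. borel) \<Otimes>\<^sub>M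
        ((\<Pi>\<^sub>M s\<in>{1..t}. borel) \<Otimes>\<^sub>M (\<Pi>\<^sub>M s\<in>{1..t}. borel))))"
    using enc1[of "Suc t"] by simp
qed auto

lemma X2_measurable: "t < n \<Longrightarrow> b \<in> {1..K2} \<Longrightarrow> X2 t b \<in> borel_measurable (hist SR t)"
  unfolding X2_def[abs_def]
proof (rule measurable_compose[OF measurable_Pair[OF measurable_const view_measurable]])
  assume "t < n"
  then show "enc2 c (Suc t) \<in> borel_measurable (count_space {1..K2} \<Otimes>\<^sub>M ((\<Pi>\<^sub>M s\<in>{1..t}. borel) \<Otimes>\<^sub>M
        ((\<Pi>\<^sub>M s\<in>{1..t}. borel) \<Otimes>\<^sub>M (\<Pi>\<^sub>M s\<in>{1..t}. borel))))"
    using enc2[of "Suc t"] by simp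
qed auto

sublocale mimo_coding SR n "{1..K1}" "{1..K2}" "\<lambda>z. z" X1 X2
  using K by (intro mimo_coding.intro X1_measurable X2_measurable sigma_finite_step_ref measurable_ident_sets refl) auto

lemma step_trace_Suc: "step_trace c a b h w (Suc t) = (step_trace c a b h w t)(Suc t := (h (Suc t),
     channel_output (h (Suc t)) (X1 t a (step_trace c a b h w t)) (X2 t b (step_trace c a b h w t)) (w (Suc t))))"
  by (simp add: X1_def X2_def)

lemma channel_output_measurable:
  assumes "H \<in> measurable M CD" "x1 \<in> borel_measurable M" "x2 \<in> borel_measurable M" "w \<in> measurable M ND"
  shows "(\<lambda>x. channel_output (H x) (x1 x) (x2 x) (w x)) \<in> measurable M (vec_ref \<Otimes>\<^sub>M vec_ref)"
proof -
  note [measurable] = measurable_channel_parts[OF assms(1)] assms(2,3)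
  have [measurable]: "(\<lambda>x. fst (w x)) \<in> borel_measurable M" "(\<lambda>x. snd (w x)) \<in> borel_measurable M"
  proof -
    have "w \<in> measurable M (borel \<Otimes>\<^sub>M borel)"
      using assms(4) by (simp cong: measurable_cong_sets add: sets_noise_dist)
    then show "(\<lambda>x. fst (w x)) \<in> borel_measurable M" "(\<lambda>x. snd (w x)) \<in> borel_measurable M" by measurable
  qed
  have "(\<lambda>x. channel_output (H x) (x1 x) (x2 x) (w x))
    = (\<lambda>x. (fst (H x) *v x1 x + fst (snd (H x)) *v x2 x + fst (w x),
        fst (snd (snd (H x))) *v x1 x + snd (snd (snd (H x))) *v x2 x + snd (w x)))"
    by (simp add: channel_output_def split_beta)
  then show ?thesis by simp
qed

lemma step_trace_measurable:
  assumes "a \<in> {1..K1}" "b \<in> {1..K2}" "t \<le> n"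
    and h: "\<And>s. 1 \<le> s \<Longrightarrow> s \<le> t \<Longrightarrow> (\<lambda>x. h x s) \<in> measurable M CD"
    and w: "\<And>s. 1 \<le> s \<Longrightarrow> s \<le> t \<Longrightarrow> (\<lambda>x. w x s) \<in> measurable M ND"
  shows "(\<lambda>x. step_trace c a b (h x) (w x) t) \<in> measurable M (hist SR t)"
  using assms(3-)
proof (induction t)
  case 0
  then show ?case by (simp add: PiM_empty)
next
  case (Suc t)
  have IH: "(\<lambda>x. step_trace c a b (h x) (w x) t) \<in> measurable M (hist SR t)"
    using Suc by simp
  have "(\<lambda>x. (step_trace c a b (h x) (w x) t)(Suc t := (h x (Suc t),
     channel_output (h x (Suc t)) (X1 t a (step_trace c a b (h x) (w x) t)) (X2 t b (step_trace c a b (h x) (w x) t)) (w x (Suc t)))))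
    \<in> measurable M (hist SR (Suc t))"
  proof (rule measurable_upd[OF IH])
    show "(\<lambda>x. (h x (Suc t), channel_output (h x (Suc t)) (X1 t a (step_trace c a b (h x) (w x) t)) (X2 t b (step_trace c a b (h x) (w x) t)) (w x (Suc t))))
      \<in> measurable M SR"
      using Suc.prems assms(1,2)
      by (intro measurable_Pair channel_output_measurable measurable_compose[OF IH X1_measurable] measurable_compose[OF IH X2_measurable]) auto
  qed auto
  then show ?case by (simp only: step_trace_Suc)
qed

text \<open>Channel and noise at time \<open>Suc t\<close> are independent of the past and can be
  integrated innermost. Given the past, the inputs are fixed vectors, so the transport of a single
  step yields the kernel.\<close>

lemma step_trace_law:
  assumes ab: "a \<in> {1..K1}" "b \<in> {1..K2}" and "t \<le> n" and F: "F \<in> borel_measurable (hist SR t)"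
  shows "(\<integral>\<^sup>+ h. \<integral>\<^sup>+ w. F (step_trace c a b h w t) \<partial>hist ND t \<partial>hist CD t)
    = (\<integral>\<^sup>+ z. ennreal (dens t a b z) * F z \<partial>hist SR t)"
  using assms(3,4)
proof (induction t arbitrary: F)
  case 0
  then show ?case by (simp add: PiM_empty nn_integral_count_space_finite dens_def)
next
  case (Suc t)
  note F = Suc.prems(2)
  have t: "t < n" using Suc.prems by simp
  interpret nd: sigma_finite_measure ND by (rule sigma_finite_noise_dist)
  interpret ndt: sigma_finite_measure "hist ND t" by (intro sigma_finite_PiM_const sigma_finite_noise_dist) simp
  interpret ndS: sigma_finite_measure "hist ND (Suc t)" by (intro sigma_finite_PiM_const sigma_finite_noise_dist) simp
  let ?T = "\<lambda>h w. step_trace c a b h w t"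
  let ?next = "\<lambda>h w H e. (?T h w)(Suc t := (H, channel_output H (X1 t a (?T h w)) (X2 t b (?T h w)) e))"
  have tr: "step_trace c a b (h(Suc t := H)) (w(Suc t := e)) (Suc t) = ?next h w H e" for h w H e
  proof -
    have "step_trace c a b (h(Suc t := H)) (w(Suc t := e)) t = ?T h w" by (rule step_trace_cong) auto
    then show ?thesis by (simp only: step_trace_Suc fun_upd_same)
  qed
  have Tm: "(\<lambda>x. ?T (hf x) (wf x)) \<in> measurable M (hist SR t)"
    if "hf \<in> measurable M (hist CD t)" "wf \<in> measurable M (hist ND t)" for hf wf and M :: "'q measure"
  proof (rule step_trace_measurable[OF ab less_imp_le[OF t]])
    fix s :: nat assume "1 \<le> s" "s \<le> t"
    then have s: "s \<in> {1..t}" by simp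
    show "(\<lambda>x. hf x s) \<in> measurable M CD" "(\<lambda>x. wf x s) \<in> measurable M ND"
      using measurable_compose[OF that(1) measurable_component_singleton[OF s]]
        measurable_compose[OF that(2) measurable_component_singleton[OF s]] .
  qed
  have nextm: "(\<lambda>x. F (?next (hf x) (wf x) (Hf x) (ef x))) \<in> borel_measurable M"
    if "hf \<in> measurable M (hist CD t)" "wf \<in> measurable M (hist ND t)" "Hf \<in> measurable M CD" "ef \<in> measurable M ND"
    for hf wf Hf ef and M :: "'q measure"
  proof (rule measurable_compose[OF _ F], rule measurable_upd[OF Tm[OF that(1,2)]])
    show "(\<lambda>x. (Hf x, channel_output (Hf x) (X1 t a (?T (hf x) (wf x))) (X2 t b (?T (hf x) (wf x))) (ef x))) \<in> measurable M SR"
      using t ab that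
      by (intro measurable_Pair channel_output_measurable measurable_compose[OF Tm X1_measurable] measurable_compose[OF Tm X2_measurable]) auto
  qed auto
  have "(\<integral>\<^sup>+ h. \<integral>\<^sup>+ w. F (step_trace c a b h w (Suc t)) \<partial>hist ND (Suc t) \<partial>hist CD (Suc t))
    = (\<integral>\<^sup>+ h. \<integral>\<^sup>+ H. \<integral>\<^sup>+ w. F (step_trace c a b (h(Suc t := H)) w (Suc t)) \<partial>hist ND (Suc t) \<partial>CD \<partial>hist CD t)"
  proof (rule nn_integral_hist_Suc[OF sigma_finite_channel_dist])
    have "(\<lambda>p. F (step_trace c a b (fst p) (snd p) (Suc t))) \<in> borel_measurable (hist CD (Suc t) \<Otimes>\<^sub>M hist ND (Suc t))"
      using ab Suc.prems(1)
      by (intro measurable_compose[OF _ F] step_trace_measurable measurable_compose[OF measurable_fst measurable_component_singleton]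
          measurable_compose[OF measurable_snd measurable_component_singleton]) auto
    then show "(\<lambda>h. \<integral>\<^sup>+ w. F (step_trace c a b h w (Suc t)) \<partial>hist ND (Suc t)) \<in> borel_measurable (hist CD (Suc t))"
      by (intro ndS.borel_measurable_nn_integral) (simp only: split_beta')
  qed
  also have "\<dots> = (\<integral>\<^sup>+ h. \<integral>\<^sup>+ H. \<integral>\<^sup>+ w. \<integral>\<^sup>+ e. F (?next h w H e) \<partial>ND \<partial>hist ND t \<partial>CD \<partial>hist CD t)"
  proof (intro nn_integral_cong)
    fix h H assume h: "h \<in> space (hist CD t)"
    have "(\<lambda>w. F (step_trace c a b (h(Suc t := H)) w (Suc t))) \<in> borel_measurable (hist ND (Suc t))"
      using ab Suc.prems(1) by (intro measurable_compose[OF _ F] step_trace_measurable measurable_component_singleton measurable_const) auto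
    from nn_integral_hist_Suc[OF sigma_finite_noise_dist this]
    show "(\<integral>\<^sup>+ w. F (step_trace c a b (h(Suc t := H)) w (Suc t)) \<partial>hist ND (Suc t))
      = (\<integral>\<^sup>+ w. \<integral>\<^sup>+ e. F (?next h w H e) \<partial>ND \<partial>hist ND t)"
      by (simp only: tr)
  qed
  \<comment> \<open>The new channel is moved inside the old noise, so that the whole past is fixed
    when the new step is integrated.\<close>
  also have "\<dots> = (\<integral>\<^sup>+ h. \<integral>\<^sup>+ w. \<integral>\<^sup>+ H. \<integral>\<^sup>+ e. F (?next h w H e) \<partial>ND \<partial>CD \<partial>hist ND t \<partial>hist CD t)"
  proof (intro nn_integral_cong nn_integral_swap sigma_finite_channel_dist ndt.sigma_finite_measure_axioms)
    fix h assume h: "h \<in> space (hist CD t)"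
    have "(\<lambda>p. F (?next h (snd (fst p)) (fst (fst p)) (snd p))) \<in> borel_measurable ((CD \<Otimes>\<^sub>M hist ND t) \<Otimes>\<^sub>M ND)"
      by (intro nextm measurable_const h measurable_snd measurable_compose[OF measurable_fst measurable_fst]
          measurable_compose[OF measurable_fst measurable_snd])
    then show "(\<lambda>(H, w). \<integral>\<^sup>+ e. F (?next h w H e) \<partial>ND) \<in> borel_measurable (CD \<Otimes>\<^sub>M hist ND t)"
      unfolding split_beta' by (intro nd.borel_measurable_nn_integral) (simp only: split_beta')
  qed
  also have "\<dots> = (\<integral>\<^sup>+ h. \<integral>\<^sup>+ w. (\<lambda>T. \<integral>\<^sup>+ z. ennreal (kern t a b T z) * F (T(Suc t := z)) \<partial>SR) (?T h w) \<partial>hist ND t \<partial>hist CD t)"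
  proof (intro nn_integral_cong)
    fix h w assume h: "h \<in> space (hist CD t)" and w: "w \<in> space (hist ND t)"
    have "?T h w \<in> space (hist SR t)"
      using measurable_space[OF Tm[OF measurable_fst measurable_snd], of "(h, w)"] h w
      by (simp add: space_pair_measure)
    then have "(\<lambda>z. F ((?T h w)(Suc t := z))) \<in> borel_measurable SR"
      by (intro measurable_compose[OF measurable_hist_upd F])
    from nn_integral_step_transport[OF this, of "X1 t a (?T h w)" "X2 t b (?T h w)"]
    show "(\<integral>\<^sup>+ H. \<integral>\<^sup>+ e. F (?next h w H e) \<partial>ND \<partial>CD)
      = (\<lambda>T. \<integral>\<^sup>+ z. ennreal (kern t a b T z) * F (T(Suc t := z)) \<partial>SR) (?T h w)"
      by (simp add: kern_def)
  qed
  also have "\<dots> = (\<integral>\<^sup>+ T. ennreal (dens t a b T) * (\<integral>\<^sup>+ z. ennreal (kern t a b T z) * F (T(Suc t := z)) \<partial>SR) \<partial>hist SR t)"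
  proof (rule Suc.IH)
    interpret sr: sigma_finite_measure SR by (rule sigma_finite_step_ref)
    show "(\<lambda>T. \<integral>\<^sup>+ z. ennreal (kern t a b T z) * F (T(Suc t := z)) \<partial>SR) \<in> borel_measurable (hist SR t)"
      using measurable_compose[OF k_meas[OF t ab] measurable_ennreal] measurable_compose[OF measurable_hist_upd' F]
      by (intro sr.borel_measurable_nn_integral) (simp only: split_beta' borel_measurable_times_ennreal)
  qed (use t in simp)
  also have "\<dots> = (\<integral>\<^sup>+ z. ennreal (dens (Suc t) a b z) * F z \<partial>hist SR (Suc t))"
  proof -
    have d: "ennreal (dens s a b z) = seqprod (\<lambda>s w z. ennreal (kern s a b w z)) s z" for s z
      unfolding dens_def by (rule ennreal_seqprod) (rule k_pos)
    have "(\<lambda>(w, z). ennreal (kern s a b w z)) \<in> borel_measurable (hist SR s \<Otimes>\<^sub>M SR)" if "s < Suc t" for s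
      using measurable_compose[OF k_meas[OF _ ab, of s] measurable_ennreal] that t by (simp add: split_beta')
    from nn_integral_seqprod_Suc[OF sigma_finite_step_ref this F] show ?thesis
      by (simp only: d)
  qed
  finally show ?case .
qed

end

section \<open>From the sample space to finite histories\<close>

lemma nn_integral_uniform_count:
  assumes "finite A"
  shows "(\<integral>\<^sup>+ x. F x \<partial>uniform_count_measure A) = ennreal (1 / real (card A)) * (\<Sum>x\<in>A. F x)"
  using assms unfolding uniform_count_measure_def
  by (simp add: nn_integral_point_measure_finite sum_distrib_left)

text \<open>The sample space carries infinite products of probability measures, but a quantity at
  time \<open>t\<close> depends on finitely many factors; the finite marginals are again
  products.\<close>

lemma nn_integral_PiM_restrict:
  assumes M: "prob_space M" and J: "finite J" "J \<subseteq> I" and F: "F \<in> borel_measurable (PiM J (\<lambda>_. M))"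
  shows "(\<integral>\<^sup>+ x. F (restrict x J) \<partial>PiM I (\<lambda>_. M)) = (\<integral>\<^sup>+ x. F x \<partial>PiM J (\<lambda>_. M))"
proof -
  interpret M: prob_space M by fact
  interpret product_prob_space "\<lambda>_. M" I by unfold_locales
  have "(\<integral>\<^sup>+ x. F x \<partial>PiM J (\<lambda>_. M)) = (\<integral>\<^sup>+ x. F x \<partial>distr (PiM I (\<lambda>_. M)) (PiM J (\<lambda>_. M)) (\<lambda>x. restrict x J))"
    by (simp only: distr_PiM_restrict_finite[OF J])
  also have "\<dots> = (\<integral>\<^sup>+ x. F (restrict x J) \<partial>PiM I (\<lambda>_. M))"
    using F by (intro nn_integral_distr measurable_restrict_subset J) simp
  finally show ?thesis by simp
qed

context coded
begin

abbreviation trc :: "nat \<Rightarrow> ('m1, 'm2, 'n1, 'n2) sample \<Rightarrow> nat \<Rightarrow> ('m1, 'm2, 'n1, 'n2) step" where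
  "trc t \<omega> \<equiv> step_trace c (fst (fst \<omega>)) (snd (fst \<omega>)) (fst (snd \<omega>)) (snd (snd \<omega>)) t"

lemma sets_sample_space:
  "sets (sample_space K1 K2 :: ('m1, 'm2, 'n1, 'n2) sample measure)
    = sets (count_space ({1..K1} \<times> {1..K2}) \<Otimes>\<^sub>M (PiM {1..} (\<lambda>_. CD) \<Otimes>\<^sub>M PiM {1..} (\<lambda>_. ND)))"
proof -
  have "sets (uniform_count_measure {1..K1} \<Otimes>\<^sub>M uniform_count_measure {1..K2}) = sets (count_space {1..K1} \<Otimes>\<^sub>M count_space {1..K2})"
    by (intro sets_pair_measure_cong sets_uniform_count_measure_count_space)
  also have "count_space {1..K1} \<Otimes>\<^sub>M count_space {1..K2} = count_space ({1..K1} \<times> {1..K2})"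
    by (intro pair_measure_countable) auto
  finally show ?thesis unfolding sample_space_def by (intro sets_pair_measure_cong) auto
qed

lemma step_trace_measurable_PiM:
  assumes "a \<in> {1..K1}" "b \<in> {1..K2}" "t \<le> n"
  shows "(\<lambda>p. step_trace c a b (fst p) (snd p) t) \<in> measurable (PiM {1..} (\<lambda>_. CD) \<Otimes>\<^sub>M PiM {1..} (\<lambda>_. ND)) (hist SR t)"
proof (rule step_trace_measurable[OF assms])
  fix s :: nat assume "1 \<le> s"
  then have s: "s \<in> {1..}" by simp
  show "(\<lambda>p. fst p s) \<in> measurable (PiM {1..} (\<lambda>_. CD) \<Otimes>\<^sub>M PiM {1..} (\<lambda>_. ND)) CD"
    "(\<lambda>p. snd p s) \<in> measurable (PiM {1..} (\<lambda>_. CD) \<Otimes>\<^sub>M PiM {1..} (\<lambda>_. ND)) ND"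
    using measurable_compose[OF measurable_fst measurable_component_singleton[OF s]]
      measurable_compose[OF measurable_snd measurable_component_singleton[OF s]] .
qed

text \<open>There are only countably many pairs of messages, so it is enough to check each fixed
  pair.\<close>

lemma sample_measurable:
  assumes t: "t \<le> n" and F: "\<And>a b. a \<in> {1..K1} \<Longrightarrow> b \<in> {1..K2} \<Longrightarrow> F a b \<in> measurable (hist SR t) N"
  shows "(\<lambda>\<omega>. F (fst (fst \<omega>)) (snd (fst \<omega>)) (trc t \<omega>)) \<in> measurable (sample_space K1 K2) N"
proof (subst measurable_cong_sets[OF sets_sample_space refl], rule measurable_pair_measure_countable1)
  show "countable ({1..K1} \<times> {1..K2})" by simp
  fix p assume "p \<in> {1..K1} \<times> {1..K2}"
  then have ab: "fst p \<in> {1..K1}" "snd p \<in> {1..K2}" by auto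
  show "(\<lambda>y. F (fst (fst (p, y))) (snd (fst (p, y))) (trc t (p, y))) \<in> measurable (PiM {1..} (\<lambda>_. CD) \<Otimes>\<^sub>M PiM {1..} (\<lambda>_. ND)) N"
    using measurable_compose[OF step_trace_measurable_PiM[OF ab t] F[OF ab]] by simp
qed

text \<open>Turns expectations of the model into those of the abstract feedback channel: uniform
  messages become a finite average, times beyond \<open>t\<close> drop out, and
  \<open>step_trace_law\<close> supplies the density.\<close>

lemma nn_integral_sample:
  assumes t: "t \<le> n" and F: "\<And>a b. a \<in> {1..K1} \<Longrightarrow> b \<in> {1..K2} \<Longrightarrow> F a b \<in> borel_measurable (hist SR t)"
  shows "(\<integral>\<^sup>+ \<omega>. F (fst (fst \<omega>)) (snd (fst \<omega>)) (trc t \<omega>) \<partial>sample_space K1 K2) = expect t F"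
proof -
  let ?U1 = "uniform_count_measure {1..K1}" and ?U2 = "uniform_count_measure {1..K2}"
  let ?C = "PiM {1..} (\<lambda>_. CD)" and ?N = "PiM {1..} (\<lambda>_. ND)"
  interpret U1: prob_space ?U1 using K by (intro prob_space_uniform_count_measure) auto
  interpret U2: prob_space ?U2 using K by (intro prob_space_uniform_count_measure) auto
  interpret C: prob_space ?C by (intro prob_space_PiM prob_space_channel_dist)
  interpret N: prob_space ?N by (intro prob_space_PiM prob_space_noise_dist)
  interpret CN: prob_space "?C \<Otimes>\<^sub>M ?N" by (intro prob_space_pair C.prob_space_axioms N.prob_space_axioms)
  let ?G = "\<lambda>\<omega>. F (fst (fst \<omega>)) (snd (fst \<omega>)) (trc t \<omega>)"
  have Gm: "?G \<in> borel_measurable ((?U1 \<Otimes>\<^sub>M ?U2) \<Otimes>\<^sub>M (?C \<Otimes>\<^sub>M ?N))"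
    using sample_measurable[OF t F] unfolding sample_space_def .
  have "(\<integral>\<^sup>+ \<omega>. ?G \<omega> \<partial>sample_space K1 K2) = (\<integral>\<^sup>+ p. \<integral>\<^sup>+ q. ?G (p, q) \<partial>(?C \<Otimes>\<^sub>M ?N) \<partial>(?U1 \<Otimes>\<^sub>M ?U2))"
    unfolding sample_space_def by (rule nn_integral_pair[OF CN.sigma_finite_measure_axioms Gm])
  also have "\<dots> = (\<integral>\<^sup>+ a. \<integral>\<^sup>+ b. \<integral>\<^sup>+ q. ?G ((a, b), q) \<partial>(?C \<Otimes>\<^sub>M ?N) \<partial>?U2 \<partial>?U1)"
    using Gm by (intro nn_integral_pair[OF U2.sigma_finite_measure_axioms] CN.borel_measurable_nn_integral) (simp add: split_beta')
  also have "\<dots> = ennreal (1 / real K1) * (\<Sum>a\<in>{1..K1}. ennreal (1 / real K2) * (\<Sum>b\<in>{1..K2}. \<integral>\<^sup>+ q. ?G ((a, b), q) \<partial>(?C \<Otimes>\<^sub>M ?N)))"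
    by (simp add: nn_integral_uniform_count)
  also have "\<dots> = ennreal (1 / (real K1 * real K2)) * (\<Sum>a\<in>{1..K1}. \<Sum>b\<in>{1..K2}. \<integral>\<^sup>+ q. ?G ((a, b), q) \<partial>(?C \<Otimes>\<^sub>M ?N))"
  proof -
    have "ennreal (1 / (real K1 * real K2)) = ennreal (1 / real K1) * ennreal (1 / real K2)"
      by (subst ennreal_mult[symmetric]) auto
    then show ?thesis by (simp only: sum_distrib_left[symmetric] mult.assoc)
  qed
  also have "(\<Sum>a\<in>{1..K1}. \<Sum>b\<in>{1..K2}. \<integral>\<^sup>+ q. ?G ((a, b), q) \<partial>(?C \<Otimes>\<^sub>M ?N))
    = (\<Sum>a\<in>{1..K1}. \<Sum>b\<in>{1..K2}. \<integral>\<^sup>+ z. ennreal (dens t a b z) * F a b z \<partial>hist SR t)"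
  proof (intro sum.cong refl)
    fix a b assume ab: "a \<in> {1..K1}" "b \<in> {1..K2}"
    interpret ndt: sigma_finite_measure "hist ND t" by (intro sigma_finite_PiM_const sigma_finite_noise_dist) simp
    have cm: "(\<lambda>p. F a b (step_trace c a b (fst p) (snd p) t)) \<in> borel_measurable (?C \<Otimes>\<^sub>M ?N)"
      by (rule measurable_compose[OF step_trace_measurable_PiM[OF ab t] F[OF ab]])
    have hm: "(\<lambda>p. F a b (step_trace c a b (fst p) (snd p) t)) \<in> borel_measurable (hist CD t \<Otimes>\<^sub>M hist ND t)"
    proof (rule measurable_compose[OF step_trace_measurable[OF ab t] F[OF ab]])
      fix s :: nat assume "1 \<le> s" "s \<le> t"
      then have s: "s \<in> {1..t}" by simp
      show "(\<lambda>p. fst p s) \<in> measurable (hist CD t \<Otimes>\<^sub>M hist ND t) CD" "(\<lambda>p. snd p s) \<in> measurable (hist CD t \<Otimes>\<^sub>M hist ND t) ND"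
        using measurable_compose[OF measurable_fst measurable_component_singleton[OF s]]
          measurable_compose[OF measurable_snd measurable_component_singleton[OF s]] .
    qed
    have hm1: "(\<lambda>w. F a b (step_trace c a b h w t)) \<in> borel_measurable (hist ND t)" for h
    proof (rule measurable_compose[OF step_trace_measurable[OF ab t] F[OF ab]])
      fix s :: nat assume "1 \<le> s" "s \<le> t"
      then have s: "s \<in> {1..t}" by simp
      show "(\<lambda>w. w s) \<in> measurable (hist ND t) ND" using s by (rule measurable_component_singleton)
    qed auto
    have "(\<integral>\<^sup>+ q. ?G ((a, b), q) \<partial>(?C \<Otimes>\<^sub>M ?N)) = (\<integral>\<^sup>+ h. \<integral>\<^sup>+ w. F a b (step_trace c a b h w t) \<partial>?N \<partial>?C)"
      using nn_integral_pair[OF N.sigma_finite_measure_axioms cm] by (simp only: fst_conv snd_conv)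
    also have "\<dots> = (\<integral>\<^sup>+ h. \<integral>\<^sup>+ w. F a b (step_trace c a b (restrict h {1..t}) (restrict w {1..t}) t) \<partial>?N \<partial>?C)"
      by (intro nn_integral_cong arg_cong[where f="F a b"] step_trace_cong) auto
    also have "\<dots> = (\<integral>\<^sup>+ h. \<integral>\<^sup>+ w. F a b (step_trace c a b (restrict h {1..t}) w t) \<partial>hist ND t \<partial>?C)"
      by (intro nn_integral_cong nn_integral_PiM_restrict[OF prob_space_noise_dist _ _ hm1]) auto
    also have "\<dots> = (\<integral>\<^sup>+ h. \<integral>\<^sup>+ w. F a b (step_trace c a b h w t) \<partial>hist ND t \<partial>hist CD t)"
    proof (rule nn_integral_PiM_restrict[OF prob_space_channel_dist, where F="\<lambda>h. \<integral>\<^sup>+ w. F a b (step_trace c a b h w t) \<partial>hist ND t"])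
      show "(\<lambda>h. \<integral>\<^sup>+ w. F a b (step_trace c a b h w t) \<partial>hist ND t) \<in> borel_measurable (hist CD t)"
        using hm by (intro ndt.borel_measurable_nn_integral) (simp only: split_beta')
    qed auto
    also have "\<dots> = (\<integral>\<^sup>+ z. ennreal (dens t a b z) * F a b z \<partial>hist SR t)"
      by (rule step_trace_law[OF ab t F[OF ab]])
    finally show "(\<integral>\<^sup>+ q. ?G ((a, b), q) \<partial>(?C \<Otimes>\<^sub>M ?N)) = (\<integral>\<^sup>+ z. ennreal (dens t a b z) * F a b z \<partial>hist SR t)" .
  qed
  finally show ?thesis unfolding expect_def by simp
qed

lemma power_input1:
  assumes "t < n" "(\<integral>\<^sup>+ \<omega>. ennreal ((norm (input1 c (Suc t) \<omega>))\<^sup>2) \<partial>sample_space K1 K2) \<le> ennreal P"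
  shows "expect t (\<lambda>a b w. ennreal ((norm (X1 t a w))\<^sup>2)) \<le> ennreal P"
proof -
  have "expect t (\<lambda>a b w. ennreal ((norm (X1 t a w))\<^sup>2))
    = (\<integral>\<^sup>+ \<omega>. ennreal ((norm (X1 t (fst (fst \<omega>)) (trc t \<omega>)))\<^sup>2) \<partial>sample_space K1 K2)"
    using assms(1) X1_measurable[OF assms(1)] by (intro nn_integral_sample[symmetric]) auto
  also have "\<dots> = (\<integral>\<^sup>+ \<omega>. ennreal ((norm (input1 c (Suc t) \<omega>))\<^sup>2) \<partial>sample_space K1 K2)"
    by (intro nn_integral_cong) (simp add: X1_def input1_def view_step_trace split_beta)
  finally show ?thesis using assms(2) by simp
qed

lemma power_input2:
  assumes "t < n" "(\<integral>\<^sup>+ \<omega>. ennreal ((norm (input2 c (Suc t) \<omega>))\<^sup>2) \<partial>sample_space K1 K2) \<le> ennreal P"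
  shows "expect t (\<lambda>a b w. ennreal ((norm (X2 t b w))\<^sup>2)) \<le> ennreal P"
proof -
  have "expect t (\<lambda>a b w. ennreal ((norm (X2 t b w))\<^sup>2))
    = (\<integral>\<^sup>+ \<omega>. ennreal ((norm (X2 t (snd (fst \<omega>)) (trc t \<omega>)))\<^sup>2) \<partial>sample_space K1 K2)"
    using assms(1) X2_measurable[OF assms(1)] by (intro nn_integral_sample[symmetric]) auto
  also have "\<dots> = (\<integral>\<^sup>+ \<omega>. ennreal ((norm (input2 c (Suc t) \<omega>))\<^sup>2) \<partial>sample_space K1 K2)"
    by (intro nn_integral_cong) (simp add: X2_def input2_def view_step_trace split_beta)
  finally show ?thesis using assms(2) by simp
qed

definition decode1 :: "(nat \<Rightarrow> ('m1, 'm2, 'n1, 'n2) step) \<Rightarrow> nat" where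
  "decode1 z = dec1 c (fst (snd (view n z)), fst (view n z))"

definition decode2 :: "(nat \<Rightarrow> ('m1, 'm2, 'n1, 'n2) step) \<Rightarrow> nat" where
  "decode2 z = dec2 c (snd (snd (view n z)), fst (view n z))"

context
  assumes dec1: "dec1 c \<in> measurable ((\<Pi>\<^sub>M s\<in>{1..n}. borel) \<Otimes>\<^sub>M (\<Pi>\<^sub>M s\<in>{1..n}. borel)) (count_space {1..K1})"
    and dec2: "dec2 c \<in> measurable ((\<Pi>\<^sub>M s\<in>{1..n}. borel) \<Otimes>\<^sub>M (\<Pi>\<^sub>M s\<in>{1..n}. borel)) (count_space {1..K2})"
begin

lemma pred_count_space: "f \<in> measurable M (count_space X) \<Longrightarrow> Measurable.pred M (\<lambda>x. f x = y)"
  by (rule measurable_compose[of f M "count_space X"]) auto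

lemma decode1_pred: "Measurable.pred (hist SR n) (\<lambda>z. decode1 z = y)"
proof (rule pred_count_space)
  show "decode1 \<in> measurable (hist SR n) (count_space {1..K1})"
    unfolding decode1_def[abs_def]
    by (intro measurable_compose[OF _ dec1] measurable_Pair measurable_compose[OF view_measurable measurable_fst]
        measurable_compose[OF measurable_compose[OF view_measurable measurable_snd] measurable_fst])
qed

lemma decode2_pred: "Measurable.pred (hist SR n) (\<lambda>z. decode2 z = y)"
proof (rule pred_count_space)
  show "decode2 \<in> measurable (hist SR n) (count_space {1..K2})"
    unfolding decode2_def[abs_def]
    by (intro measurable_compose[OF _ dec2] measurable_Pair measurable_compose[OF view_measurable measurable_fst]
        measurable_compose[OF measurable_compose[OF view_measurable measurable_snd] measurable_snd])
qed

text \<open>Either a given message is decoded correctly or the joint error event occurs, so each of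
  the two success probabilities is at least one minus the joint error probability.\<close>

lemma correct_decoding:
  assumes e: "error_prob n K1 K2 c \<le> 1 - r"
  shows "ennreal r \<le> expect n (\<lambda>a b w. if decode1 w = a then 1 else 0)"
    and "ennreal r \<le> expect n (\<lambda>a b w. if decode2 w = b then 1 else 0)"
proof -
  note [measurable] = decode1_pred decode2_pred
  define E where "E = {\<omega> \<in> space (sample_space K1 K2 :: ('m1, 'm2, 'n1, 'n2) sample measure).
      decode1 (trc n \<omega>) \<noteq> fst (fst \<omega>) \<or> decode2 (trc n \<omega>) \<noteq> snd (fst \<omega>)}"
  let ?err = "\<lambda>a b w. decode1 w \<noteq> a \<or> decode2 w \<noteq> b"
  have "Measurable.pred (hist SR n) (?err a b)" for a b
    by measurable
  then have "Measurable.pred (sample_space K1 K2) (\<lambda>\<omega>. ?err (fst (fst \<omega>)) (snd (fst \<omega>)) (trc n \<omega>))"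
    by (intro sample_measurable[OF order_refl, where F="?err"])
  then have Em: "E \<in> sets (sample_space K1 K2)"
    unfolding E_def by (rule predE)
  have "error_prob n K1 K2 c = measure (sample_space K1 K2) E"
    unfolding error_prob_def E_def decode1_def decode2_def view_step_trace
    by (intro arg_cong[where f="measure _"] Collect_cong) (auto simp: view_step_trace split_beta)
  then have mE: "measure (sample_space K1 K2) E \<le> 1 - r" using e by simp
  have eE: "emeasure (sample_space K1 K2) E = expect n (\<lambda>a b w. if ?err a b w then 1 else 0)"
  proof -
    have "emeasure (sample_space K1 K2) E = (\<integral>\<^sup>+ \<omega>. indicator E \<omega> \<partial>sample_space K1 K2)"
      using Em by simp
    also have "\<dots> = (\<integral>\<^sup>+ \<omega>. (if ?err (fst (fst \<omega>)) (snd (fst \<omega>)) (trc n \<omega>) then 1 else 0) \<partial>sample_space K1 K2)"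
      by (intro nn_integral_cong) (auto simp: E_def indicator_def)
    also have "\<dots> = expect n (\<lambda>a b w. if ?err a b w then 1 else 0)"
      by (rule nn_integral_sample[OF order_refl, where F="\<lambda>a b w. if ?err a b w then 1 else 0"]) measurable
    finally show ?thesis .
  qed
  have "expect n (\<lambda>a b w. if ?err a b w then 1 else 0) \<le> expect n (\<lambda>_ _ _. 1)"
    by (rule expect_mono) auto
  also have "\<dots> = 1" by (rule expect_1[OF order_refl])
  finally have le1: "expect n (\<lambda>a b w. if ?err a b w then 1 else 0) \<le> 1" .
  then have eE': "emeasure (sample_space K1 K2) E = ennreal (measure (sample_space K1 K2) E)"
    unfolding eE[symmetric] by (intro emeasure_eq_ennreal_measure) (auto simp: top_unique)
  have key: "ennreal r \<le> expect n (\<lambda>a b w. if Q a b w then 1 else 0)"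
    if Qm: "\<And>a b. Measurable.pred (hist SR n) (Q a b)" and Q: "\<And>a b w. Q a b w \<or> ?err a b w" for Q
  proof -
    note [measurable] = Qm
    have "1 = expect n (\<lambda>_ _ _. 1)" by (rule expect_1[OF order_refl, symmetric])
    also have "\<dots> \<le> expect n (\<lambda>a b w. (if Q a b w then 1 else 0) + (if ?err a b w then 1 else 0))"
      using Q by (intro expect_mono) auto
    also have "\<dots> = expect n (\<lambda>a b w. if Q a b w then 1 else 0) + expect n (\<lambda>a b w. if ?err a b w then 1 else 0)"
      by (intro expect_add order_refl) measurable
    also have "\<dots> \<le> expect n (\<lambda>a b w. if Q a b w then 1 else 0) + ennreal (1 - r)"
      unfolding eE[symmetric] eE' using mE by (intro add_left_mono ennreal_leI)
    finally have le: "1 \<le> expect n (\<lambda>a b w. if Q a b w then 1 else 0) + ennreal (1 - r)" .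
    show ?thesis
    proof (cases "expect n (\<lambda>a b w. if Q a b w then 1 else 0)")
      case (real x)
      have r1: "0 \<le> 1 - r" using mE measure_nonneg[of "sample_space K1 K2" E] by linarith
      have "ennreal 1 \<le> ennreal (x + (1 - r))" using le real r1 by simp
      then have "1 \<le> x + (1 - r)" using real r1 by (subst (asm) ennreal_le_iff) auto
      then show ?thesis using real by (simp add: ennreal_leI)
    qed simp
  qed
  show "ennreal r \<le> expect n (\<lambda>a b w. if decode1 w = a then 1 else 0)"
    by (rule key[where Q="\<lambda>a b w. decode1 w = a"], rule decode1_pred) blast
  show "ennreal r \<le> expect n (\<lambda>a b w. if decode2 w = b then 1 else 0)"
    by (rule key[where Q="\<lambda>a b w. decode2 w = b"], rule decode2_pred) blast
qed

end

end

section \<open>Exchanging the users\<close>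

lemma nn_integral_reverse3:
  assumes "sigma_finite_measure A" "sigma_finite_measure B" "sigma_finite_measure C"
    and f: "f \<in> borel_measurable (C \<Otimes>\<^sub>M (B \<Otimes>\<^sub>M A))"
  shows "(\<integral>\<^sup>+ a. \<integral>\<^sup>+ b. \<integral>\<^sup>+ c. f (c, b, a) \<partial>C \<partial>B \<partial>A) = (\<integral>\<^sup>+ c. \<integral>\<^sup>+ b. \<integral>\<^sup>+ a. f (c, b, a) \<partial>A \<partial>B \<partial>C)"
proof -
  interpret A: sigma_finite_measure A by fact
  interpret B: sigma_finite_measure B by fact
  interpret C: sigma_finite_measure C by fact
  note [measurable] = f
  have "(\<integral>\<^sup>+ a. \<integral>\<^sup>+ b. \<integral>\<^sup>+ c. f (c, b, a) \<partial>C \<partial>B \<partial>A) = (\<integral>\<^sup>+ a. \<integral>\<^sup>+ c. \<integral>\<^sup>+ b. f (c, b, a) \<partial>B \<partial>C \<partial>A)"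
  proof (intro nn_integral_cong nn_integral_swap assms(1-3))
    fix a assume "a \<in> space A"
    then have "(\<lambda>p. (snd p, fst p, a)) \<in> measurable (B \<Otimes>\<^sub>M C) (C \<Otimes>\<^sub>M (B \<Otimes>\<^sub>M A))"
      by (intro measurable_Pair measurable_const measurable_snd measurable_fst)
    from measurable_compose[OF this f] show "(\<lambda>(b, c). f (c, b, a)) \<in> borel_measurable (B \<Otimes>\<^sub>M C)"
      by (simp add: split_beta')
  qed
  also have "\<dots> = (\<integral>\<^sup>+ c. \<integral>\<^sup>+ a. \<integral>\<^sup>+ b. f (c, b, a) \<partial>B \<partial>A \<partial>C)"
    by (intro nn_integral_swap assms) measurable
  also have "\<dots> = (\<integral>\<^sup>+ c. \<integral>\<^sup>+ b. \<integral>\<^sup>+ a. f (c, b, a) \<partial>A \<partial>B \<partial>C)"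
    by (intro nn_integral_cong nn_integral_swap assms) measurable
  finally show ?thesis .
qed

lemma nn_integral_reverse4:
  assumes "sigma_finite_measure A" "sigma_finite_measure B" "sigma_finite_measure C" "sigma_finite_measure D"
    and f: "f \<in> borel_measurable (D \<Otimes>\<^sub>M (C \<Otimes>\<^sub>M (B \<Otimes>\<^sub>M A)))"
  shows "(\<integral>\<^sup>+ a. \<integral>\<^sup>+ b. \<integral>\<^sup>+ c. \<integral>\<^sup>+ d. f (d, c, b, a) \<partial>D \<partial>C \<partial>B \<partial>A)
    = (\<integral>\<^sup>+ d. \<integral>\<^sup>+ c. \<integral>\<^sup>+ b. \<integral>\<^sup>+ a. f (d, c, b, a) \<partial>A \<partial>B \<partial>C \<partial>D)"
proof -
  interpret A: sigma_finite_measure A by fact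
  interpret B: sigma_finite_measure B by fact
  interpret C: sigma_finite_measure C by fact
  interpret D: sigma_finite_measure D by fact
  note [measurable] = f
  have "(\<integral>\<^sup>+ a. \<integral>\<^sup>+ b. \<integral>\<^sup>+ c. \<integral>\<^sup>+ d. f (d, c, b, a) \<partial>D \<partial>C \<partial>B \<partial>A) = (\<integral>\<^sup>+ a. \<integral>\<^sup>+ d. \<integral>\<^sup>+ c. \<integral>\<^sup>+ b. f (d, c, b, a) \<partial>B \<partial>C \<partial>D \<partial>A)"
  proof (rule nn_integral_cong)
    fix a assume "a \<in> space A"
    then have "(\<lambda>p. f (fst p, fst (snd p), snd (snd p), a)) \<in> borel_measurable (D \<Otimes>\<^sub>M (C \<Otimes>\<^sub>M B))"
      by measurable
    from nn_integral_reverse3[OF assms(2-4) this]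
    show "(\<integral>\<^sup>+ b. \<integral>\<^sup>+ c. \<integral>\<^sup>+ d. f (d, c, b, a) \<partial>D \<partial>C \<partial>B) = (\<integral>\<^sup>+ d. \<integral>\<^sup>+ c. \<integral>\<^sup>+ b. f (d, c, b, a) \<partial>B \<partial>C \<partial>D)"
      by simp
  qed
  also have "\<dots> = (\<integral>\<^sup>+ d. \<integral>\<^sup>+ a. \<integral>\<^sup>+ c. \<integral>\<^sup>+ b. f (d, c, b, a) \<partial>B \<partial>C \<partial>A \<partial>D)"
    by (intro nn_integral_swap assms) measurable
  also have "\<dots> = (\<integral>\<^sup>+ d. \<integral>\<^sup>+ c. \<integral>\<^sup>+ a. \<integral>\<^sup>+ b. f (d, c, b, a) \<partial>B \<partial>A \<partial>C \<partial>D)"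
    by (intro nn_integral_cong nn_integral_swap assms) measurable
  also have "\<dots> = (\<integral>\<^sup>+ d. \<integral>\<^sup>+ c. \<integral>\<^sup>+ b. \<integral>\<^sup>+ a. f (d, c, b, a) \<partial>A \<partial>B \<partial>C \<partial>D)"
    by (intro nn_integral_cong nn_integral_swap assms) measurable
  finally show ?thesis .
qed

text \<open>Exchanging the users reverses the order of the four matrices. For this reason the
  symmetry of \<open>channel_dist\<close> reduces to a complete reversal of iterated
  integrals.\<close>

definition swap_channel :: "('m1, 'm2, 'n1, 'n2) channel \<Rightarrow> ('m2, 'm1, 'n2, 'n1) channel" where
  "swap_channel H = (snd (snd (snd H)), fst (snd (snd H)), fst (snd H), fst H)"

definition swap_step :: "('m1, 'm2, 'n1, 'n2) step \<Rightarrow> ('m2, 'm1, 'n2, 'n1) step" where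
  "swap_step z = (swap_channel (fst z), snd (snd z), fst (snd z))"

lemma swap_channel_swap [simp]: "swap_channel (swap_channel H) = H"
  by (simp add: swap_channel_def)

lemma swap_channel_measurable:
  assumes H: "H \<in> measurable M (channel_dist :: ('m1::finite, 'm2::finite, 'n1::finite, 'n2::finite) channel measure)"
  shows "(\<lambda>x. swap_channel (H x)) \<in> measurable M channel_dist"
  unfolding swap_channel_def measurable_cong_sets[OF refl sets_channel_dist]
  by (intro measurable_Pair measurable_channel_parts[OF H])

lemma swap_step_measurable:
  "swap_step \<in> measurable (step_ref :: ('m1::finite, 'm2::finite, 'n1::finite, 'n2::finite) step measure) step_ref"
proof -
  have z: "(\<lambda>z. z) \<in> measurable step_ref (step_ref :: ('m1, 'm2, 'n1, 'n2) step measure)" by simp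
  note p = step_parts_measurable[OF z]
  show ?thesis
    unfolding swap_step_def[abs_def]
    by (intro measurable_Pair swap_channel_measurable p(1))
       (use p(2,3) in \<open>simp_all cong: measurable_cong_sets\<close>)
qed

lemma nn_integral_swap_channel:
  fixes F :: "('m2::finite, 'm1::finite, 'n2::finite, 'n1::finite) channel \<Rightarrow> ennreal"
  assumes F: "F \<in> borel_measurable channel_dist"
  shows "(\<integral>\<^sup>+ H. F (swap_channel H) \<partial>(channel_dist :: ('m1, 'm2, 'n1, 'n2) channel measure)) = (\<integral>\<^sup>+ H. F H \<partial>channel_dist)"
proof -
  note sf = sigma_finite_rayleigh_matrix
  have Fs: "(\<lambda>H. F (swap_channel H)) \<in> borel_measurable (channel_dist :: ('m1, 'm2, 'n1, 'n2) channel measure)"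
    by (rule measurable_compose[OF swap_channel_measurable[OF measurable_ident_sets[OF refl]] F])
  have "(\<integral>\<^sup>+ H. F (swap_channel H) \<partial>(channel_dist :: ('m1, 'm2, 'n1, 'n2) channel measure))
    = (\<integral>\<^sup>+ H11. \<integral>\<^sup>+ H12. \<integral>\<^sup>+ H21. \<integral>\<^sup>+ H22. F (H22, H21, H12, H11) \<partial>rayleigh_matrix \<partial>rayleigh_matrix \<partial>rayleigh_matrix \<partial>rayleigh_matrix)"
    unfolding nn_integral_channel_dist[OF Fs] by (simp add: swap_channel_def)
  also have "\<dots> = (\<integral>\<^sup>+ H22. \<integral>\<^sup>+ H21. \<integral>\<^sup>+ H12. \<integral>\<^sup>+ H11. F (H22, H21, H12, H11) \<partial>rayleigh_matrix \<partial>rayleigh_matrix \<partial>rayleigh_matrix \<partial>rayleigh_matrix)"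
    using F by (intro nn_integral_reverse4 sf) (simp add: channel_dist_def)
  also have "\<dots> = (\<integral>\<^sup>+ H. F H \<partial>channel_dist)"
    by (rule nn_integral_channel_dist[OF F, symmetric])
  finally show ?thesis .
qed

lemma nn_integral_swap_step:
  fixes F :: "('m2::finite, 'm1::finite, 'n2::finite, 'n1::finite) step \<Rightarrow> ennreal"
  assumes F: "F \<in> borel_measurable step_ref"
  shows "(\<integral>\<^sup>+ z. F (swap_step z) \<partial>(step_ref :: ('m1, 'm2, 'n1, 'n2) step measure)) = (\<integral>\<^sup>+ z. F z \<partial>step_ref)"
proof -
  let ?V1 = "vec_ref :: (complex ^ 'n1) measure" and ?V2 = "vec_ref :: (complex ^ 'n2) measure"
  interpret V1: sigma_finite_measure ?V1 by (rule sigma_finite_vec_ref)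
  interpret V2: sigma_finite_measure ?V2 by (rule sigma_finite_vec_ref)
  note [measurable] = F
  define G where "G = (\<lambda>H. \<integral>\<^sup>+ y2. \<integral>\<^sup>+ y1. F (H, y2, y1) \<partial>?V1 \<partial>?V2)"
  have Gm: "G \<in> borel_measurable channel_dist" unfolding G_def by measurable
  have "(\<integral>\<^sup>+ z. F (swap_step z) \<partial>(step_ref :: ('m1, 'm2, 'n1, 'n2) step measure))
    = (\<integral>\<^sup>+ H. \<integral>\<^sup>+ y1. \<integral>\<^sup>+ y2. F (swap_channel H, y2, y1) \<partial>?V2 \<partial>?V1 \<partial>(channel_dist :: ('m1, 'm2, 'n1, 'n2) channel measure))"
    unfolding nn_integral_step_ref[OF measurable_compose[OF swap_step_measurable F]] by (simp add: swap_step_def)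
  also have "\<dots> = (\<integral>\<^sup>+ H. G (swap_channel H) \<partial>(channel_dist :: ('m1, 'm2, 'n1, 'n2) channel measure))"
  proof (rule nn_integral_cong)
    fix H :: "('m1, 'm2, 'n1, 'n2) channel"
    have "(\<lambda>y. F (swap_channel H, y)) \<in> borel_measurable (?V2 \<Otimes>\<^sub>M ?V1)"
      by (rule measurable_compose[OF measurable_Pair1' F]) simp
    from measurable_compose[OF measurable_pair_swap' this]
    show "(\<integral>\<^sup>+ y1. \<integral>\<^sup>+ y2. F (swap_channel H, y2, y1) \<partial>?V2 \<partial>?V1) = G (swap_channel H)"
      unfolding G_def by (intro nn_integral_swap sigma_finite_vec_ref) (simp add: split_beta')
  qed
  also have "\<dots> = (\<integral>\<^sup>+ H. G H \<partial>channel_dist)"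
    by (rule nn_integral_swap_channel[OF Gm])
  also have "\<dots> = (\<integral>\<^sup>+ z. F z \<partial>step_ref)"
    unfolding G_def by (rule nn_integral_step_ref[OF F, symmetric])
  finally show ?thesis .
qed

lemma step_density_swap: "step_density xb xa (swap_step z) = step_density xa xb z"
  by (simp add: step_density_def rx2_density_def rx_density_def swap_step_def swap_channel_def add.commute mult.commute)

context coded
begin

text \<open>Paths and reference measure stay the same; only the roles of messages and receivers
  change, with \<open>swap_step\<close> as \<open>\<tau>\<close>. All bounds for the other order of
  the users thus refer to the same code.\<close>

sublocale swapped: mimo_coding SR n "{1..K2}" "{1..K1}" swap_step X2 X1
  using K by (intro mimo_coding.intro X1_measurable X2_measurable sigma_finite_step_ref swap_step_measurable nn_integral_swap_step) auto

text \<open>The step density is symmetric under the exchange, so kernels and path densities agree,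
  and only the order of the message arguments differs.\<close>

lemma swapped_expect: "swapped.expect t F = expect t (\<lambda>a b. F b a)"
proof -
  have kern: "swapped.kern s b a = kern s a b" for s a b
    by (intro ext) (simp only: swapped.kern_def kern_def step_density_swap)
  have "swapped.dens t b a = dens t a b" for a b
    by (intro ext) (simp only: swapped.dens_def dens_def kern)
  then show ?thesis
    unfolding swapped.expect_def expect_def by (subst sum.swap) (simp add: mult.commute)
qed

context
  fixes P r :: real
  assumes P: "1 \<le> P" and r: "0 \<le> r" "error_prob n K1 K2 c \<le> 1 - r" and valid: "valid_code P n K1 K2 c"
begin

lemma dec_measurable:
  "dec1 c \<in> measurable ((\<Pi>\<^sub>M s\<in>{1..n}. borel) \<Otimes>\<^sub>M (\<Pi>\<^sub>M s\<in>{1..n}. borel)) (count_space {1..K1})"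
  "dec2 c \<in> measurable ((\<Pi>\<^sub>M s\<in>{1..n}. borel) \<Otimes>\<^sub>M (\<Pi>\<^sub>M s\<in>{1..n}. borel)) (count_space {1..K2})"
  using valid unfolding valid_code_def by blast+

lemma power1: "t < n \<Longrightarrow> expect t (\<lambda>a b w. ennreal ((norm (X1 t a w))\<^sup>2)) \<le> ennreal P"
proof (rule power_input1)
  assume "t < n"
  then have "Suc t \<in> {1..n}" by simp
  then show "(\<integral>\<^sup>+ \<omega>. ennreal ((norm (input1 c (Suc t) \<omega>))\<^sup>2) \<partial>sample_space K1 K2) \<le> ennreal P"
    using valid unfolding valid_code_def by blast
qed

lemma power2: "t < n \<Longrightarrow> expect t (\<lambda>a b w. ennreal ((norm (X2 t b w))\<^sup>2)) \<le> ennreal P"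
proof (rule power_input2)
  assume "t < n"
  then have "Suc t \<in> {1..n}" by simp
  then show "(\<integral>\<^sup>+ \<omega>. ennreal ((norm (input2 c (Suc t) \<omega>))\<^sup>2) \<partial>sample_space K1 K2) \<le> ennreal P"
    using valid unfolding valid_code_def by blast
qed

lemmas correct = correct_decoding[OF dec_measurable r(2)]

lemma single_rate_bounds:
  shows "r * ln (real K1) \<le> ln 2 + real n * (real CARD('m1) * (ln P + 12 * (real CARD('m1) + real CARD('m2) + 1))
      + real (CARD('n1) + CARD('n2)) * extrapolation_cost TYPE('m1))"
    and "r * ln (real K2) \<le> ln 2 + real n * (real CARD('m2) * (ln P + 12 * (real CARD('m2) + real CARD('m1) + 1))
      + real (CARD('n2) + CARD('n1)) * extrapolation_cost TYPE('m2))"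
proof -
  show "r * ln (real K1) \<le> ln 2 + real n * (real CARD('m1) * (ln P + 12 * (real CARD('m1) + real CARD('m2) + 1))
      + real (CARD('n1) + CARD('n2)) * extrapolation_cost TYPE('m1))"
    using rate_known_message[OF P power1 power2 decode1_pred[OF dec_measurable] r(1) correct(1)] by (simp only: card_atLeastAtMost diff_Suc_1)
  show "r * ln (real K2) \<le> ln 2 + real n * (real CARD('m2) * (ln P + 12 * (real CARD('m2) + real CARD('m1) + 1))
      + real (CARD('n2) + CARD('n1)) * extrapolation_cost TYPE('m2))"
    using swapped.rate_known_message[OF P _ _ decode2_pred[OF dec_measurable] r(1)]
    unfolding swapped_expect using power1 power2 correct(2) by (simp only: card_atLeastAtMost diff_Suc_1)
qed

text \<open>Fano's inequality for the receiver with partial observation asks for a decoder acting on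
  the observed sequence alone. \<open>decB1\<close> rearranges that sequence into the arguments of
  \<open>dec2\<close>; \<open>decB2\<close> does so for \<open>dec1\<close> and also undoes the
  exchange of the channels.\<close>

lemma weighted_rate_bounds:
  defines "N \<equiv> CARD('n1) + CARD('n2)"
  shows "r * (1 / real (min N CARD('m1)) * ln (real K1) + 1 / real (min CARD('n2) CARD('m1)) * ln (real K2))
      \<le> (1 / real (min N CARD('m1)) + 1 / real (min CARD('n2) CARD('m1))) * ln 2
        + real n * (1 / real (min CARD('n2) CARD('m1)) * (real CARD('n2) * (ln P + 12 * (real CARD('m1) + real CARD('m2) + 1)))
          + real N * extrapolation_cost TYPE('m1))"
    and "r * (1 / real (min N CARD('m2)) * ln (real K2) + 1 / real (min CARD('n1) CARD('m2)) * ln (real K1))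
      \<le> (1 / real (min N CARD('m2)) + 1 / real (min CARD('n1) CARD('m2))) * ln 2
        + real n * (1 / real (min CARD('n1) CARD('m2)) * (real CARD('n1) * (ln P + 12 * (real CARD('m2) + real CARD('m1) + 1)))
          + real N * extrapolation_cost TYPE('m2))"
proof -
  define decB1 where "decB1 = (\<lambda>x :: nat \<Rightarrow> ('m1, 'm2, 'n1, 'n2) channel \<times> (complex ^ 'n2).
      dec2 c (\<lambda>s\<in>{1..n}. snd (x s), \<lambda>s\<in>{1..n}. fst (x s)))"
  have dB1: "decB1 (\<lambda>i\<in>{1..n}. v (w i)) = decode2 w" for w
    unfolding decB1_def decode2_def view_def v_def by (intro arg_cong[where f="dec2 c"]) (simp add: fun_eq_iff)
  have p1: "Measurable.pred (hist rx2_ref n) (\<lambda>x. decB1 x = b)" for b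
  proof (rule pred_count_space[OF dec_measurable])
    show "decB1 \<in> measurable (hist rx2_ref n) (count_space {1..K2})"
      unfolding decB1_def
    proof (intro measurable_compose[OF _ dec_measurable(2)] measurable_Pair measurable_restrict)
      fix s assume "s \<in> {1..n}"
      then have x: "(\<lambda>x. x s) \<in> measurable (hist rx2_ref n) (rx2_ref :: (('m1, 'm2, 'n1, 'n2) channel \<times> (complex ^ 'n2)) measure)"
        by (rule measurable_component_singleton)
      show "(\<lambda>x. snd (x s)) \<in> borel_measurable (hist (rx2_ref :: (('m1, 'm2, 'n1, 'n2) channel \<times> (complex ^ 'n2)) measure) n)"
        using measurable_compose[OF x measurable_snd] by (simp cong: measurable_cong_sets)
      show "(\<lambda>x. fst (x s)) \<in> borel_measurable (hist (rx2_ref :: (('m1, 'm2, 'n1, 'n2) channel \<times> (complex ^ 'n2)) measure) n)"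
        using measurable_compose[OF x measurable_fst] by (simp cong: measurable_cong_sets add: sets_channel_dist_borel)
    qed
  qed
  have c1: "ennreal r \<le> expect n (\<lambda>a b w. if decB1 (\<lambda>i\<in>{1..n}. v (w i)) = b then 1 else 0)"
    unfolding dB1 by (rule correct(2))
  show "r * (1 / real (min N CARD('m1)) * ln (real K1) + 1 / real (min CARD('n2) CARD('m1)) * ln (real K2))
      \<le> (1 / real (min N CARD('m1)) + 1 / real (min CARD('n2) CARD('m1))) * ln 2
        + real n * (1 / real (min CARD('n2) CARD('m1)) * (real CARD('n2) * (ln P + 12 * (real CARD('m1) + real CARD('m2) + 1)))
          + real N * extrapolation_cost TYPE('m1))"
    using weighted_sum_rate[OF P power1 power2 decode1_pred[OF dec_measurable] p1 r(1) correct(1) c1]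
    unfolding N_def by (simp only: card_atLeastAtMost diff_Suc_1)
  define decB2 where "decB2 = (\<lambda>x :: nat \<Rightarrow> ('m2, 'm1, 'n2, 'n1) channel \<times> (complex ^ 'n1).
      dec1 c (\<lambda>s\<in>{1..n}. snd (x s), \<lambda>s\<in>{1..n}. swap_channel (fst (x s))))"
  have dB2: "decB2 (\<lambda>i\<in>{1..n}. swapped.v (w i)) = decode1 w" for w
    unfolding decB2_def decode1_def view_def swapped.v_def swap_step_def by (intro arg_cong[where f="dec1 c"]) (simp add: fun_eq_iff)
  have p2: "Measurable.pred (hist rx2_ref n) (\<lambda>x. decB2 x = b)" for b
  proof (rule pred_count_space[OF dec_measurable])
    show "decB2 \<in> measurable (hist rx2_ref n) (count_space {1..K1})"
      unfolding decB2_def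
    proof (intro measurable_compose[OF _ dec_measurable(1)] measurable_Pair measurable_restrict)
      fix s assume "s \<in> {1..n}"
      then have x: "(\<lambda>x. x s) \<in> measurable (hist rx2_ref n) (rx2_ref :: (('m2, 'm1, 'n2, 'n1) channel \<times> (complex ^ 'n1)) measure)"
        by (rule measurable_component_singleton)
      show "(\<lambda>x. snd (x s)) \<in> borel_measurable (hist (rx2_ref :: (('m2, 'm1, 'n2, 'n1) channel \<times> (complex ^ 'n1)) measure) n)"
        using measurable_compose[OF x measurable_snd] by (simp cong: measurable_cong_sets)
      show "(\<lambda>x. swap_channel (fst (x s))) \<in> borel_measurable (hist (rx2_ref :: (('m2, 'm1, 'n2, 'n1) channel \<times> (complex ^ 'n1)) measure) n)"
        using swap_channel_measurable[OF measurable_compose[OF x measurable_fst]]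
        by (simp cong: measurable_cong_sets add: sets_channel_dist_borel)
    qed
  qed
  have c2: "ennreal r \<le> swapped.expect n (\<lambda>b a w. if decB2 (\<lambda>i\<in>{1..n}. swapped.v (w i)) = a then 1 else 0)"
    "ennreal r \<le> swapped.expect n (\<lambda>b a w. if decode2 w = b then 1 else 0)"
    unfolding dB2 swapped_expect by (rule correct)+
  have pw: "t < n \<Longrightarrow> swapped.expect t (\<lambda>b a w. ennreal ((norm (X2 t b w))\<^sup>2)) \<le> ennreal P"
    "t < n \<Longrightarrow> swapped.expect t (\<lambda>b a w. ennreal ((norm (X1 t a w))\<^sup>2)) \<le> ennreal P" for t
    unfolding swapped_expect by (rule power1 power2, assumption)+
  show "r * (1 / real (min N CARD('m2)) * ln (real K2) + 1 / real (min CARD('n1) CARD('m2)) * ln (real K1))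
      \<le> (1 / real (min N CARD('m2)) + 1 / real (min CARD('n1) CARD('m2))) * ln 2
        + real n * (1 / real (min CARD('n1) CARD('m2)) * (real CARD('n1) * (ln P + 12 * (real CARD('m2) + real CARD('m1) + 1)))
          + real N * extrapolation_cost TYPE('m2))"
    using swapped.weighted_sum_rate[OF P pw decode2_pred[OF dec_measurable] p2 r(1) c2(2,1)]
    unfolding N_def add.commute[of "CARD('n1)" "CARD('n2)"] by (simp only: card_atLeastAtMost diff_Suc_1)
qed

end

end

section \<open>Degrees of freedom\<close>

lemma codedI:
  assumes "valid_code P n K1 K2 c" "1 \<le> K1" "1 \<le> K2"
  shows "coded n K1 K2 c"
  using assms unfolding valid_code_def by unfold_locales blast+

lemma prob_space_sample_space:
  assumes "1 \<le> K1" "1 \<le> K2"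
  shows "prob_space (sample_space K1 K2)"
  unfolding sample_space_def using assms
  by (intro prob_space_pair prob_space_uniform_count_measure prob_space_PiM prob_space_channel_dist prob_space_noise_dist) auto

lemma num_messages_ge: "2 powr (real n * R) \<le> real (num_messages n R)"
  unfolding num_messages_def by linarith

text \<open>Dividing by \<open>n\<close> removes \<open>C\<close>, and the vanishing error removes
  the factor \<open>1 - e n\<close>. Rounding up the number of messages only helps, since its
  logarithm is at least \<open>n * R * ln 2\<close>.\<close>

lemma rate_limit:
  assumes le: "\<And>n. 1 \<le> n \<Longrightarrow> (1 - e n) * (a * ln (real (num_messages n R1)) + b * ln (real (num_messages n R2))) \<le> C + real n * L"
    and e: "e \<longlonglongrightarrow> 0" "\<And>n. 1 \<le> n \<Longrightarrow> e n \<le> 1" and ab: "0 \<le> a" "0 \<le> b"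
  shows "(a * R1 + b * R2) * ln 2 \<le> L"
proof (rule LIMSEQ_le)
  show "(\<lambda>n. (1 - e n) * ((a * R1 + b * R2) * ln 2)) \<longlonglongrightarrow> (a * R1 + b * R2) * ln 2"
    using tendsto_mult_right[OF tendsto_diff[OF tendsto_const[of 1] e(1)], of "(a * R1 + b * R2) * ln 2"] by simp
  show "(\<lambda>n. C / real n + L) \<longlonglongrightarrow> L"
    using tendsto_add[OF tendsto_divide_0[OF tendsto_const filterlim_at_top_imp_at_infinity[OF filterlim_real_sequentially], of C] tendsto_const[of L]] by simp
  have ln_ge: "real n * R * ln 2 \<le> ln (real (num_messages n R))" for n R
  proof -
    have "ln (2 powr (real n * R)) \<le> ln (real (num_messages n R))"
      using num_messages_ge[of n R] by (intro ln_mono) (auto intro: less_le_trans[of _ "2 powr (real n * R)"])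
    then show ?thesis by (simp add: ln_powr)
  qed
  have "(1 - e n) * ((a * R1 + b * R2) * ln 2) \<le> C / real n + L" if n: "1 \<le> n" for n
  proof -
    have "(1 - e n) * (a * (real n * R1 * ln 2) + b * (real n * R2 * ln 2))
      \<le> (1 - e n) * (a * ln (real (num_messages n R1)) + b * ln (real (num_messages n R2)))"
      using e(2)[OF n] ab by (intro mult_left_mono add_mono ln_ge) auto
    also have "\<dots> \<le> C + real n * L" by (rule le[OF n])
    finally have "real n * ((1 - e n) * ((a * R1 + b * R2) * ln 2)) \<le> real n * (C / real n + L)"
      using n by (simp add: algebra_simps)
    then show ?thesis using n by simp
  qed
  then show "\<exists>N. \<forall>n\<ge>N. (1 - e n) * ((a * R1 + b * R2) * ln 2) \<le> C / real n + L" by blast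
qed

text \<open>\<open>r\<close> is instantiated with one minus the error probability. \<open>C\<close>
  collects what does not grow with the block length, \<open>L\<close> the cost per letter.\<close>

lemma capacity_bound:
  fixes m1 :: "'m1::finite itself" and m2 :: "'m2::finite itself" and n1 :: "'n1::finite itself" and n2 :: "'n2::finite itself"
  assumes R: "(R1, R2) \<in> capacity_region m1 m2 n1 n2 P" and ab: "0 \<le> a" "0 \<le> b"
    and bound: "\<And>n K1 K2 r (c :: ('m1, 'm2, 'n1, 'n2) ic_code). coded n K1 K2 c \<Longrightarrow> valid_code P n K1 K2 c \<Longrightarrow> 0 \<le> r
      \<Longrightarrow> error_prob n K1 K2 c \<le> 1 - r \<Longrightarrow> r * (a * ln (real K1) + b * ln (real K2)) \<le> C + real n * L"
  shows "(a * R1 + b * R2) * ln 2 \<le> L"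
proof -
  obtain c :: "nat \<Rightarrow> ('m1, 'm2, 'n1, 'n2) ic_code"
    where valid: "\<And>n. 1 \<le> n \<Longrightarrow> valid_code P n (num_messages n R1) (num_messages n R2) (c n)"
      and e: "(\<lambda>n. error_prob n (num_messages n R1) (num_messages n R2) (c n)) \<longlonglongrightarrow> 0"
    using R unfolding capacity_region_def by blast
  have K: "1 \<le> num_messages n R" for n R
  proof -
    have "0 < real (num_messages n R)" using num_messages_ge[of n R] by (rule less_le_trans[rotated]) simp
    then show ?thesis by simp
  qed
  have e1: "error_prob n (num_messages n R1) (num_messages n R2) (c n) \<le> 1" for n
    unfolding error_prob_def by (rule prob_space.prob_le_1[OF prob_space_sample_space[OF K K]])
  show ?thesis
  proof (rule rate_limit[OF _ e e1 ab])
    fix n :: nat assume n: "1 \<le> n"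
    let ?r = "1 - error_prob n (num_messages n R1) (num_messages n R2) (c n)"
    show "?r * (a * ln (real (num_messages n R1)) + b * ln (real (num_messages n R2))) \<le> C + real n * L"
      using e1[of n] by (intro bound[OF codedI[OF valid[OF n] K K] valid[OF n]]) auto
  qed
qed

text \<open>Rates are measured in bits and the entropies here in nats: the factor
  \<open>ln 2\<close> cancels against the one in \<open>log 2 P\<close>. The constant
  \<open>C\<close> vanishes after division by \<open>ln P\<close>.\<close>

lemma DoF_bound:
  assumes d: "(d1, d2) \<in> DoF_region m1 m2 n1 n2" and w: "0 \<le> w1" "0 \<le> w2"
    and le: "\<And>P R1 R2. 1 \<le> P \<Longrightarrow> (R1, R2) \<in> capacity_region m1 m2 n1 n2 P \<Longrightarrow> (w1 * R1 + w2 * R2) * ln 2 \<le> L * ln P + C"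
  shows "w1 * d1 + w2 * d2 \<le> L"
proof -
  have "ereal (w1 * d1 + w2 * d2) \<le> Limsup at_top (\<lambda>P::real. ereal (1 / log 2 P) *
          (SUP (R1, R2)\<in>capacity_region m1 m2 n1 n2 P. ereal (w1 * R1 + w2 * R2)))"
    using d w unfolding DoF_region_def by blast
  also have "\<dots> \<le> Limsup at_top (\<lambda>P::real. ereal (L + C / ln P))"
  proof (rule Limsup_mono)
    show "\<forall>\<^sub>F P in at_top. ereal (1 / log 2 P) * (SUP (R1, R2)\<in>capacity_region m1 m2 n1 n2 P. ereal (w1 * R1 + w2 * R2)) \<le> ereal (L + C / ln P)"
      using eventually_gt_at_top[of "1::real"]
    proof eventually_elim
      case (elim P)
      have "(SUP (R1, R2)\<in>capacity_region m1 m2 n1 n2 P. ereal (w1 * R1 + w2 * R2)) \<le> ereal ((L * ln P + C) / ln 2)"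
        using le elim by (intro SUP_least) (auto simp: field_simps)
      then have "ereal (1 / log 2 P) * (SUP (R1, R2)\<in>capacity_region m1 m2 n1 n2 P. ereal (w1 * R1 + w2 * R2))
        \<le> ereal (1 / log 2 P) * ereal ((L * ln P + C) / ln 2)"
        using elim by (intro ereal_mult_left_mono) auto
      also have "\<dots> = ereal (L + C / ln P)"
        using elim by (simp add: log_def field_simps)
      finally show ?case .
    qed
  qed
  also have "\<dots> = ereal L"
  proof (rule lim_imp_Limsup)
    have "((\<lambda>P::real. C / ln P) \<longlongrightarrow> 0) at_top"
      by (rule tendsto_divide_0[OF tendsto_const filterlim_at_top_imp_at_infinity[OF ln_at_top]])
    from tendsto_add[OF tendsto_const[of L] this]
    show "((\<lambda>P. ereal (L + C / ln P)) \<longlongrightarrow> ereal L) at_top" by simp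
  qed simp
  finally show ?thesis by simp
qed

text \<open>The hypotheses \<open>w1\<close> and \<open>w2\<close> have \<open>N2\<close> and
  \<open>N1\<close> where the region has minima with \<open>M1 + M2\<close>; the gap is closed by
  \<open>d1 \<le> M1\<close> and \<open>d2 \<le> M2\<close>. Among the sum bounds,
  \<open>M1 + M2\<close> and \<open>N1 + N2\<close> follow from the bounds on \<open>d1\<close> and
  \<open>d2\<close> separately.\<close>

lemma DoF_outer_arith:
  fixes d1 d2 :: real and M1 M2 N1 N2 :: nat
  assumes pos: "0 < M1" "0 < M2" "0 < N1" "0 < N2" and d: "0 \<le> d1" "0 \<le> d2" "d1 \<le> real M1" "d2 \<le> real M2"
    and w1: "1 / real (min (N1 + N2) M1) * d1 + 1 / real (min N2 M1) * d2 \<le> 1 / real (min N2 M1) * real N2"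
    and w2: "1 / real (min (N1 + N2) M2) * d2 + 1 / real (min N1 M2) * d1 \<le> 1 / real (min N1 M2) * real N1"
  shows "(d1, d2) \<in> DoF_outer M1 M2 N1 N2"
proof -
  \<comment> \<open>Dropping the nonnegative term with \<open>x\<close> leaves the bound by the
    number of receive antennas.\<close>
  have single: "y \<le> real N" if "0 < N" "0 < M" "0 \<le> x" "0 \<le> (y::real)"
    "1 / real (min N' M) * x + 1 / real (min N M) * y \<le> 1 / real (min N M) * real N" for N N' M :: nat and x y
  proof -
    have "0 \<le> 1 / real (min N' M) * x" using that by simp
    then have "1 / real (min N M) * y \<le> 1 / real (min N M) * real N" using that by linarith
    then show ?thesis using that by (simp add: divide_le_cancel)
  qed
  \<comment> \<open>If \<open>N > M + M'\<close>, both denominators are \<open>M\<close>, and adding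
    \<open>x \<le> M\<close> and \<open>y \<le> M'\<close> suffices.\<close>
  have weighted: "x / real (min N' M) + y / real (min N M) \<le> real (min N (M + M')) / real (min N M)"
    if "0 < M" "x \<le> real M" "y \<le> real M'" "N \<le> N'"
      "1 / real (min N' M) * x + 1 / real (min N M) * y \<le> 1 / real (min N M) * real N" for N N' M M' :: nat and x y
  proof (cases "N \<le> M + M'")
    case True
    then show ?thesis using that by simp
  next
    case False
    then have "x / real M + y / real M \<le> real (M + M') / real M"
      using that by (simp add: add_divide_distrib[symmetric] divide_right_mono)
    then show ?thesis using False that by simp
  qed
  \<comment> \<open>For \<open>M \<le> N\<close> both denominators equal \<open>M\<close>. Otherwise
    the right-hand side is \<open>1\<close> and both denominators are at most \<open>M\<close>, so
    replacing them by \<open>M\<close> only decreases the left-hand side.\<close>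
  have sum: "x + y \<le> real (max M N)"
    if "0 < M" "0 < N" "0 \<le> x" "0 \<le> (y::real)" "N \<le> N'"
      "1 / real (min N' M) * x + 1 / real (min N M) * y \<le> 1 / real (min N M) * real N" for N N' M :: nat and x y
  proof (cases "M \<le> N")
    case True
    then have "(x + y) / real M \<le> real N / real M" using that by (simp add: add_divide_distrib)
    then show ?thesis using True that by (simp add: divide_le_cancel)
  next
    case False
    then have "x / real (min N' M) + y / real N \<le> 1" using that by simp
    moreover have "x / real M \<le> x / real (min N' M)" "y / real M \<le> y / real N"
      using that False by (auto intro!: divide_left_mono)
    ultimately have "(x + y) / real M \<le> 1" unfolding add_divide_distrib by linarith
    then show ?thesis using False that by simp
  qed
  have N: "d1 \<le> real N1" "d2 \<le> real N2"
    using single[OF pos(3,2) d(2,1) w2] single[OF pos(4,1) d(1,2) w1] .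
  have s: "d1 + d2 \<le> real (max M1 N2)" "d1 + d2 \<le> real (max M2 N1)"
    using sum[OF pos(1,4) d(1,2) _ w1] sum[OF pos(2,3) d(2,1) _ w2] by (simp_all add: add.commute)
  show ?thesis
    unfolding DoF_outer_def
    using d N s weighted[OF pos(1) d(3,4) _ w1] weighted[OF pos(2) d(4,3) _ w2]
    by (simp add: min_def add.commute)
qed

theorem theorem1:
  shows "DoF_region TYPE('m1::finite) TYPE('m2::finite) TYPE('n1::finite) TYPE('n2::finite)
    \<subseteq> DoF_outer CARD('m1) CARD('m2) CARD('n1) CARD('n2)"
proof
  fix d assume "d \<in> DoF_region TYPE('m1) TYPE('m2) TYPE('n1) TYPE('n2)"
  moreover obtain d1 d2 where d12: "d = (d1, d2)" by fastforce
  ultimately have d: "(d1, d2) \<in> DoF_region TYPE('m1) TYPE('m2) TYPE('n1) TYPE('n2)" by simp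
  then have nn: "0 \<le> d1" "0 \<le> d2" unfolding DoF_region_def by auto
  let ?N = "CARD('n1) + CARD('n2)"
  let ?k = "12 * (real CARD('m1) + real CARD('m2) + 1)" and ?k' = "12 * (real CARD('m2) + real CARD('m1) + 1)"
  let ?D1 = "real ?N * extrapolation_cost TYPE('m1)" and ?D2 = "real ?N * extrapolation_cost TYPE('m2)"
  let ?a1 = "1 / real (min ?N CARD('m1))" and ?b1 = "1 / real (min CARD('n2) CARD('m1))"
  let ?a2 = "1 / real (min ?N CARD('m2))" and ?b2 = "1 / real (min CARD('n1) CARD('m2))"
  have "1 * d1 + 0 * d2 \<le> real CARD('m1)"
  proof (rule DoF_bound[OF d])
    fix P R1 R2 :: real assume P: "1 \<le> P" and R: "(R1, R2) \<in> capacity_region TYPE('m1) TYPE('m2) TYPE('n1) TYPE('n2) P"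
    have "(1 * R1 + 0 * R2) * ln 2 \<le> real CARD('m1) * (ln P + ?k) + ?D1"
    proof (rule capacity_bound[OF R])
      fix n K1 K2 r and c :: "('m1, 'm2, 'n1, 'n2) ic_code"
      assume "coded n K1 K2 c" "valid_code P n K1 K2 c" "0 \<le> r" "error_prob n K1 K2 c \<le> 1 - r"
      then show "r * (1 * ln (real K1) + 0 * ln (real K2)) \<le> ln 2 + real n * (real CARD('m1) * (ln P + ?k) + ?D1)"
        using coded.single_rate_bounds(1)[OF _ P, of n K1 K2 c r]
        by (simp only: mult_zero_left mult_1 add_0_right)
    qed auto
    \<comment> \<open>Only the coefficient of \<open>ln P\<close> survives the limit; all other
      terms form the constant of \<open>DoF_bound\<close>.\<close>
    then show "(1 * R1 + 0 * R2) * ln 2 \<le> real CARD('m1) * ln P + (real CARD('m1) * ?k + ?D1)" by (simp add: algebra_simps)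
  qed auto
  moreover have "0 * d1 + 1 * d2 \<le> real CARD('m2)"
  proof (rule DoF_bound[OF d])
    fix P R1 R2 :: real assume P: "1 \<le> P" and R: "(R1, R2) \<in> capacity_region TYPE('m1) TYPE('m2) TYPE('n1) TYPE('n2) P"
    have "(0 * R1 + 1 * R2) * ln 2 \<le> real CARD('m2) * (ln P + ?k') + ?D2"
    proof (rule capacity_bound[OF R])
      fix n K1 K2 r and c :: "('m1, 'm2, 'n1, 'n2) ic_code"
      assume "coded n K1 K2 c" "valid_code P n K1 K2 c" "0 \<le> r" "error_prob n K1 K2 c \<le> 1 - r"
      then show "r * (0 * ln (real K1) + 1 * ln (real K2)) \<le> ln 2 + real n * (real CARD('m2) * (ln P + ?k') + ?D2)"
        using coded.single_rate_bounds(2)[OF _ P, of n K1 K2 c r]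
        by (simp only: mult_zero_left mult_1 add_0 add.commute[of "CARD('n2)"])
    qed auto
    then show "(0 * R1 + 1 * R2) * ln 2 \<le> real CARD('m2) * ln P + (real CARD('m2) * ?k' + ?D2)" by (simp add: algebra_simps)
  qed auto
  moreover have "?a1 * d1 + ?b1 * d2 \<le> ?b1 * real CARD('n2)"
  proof (rule DoF_bound[OF d])
    fix P R1 R2 :: real assume P: "1 \<le> P" and R: "(R1, R2) \<in> capacity_region TYPE('m1) TYPE('m2) TYPE('n1) TYPE('n2) P"
    have "(?a1 * R1 + ?b1 * R2) * ln 2 \<le> ?b1 * (real CARD('n2) * (ln P + ?k)) + ?D1"
      by (rule capacity_bound[OF R _ _ coded.weighted_rate_bounds(1)[OF _ P]]) auto
    then show "(?a1 * R1 + ?b1 * R2) * ln 2 \<le> (?b1 * real CARD('n2)) * ln P + (?b1 * (real CARD('n2) * ?k) + ?D1)"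
      by (simp only: distrib_left mult.assoc add.assoc)
  qed auto
  moreover have "?b2 * d1 + ?a2 * d2 \<le> ?b2 * real CARD('n1)"
  proof (rule DoF_bound[OF d])
    fix P R1 R2 :: real assume P: "1 \<le> P" and R: "(R1, R2) \<in> capacity_region TYPE('m1) TYPE('m2) TYPE('n1) TYPE('n2) P"
    have "(?b2 * R1 + ?a2 * R2) * ln 2 \<le> ?b2 * (real CARD('n1) * (ln P + ?k')) + ?D2"
    proof (rule capacity_bound[OF R])
      fix n K1 K2 r and c :: "('m1, 'm2, 'n1, 'n2) ic_code"
      assume "coded n K1 K2 c" "valid_code P n K1 K2 c" "0 \<le> r" "error_prob n K1 K2 c \<le> 1 - r"
      then show "r * (?b2 * ln (real K1) + ?a2 * ln (real K2)) \<le> (?a2 + ?b2) * ln 2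
          + real n * (?b2 * (real CARD('n1) * (ln P + ?k')) + ?D2)"
        using coded.weighted_rate_bounds(2)[OF _ P, of n K1 K2 c r] by (simp only: add.commute[of "?b2 * _"])
    qed auto
    then show "(?b2 * R1 + ?a2 * R2) * ln 2 \<le> (?b2 * real CARD('n1)) * ln P + (?b2 * (real CARD('n1) * ?k') + ?D2)"
      by (simp only: distrib_left mult.assoc add.assoc)
  qed auto
  ultimately show "d \<in> DoF_outer CARD('m1) CARD('m2) CARD('n1) CARD('n2)"
    unfolding d12 using nn by (intro DoF_outer_arith) (auto simp only: add.commute mult_1 mult_zero_left add_0 add_0_right zero_less_card_finite)
qed

end
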